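(* Let $\mathsf{A}$ be an abelian category, $\mathsf{V}$ a special preenveloping subcategory of $\mathsf{A}$ and $\mathsf{W}$ a special precovering subcategory of $\mathsf{A}$. Let $M$ and $N$ be objects in $\mathsf{A}$. Then for all $n\in\mathbb{Z}$ there are natural isomorphisms $$\widetilde{\operatorname{Ext}}{}^{n}_{\mathsf{V}}(M,N)\cong\check{\operatorname{Ext}}{}^{n}_{\mathsf{V}}(M,N)\quad\text{and}\quad\widetilde{\operatorname{Ext}}{}^{n}_{\mathsf{W}}(M,N)\cong\widehat{\operatorname{Ext}}{}^{n}_{\mathsf{W}}(M,N).$$
   Context: "Subcategory" means a full additive subcategory closed under isomorphisms; Ext is Yoneda Ext. ${}^{\perp}\mathsf{V}=\{M\mid\operatorname{Ext}^1_{\mathsf{A}}(M,V)=0\ \forall V\in\mathsf{V}\}$, $\mathsf{W}^{\perp}=\{N\mid\operatorname{Ext}^1_{\mathsf{A}}(W,N)=0\ \forall W\in\mathsf{W}\}$. A special $\mathsf{V}$-preenvelope of $M$ is an exact sequence $0\to M\to V\to C\to0$ with $V\in\mathsf{V}$, $C\in{}^{\perp}\mathsf{V}$; a special $\mathsf{W}$-precover of $M$ is an exact sequence $0\to K\to W\to M\to0$ with $W\in\mathsf{W}$, $K\in\mathsf{W}^{\perp}$. $\mathsf{V}$ is special preenveloping (resp. $\mathsf{W}$ special precovering) if every object has one. A proper $\mathsf{V}$-coresolution $M\xrightarrow{\simeq}I$ is a complex $I=(0\to I^0\to I^1\to\cdots)$ of objects in $\mathsf{V}$ with an exact sequence $0\to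 M\to I^0\to I^1\to\cdots$ staying exact under $\operatorname{Hom}_{\mathsf{A}}(-,V)$ for all $V\in\mathsf{V}$; it is special if $\operatorname{Ker}(I^i\to I^{i+1})\in{}^{\perp}\mathsf{V}$ for $i\ge1$. A proper $\mathsf{W}$-resolution $P\xrightarrow{\simeq}M$ is a complex $P=(\cdots\to P_1\to P_0\to0)$ of objects in $\mathsf{W}$ with an exact sequence $\cdots\to P_1\to P_0\to M\to0$ staying exact under $\operatorname{Hom}_{\mathsf{A}}(W,-)$ for all $W\in\mathsf{W}$; it is special if $\operatorname{Coker}(P_{i+1}\to P_i)\in\mathsf{W}^{\perp}$ for $i\ge1$. View $P$ as a cochain complex via $P^{-i}=P_i$. For chosen special ones, $\mathsf{\Theta}^i_{\mathsf{V}}M=\operatorname{Ker}(I^i\to I^{i+1})$ and $\mathsf{\Omega}_i^{\mathsf{W}}M=\operatorname{Coker}(P_{i+1}\to P_i)$; $\mathsf{\Theta}^0_{\mathsf{V}}M=M=\mathsf{\Omega}_0^{\mathsf{W}}M$, $\mathsf{\Theta}_{\mathsf{V}}=\mathsf{\Theta}_{\mathsf{V}}^1$, $\mathsf{\Omega}^{\mathsf{W}}=\mathsf{\Omega}_1^{\mathsf{W}}$. Stable cohomology. For cochain complexes $X,Y$ in $\mathsf{A}$, $\operatorname{Hom}_{\mathsf{A}}(X,Y)^n=\prod_i\operatorname{Hom}_{\mathsf{A}}(X^i,Y^{n+i})$ with differential $\partial(\alpha)=\partial_Y\alpha-(-1)^{|\alpha|}\alpha\partial_X$; $\overline{\operatorname{Hom}}_{\mathsf{A}}(X,Y)$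 is the subcomplex with $n$th term $\coprod_i\operatorname{Hom}_{\mathsf{A}}(X^i,Y^{n+i})$; $\widetilde{\operatorname{Hom}}_{\mathsf{A}}(X,Y)$ is the quotient complex. For proper $\mathsf{V}$-coresolutions $M\xrightarrow{\simeq}I$, $N\xrightarrow{\simeq}J$, $\widetilde{\operatorname{Ext}}{}^{n}_{\mathsf{V}}(M,N)=\mathrm{H}^n(\widetilde{\operatorname{Hom}}_{\mathsf{A}}(I,J))$; for proper $\mathsf{W}$-resolutions $P\xrightarrow{\simeq}M$, $Q\xrightarrow{\simeq}N$, $\widetilde{\operatorname{Ext}}{}^{n}_{\mathsf{W}}(M,N)=\mathrm{H}^n(\widetilde{\operatorname{Hom}}_{\mathsf{A}}(P,Q))$. Complete cohomology. $\overline{\operatorname{Hom}}{}^{\mathsf{V}}_{\mathsf{A}}(M,N)$ (resp. $\underline{\operatorname{Hom}}{}^{\mathsf{W}}_{\mathsf{A}}(M,N)$) is $\operatorname{Hom}_{\mathsf{A}}(M,N)$ modulo morphisms factoring through an object of $\mathsf{V}$ (resp. $\mathsf{W}$). With special $\mathsf{V}$-preenvelopes $0\to M\to I^0\to\mathsf{\Theta}_{\mathsf{V}}M\to0$ and $0\to N\to J^0\to\mathsf{\Theta}_{\mathsf{V}}N\to0$, the connecting morphism $\operatorname{Hom}_{\mathsf{A}}(M,N)\to\operatorname{Ext}^1_{\mathsf{A}}(\mathsf{\Theta}_{\mathsf{V}}M,N)$ induces a monomorphism $\overline{\delta}\colon\overline{\operatorname{Hom}}{}^{\mathsf{V}}_{\mathsf{A}}(M,N)\to\operatorname{Ext}^1_{\mathsf{A}}(\mathsf{\Theta}_{\mathsf{V}}M,N)$;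 the connecting morphism $\partial\colon\operatorname{Hom}_{\mathsf{A}}(\mathsf{\Theta}_{\mathsf{V}}M,\mathsf{\Theta}_{\mathsf{V}}N)\to\operatorname{Ext}^1_{\mathsf{A}}(\mathsf{\Theta}_{\mathsf{V}}M,N)$ is epi and there is a unique $\beta\colon\operatorname{Ext}^1_{\mathsf{A}}(\mathsf{\Theta}_{\mathsf{V}}M,N)\to\overline{\operatorname{Hom}}{}^{\mathsf{V}}_{\mathsf{A}}(\mathsf{\Theta}_{\mathsf{V}}M,\mathsf{\Theta}_{\mathsf{V}}N)$ with $\beta\partial$ the canonical projection. Iterating $\beta\overline{\delta}$ gives a direct system over integers $i\ge\max\{0,-n\}$ and $\check{\operatorname{Ext}}{}^{n}_{\mathsf{V}}(M,N)=\operatorname{colim}_i\overline{\operatorname{Hom}}{}^{\mathsf{V}}_{\mathsf{A}}(\mathsf{\Theta}^i_{\mathsf{V}}M,\mathsf{\Theta}^{i+n}_{\mathsf{V}}N)$. Dually, with special $\mathsf{W}$-precovers of $M$ and $N$ there are a monomorphism $\overline{\delta}\colon\underline{\operatorname{Hom}}{}^{\mathsf{W}}_{\mathsf{A}}(M,N)\to\operatorname{Ext}^1_{\mathsf{A}}(M,\mathsf{\Omega}^{\mathsf{W}}N)$ induced by the connecting morphism and a unique $\beta\colon\operatorname{Ext}^1_{\mathsf{A}}(M,\mathsf{\Omega}^{\mathsf{W}}N)\to\underline{\operatorname{Hom}}{}^{\mathsf{W}}_{\mathsf{A}}(\mathsf{\Omega}^{\mathsf{W}}M,\mathsf{\Omega}^{\mathsf{W}}N)$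 whose composite with the (epic) connecting morphism $\operatorname{Hom}_{\mathsf{A}}(\mathsf{\Omega}^{\mathsf{W}}M,\mathsf{\Omega}^{\mathsf{W}}N)\to\operatorname{Ext}^1_{\mathsf{A}}(M,\mathsf{\Omega}^{\mathsf{W}}N)$ is the canonical projection; iterating $\beta\overline{\delta}$, $\widehat{\operatorname{Ext}}{}^{n}_{\mathsf{W}}(M,N)=\operatorname{colim}_i\underline{\operatorname{Hom}}{}^{\mathsf{W}}_{\mathsf{A}}(\mathsf{\Omega}^{\mathsf{W}}_{i+n}M,\mathsf{\Omega}^{\mathsf{W}}_iN)$ over $i\ge\max\{0,-n\}$. *)

theory Defs
  imports "HOL-Algebra.Product_Groups"
begin

section \<open>Abelian categories\<close>

text \<open>
  A category is given by its set of objects and its set of arrows; every arrow knows its source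
  and its target.  The fields \<open>Plus\<close> and \<open>Zero\<close> carry the preadditive structure.
\<close>

record ('o, 'm) addcat =
  Ob :: "'o set"
  Ar :: "'m set"
  Src :: "'m \<Rightarrow> 'o"
  Tgt :: "'m \<Rightarrow> 'o"
  Ident :: "'o \<Rightarrow> 'm"
  Compose :: "'m \<Rightarrow> 'm \<Rightarrow> 'm" (infixr "\<cdot>\<index>" 75)
  Plus :: "'m \<Rightarrow> 'm \<Rightarrow> 'm"
  Zero :: "'o \<Rightarrow> 'o \<Rightarrow> 'm"

context
  fixes A :: "('o, 'm) addcat" (structure)
begin

definition mor :: "'o \<Rightarrow> 'o \<Rightarrow> 'm set" where
  "mor X Y = {f \<in> Ar A. Src A f = X \<and> Tgt A f = Y}"

text \<open>The hom groups are groups in the sense of HOL-Algebra, hence written multiplicatively.\<close>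

definition Hom :: "'o \<Rightarrow> 'o \<Rightarrow> 'm monoid" where
  "Hom X Y = \<lparr>carrier = mor X Y, monoid.mult = Plus A, one = Zero A X Y\<rparr>"

definition Neg :: "'m \<Rightarrow> 'm" where
  "Neg f = inv\<^bsub>Hom (Src A f) (Tgt A f)\<^esub> f"

definition zero_object :: "'o \<Rightarrow> bool" where
  "zero_object Z \<longleftrightarrow> Z \<in> Ob A \<and> (\<forall>X\<in>Ob A. (\<exists>!f. f \<in> mor Z X) \<and> (\<exists>!f. f \<in> mor X Z))"

definition isomorphic :: "'o \<Rightarrow> 'o \<Rightarrow> bool" where
  "isomorphic X Y \<longleftrightarrow>
     (\<exists>f\<in>mor X Y. \<exists>g\<in>mor Y X. g \<cdot> f = Ident A X \<and> f \<cdot> g = Ident A Y)"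

definition biproduct :: "'o \<Rightarrow> 'o \<Rightarrow> 'o \<Rightarrow> bool" where
  "biproduct X Y Z \<longleftrightarrow>
     X \<in> Ob A \<and> Y \<in> Ob A \<and> Z \<in> Ob A \<and>
     (\<exists>i\<in>mor X Z. \<exists>j\<in>mor Y Z. \<exists>p\<in>mor Z X. \<exists>q\<in>mor Z Y.
        p \<cdot> i = Ident A X \<and> q \<cdot> j = Ident A Y \<and>
        q \<cdot> i = Zero A X Y \<and> p \<cdot> j = Zero A Y X \<and>
        Plus A (i \<cdot> p) (j \<cdot> q) = Ident A Z)"

definition mono_arrow :: "'m \<Rightarrow> bool" where
  "mono_arrow f \<longleftrightarrow> f \<in> Ar A \<and>
     (\<forall>X\<in>Ob A. \<forall>g\<in>mor X (Src A f). \<forall>h\<in>mor X (Src A f). f \<cdot> g = f \<cdot> h \<longrightarrow> g = h)"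

definition epi_arrow :: "'m \<Rightarrow> bool" where
  "epi_arrow f \<longleftrightarrow> f \<in> Ar A \<and>
     (\<forall>X\<in>Ob A. \<forall>g\<in>mor (Tgt A f) X. \<forall>h\<in>mor (Tgt A f) X. g \<cdot> f = h \<cdot> f \<longrightarrow> g = h)"

definition is_kernel :: "'m \<Rightarrow> 'm \<Rightarrow> bool" where
  "is_kernel f k \<longleftrightarrow> f \<in> Ar A \<and> k \<in> Ar A \<and> Tgt A k = Src A f \<and>
     f \<cdot> k = Zero A (Src A k) (Tgt A f) \<and>
     (\<forall>X\<in>Ob A. \<forall>g\<in>mor X (Src A f). f \<cdot> g = Zero A X (Tgt A f) \<longrightarrow>
        (\<exists>!h. h \<in> mor X (Src A k) \<and> k \<cdot> h = g))"

definition is_cokernel :: "'m \<Rightarrow> 'm \<Rightarrow> bool" where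
  "is_cokernel f c \<longleftrightarrow> f \<in> Ar A \<and> c \<in> Ar A \<and> Src A c = Tgt A f \<and>
     c \<cdot> f = Zero A (Src A f) (Tgt A c) \<and>
     (\<forall>X\<in>Ob A. \<forall>g\<in>mor (Tgt A f) X. g \<cdot> f = Zero A (Src A f) X \<longrightarrow>
        (\<exists>!h. h \<in> mor (Tgt A c) X \<and> h \<cdot> c = g))"

definition ker_arrow :: "'m \<Rightarrow> 'm" where
  "ker_arrow f = (SOME k. is_kernel f k)"

definition coker_arrow :: "'m \<Rightarrow> 'm" where
  "coker_arrow f = (SOME c. is_cokernel f c)"

text \<open>The image of an arrow is the kernel of its cokernel.\<close>

definition is_image :: "'m \<Rightarrow> 'm \<Rightarrow> bool" where
  "is_image f k \<longleftrightarrow> (\<exists>c. is_cokernel f c \<and> is_kernel c k)"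

definition exact_at :: "'m \<Rightarrow> 'm \<Rightarrow> bool" where
  "exact_at f g \<longleftrightarrow> (\<exists>k. is_image f k \<and> is_kernel g k)"

definition short_exact :: "'m \<Rightarrow> 'm \<Rightarrow> bool" where
  "short_exact a b \<longleftrightarrow> mono_arrow a \<and> exact_at a b \<and> epi_arrow b"

end

locale preadditive_category =
  fixes A :: "('o, 'm) addcat" (structure)
  assumes arrow_objects: "f \<in> Ar A \<Longrightarrow> Src A f \<in> Ob A \<and> Tgt A f \<in> Ob A"
    and ident_arrow: "X \<in> Ob A \<Longrightarrow> Ident A X \<in> mor A X X"
    and compose_arrow: "f \<in> mor A X Y \<Longrightarrow> g \<in> mor A Y Z \<Longrightarrow> g \<cdot> f \<in> mor A X Z"
    and compose_assoc: "f \<in> mor A X Y \<Longrightarrow> g \<in> mor A Y Z \<Longrightarrow> h \<in> mor A Z U \<Longrightarrow>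
                          (h \<cdot> g) \<cdot> f = h \<cdot> (g \<cdot> f)"
    and ident_right: "f \<in> mor A X Y \<Longrightarrow> f \<cdot> Ident A X = f"
    and ident_left: "f \<in> mor A X Y \<Longrightarrow> Ident A Y \<cdot> f = f"
    and hom_group: "X \<in> Ob A \<Longrightarrow> Y \<in> Ob A \<Longrightarrow> comm_group (Hom A X Y)"
    and compose_plus_left: "f \<in> mor A X Y \<Longrightarrow> g \<in> mor A Y Z \<Longrightarrow> h \<in> mor A Y Z \<Longrightarrow>
                              Plus A g h \<cdot> f = Plus A (g \<cdot> f) (h \<cdot> f)"
    and compose_plus_right: "f \<in> mor A X Y \<Longrightarrow> g \<in> mor A X Y \<Longrightarrow> h \<in> mor A Y Z \<Longrightarrow>
                              h \<cdot> Plus A f g = Plus A (h \<cdot> f) (h \<cdot> g)"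

locale abelian_category = preadditive_category +
  assumes has_zero_object: "\<exists>Z. zero_object A Z"
    and has_biproducts: "X \<in> Ob A \<Longrightarrow> Y \<in> Ob A \<Longrightarrow> \<exists>Z. biproduct A X Y Z"
    and has_kernels: "f \<in> Ar A \<Longrightarrow> \<exists>k. is_kernel A f k"
    and has_cokernels: "f \<in> Ar A \<Longrightarrow> \<exists>c. is_cokernel A f c"
    and mono_is_kernel: "mono_arrow A f \<Longrightarrow> \<exists>g. is_kernel A g f"
    and epi_is_cokernel: "epi_arrow A f \<Longrightarrow> \<exists>g. is_cokernel A g f"


section \<open>Yoneda Ext and special (pre)covers and (pre)envelopes\<close>

context
  fixes A :: "('o, 'm) addcat" (structure)
begin

text \<open>A full subcategory is identified with its set of objects.\<close>

definition subcategory :: "'o set \<Rightarrow> bool" where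
  "subcategory V \<longleftrightarrow> V \<subseteq> Ob A \<and>
     (\<forall>X\<in>V. \<forall>Y\<in>Ob A. isomorphic A X Y \<longrightarrow> Y \<in> V) \<and>
     (\<exists>Z\<in>V. zero_object A Z) \<and>
     (\<forall>X\<in>V. \<forall>Y\<in>V. \<forall>Z. biproduct A X Y Z \<longrightarrow> Z \<in> V)"

text \<open>
  An extension \<open>0 \<rightarrow> X \<rightarrow> E \<rightarrow> C \<rightarrow> 0\<close> is stored as the pair of its two middle arrows.
\<close>

definition extensions :: "'o \<Rightarrow> 'o \<Rightarrow> ('m \<times> 'm) set" where
  "extensions C X = {(a, b). short_exact A a b \<and> Src A a = X \<and> Tgt A b = C}"

definition ext_equiv :: "'o \<Rightarrow> 'o \<Rightarrow> (('m \<times> 'm) \<times> ('m \<times> 'm)) set" where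
  "ext_equiv C X = {((a, b), (a', b')). (a, b) \<in> extensions C X \<and> (a', b') \<in> extensions C X \<and>
     (\<exists>h\<in>mor A (Tgt A a) (Tgt A a'). h \<cdot> a = a' \<and> b' \<cdot> h = b)}"

definition Ext1 :: "'o \<Rightarrow> 'o \<Rightarrow> ('m \<times> 'm) set set" where
  "Ext1 C X = extensions C X // ext_equiv C X"

text \<open>The zero element of \<open>Ext\<^sup>1\<close> is the class of the split extensions.\<close>

definition Ext1_zero :: "'o \<Rightarrow> 'o \<Rightarrow> ('m \<times> 'm) set" where
  "Ext1_zero C X =
     {(a, b) \<in> extensions C X. \<exists>s\<in>mor A C (Tgt A a). b \<cdot> s = Ident A C}"

definition left_perp :: "'o set \<Rightarrow> 'o set" where
  "left_perp V = {M \<in> Ob A. \<forall>X\<in>V. Ext1 M X = {Ext1_zero M X}}"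

definition right_perp :: "'o set \<Rightarrow> 'o set" where
  "right_perp W = {N \<in> Ob A. \<forall>X\<in>W. Ext1 X N = {Ext1_zero X N}}"

definition special_preenveloping :: "'o set \<Rightarrow> bool" where
  "special_preenveloping V \<longleftrightarrow>
     (\<forall>M\<in>Ob A. \<exists>a b. short_exact A a b \<and> Src A a = M \<and> Tgt A a \<in> V \<and> Tgt A b \<in> left_perp V)"

definition special_precovering :: "'o set \<Rightarrow> bool" where
  "special_precovering W \<longleftrightarrow>
     (\<forall>M\<in>Ob A. \<exists>a b. short_exact A a b \<and> Tgt A b = M \<and> Tgt A a \<in> W \<and> Src A a \<in> right_perp W)"

text \<open>
  Pushout \<open>f \<cdot> (a, b)\<close> of an extension along \<open>f\<close> and pullback \<open>(a, b) \<cdot> g\<close> along \<open>g\<close>: the class of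
  all extensions that receive from (respectively map to) \<open>(a, b)\<close> a morphism of short exact
  sequences which is \<open>f\<close> on the left and the identity on the right (respectively the identity on
  the left and \<open>g\<close> on the right).  These are the connecting maps
  \<open>Hom (X, Y) \<rightarrow> Ext\<^sup>1 (C, Y)\<close> and \<open>Hom (Y, C) \<rightarrow> Ext\<^sup>1 (Y, X)\<close> of \<open>0 \<rightarrow> X \<rightarrow> E \<rightarrow> C \<rightarrow> 0\<close>.
\<close>

definition ext_push :: "'m \<times> 'm \<Rightarrow> 'm \<Rightarrow> ('m \<times> 'm) set" where
  "ext_push s f = (case s of (a, b) \<Rightarrow>
     {(a', b') \<in> extensions (Tgt A b) (Tgt A f).
        \<exists>h\<in>mor A (Tgt A a) (Tgt A a'). h \<cdot> a = a' \<cdot> f \<and> b' \<cdot> h = b})"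

definition ext_pull :: "'m \<times> 'm \<Rightarrow> 'm \<Rightarrow> ('m \<times> 'm) set" where
  "ext_pull s g = (case s of (a, b) \<Rightarrow>
     {(a', b') \<in> extensions (Src A g) (Src A a).
        \<exists>h\<in>mor A (Tgt A a') (Tgt A a). h \<cdot> a' = a \<and> b \<cdot> h = g \<cdot> b'})"

end


section \<open>Cochain complexes, proper and special (co)resolutions\<close>

record ('o, 'm) cochain =
  cobj :: "int \<Rightarrow> 'o"
  cdiff :: "int \<Rightarrow> 'm"

text \<open>
  A (co)resolution is a cochain complex with an augmentation: an arrow \<open>M \<rightarrow> I\<^sup>0\<close> for a
  coresolution, and \<open>P\<^sup>0 \<rightarrow> M\<close> for a resolution, where \<open>P\<^sub>i\<close> sits in degree \<open>-i\<close>.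
\<close>

record ('o, 'm) augmented = "('o, 'm) cochain" +
  aug :: 'm

context
  fixes A :: "('o, 'm) addcat" (structure)
begin

definition cochain_complex :: "('o, 'm, 'z) cochain_scheme \<Rightarrow> bool" where
  "cochain_complex X \<longleftrightarrow>
     (\<forall>i. cobj X i \<in> Ob A \<and> cdiff X i \<in> mor A (cobj X i) (cobj X (i + 1)) \<and>
          cdiff X (i + 1) \<cdot> cdiff X i = Zero A (cobj X i) (cobj X (i + 2)))"

definition cochain_map ::
  "('o, 'm, 'z) cochain_scheme \<Rightarrow> ('o, 'm, 'z) cochain_scheme \<Rightarrow> (int \<Rightarrow> 'm) \<Rightarrow> bool" where
  "cochain_map X Y \<phi> \<longleftrightarrow>
     (\<forall>i. \<phi> i \<in> mor A (cobj X i) (cobj Y i) \<and> cdiff Y i \<cdot> \<phi> i = \<phi> (i + 1) \<cdot> cdiff X i)"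

definition proper_coresolution :: "'o set \<Rightarrow> 'o \<Rightarrow> ('o, 'm) augmented \<Rightarrow> bool" where
  "proper_coresolution V M I \<longleftrightarrow>
     cochain_complex I \<and>
     (\<forall>i<0. zero_object A (cobj I i)) \<and> (\<forall>i\<ge>0. cobj I i \<in> V) \<and>
     aug I \<in> mor A M (cobj I 0) \<and>
     mono_arrow A (aug I) \<and> exact_at A (aug I) (cdiff I 0) \<and>
     (\<forall>i\<ge>0. exact_at A (cdiff I i) (cdiff I (i + 1))) \<and>
     (\<forall>X\<in>V.
        (\<lambda>h. h \<cdot> aug I) ` mor A (cobj I 0) X = mor A M X \<and>
        kernel (Hom A (cobj I 0) X) (Hom A M X) (\<lambda>h. h \<cdot> aug I)
          = (\<lambda>h. h \<cdot> cdiff I 0) ` mor A (cobj I 1) X \<and>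
        (\<forall>i\<ge>0. kernel (Hom A (cobj I (i + 1)) X) (Hom A (cobj I i) X) (\<lambda>h. h \<cdot> cdiff I i)
          = (\<lambda>h. h \<cdot> cdiff I (i + 1)) ` mor A (cobj I (i + 2)) X))"

definition proper_resolution :: "'o set \<Rightarrow> 'o \<Rightarrow> ('o, 'm) augmented \<Rightarrow> bool" where
  "proper_resolution W M P \<longleftrightarrow>
     cochain_complex P \<and>
     (\<forall>i>0. zero_object A (cobj P i)) \<and> (\<forall>i\<le>0. cobj P i \<in> W) \<and>
     aug P \<in> mor A (cobj P 0) M \<and>
     epi_arrow A (aug P) \<and> exact_at A (cdiff P (-1)) (aug P) \<and>
     (\<forall>i<0. exact_at A (cdiff P (i - 1)) (cdiff P i)) \<and>
     (\<forall>X\<in>W.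
        (\<lambda>h. aug P \<cdot> h) ` mor A X (cobj P 0) = mor A X M \<and>
        kernel (Hom A X (cobj P 0)) (Hom A X M) (\<lambda>h. aug P \<cdot> h)
          = (\<lambda>h. cdiff P (-1) \<cdot> h) ` mor A X (cobj P (-1)) \<and>
        (\<forall>i<0. kernel (Hom A X (cobj P i)) (Hom A X (cobj P (i + 1))) (\<lambda>h. cdiff P i \<cdot> h)
          = (\<lambda>h. cdiff P (i - 1) \<cdot> h) ` mor A X (cobj P (i - 1))))"

text \<open>
  \<open>\<Theta>\<^sup>i M\<close> is the source of \<open>Theta_inc\<close>, the chosen kernel \<open>\<Theta>\<^sup>i M \<rightarrow> I\<^sup>i\<close> of \<open>I\<^sup>i \<rightarrow> I\<^sup>i\<^sup>+\<^sup>1\<close>, which is the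
  augmentation for \<open>i = 0\<close>.  \<open>Theta_seq\<close> is \<open>0 \<rightarrow> \<Theta>\<^sup>i M \<rightarrow> I\<^sup>i \<rightarrow> \<Theta>\<^sup>i\<^sup>+\<^sup>1 M \<rightarrow> 0\<close>.
\<close>

definition Theta_inc :: "('o, 'm) augmented \<Rightarrow> nat \<Rightarrow> 'm" where
  "Theta_inc I i = (if i = 0 then aug I else ker_arrow A (cdiff I (int i)))"

definition Theta :: "('o, 'm) augmented \<Rightarrow> nat \<Rightarrow> 'o" where
  "Theta I i = Src A (Theta_inc I i)"

definition Theta_proj :: "('o, 'm) augmented \<Rightarrow> nat \<Rightarrow> 'm" where
  "Theta_proj I i = (THE p. p \<in> mor A (cobj I (int i)) (Theta I (Suc i)) \<and>
                            Theta_inc I (Suc i) \<cdot> p = cdiff I (int i))"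

definition Theta_seq :: "('o, 'm) augmented \<Rightarrow> nat \<Rightarrow> 'm \<times> 'm" where
  "Theta_seq I i = (Theta_inc I i, Theta_proj I i)"

text \<open>
  Dually, \<open>\<Omega>\<^sub>i M\<close> is the target of \<open>Omega_proj\<close>, the chosen cokernel \<open>P\<^sub>i \<rightarrow> \<Omega>\<^sub>i M\<close> of
  \<open>P\<^sub>i\<^sub>+\<^sub>1 \<rightarrow> P\<^sub>i\<close>, and \<open>Omega_seq\<close> is \<open>0 \<rightarrow> \<Omega>\<^sub>i\<^sub>+\<^sub>1 M \<rightarrow> P\<^sub>i \<rightarrow> \<Omega>\<^sub>i M \<rightarrow> 0\<close>.
\<close>

definition Omega_proj :: "('o, 'm) augmented \<Rightarrow> nat \<Rightarrow> 'm" where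
  "Omega_proj P i = (if i = 0 then aug P else coker_arrow A (cdiff P (- int (Suc i))))"

definition Omega :: "('o, 'm) augmented \<Rightarrow> nat \<Rightarrow> 'o" where
  "Omega P i = Tgt A (Omega_proj P i)"

definition Omega_inc :: "('o, 'm) augmented \<Rightarrow> nat \<Rightarrow> 'm" where
  "Omega_inc P i = (THE j. j \<in> mor A (Omega P (Suc i)) (cobj P (- int i)) \<and>
                           j \<cdot> Omega_proj P (Suc i) = cdiff P (- int (Suc i)))"

definition Omega_seq :: "('o, 'm) augmented \<Rightarrow> nat \<Rightarrow> 'm \<times> 'm" where
  "Omega_seq P i = (Omega_inc P i, Omega_proj P i)"

definition special_coresolution :: "'o set \<Rightarrow> 'o \<Rightarrow> ('o, 'm) augmented \<Rightarrow> bool" where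
  "special_coresolution V M I \<longleftrightarrow>
     proper_coresolution V M I \<and> (\<forall>i\<ge>1. Theta I i \<in> left_perp A V)"

definition special_resolution :: "'o set \<Rightarrow> 'o \<Rightarrow> ('o, 'm) augmented \<Rightarrow> bool" where
  "special_resolution W M P \<longleftrightarrow>
     proper_resolution W M P \<and> (\<forall>i\<ge>1. Omega P i \<in> right_perp A W)"

definition coresolution_lift ::
  "('o, 'm) augmented \<Rightarrow> 'm \<Rightarrow> ('o, 'm) augmented \<Rightarrow> (int \<Rightarrow> 'm) \<Rightarrow> bool" where
  "coresolution_lift I f J \<phi> \<longleftrightarrow> cochain_map I J \<phi> \<and> \<phi> 0 \<cdot> aug I = aug J \<cdot> f"

definition resolution_lift ::
  "('o, 'm) augmented \<Rightarrow> 'm \<Rightarrow> ('o, 'm) augmented \<Rightarrow> (int \<Rightarrow> 'm) \<Rightarrow> bool" where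
  "resolution_lift P f Q \<phi> \<longleftrightarrow> cochain_map P Q \<phi> \<and> aug Q \<cdot> \<phi> 0 = f \<cdot> aug P"

end


section \<open>Stable cohomology\<close>

text \<open>The map on cosets induced by \<open>f\<close>, with values in the cosets of the subgroup \<open>H\<close> of \<open>G\<close>.\<close>

definition coset_map :: "('b, 'x) monoid_scheme \<Rightarrow> 'b set \<Rightarrow> ('a \<Rightarrow> 'b) \<Rightarrow> 'a set \<Rightarrow> 'b set" where
  "coset_map G H f c = (\<Union>x\<in>c. H #>\<^bsub>G\<^esub> f x)"

context
  fixes A :: "('o, 'm) addcat" (structure)
begin

definition hom_cx ::
  "('o, 'm, 'z) cochain_scheme \<Rightarrow> ('o, 'm, 'z) cochain_scheme \<Rightarrow> int \<Rightarrow> (int \<Rightarrow> 'm) monoid" where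
  "hom_cx X Y n = product_group UNIV (\<lambda>i. Hom A (cobj X i) (cobj Y (n + i)))"

definition bounded_hom_cx ::
  "('o, 'm, 'z) cochain_scheme \<Rightarrow> ('o, 'm, 'z) cochain_scheme \<Rightarrow> int \<Rightarrow> (int \<Rightarrow> 'm) monoid" where
  "bounded_hom_cx X Y n = sum_group UNIV (\<lambda>i. Hom A (cobj X i) (cobj Y (n + i)))"

text \<open>\<open>\<partial>(\<alpha>) = \<partial>\<^sub>Y \<alpha> - (-1)\<^sup>n \<alpha> \<partial>\<^sub>X\<close> for \<open>\<alpha>\<close> of degree \<open>n\<close>\<close>

definition hom_diff ::
  "('o, 'm, 'z) cochain_scheme \<Rightarrow> ('o, 'm, 'z) cochain_scheme \<Rightarrow> int \<Rightarrow>
     (int \<Rightarrow> 'm) \<Rightarrow> (int \<Rightarrow> 'm)" where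
  "hom_diff X Y n \<alpha> = (\<lambda>i.
     Plus A (cdiff Y (n + i) \<cdot> \<alpha> i)
            (if even n then Neg A (\<alpha> (i + 1) \<cdot> cdiff X i) else \<alpha> (i + 1) \<cdot> cdiff X i))"

definition stable_hom_cx ::
  "('o, 'm, 'z) cochain_scheme \<Rightarrow> ('o, 'm, 'z) cochain_scheme \<Rightarrow> int \<Rightarrow>
     (int \<Rightarrow> 'm) set monoid" where
  "stable_hom_cx X Y n = hom_cx X Y n Mod carrier (bounded_hom_cx X Y n)"

definition stable_hom_diff ::
  "('o, 'm, 'z) cochain_scheme \<Rightarrow> ('o, 'm, 'z) cochain_scheme \<Rightarrow> int \<Rightarrow>
     (int \<Rightarrow> 'm) set \<Rightarrow> (int \<Rightarrow> 'm) set" where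
  "stable_hom_diff X Y n =
     coset_map (hom_cx X Y (n + 1)) (carrier (bounded_hom_cx X Y (n + 1))) (hom_diff X Y n)"

definition stable_cocycles ::
  "('o, 'm, 'z) cochain_scheme \<Rightarrow> ('o, 'm, 'z) cochain_scheme \<Rightarrow> int \<Rightarrow>
     (int \<Rightarrow> 'm) set set" where
  "stable_cocycles X Y n =
     kernel (stable_hom_cx X Y n) (stable_hom_cx X Y (n + 1)) (stable_hom_diff X Y n)"

definition stable_coboundaries ::
  "('o, 'm, 'z) cochain_scheme \<Rightarrow> ('o, 'm, 'z) cochain_scheme \<Rightarrow> int \<Rightarrow>
     (int \<Rightarrow> 'm) set set" where
  "stable_coboundaries X Y n =
     stable_hom_diff X Y (n - 1) ` carrier (stable_hom_cx X Y (n - 1))"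

text \<open>
  \<open>H\<^sup>n\<close> of the quotient complex.  For \<open>X\<close>, \<open>Y\<close> proper \<open>V\<close>-coresolutions (proper \<open>W\<close>-resolutions) of \<open>M\<close>
  and \<open>N\<close> this is the stable cohomology of \<open>M\<close> and \<open>N\<close>.
\<close>

definition stable_Ext ::
  "('o, 'm, 'z) cochain_scheme \<Rightarrow> ('o, 'm, 'z) cochain_scheme \<Rightarrow> int \<Rightarrow>
     (int \<Rightarrow> 'm) set set monoid" where
  "stable_Ext X Y n =
     (stable_hom_cx X Y n)\<lparr>carrier := stable_cocycles X Y n\<rparr> Mod stable_coboundaries X Y n"

text \<open>
  The action \<open>[\<alpha>] \<mapsto> [\<gamma> \<alpha> \<phi>]\<close> of cochain maps \<open>\<phi> : X' \<rightarrow> X\<close> and \<open>\<gamma> : Y \<rightarrow> Y'\<close>, with values in the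
  stable cohomology of \<open>X'\<close> and \<open>Y'\<close>
\<close>

definition stable_Ext_act ::
  "('o, 'm, 'z) cochain_scheme \<Rightarrow> ('o, 'm, 'z) cochain_scheme \<Rightarrow> int \<Rightarrow>
     (int \<Rightarrow> 'm) \<Rightarrow> (int \<Rightarrow> 'm) \<Rightarrow> (int \<Rightarrow> 'm) set set \<Rightarrow> (int \<Rightarrow> 'm) set set" where
  "stable_Ext_act X' Y' n \<phi> \<gamma> =
     coset_map (stable_hom_cx X' Y' n) (stable_coboundaries X' Y' n)
       (coset_map (hom_cx X' Y' n) (carrier (bounded_hom_cx X' Y' n))
          (\<lambda>\<alpha> i. \<gamma> (n + i) \<cdot> \<alpha> i \<cdot> \<phi> i))"

text \<open>
  The maps induced by \<open>f : M' \<rightarrow> M\<close> and \<open>g : N \<rightarrow> N'\<close>: the common value of the action of all lifts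
  of \<open>f\<close> and \<open>g\<close> to (co)resolutions \<open>I'\<close>, \<open>I\<close>, \<open>J\<close>, \<open>J'\<close> of \<open>M'\<close>, \<open>M\<close>, \<open>N\<close>, \<open>N'\<close>
\<close>

definition stable_Ext_map_V ::
  "('o, 'm) augmented \<Rightarrow> ('o, 'm) augmented \<Rightarrow> ('o, 'm) augmented \<Rightarrow> ('o, 'm) augmented \<Rightarrow>
     int \<Rightarrow> 'm \<Rightarrow> 'm \<Rightarrow> (int \<Rightarrow> 'm) set set \<Rightarrow> (int \<Rightarrow> 'm) set set" where
  "stable_Ext_map_V I' I J J' n f g x =
     (THE y. \<exists>\<phi> \<gamma>. coresolution_lift A I' f I \<phi> \<and> coresolution_lift A J g J' \<gamma> \<and>
                   y = stable_Ext_act I' J' n \<phi> \<gamma> x)"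

definition stable_Ext_map_W ::
  "('o, 'm) augmented \<Rightarrow> ('o, 'm) augmented \<Rightarrow> ('o, 'm) augmented \<Rightarrow> ('o, 'm) augmented \<Rightarrow>
     int \<Rightarrow> 'm \<Rightarrow> 'm \<Rightarrow> (int \<Rightarrow> 'm) set set \<Rightarrow> (int \<Rightarrow> 'm) set set" where
  "stable_Ext_map_W P' P Q Q' n f g x =
     (THE y. \<exists>\<phi> \<gamma>. resolution_lift A P' f P \<phi> \<and> resolution_lift A Q g Q' \<gamma> \<and>
                   y = stable_Ext_act P' Q' n \<phi> \<gamma> x)"

end


section \<open>Sequential colimits of groups\<close>

text \<open>
  The direct system consists of groups \<open>G i\<close> and homomorphisms \<open>t i : G i \<rightarrow> G (i + 1)\<close> for
  \<open>i \<ge> i\<^sub>0\<close>; values for \<open>i < i\<^sub>0\<close> are irrelevant.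
\<close>

fun transition :: "(nat \<Rightarrow> 'a \<Rightarrow> 'a) \<Rightarrow> nat \<Rightarrow> nat \<Rightarrow> 'a \<Rightarrow> 'a" where
  "transition t i 0 x = x"
| "transition t i (Suc k) x = t (i + k) (transition t i k x)"

definition colim_rel ::
  "nat \<Rightarrow> (nat \<Rightarrow> 'a monoid) \<Rightarrow> (nat \<Rightarrow> 'a \<Rightarrow> 'a) \<Rightarrow> ((nat \<times> 'a) \<times> (nat \<times> 'a)) set" where
  "colim_rel i\<^sub>0 G t = {((i, x), (j, y)).
     i\<^sub>0 \<le> i \<and> x \<in> carrier (G i) \<and> i\<^sub>0 \<le> j \<and> y \<in> carrier (G j) \<and>
     (\<exists>k. i \<le> k \<and> j \<le> k \<and> transition t i (k - i) x = transition t j (k - j) y)}"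

definition seq_colim ::
  "nat \<Rightarrow> (nat \<Rightarrow> 'a monoid) \<Rightarrow> (nat \<Rightarrow> 'a \<Rightarrow> 'a) \<Rightarrow> (nat \<times> 'a) set monoid" where
  "seq_colim i\<^sub>0 G t =
     \<lparr>carrier = {(i, x). i\<^sub>0 \<le> i \<and> x \<in> carrier (G i)} // colim_rel i\<^sub>0 G t,
      monoid.mult = (\<lambda>p q. \<Union>(i, x)\<in>p. \<Union>(j, y)\<in>q. let k = max i j in
         colim_rel i\<^sub>0 G t `` {(k, transition t i (k - i) x \<otimes>\<^bsub>G k\<^esub> transition t j (k - j) y)}),
      one = colim_rel i\<^sub>0 G t `` {(i\<^sub>0, \<one>\<^bsub>G i\<^sub>0\<^esub>)}\<rparr>"

text \<open>The map into the colimit of \<open>(G, t)\<close> induced by levelwise maps \<open>u i\<close> into \<open>G i\<close>\<close>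

definition seq_colim_map ::
  "nat \<Rightarrow> (nat \<Rightarrow> 'a monoid) \<Rightarrow> (nat \<Rightarrow> 'a \<Rightarrow> 'a) \<Rightarrow> (nat \<Rightarrow> 'a \<Rightarrow> 'a) \<Rightarrow>
     (nat \<times> 'a) set \<Rightarrow> (nat \<times> 'a) set" where
  "seq_colim_map i\<^sub>0 G t u p = (\<Union>(i, x)\<in>p. colim_rel i\<^sub>0 G t `` {(i, u i x)})"


section \<open>Complete cohomology\<close>

context
  fixes A :: "('o, 'm) addcat" (structure)
begin

definition factoring :: "'o set \<Rightarrow> 'o \<Rightarrow> 'o \<Rightarrow> 'm set" where
  "factoring V X Y = {f \<in> mor A X Y. \<exists>Z\<in>V. \<exists>a\<in>mor A X Z. \<exists>b\<in>mor A Z Y. f = b \<cdot> a}"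

definition Hom_mod :: "'o set \<Rightarrow> 'o \<Rightarrow> 'o \<Rightarrow> 'm set monoid" where
  "Hom_mod V X Y = Hom A X Y Mod factoring V X Y"

definition Hom_mod_class :: "'o set \<Rightarrow> 'o \<Rightarrow> 'o \<Rightarrow> 'm \<Rightarrow> 'm set" where
  "Hom_mod_class V X Y f = factoring V X Y #>\<^bsub>Hom A X Y\<^esub> f"

text \<open>
  For \<open>s = (0 \<rightarrow> M \<rightarrow> I \<rightarrow> M\<^sub>1 \<rightarrow> 0)\<close> and \<open>t = (0 \<rightarrow> N \<rightarrow> J \<rightarrow> N\<^sub>1 \<rightarrow> 0)\<close> the following are the maps
  \<open>Hom(M, N)/V \<rightarrow> Ext\<^sup>1(M\<^sub>1, N)\<close> and \<open>Ext\<^sup>1(M\<^sub>1, N) \<rightarrow> Hom(M\<^sub>1, N\<^sub>1)/V\<close>; the latter sends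
  \<open>e\<close> to the class of any \<open>g\<close> with connecting image \<open>e\<close>.
\<close>

definition delta_V :: "'m \<times> 'm \<Rightarrow> 'm set \<Rightarrow> ('m \<times> 'm) set" where
  "delta_V s c = the_elem (ext_push A s ` c)"

definition beta_V :: "'o set \<Rightarrow> 'm \<times> 'm \<Rightarrow> 'm \<times> 'm \<Rightarrow> ('m \<times> 'm) set \<Rightarrow> 'm set" where
  "beta_V V s t e = (THE c. \<exists>g\<in>mor A (Tgt A (snd s)) (Tgt A (snd t)).
     ext_pull A t g = e \<and> c = Hom_mod_class V (Tgt A (snd s)) (Tgt A (snd t)) g)"

text \<open>
  Dually, for \<open>s = (0 \<rightarrow> M\<^sub>1 \<rightarrow> P \<rightarrow> M \<rightarrow> 0)\<close> and \<open>t = (0 \<rightarrow> N\<^sub>1 \<rightarrow> Q \<rightarrow> N \<rightarrow> 0)\<close>: the maps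
  \<open>Hom(M, N)/W \<rightarrow> Ext\<^sup>1(M, N\<^sub>1)\<close> and \<open>Ext\<^sup>1(M, N\<^sub>1) \<rightarrow> Hom(M\<^sub>1, N\<^sub>1)/W\<close>.
\<close>

definition delta_W :: "'m \<times> 'm \<Rightarrow> 'm set \<Rightarrow> ('m \<times> 'm) set" where
  "delta_W t c = the_elem (ext_pull A t ` c)"

definition beta_W :: "'o set \<Rightarrow> 'm \<times> 'm \<Rightarrow> 'm \<times> 'm \<Rightarrow> ('m \<times> 'm) set \<Rightarrow> 'm set" where
  "beta_W W s t e = (THE c. \<exists>g\<in>mor A (Src A (fst s)) (Src A (fst t)).
     ext_push A s g = e \<and> c = Hom_mod_class W (Src A (fst s)) (Src A (fst t)) g)"

text \<open>
  Direct systems for \<open>i \<ge> max {0, -n}\<close>; note that \<open>nat (-n) = max {0, -n}\<close> and that \<open>int i + n\<close> is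
  nonnegative in this range.
\<close>

definition complete_V_obj ::
  "'o set \<Rightarrow> ('o, 'm) augmented \<Rightarrow> ('o, 'm) augmented \<Rightarrow> int \<Rightarrow> nat \<Rightarrow> 'm set monoid" where
  "complete_V_obj V I J n i = Hom_mod V (Theta A I i) (Theta A J (nat (int i + n)))"

definition complete_V_step ::
  "'o set \<Rightarrow> ('o, 'm) augmented \<Rightarrow> ('o, 'm) augmented \<Rightarrow> int \<Rightarrow> nat \<Rightarrow> 'm set \<Rightarrow> 'm set" where
  "complete_V_step V I J n i c =
     beta_V V (Theta_seq A I i) (Theta_seq A J (nat (int i + n))) (delta_V (Theta_seq A I i) c)"

definition complete_Ext_V ::
  "'o set \<Rightarrow> ('o, 'm) augmented \<Rightarrow> ('o, 'm) augmented \<Rightarrow> int \<Rightarrow> (nat \<times> 'm set) set monoid" where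
  "complete_Ext_V V I J n =
     seq_colim (nat (- n)) (complete_V_obj V I J n) (complete_V_step V I J n)"

definition complete_W_obj ::
  "'o set \<Rightarrow> ('o, 'm) augmented \<Rightarrow> ('o, 'm) augmented \<Rightarrow> int \<Rightarrow> nat \<Rightarrow> 'm set monoid" where
  "complete_W_obj W P Q n i = Hom_mod W (Omega A P (nat (int i + n))) (Omega A Q i)"

definition complete_W_step ::
  "'o set \<Rightarrow> ('o, 'm) augmented \<Rightarrow> ('o, 'm) augmented \<Rightarrow> int \<Rightarrow> nat \<Rightarrow> 'm set \<Rightarrow> 'm set" where
  "complete_W_step W P Q n i c =
     beta_W W (Omega_seq A P (nat (int i + n))) (Omega_seq A Q i) (delta_W (Omega_seq A Q i) c)"

definition complete_Ext_W ::
  "'o set \<Rightarrow> ('o, 'm) augmented \<Rightarrow> ('o, 'm) augmented \<Rightarrow> int \<Rightarrow> (nat \<times> 'm set) set monoid" where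
  "complete_Ext_W W P Q n =
     seq_colim (nat (- n)) (complete_W_obj W P Q n) (complete_W_step W P Q n)"

text \<open>Functoriality: a lift \<open>\<phi>\<close> of \<open>f\<close> restricts to the kernels and descends to the cokernels.\<close>

definition Theta_map ::
  "('o, 'm) augmented \<Rightarrow> ('o, 'm) augmented \<Rightarrow> (int \<Rightarrow> 'm) \<Rightarrow> nat \<Rightarrow> 'm" where
  "Theta_map I J \<phi> i = (THE h. h \<in> mor A (Theta A I i) (Theta A J i) \<and>
     Theta_inc A J i \<cdot> h = \<phi> (int i) \<cdot> Theta_inc A I i)"

definition Omega_map ::
  "('o, 'm) augmented \<Rightarrow> ('o, 'm) augmented \<Rightarrow> (int \<Rightarrow> 'm) \<Rightarrow> nat \<Rightarrow> 'm" where
  "Omega_map P Q \<phi> i = (THE h. h \<in> mor A (Omega A P i) (Omega A Q i) \<and>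
     h \<cdot> Omega_proj A P i = Omega_proj A Q i \<cdot> \<phi> (- int i))"

definition complete_Ext_act_V ::
  "'o set \<Rightarrow> ('o, 'm) augmented \<Rightarrow> ('o, 'm) augmented \<Rightarrow> ('o, 'm) augmented \<Rightarrow> ('o, 'm) augmented \<Rightarrow>
     int \<Rightarrow> (int \<Rightarrow> 'm) \<Rightarrow> (int \<Rightarrow> 'm) \<Rightarrow> (nat \<times> 'm set) set \<Rightarrow> (nat \<times> 'm set) set" where
  "complete_Ext_act_V V I' I J J' n \<phi> \<gamma> =
     seq_colim_map (nat (- n)) (complete_V_obj V I' J' n) (complete_V_step V I' J' n)
       (\<lambda>i. let k = nat (int i + n) in
          coset_map (Hom A (Theta A I' i) (Theta A J' k)) (factoring V (Theta A I' i) (Theta A J' k))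
            (\<lambda>h. Theta_map J J' \<gamma> k \<cdot> h \<cdot> Theta_map I' I \<phi> i))"

definition complete_Ext_act_W ::
  "'o set \<Rightarrow> ('o, 'm) augmented \<Rightarrow> ('o, 'm) augmented \<Rightarrow> ('o, 'm) augmented \<Rightarrow> ('o, 'm) augmented \<Rightarrow>
     int \<Rightarrow> (int \<Rightarrow> 'm) \<Rightarrow> (int \<Rightarrow> 'm) \<Rightarrow> (nat \<times> 'm set) set \<Rightarrow> (nat \<times> 'm set) set" where
  "complete_Ext_act_W W P' P Q Q' n \<phi> \<gamma> =
     seq_colim_map (nat (- n)) (complete_W_obj W P' Q' n) (complete_W_step W P' Q' n)
       (\<lambda>i. let k = nat (int i + n) in
          coset_map (Hom A (Omega A P' k) (Omega A Q' i)) (factoring W (Omega A P' k) (Omega A Q' i))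
            (\<lambda>h. Omega_map Q Q' \<gamma> i \<cdot> h \<cdot> Omega_map P' P \<phi> k))"

definition complete_Ext_map_V ::
  "'o set \<Rightarrow> ('o, 'm) augmented \<Rightarrow> ('o, 'm) augmented \<Rightarrow> ('o, 'm) augmented \<Rightarrow> ('o, 'm) augmented \<Rightarrow>
     int \<Rightarrow> 'm \<Rightarrow> 'm \<Rightarrow> (nat \<times> 'm set) set \<Rightarrow> (nat \<times> 'm set) set" where
  "complete_Ext_map_V V I' I J J' n f g x =
     (THE y. \<exists>\<phi> \<gamma>. coresolution_lift A I' f I \<phi> \<and> coresolution_lift A J g J' \<gamma> \<and>
                   y = complete_Ext_act_V V I' I J J' n \<phi> \<gamma> x)"

definition complete_Ext_map_W ::
  "'o set \<Rightarrow> ('o, 'm) augmented \<Rightarrow> ('o, 'm) augmented \<Rightarrow> ('o, 'm) augmented \<Rightarrow> ('o, 'm) augmented \<Rightarrow>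
     int \<Rightarrow> 'm \<Rightarrow> 'm \<Rightarrow> (nat \<times> 'm set) set \<Rightarrow> (nat \<times> 'm set) set" where
  "complete_Ext_map_W W P' P Q Q' n f g x =
     (THE y. \<exists>\<phi> \<gamma>. resolution_lift A P' f P \<phi> \<and> resolution_lift A Q g Q' \<gamma> \<and>
                   y = complete_Ext_act_W W P' P Q Q' n \<phi> \<gamma> x)"

end

end

(* A degree-n cocycle of the quotient complex Hom~(I,J) commutes, up to the sign (-1)^n, with the
   differentials in all large degrees.  Twisting its i-th component by (-1)^(n i) turns it into an honest
   morphism of complexes there, which induces morphisms Theta^i M -> Theta^(i+n) N on kernels.  Such a
   ladder of short exact sequences is precisely what the transition maps beta delta of the direct system
   compute, because pushing out along the left component and pulling back along the right component
   give the same extension.  Conversely, properness extends a morphism Theta^i M -> Theta^(i+n) N to a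
   ladder, and the ladder is null homotopic in higher degrees once its first component factors through V.
   Hence sending a cocycle to the class of its induced morphisms is an isomorphism onto the colimit for
   any proper coresolutions; the choice of coresolutions is absorbed by lifting identities.
   The statement for W is the one for V in the opposite category. *)

theory Submission
  imports Defs
begin

section \<open>Arrow calculus in preadditive categories\<close>

text \<open>All groups involved are iterated quotients, and most maps between them are given by
  \<open>THE\<close> or by unions over cosets. The isomorphism is therefore not written as a formula
  but as a relation \<open>rep\<close> between cocycles and morphisms of syzygies. It suffices that
  the relation is total on both sides, additive, and respects and reflects equality of classes; a
  function is extracted from it once. Naturality is checked on related pairs, where both functorial
  maps are composition with lifts. Independence of the lifts is seen on the colimit side: two lifts
  of f agree at level 0, and the transition maps propagate equality of their classes modulo V. The
  stable side inherits this through the relation. Coresolutions vanish in negative degrees, so "up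
  to finitely many degrees" means "in all large degrees". The dual half is not a literal rewriting:
  extensions appear with their two arrows swapped, the transition maps are known to agree only on
  elements of the groups, and reversing a cochain changes the differential by a sign.\<close>

lemma carrier_Hom [simp]: "carrier (Hom A X Y) = mor A X Y"
  and mult_Hom [simp]: "monoid.mult (Hom A X Y) = Plus A"
  and one_Hom [simp]: "one (Hom A X Y) = Zero A X Y"
  by (simp_all add: Hom_def)

definition Minus :: "('o, 'm) addcat \<Rightarrow> 'm \<Rightarrow> 'm \<Rightarrow> 'm" where
  "Minus A f g = Plus A f (Neg A g)"

context preadditive_category
begin

lemma mor_objects: "f \<in> mor A X Y \<Longrightarrow> X \<in> Ob A" "f \<in> mor A X Y \<Longrightarrow> Y \<in> Ob A"
  using arrow_objects by (auto simp: mor_def)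

lemma Src_Ob [simp]: "f \<in> Ar A \<Longrightarrow> Src A f \<in> Ob A"
  and Tgt_Ob [simp]: "f \<in> Ar A \<Longrightarrow> Tgt A f \<in> Ob A"
  using arrow_objects by auto

text \<open>Typing is phrased by equations for \<open>Src\<close> and \<open>Tgt\<close> rather than
  by membership in \<open>mor\<close>: the ends of a nested composite are then computed by
  rewriting, and so are the side conditions of associativity and bilinearity. Composites are
  normalised to right-nested form.\<close>

lemma comp_arrow [simp]:
  assumes "f \<in> Ar A" "g \<in> Ar A" "Tgt A f = Src A g"
  shows "g \<cdot> f \<in> Ar A" "Src A (g \<cdot> f) = Src A f" "Tgt A (g \<cdot> f) = Tgt A g"
  using compose_arrow[of f "Src A f" "Tgt A f" g "Tgt A g"] assms by (auto simp: mor_def)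

lemma comp_assoc [simp]:
  assumes "f \<in> Ar A" "g \<in> Ar A" "h \<in> Ar A" "Tgt A f = Src A g" "Tgt A g = Src A h"
  shows "(h \<cdot> g) \<cdot> f = h \<cdot> g \<cdot> f"
  using compose_assoc[of f "Src A f" "Tgt A f" g "Tgt A g" h "Tgt A h"] assms by (auto simp: mor_def)

lemma ident [simp]:
  assumes "X \<in> Ob A"
  shows "Ident A X \<in> Ar A" "Src A (Ident A X) = X" "Tgt A (Ident A X) = X"
  using ident_arrow[OF assms] by (auto simp: mor_def)

lemma comp_ident [simp]:
  "f \<in> Ar A \<Longrightarrow> Src A f = X \<Longrightarrow> f \<cdot> Ident A X = f"
  "f \<in> Ar A \<Longrightarrow> Tgt A f = X \<Longrightarrow> Ident A X \<cdot> f = f"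
  using ident_right ident_left by (auto simp: mor_def)

lemma zero_arrow [simp]:
  assumes "X \<in> Ob A" "Y \<in> Ob A"
  shows "Zero A X Y \<in> Ar A" "Src A (Zero A X Y) = X" "Tgt A (Zero A X Y) = Y"
proof -
  interpret comm_group "Hom A X Y" by (rule hom_group[OF assms])
  show "Zero A X Y \<in> Ar A" "Src A (Zero A X Y) = X" "Tgt A (Zero A X Y) = Y"
    using one_closed by (auto simp: mor_def)
qed

lemma plus_arrow [simp]:
  assumes "f \<in> Ar A" "g \<in> Ar A" "Src A g = Src A f" "Tgt A g = Tgt A f"
  shows "Plus A f g \<in> Ar A" "Src A (Plus A f g) = Src A f" "Tgt A (Plus A f g) = Tgt A f"
proof -
  interpret comm_group "Hom A (Src A f) (Tgt A f)" using assms by (simp add: hom_group)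
  have "Plus A f g \<in> mor A (Src A f) (Tgt A f)"
    using m_closed[of f g] assms by (simp add: mor_def)
  then show "Plus A f g \<in> Ar A" "Src A (Plus A f g) = Src A f" "Tgt A (Plus A f g) = Tgt A f"
    by (auto simp: mor_def)
qed

lemma neg_arrow [simp]:
  assumes "f \<in> Ar A"
  shows "Neg A f \<in> Ar A" "Src A (Neg A f) = Src A f" "Tgt A (Neg A f) = Tgt A f"
proof -
  interpret comm_group "Hom A (Src A f) (Tgt A f)" using assms by (simp add: hom_group)
  have "Neg A f \<in> mor A (Src A f) (Tgt A f)"
    using inv_closed[of f] assms by (simp add: mor_def Neg_def)
  then show "Neg A f \<in> Ar A" "Src A (Neg A f) = Src A f" "Tgt A (Neg A f) = Tgt A f"
    by (auto simp: mor_def)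
qed

lemma plus_commute:
  assumes "f \<in> Ar A" "g \<in> Ar A" "Src A g = Src A f" "Tgt A g = Tgt A f"
  shows "Plus A f g = Plus A g f"
proof -
  interpret comm_group "Hom A (Src A f) (Tgt A f)" using assms by (simp add: hom_group)
  show ?thesis using m_comm[of f g] assms by (simp add: mor_def)
qed

lemma plus_assoc [simp]:
  assumes "f \<in> Ar A" "g \<in> Ar A" "h \<in> Ar A" "Src A g = Src A f" "Tgt A g = Tgt A f"
    "Src A h = Src A f" "Tgt A h = Tgt A f"
  shows "Plus A (Plus A f g) h = Plus A f (Plus A g h)"
proof -
  interpret comm_group "Hom A (Src A f) (Tgt A f)" using assms by (simp add: hom_group)
  show ?thesis using m_assoc[of f g h] assms by (simp add: mor_def)
qed

lemma plus_left_commute: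
  assumes "f \<in> Ar A" "g \<in> Ar A" "h \<in> Ar A" "Src A g = Src A f" "Tgt A g = Tgt A f"
    "Src A h = Src A f" "Tgt A h = Tgt A f"
  shows "Plus A f (Plus A g h) = Plus A g (Plus A f h)"
proof -
  interpret comm_group "Hom A (Src A f) (Tgt A f)" using assms by (simp add: hom_group)
  show ?thesis using m_lcomm[of f g h] assms by (simp add: mor_def)
qed

lemma plus_zero [simp]:
  assumes "f \<in> Ar A" "Src A f = X" "Tgt A f = Y"
  shows "Plus A f (Zero A X Y) = f" "Plus A (Zero A X Y) f = f"
proof -
  interpret comm_group "Hom A X Y" using assms by (auto intro!: hom_group)
  show "Plus A f (Zero A X Y) = f" "Plus A (Zero A X Y) f = f"
    using r_one[of f] l_one[of f] assms by (simp_all add: mor_def)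
qed

lemma plus_neg [simp]:
  assumes "f \<in> Ar A"
  shows "Plus A f (Neg A f) = Zero A (Src A f) (Tgt A f)"
    "Plus A (Neg A f) f = Zero A (Src A f) (Tgt A f)"
proof -
  interpret comm_group "Hom A (Src A f) (Tgt A f)" using assms by (simp add: hom_group)
  show "Plus A f (Neg A f) = Zero A (Src A f) (Tgt A f)"
    "Plus A (Neg A f) f = Zero A (Src A f) (Tgt A f)"
    using r_inv[of f] l_inv[of f] assms by (simp_all add: mor_def Neg_def)
qed

lemma plus_neg_cancel [simp]:
  assumes "f \<in> Ar A" "g \<in> Ar A" "Src A g = Src A f" "Tgt A g = Tgt A f"
  shows "Plus A f (Plus A (Neg A f) g) = g" "Plus A (Neg A f) (Plus A f g) = g"
  using plus_assoc[of f "Neg A f" g] plus_assoc[of "Neg A f" f g] assms by simp_all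

lemma neg_neg [simp]:
  assumes "f \<in> Ar A"
  shows "Neg A (Neg A f) = f"
proof -
  interpret comm_group "Hom A (Src A f) (Tgt A f)" using assms by (simp add: hom_group)
  have "Neg A (Neg A f) = inv\<^bsub>Hom A (Src A f) (Tgt A f)\<^esub> (Neg A f)"
    using assms by (simp add: Neg_def[of A "Neg A f"])
  then show ?thesis using inv_inv[of f] assms by (simp add: mor_def Neg_def)
qed

lemma neg_plus [simp]:
  assumes "f \<in> Ar A" "g \<in> Ar A" "Src A g = Src A f" "Tgt A g = Tgt A f"
  shows "Neg A (Plus A f g) = Plus A (Neg A f) (Neg A g)"
proof -
  interpret comm_group "Hom A (Src A f) (Tgt A f)" using assms by (simp add: hom_group)
  show ?thesis using inv_mult[of f g] assms by (simp add: mor_def Neg_def)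
qed

lemma plus_eq_self:
  assumes "f \<in> Ar A" "g \<in> Ar A" "Src A g = Src A f" "Tgt A g = Tgt A f" "Plus A f g = f"
  shows "g = Zero A (Src A f) (Tgt A f)"
  using plus_neg_cancel(2)[of f g] assms by simp

lemma comp_plus [simp]:
  assumes "f \<in> Ar A" "g \<in> Ar A" "h \<in> Ar A" "Src A g = Src A f" "Tgt A g = Tgt A f"
  shows "Tgt A f = Src A h \<Longrightarrow> h \<cdot> Plus A f g = Plus A (h \<cdot> f) (h \<cdot> g)"
    "Src A f = Tgt A h \<Longrightarrow> Plus A f g \<cdot> h = Plus A (f \<cdot> h) (g \<cdot> h)"
  using assms compose_plus_right[of f "Src A f" "Tgt A f" g h "Tgt A h"]
    compose_plus_left[of h "Src A h" "Tgt A h" f "Tgt A f" g] by (simp_all add: mor_def)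

text \<open>By bilinearity a composite x with a zero arrow satisfies x + x = x, and in a group only
  the neutral element does.\<close>

lemma comp_zero [simp]:
  assumes "h \<in> Ar A" "X \<in> Ob A"
  shows "Src A h = Y \<Longrightarrow> h \<cdot> Zero A X Y = Zero A X (Tgt A h)"
    "Tgt A h = Y \<Longrightarrow> Zero A Y X \<cdot> h = Zero A (Src A h) X"
proof -
  show "h \<cdot> Zero A X Y = Zero A X (Tgt A h)" if [symmetric, simp]: "Src A h = Y"
  proof -
    have "Plus A (Zero A X Y) (Zero A X Y) = Zero A X Y" using assms by simp
    then have "Plus A (h \<cdot> Zero A X Y) (h \<cdot> Zero A X Y) = h \<cdot> Zero A X Y"
      using comp_plus(1)[of "Zero A X Y" "Zero A X Y" h] assms by simp
    from plus_eq_self[OF _ _ _ _ this] show ?thesis using assms by simp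
  qed
  show "Zero A Y X \<cdot> h = Zero A (Src A h) X" if [symmetric, simp]: "Tgt A h = Y"
  proof -
    have "Plus A (Zero A Y X) (Zero A Y X) = Zero A Y X" using assms by simp
    then have "Plus A (Zero A Y X \<cdot> h) (Zero A Y X \<cdot> h) = Zero A Y X \<cdot> h"
      using comp_plus(2)[of "Zero A Y X" "Zero A Y X" h] assms by simp
    from plus_eq_self[OF _ _ _ _ this] show ?thesis using assms by simp
  qed
qed

lemma neg_unique:
  assumes "f \<in> Ar A" "g \<in> Ar A" "Src A g = Src A f" "Tgt A g = Tgt A f"
    "Plus A f g = Zero A (Src A f) (Tgt A f)"
  shows "g = Neg A f"
  using plus_neg_cancel(2)[of f g] assms by simp

lemma neg_zero [simp]: "X \<in> Ob A \<Longrightarrow> Y \<in> Ob A \<Longrightarrow> Neg A (Zero A X Y) = Zero A X Y"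
  by (rule neg_unique[symmetric]) simp_all

lemma comp_neg [simp]:
  assumes "f \<in> Ar A" "g \<in> Ar A" "Tgt A f = Src A g"
  shows "g \<cdot> Neg A f = Neg A (g \<cdot> f)" "Neg A g \<cdot> f = Neg A (g \<cdot> f)"
proof -
  have "Plus A (g \<cdot> f) (g \<cdot> Neg A f) = g \<cdot> Plus A f (Neg A f)"
    using assms by (subst comp_plus(1)) simp_all
  also have "\<dots> = Zero A (Src A f) (Tgt A g)"
    using assms by simp
  finally show "g \<cdot> Neg A f = Neg A (g \<cdot> f)"
    using assms by (intro neg_unique) simp_all
  have "Plus A (g \<cdot> f) (Neg A g \<cdot> f) = Plus A g (Neg A g) \<cdot> f"
    using assms by (subst comp_plus(2)) simp_all
  also have "\<dots> = Zero A (Src A f) (Tgt A g)"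
    using assms by simp
  finally show "Neg A g \<cdot> f = Neg A (g \<cdot> f)"
    using assms by (intro neg_unique) simp_all
qed

lemma minus_arrow [simp]:
  assumes "f \<in> Ar A" "g \<in> Ar A" "Src A g = Src A f" "Tgt A g = Tgt A f"
  shows "Minus A f g \<in> Ar A" "Src A (Minus A f g) = Src A f" "Tgt A (Minus A f g) = Tgt A f"
  using assms by (simp_all add: Minus_def)

lemma comp_minus [simp]:
  assumes "f \<in> Ar A" "g \<in> Ar A" "h \<in> Ar A" "Src A g = Src A f" "Tgt A g = Tgt A f"
  shows "Tgt A f = Src A h \<Longrightarrow> h \<cdot> Minus A f g = Minus A (h \<cdot> f) (h \<cdot> g)"
    "Src A f = Tgt A h \<Longrightarrow> Minus A f g \<cdot> h = Minus A (f \<cdot> h) (g \<cdot> h)"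
  using assms by (simp_all add: Minus_def)

lemma minus_eq_iff:
  assumes "f \<in> Ar A" "g \<in> Ar A" "h \<in> Ar A" "Src A g = Src A f" "Tgt A g = Tgt A f"
    "Src A h = Src A f" "Tgt A h = Tgt A f"
  shows "Minus A f g = h \<longleftrightarrow> f = Plus A h g"
proof
  assume "Minus A f g = h"
  then have "Plus A h g = Plus A (Plus A f (Neg A g)) g" by (simp add: Minus_def)
  also have "\<dots> = f" using assms plus_assoc[of f "Neg A g" g] by simp
  finally show "f = Plus A h g" by simp
next
  assume f: "f = Plus A h g"
  have "Minus A (Plus A h g) g = h"
    unfolding Minus_def using assms plus_assoc[of h g "Neg A g"] by simp
  then show "Minus A f g = h" using f by simp
qed

lemma minus_self [simp]: "f \<in> Ar A \<Longrightarrow> Minus A f f = Zero A (Src A f) (Tgt A f)"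
  by (simp add: Minus_def)

lemma minus_eq_zero:
  assumes "f \<in> Ar A" "g \<in> Ar A" "Src A g = Src A f" "Tgt A g = Tgt A f"
    "Minus A f g = Zero A X Y" "X = Src A f" "Y = Tgt A f"
  shows "f = g"
  using minus_eq_iff[of f g "Zero A X Y"] assms by simp

lemma minus_zeroD:
  assumes "Minus A f g = Zero A X Y" "f \<in> mor A X Y" "g \<in> mor A X Y"
  shows "f = g"
  by (rule minus_eq_zero[OF _ _ _ _ assms(1)]) (use assms in \<open>auto simp: mor_def\<close>)

lemma mor_simps:
  "f \<in> mor A X Y \<Longrightarrow> g \<in> mor A Y Z \<Longrightarrow> g \<cdot> f \<in> mor A X Z"
  "f \<in> mor A X Y \<Longrightarrow> f' \<in> mor A X Y \<Longrightarrow> Plus A f f' \<in> mor A X Y"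
  "f \<in> mor A X Y \<Longrightarrow> f' \<in> mor A X Y \<Longrightarrow> Minus A f f' \<in> mor A X Y"
  "f \<in> mor A X Y \<Longrightarrow> Neg A f \<in> mor A X Y"
  "X \<in> Ob A \<Longrightarrow> Y \<in> Ob A \<Longrightarrow> Zero A X Y \<in> mor A X Y"
  "X \<in> Ob A \<Longrightarrow> Ident A X \<in> mor A X X"
  by (simp_all add: mor_def)

section \<open>Monos, epis, kernels and cokernels in additive terms\<close>

text \<open>Two arrows equalised by f have a difference killed by f, so cancellation need only be
  tested against zero.\<close>

lemma mono_arrowI:
  assumes "f \<in> mor A X Y"
    "\<And>Z g. g \<in> mor A Z X \<Longrightarrow> f \<cdot> g = Zero A Z Y \<Longrightarrow> g = Zero A Z X"
  shows "mono_arrow A f"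
  unfolding mono_arrow_def
proof (intro conjI ballI impI)
  show "f \<in> Ar A" using assms by (simp add: mor_def)
  fix Z g h assume gh: "g \<in> mor A Z (Src A f)" "h \<in> mor A Z (Src A f)" "f \<cdot> g = f \<cdot> h"
  have "Minus A g h = Zero A Z X"
    using gh assms(1) mor_objects[OF gh(1)] by (intro assms(2)) (auto simp: mor_def)
  then show "g = h" using gh assms(1) by (intro minus_eq_zero[of g h Z X]) (auto simp: mor_def)
qed

lemma epi_arrowI:
  assumes "f \<in> mor A X Y"
    "\<And>Z g. g \<in> mor A Y Z \<Longrightarrow> g \<cdot> f = Zero A X Z \<Longrightarrow> g = Zero A Y Z"
  shows "epi_arrow A f"
  unfolding epi_arrow_def
proof (intro conjI ballI impI)
  show "f \<in> Ar A" using assms by (simp add: mor_def)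
  fix Z g h assume gh: "g \<in> mor A (Tgt A f) Z" "h \<in> mor A (Tgt A f) Z" "g \<cdot> f = h \<cdot> f"
  have "Minus A g h = Zero A Y Z"
    using gh assms(1) mor_objects[OF gh(1)] by (intro assms(2)) (auto simp: mor_def)
  then show "g = h" using gh assms(1) by (intro minus_eq_zero[of g h Y Z]) (auto simp: mor_def)
qed

lemma mono_arrowD:
  assumes "mono_arrow A f" "f \<in> mor A X Y" "g \<in> mor A Z X" "h \<in> mor A Z X" "f \<cdot> g = f \<cdot> h"
  shows "g = h"
proof -
  have "Z \<in> Ob A" "Src A f = X" using assms(2,3) by (auto simp: mor_def)
  then show ?thesis using assms unfolding mono_arrow_def by blast
qed

lemma epi_arrowD:
  assumes "epi_arrow A f" "f \<in> mor A X Y" "g \<in> mor A Y Z" "h \<in> mor A Y Z" "g \<cdot> f = h \<cdot> f"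
  shows "g = h"
proof -
  have "Z \<in> Ob A" "Tgt A f = Y" using assms(2,3) by (auto simp: mor_def)
  then show ?thesis using assms unfolding epi_arrow_def by blast
qed

lemma kernel_factor:
  assumes "is_kernel A f k" "f \<in> mor A X Y" "g \<in> mor A Z X" "f \<cdot> g = Zero A Z Y"
  shows "\<exists>h\<in>mor A Z (Src A k). k \<cdot> h = g"
proof -
  have "Z \<in> Ob A" "Src A f = X" "Tgt A f = Y" using assms(2,3) by (auto simp: mor_def)
  then show ?thesis using assms unfolding is_kernel_def by blast
qed

lemma cokernel_factor:
  assumes "is_cokernel A f c" "f \<in> mor A X Y" "g \<in> mor A Y Z" "g \<cdot> f = Zero A X Z"
  shows "\<exists>h\<in>mor A (Tgt A c) Z. h \<cdot> c = g"
proof -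
  have "Z \<in> Ob A" "Src A f = X" "Tgt A f = Y" using assms(2,3) by (auto simp: mor_def)
  then show ?thesis using assms unfolding is_cokernel_def by blast
qed

lemma kernel_arrow:
  assumes "is_kernel A f k" "f \<in> mor A X Y"
  shows "k \<in> mor A (Src A k) X" "f \<cdot> k = Zero A (Src A k) Y"
  using assms by (auto simp: is_kernel_def mor_def)

lemma cokernel_arrow:
  assumes "is_cokernel A f c" "f \<in> mor A X Y"
  shows "c \<in> mor A Y (Tgt A c)" "c \<cdot> f = Zero A X (Tgt A c)"
  using assms by (auto simp: is_cokernel_def mor_def)

text \<open>The zero arrow factors through k in only one way, so everything that k kills is
  zero.\<close>

lemma kernel_mono:
  assumes "is_kernel A f k"
  shows "mono_arrow A k"
proof -
  have k: "k \<in> Ar A" "f \<in> Ar A" "Tgt A k = Src A f" "f \<cdot> k = Zero A (Src A k) (Tgt A f)"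
    using assms by (auto simp: is_kernel_def)
  show ?thesis
  proof (rule mono_arrowI)
    show "k \<in> mor A (Src A k) (Src A f)" using k by (simp add: mor_def)
    fix Z g assume g: "g \<in> mor A Z (Src A k)" "k \<cdot> g = Zero A Z (Src A f)"
    then have Z: "Z \<in> Ob A" by (auto simp: mor_def)
    have "\<exists>!h. h \<in> mor A Z (Src A k) \<and> k \<cdot> h = Zero A Z (Src A f)"
      using assms Z k unfolding is_kernel_def by (auto simp: mor_def)
    moreover have "Zero A Z (Src A k) \<in> mor A Z (Src A k)" "k \<cdot> Zero A Z (Src A k) = Zero A Z (Src A f)"
      using Z k by (simp_all add: mor_def)
    ultimately show "g = Zero A Z (Src A k)" using g by blast
  qed
qed

lemma cokernel_epi:
  assumes "is_cokernel A f k"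
  shows "epi_arrow A k"
proof -
  have k: "k \<in> Ar A" "f \<in> Ar A" "Src A k = Tgt A f" "k \<cdot> f = Zero A (Src A f) (Tgt A k)"
    using assms by (auto simp: is_cokernel_def)
  show ?thesis
  proof (rule epi_arrowI)
    show "k \<in> mor A (Tgt A f) (Tgt A k)" using k by (simp add: mor_def)
    fix Z g assume g: "g \<in> mor A (Tgt A k) Z" "g \<cdot> k = Zero A (Tgt A f) Z"
    then have Z: "Z \<in> Ob A" by (auto simp: mor_def)
    have "\<exists>!h. h \<in> mor A (Tgt A k) Z \<and> h \<cdot> k = Zero A (Tgt A f) Z"
      using assms Z k unfolding is_cokernel_def by (auto simp: mor_def)
    moreover have "Zero A (Tgt A k) Z \<in> mor A (Tgt A k) Z" "Zero A (Tgt A k) Z \<cdot> k = Zero A (Tgt A f) Z"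
      using Z k by (simp_all add: mor_def)
    ultimately show "g = Zero A (Tgt A k) Z" using g by blast
  qed
qed

lemma is_kernelI:
  assumes "f \<in> mor A X Y" "k \<in> mor A K X" "f \<cdot> k = Zero A K Y" "mono_arrow A k"
    "\<And>Z g. g \<in> mor A Z X \<Longrightarrow> f \<cdot> g = Zero A Z Y \<Longrightarrow> \<exists>h\<in>mor A Z K. k \<cdot> h = g"
  shows "is_kernel A f k"
  unfolding is_kernel_def
proof (intro conjI ballI impI)
  fix Z g assume g: "g \<in> mor A Z (Src A f)" "f \<cdot> g = Zero A Z (Tgt A f)"
  then obtain h where "h \<in> mor A Z K" "k \<cdot> h = g"
    using assms(1,5) by (auto simp: mor_def)
  then show "\<exists>!h. h \<in> mor A Z (Src A k) \<and> k \<cdot> h = g"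
    using mono_arrowD[OF assms(4,2)] assms(2) by (auto simp: mor_def)
qed (use assms in \<open>auto simp: mor_def\<close>)

end

section \<open>Opposite categories and images\<close>

text \<open>Objects, arrows, identities and sums are shared with the original category, so every
  arrow is literally its own dual and \<open>opcat\<close> is an involution on the nose. Dual
  statements become instances that simplification rewrites back.\<close>

definition opcat :: "('o, 'm) addcat \<Rightarrow> ('o, 'm) addcat" where
  "opcat A = \<lparr>Ob = Ob A, Ar = Ar A, Src = Tgt A, Tgt = Src A, Ident = Ident A,
     Compose = (\<lambda>g f. Compose A f g), Plus = Plus A, Zero = (\<lambda>X Y. Zero A Y X)\<rparr>"

lemma opcat_simps [simp]:
  "Ob (opcat A) = Ob A" "Ar (opcat A) = Ar A" "Src (opcat A) = Tgt A" "Tgt (opcat A) = Src A"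
  "Ident (opcat A) = Ident A" "Compose (opcat A) g f = Compose A f g" "Plus (opcat A) = Plus A"
  "Zero (opcat A) X Y = Zero A Y X"
  by (simp_all add: opcat_def)

lemma mor_opcat [simp]: "mor (opcat A) X Y = mor A Y X"
  by (auto simp: mor_def)

lemma Hom_opcat [simp]: "Hom (opcat A) X Y = Hom A Y X"
  by (simp add: Hom_def)

lemma Neg_opcat [simp]: "Neg (opcat A) = Neg A"
  by (simp add: Neg_def fun_eq_iff)

lemma opcat_opcat [simp]: "opcat (opcat A) = A"
  by (simp add: opcat_def)

lemma is_kernel_opcat [simp]: "is_kernel (opcat A) = is_cokernel A"
  by (simp add: is_kernel_def is_cokernel_def fun_eq_iff)

lemma is_cokernel_opcat [simp]: "is_cokernel (opcat A) = is_kernel A"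
  by (simp add: is_kernel_def is_cokernel_def fun_eq_iff)

lemma mono_arrow_opcat [simp]: "mono_arrow (opcat A) = epi_arrow A"
  by (simp add: mono_arrow_def epi_arrow_def fun_eq_iff)

lemma epi_arrow_opcat [simp]: "epi_arrow (opcat A) = mono_arrow A"
  by (simp add: mono_arrow_def epi_arrow_def fun_eq_iff)

lemma zero_object_opcat [simp]: "zero_object (opcat A) = zero_object A"
  by (auto simp: zero_object_def fun_eq_iff)

lemma isomorphic_opcat [simp]: "isomorphic (opcat A) X Y = isomorphic A X Y"
  by (auto simp: isomorphic_def)

lemma biproduct_opcat [simp]: "biproduct (opcat A) X Y Z = biproduct A X Y Z"
  unfolding biproduct_def by (simp; blast)

lemma subcategory_opcat [simp]: "subcategory (opcat A) V = subcategory A V"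
  by (simp add: subcategory_def)

lemma factoring_opcat [simp]: "factoring (opcat A) V X Y = factoring A V Y X"
  by (auto simp: factoring_def)

lemma abelian_category_opcat:
  assumes "abelian_category A"
  shows "abelian_category (opcat A)"
proof -
  interpret abelian_category A by (rule assms)
  show ?thesis
    by (intro abelian_category.intro preadditive_category.intro abelian_category_axioms.intro)
      (use has_zero_object has_biproducts in
        \<open>auto simp: mor_def hom_group has_kernels has_cokernels mono_is_kernel epi_is_cokernel\<close>)
qed

context abelian_category
begin

text \<open>a is the kernel of some g. Since g kills a, it factors through the cokernel c, so
  whatever c kills is killed by g and hence factors through a.\<close>

lemma mono_kernel_of_cokernel:
  assumes "mono_arrow A a" "is_cokernel A a c"
  shows "is_kernel A c a"
proof -
  obtain g where g: "is_kernel A g a" using mono_is_kernel assms by blast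
  then have gm: "g \<in> mor A (Tgt A a) (Tgt A g)" and a: "a \<in> mor A (Src A a) (Tgt A a)"
    and ga: "g \<cdot> a = Zero A (Src A a) (Tgt A g)"
    by (auto simp: is_kernel_def mor_def)
  note c = cokernel_arrow[OF assms(2) a]
  obtain w where w: "w \<in> mor A (Tgt A c) (Tgt A g)" "w \<cdot> c = g"
    using cokernel_factor[OF assms(2) a gm ga] by blast
  show ?thesis
  proof (rule is_kernelI[OF c(1) a c(2) assms(1)])
    fix Z x assume x: "x \<in> mor A Z (Tgt A a)" "c \<cdot> x = Zero A Z (Tgt A c)"
    have "g \<cdot> x = w \<cdot> (c \<cdot> x)" using w c x(1) by (auto simp: mor_def)
    also have "\<dots> = Zero A Z (Tgt A g)" using x w by (auto simp: mor_def)
    finally show "\<exists>h\<in>mor A Z (Src A a). a \<cdot> h = x"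
      using kernel_factor[OF g gm x(1)] by blast
  qed
qed

text \<open>Exactness is defined by images, that is, by kernels of cokernels, which is not visibly
  self-dual. It becomes so because the cokernel c of f is also the cokernel of its own kernel
  k.\<close>

lemma exact_at_opcat_imp:
  assumes "exact_at A f g"
  shows "exact_at (opcat A) g f"
proof -
  obtain k c where k: "is_cokernel A f c" "is_kernel A c k" "is_kernel A g k"
    using assms by (auto simp: exact_at_def is_image_def)
  interpret op: abelian_category "opcat A"
    by (rule abelian_category_opcat) unfold_locales
  have "is_cokernel A k c"
    using op.mono_kernel_of_cokernel[of c k] cokernel_epi[OF k(1)] k(2) by simp
  then show ?thesis
    using k by (auto simp: exact_at_def is_image_def)
qed

end

lemma exact_at_opcat:
  assumes "abelian_category A"
  shows "exact_at (opcat A) g f \<longleftrightarrow> exact_at A f g"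
  using abelian_category.exact_at_opcat_imp[OF assms, of f g]
    abelian_category.exact_at_opcat_imp[OF abelian_category_opcat[OF assms], of g f] by auto

lemma short_exact_opcat:
  assumes "abelian_category A"
  shows "short_exact (opcat A) b a \<longleftrightarrow> short_exact A a b"
  by (auto simp: short_exact_def exact_at_opcat[OF assms])

section \<open>Images and short exact sequences\<close>

context abelian_category
begin

lemma op_abelian: "abelian_category (opcat A)"
  by (rule abelian_category_opcat) unfold_locales

lemma kernel_unique:
  assumes "is_kernel A f k" "is_kernel A f k'"
  obtains h h' where "h \<in> mor A (Src A k) (Src A k')" "h' \<in> mor A (Src A k') (Src A k)"
    "k' \<cdot> h = k" "k \<cdot> h' = k'"
proof -
  have f: "f \<in> mor A (Src A f) (Tgt A f)" using assms by (auto simp: is_kernel_def mor_def)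
  show thesis
    using kernel_factor[OF assms(2) f kernel_arrow[OF assms(1) f]]
      kernel_factor[OF assms(1) f kernel_arrow[OF assms(2) f]] that by blast
qed

text \<open>Sharing the kernel k, the arrows f and g kill the same arrows. This moves a property
  from the kernel that an existential provides to the kernel at hand.\<close>

lemma is_kernel_iso:
  assumes "is_kernel A f k" "is_kernel A g k" "is_kernel A f a"
  shows "is_kernel A g a"
proof -
  have f: "f \<in> mor A (Src A f) (Tgt A f)" using assms by (auto simp: is_kernel_def mor_def)
  have g: "g \<in> mor A (Src A f) (Tgt A g)" using assms by (auto simp: is_kernel_def mor_def)
  note a = kernel_arrow[OF assms(3) f] and k = kernel_arrow[OF assms(2) g]
  obtain h h' where h: "h \<in> mor A (Src A a) (Src A k)" "h' \<in> mor A (Src A k) (Src A a)"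
    "k \<cdot> h = a" "a \<cdot> h' = k" by (rule kernel_unique[OF assms(3,1)])
  have "g \<cdot> a = (g \<cdot> k) \<cdot> h" using g k(1) h(1,3) by (auto simp: mor_def)
  also have "\<dots> = Zero A (Src A a) (Tgt A g)"
    unfolding k(2) using h(1) k(1) g by (auto simp: mor_def)
  finally show ?thesis
  proof (rule is_kernelI[OF g a(1) _ kernel_mono[OF assms(3)]])
    fix Z x assume x: "x \<in> mor A Z (Src A f)" "g \<cdot> x = Zero A Z (Tgt A g)"
    then obtain y where y: "y \<in> mor A Z (Src A k)" "k \<cdot> y = x"
      using kernel_factor[OF assms(2) g] by blast
    have "a \<cdot> (h' \<cdot> y) = (a \<cdot> h') \<cdot> y" using a(1) h(2) y(1) by (auto simp: mor_def)
    then have "a \<cdot> (h' \<cdot> y) = x" using h(4) y(2) by simp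
    moreover have "h' \<cdot> y \<in> mor A Z (Src A a)" using h(2) y(1) by (auto simp: mor_def)
    ultimately show "\<exists>h\<in>mor A Z (Src A a). a \<cdot> h = x" by blast
  qed
qed

lemma mono_exact_is_kernel:
  assumes "mono_arrow A a" "exact_at A a b"
  shows "is_kernel A b a"
proof -
  obtain k c where k: "is_cokernel A a c" "is_kernel A c k" "is_kernel A b k"
    using assms by (auto simp: exact_at_def is_image_def)
  then show ?thesis
    using mono_kernel_of_cokernel[OF assms(1) k(1)] is_kernel_iso by blast
qed

lemma epi_exact_is_cokernel:
  assumes "epi_arrow A b" "exact_at A a b"
  shows "is_cokernel A a b"
  using abelian_category.mono_exact_is_kernel[OF op_abelian, of b a] assms
  by (simp add: exact_at_opcat[OF abelian_category_axioms])

text \<open>The working form of short exactness: it is self-dual and gives both universal properties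
  directly.\<close>

lemma short_exact_iff: "short_exact A a b \<longleftrightarrow> is_kernel A b a \<and> is_cokernel A a b"
proof
  show "short_exact A a b \<Longrightarrow> is_kernel A b a \<and> is_cokernel A a b"
    by (simp add: short_exact_def mono_exact_is_kernel epi_exact_is_cokernel)
  assume "is_kernel A b a \<and> is_cokernel A a b"
  then show "short_exact A a b"
    unfolding short_exact_def exact_at_def is_image_def
    using kernel_mono cokernel_epi by blast
qed

lemma epi_cokernel_of_kernel:
  assumes "epi_arrow A b" "is_kernel A b k"
  shows "is_cokernel A k b"
  using abelian_category.mono_kernel_of_cokernel[OF op_abelian, of b k] assms by simp

text \<open>If v p = 0, then p factors through the kernel w of v, so f factors through the subobject
  k w of its image. That subobject is itself a kernel, whence k factors through it; so w has a right
  inverse and v vanishes.\<close>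

lemma image_epi:
  assumes f: "f \<in> mor A X Y" and c: "is_cokernel A f c" and k: "is_kernel A c k"
    and p: "p \<in> mor A X (Src A k)" "k \<cdot> p = f"
  shows "epi_arrow A p"
proof (rule epi_arrowI[OF p(1)])
  fix Z v assume v: "v \<in> mor A (Src A k) Z" "v \<cdot> p = Zero A X Z"
  have km: "k \<in> mor A (Src A k) Y"
    using kernel_arrow(1)[OF k cokernel_arrow(1)[OF c f]] .
  have "v \<in> Ar A" using v by (simp add: mor_def)
  then obtain w where w: "is_kernel A v w" using has_kernels by blast
  note wm = kernel_arrow[OF w v(1)]
  obtain q where q: "q \<in> mor A X (Src A w)" "w \<cdot> q = p"
    using kernel_factor[OF w v(1) p(1) v(2)] by blast
  have kw: "k \<cdot> w \<in> mor A (Src A w) Y" using km wm by (auto simp: mor_def)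
  have "mono_arrow A (k \<cdot> w)"
  proof (rule mono_arrowI[OF kw])
    fix U g assume g: "g \<in> mor A U (Src A w)" "(k \<cdot> w) \<cdot> g = Zero A U Y"
    have wg: "w \<cdot> g \<in> mor A U (Src A k)" and z: "Zero A U (Src A k) \<in> mor A U (Src A k)"
      and z': "Zero A U (Src A w) \<in> mor A U (Src A w)"
      using wm km g by (auto simp: mor_def)
    have "k \<cdot> (w \<cdot> g) = k \<cdot> Zero A U (Src A k)"
      using g km wm by (auto simp: mor_def)
    then have "w \<cdot> g = Zero A U (Src A k)"
      using mono_arrowD[OF kernel_mono[OF k] km wg z] by blast
    then have "w \<cdot> g = w \<cdot> Zero A U (Src A w)"
      using g km wm by (auto simp: mor_def)
    then show "g = Zero A U (Src A w)"
      using mono_arrowD[OF kernel_mono[OF w] wm(1) g(1) z'] by blast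
  qed
  \<comment> \<open>Here the axiom that monos are kernels enters: z kills \<open>f = k w q\<close>,
    hence factors through the cokernel c, hence kills k.\<close>
  then obtain z where z: "is_kernel A z (k \<cdot> w)" using mono_is_kernel by blast
  then have zm: "z \<in> mor A Y (Tgt A z)" using kw by (auto simp: is_kernel_def mor_def)
  have zkw: "z \<cdot> (k \<cdot> w) = Zero A (Src A w) (Tgt A z)"
    using z kw by (auto simp: is_kernel_def mor_def)
  have "z \<cdot> f = (z \<cdot> (k \<cdot> w)) \<cdot> q"
    unfolding p(2)[symmetric] q(2)[symmetric] using zm km wm q by (auto simp: mor_def)
  also have "\<dots> = Zero A X (Tgt A z)" unfolding zkw using zm wm q by (auto simp: mor_def)
  finally obtain z' where z': "z' \<in> mor A (Tgt A c) (Tgt A z)" "z' \<cdot> c = z"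
    using cokernel_factor[OF c f zm] by blast
  note cm = cokernel_arrow[OF c f]
  have ck: "c \<cdot> k = Zero A (Src A k) (Tgt A c)" using kernel_arrow(2)[OF k cm(1)] .
  have "z \<cdot> k = z' \<cdot> (c \<cdot> k)"
    unfolding z'(2)[symmetric] using z' cm km by (auto simp: mor_def)
  also have "\<dots> = Zero A (Src A k) (Tgt A z)"
    unfolding ck using z' km by (auto simp: mor_def)
  finally obtain y where y: "y \<in> mor A (Src A k) (Src A w)" "(k \<cdot> w) \<cdot> y = k"
    using kernel_factor[OF z zm km] kw by (auto simp: mor_def)
  have "k \<cdot> (w \<cdot> y) = k \<cdot> Ident A (Src A k)"
    using y km wm by (auto simp: mor_def)
  moreover have "w \<cdot> y \<in> mor A (Src A k) (Src A k)" "Ident A (Src A k) \<in> mor A (Src A k) (Src A k)"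
    using y km wm by (auto simp: mor_def)
  ultimately have wy: "w \<cdot> y = Ident A (Src A k)"
    using mono_arrowD[OF kernel_mono[OF k] km] by blast
  have "v = v \<cdot> (w \<cdot> y)" unfolding wy using v by (auto simp: mor_def)
  also have "\<dots> = (v \<cdot> w) \<cdot> y" using v(1) wm(1) y(1) by (auto simp: mor_def)
  also have "\<dots> = Zero A (Src A k) Z" unfolding wm(2) using v(1) wm(1) y(1) km by (auto simp: mor_def)
  finally show "v = Zero A (Src A k) Z" .
qed

text \<open>Exactness makes k a kernel of the cokernel of f, so the corestriction p of f to k is the
  epi part of the image factorisation. As k is mono, p and f have the same kernel.\<close>

lemma exact_factorization:
  assumes f: "f \<in> mor A X Y" and g: "g \<in> mor A Y Z" and ex: "exact_at A f g"
    and i: "is_kernel A f i" and k: "is_kernel A g k"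
  shows "\<exists>!p. p \<in> mor A X (Src A k) \<and> k \<cdot> p = f"
    "p \<in> mor A X (Src A k) \<Longrightarrow> k \<cdot> p = f \<Longrightarrow> short_exact A i p"
proof -
  obtain k' c where k': "is_cokernel A f c" "is_kernel A c k'" "is_kernel A g k'"
    using ex by (auto simp: exact_at_def is_image_def)
  have ck: "is_kernel A c k" by (rule is_kernel_iso[OF k'(3,2) k])
  note km = kernel_arrow[OF k g] and cm = cokernel_arrow[OF k'(1) f]
  obtain q where q: "q \<in> mor A X (Src A k)" "k \<cdot> q = f"
    using kernel_factor[OF ck cm(1) f cm(2)] by blast
  then show "\<exists>!p. p \<in> mor A X (Src A k) \<and> k \<cdot> p = f"
    using mono_arrowD[OF kernel_mono[OF k] km(1)] by auto
  fix p assume p: "p \<in> mor A X (Src A k)" "k \<cdot> p = f"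
  have "epi_arrow A p" by (rule image_epi[OF f k'(1) ck p])
  moreover have "is_kernel A p i"
  proof (rule is_kernelI[OF p(1) kernel_arrow(1)[OF i f] _ kernel_mono[OF i]])
    note im = kernel_arrow[OF i f]
    have "k \<cdot> (p \<cdot> i) = k \<cdot> Zero A (Src A i) (Src A k)"
      using im p km by (auto simp: mor_def simp flip: comp_assoc)
    moreover have "p \<cdot> i \<in> mor A (Src A i) (Src A k)" "Zero A (Src A i) (Src A k) \<in> mor A (Src A i) (Src A k)"
      using im p km by (auto simp: mor_def)
    ultimately show "p \<cdot> i = Zero A (Src A i) (Src A k)"
      using mono_arrowD[OF kernel_mono[OF k] km(1)] by blast
    fix U x assume x: "x \<in> mor A U X" "p \<cdot> x = Zero A U (Src A k)"
    have "f \<cdot> x = k \<cdot> (p \<cdot> x)" unfolding p(2)[symmetric] using km p x(1) by (auto simp: mor_def)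
    also have "\<dots> = Zero A U Y" unfolding x(2) using km x(1) by (auto simp: mor_def)
    finally show "\<exists>h\<in>mor A U (Src A i). i \<cdot> h = x" using kernel_factor[OF i f x(1)] by blast
  qed
  ultimately show "short_exact A i p"
    by (simp add: short_exact_iff epi_cokernel_of_kernel)
qed

end

section \<open>Connecting maps of short exact sequences\<close>

definition ses_map :: "('o, 'm) addcat \<Rightarrow> 'm \<times> 'm \<Rightarrow> 'm \<times> 'm \<Rightarrow> 'm \<Rightarrow> 'm \<Rightarrow> 'm \<Rightarrow> bool" where
  "ses_map A s t h u g \<longleftrightarrow>
     h \<in> mor A (Src A (fst s)) (Src A (fst t)) \<and> u \<in> mor A (Tgt A (fst s)) (Tgt A (fst t)) \<and>
     g \<in> mor A (Tgt A (snd s)) (Tgt A (snd t)) \<and>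
     Compose A u (fst s) = Compose A (fst t) h \<and> Compose A (snd t) u = Compose A g (snd s)"

context abelian_category
begin

lemma short_exactD:
  assumes "short_exact A a b"
  shows "a \<in> mor A (Src A a) (Tgt A a)" "b \<in> mor A (Tgt A a) (Tgt A b)" "Src A b = Tgt A a"
    "b \<cdot> a = Zero A (Src A a) (Tgt A b)" "mono_arrow A a" "epi_arrow A b"
  using assms by (auto simp: short_exact_iff is_kernel_def mor_def kernel_mono cokernel_epi)

lemma short_exact_mono:
  assumes "short_exact A a b" "a \<cdot> g = a \<cdot> h" "g \<in> mor A Z X" "h \<in> mor A Z X" "X = Src A a"
  shows "g = h"
  using mono_arrowD[OF short_exactD(5)[OF assms(1)] short_exactD(1)[OF assms(1)]] assms by blast

lemma short_exact_epi:
  assumes "short_exact A a b" "g \<cdot> b = h \<cdot> b" "g \<in> mor A C Z" "h \<in> mor A C Z" "C = Tgt A b"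
  shows "g = h"
  using epi_arrowD[OF short_exactD(6)[OF assms(1)] short_exactD(2)[OF assms(1)]] assms by blast

lemma short_exact_mono_zero:
  assumes "short_exact A a b" "a \<cdot> g = Zero A Z E" "g \<in> mor A Z X" "X = Src A a" "E = Tgt A a"
  shows "g = Zero A Z X"
proof (rule short_exact_mono[OF assms(1) _ assms(3) _ assms(4)])
  show "a \<cdot> g = a \<cdot> Zero A Z X" "Zero A Z X \<in> mor A Z X"
    unfolding assms(2) using assms(3-5) short_exactD(1)[OF assms(1)] by (auto simp: mor_def)
qed

lemma short_exact_epi_zero:
  assumes "short_exact A a b" "g \<cdot> b = Zero A E Z" "g \<in> mor A C Z" "C = Tgt A b" "E = Tgt A a"
  shows "g = Zero A C Z"
proof (rule short_exact_epi[OF assms(1) _ assms(3) _ assms(4)])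
  show "g \<cdot> b = Zero A C Z \<cdot> b" "Zero A C Z \<in> mor A C Z"
    unfolding assms(2) using assms(3-5) short_exactD(2)[OF assms(1)] by (auto simp: mor_def)
qed

lemma short_exact_kernel:
  assumes "short_exact A a b" "g \<in> mor A Z (Tgt A a)" "b \<cdot> g = Zero A Z (Tgt A b)"
  shows "\<exists>h\<in>mor A Z (Src A a). a \<cdot> h = g"
  using kernel_factor[OF _ short_exactD(2)[OF assms(1)] assms(2,3)] assms(1)
  by (simp add: short_exact_iff)

lemma short_exact_cokernel:
  assumes "short_exact A a b" "g \<in> mor A (Tgt A a) Z" "g \<cdot> a = Zero A (Src A a) Z"
  shows "\<exists>h\<in>mor A (Tgt A b) Z. h \<cdot> b = g"
  using cokernel_factor[OF _ short_exactD(1)[OF assms(1)] assms(2,3)] assms(1)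
  by (simp add: short_exact_iff)

lemma biproductE:
  assumes "X \<in> Ob A" "Y \<in> Ob A"
  obtains Z i j p q where "Z \<in> Ob A" "i \<in> mor A X Z" "j \<in> mor A Y Z" "p \<in> mor A Z X" "q \<in> mor A Z Y"
    "p \<cdot> i = Ident A X" "q \<cdot> j = Ident A Y" "q \<cdot> i = Zero A X Y" "p \<cdot> j = Zero A Y X"
    "Plus A (i \<cdot> p) (j \<cdot> q) = Ident A Z" "biproduct A X Y Z"
  using has_biproducts[OF assms] unfolding biproduct_def by blast

lemma copair_components:
  assumes "i \<in> mor A X S" "j \<in> mor A Y S" "p \<in> mor A S X" "q \<in> mor A S Y"
    "p \<cdot> i = Ident A X" "q \<cdot> j = Ident A Y" "q \<cdot> i = Zero A X Y" "p \<cdot> j = Zero A Y X"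
    and "f \<in> mor A X Z" "g \<in> mor A Y Z"
  shows "Plus A (f \<cdot> p) (g \<cdot> q) \<cdot> i = f" "Plus A (f \<cdot> p) (g \<cdot> q) \<cdot> j = g"
    "Plus A (f \<cdot> p) (g \<cdot> q) \<in> mor A S Z"
  using assms by (auto simp: mor_def)

section \<open>Pushouts and pullbacks of extensions\<close>

lemma pushout_factor:
  assumes ab: "short_exact A a b" and ab': "short_exact A a' b'"
    and u': "u' \<in> mor A (Tgt A a) (Tgt A a')" and h: "h \<in> mor A (Src A a) (Src A a')"
    and sq: "u' \<cdot> a = a' \<cdot> h" and id: "b' \<cdot> u' = b"
    and c: "c \<in> mor A (Src A a') Z" and u: "u \<in> mor A (Tgt A a) Z" and uc: "u \<cdot> a = c \<cdot> h"
  shows "\<exists>k\<in>mor A (Tgt A a') Z. k \<cdot> u' = u \<and> k \<cdot> a' = c"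
proof -
  define X E Y E' where XE: "X = Src A a" "E = Tgt A a" "Y = Src A a'" "E' = Tgt A a'"
  note m = short_exactD[OF ab, folded XE] note m' = short_exactD[OF ab', folded XE]
  have bb: "Tgt A b' = Tgt A b" using id u' m(2) m'(2) by (auto simp: mor_def XE)
  note u' = u'[folded XE] and h = h[folded XE] and c = c[folded XE] and u = u[folded XE]
  have "E \<in> Ob A" "Y \<in> Ob A" using mor_objects u c by blast+
  then obtain S i j p q where S: "S \<in> Ob A" "i \<in> mor A E S" "j \<in> mor A Y S" "p \<in> mor A S E" "q \<in> mor A S Y"
    "p \<cdot> i = Ident A E" "q \<cdot> j = Ident A Y" "q \<cdot> i = Zero A E Y" "p \<cdot> j = Zero A Y E"
    by (rule biproductE)
  define e w where "e = Plus A (u' \<cdot> p) (a' \<cdot> q)" and "w = Plus A (u \<cdot> p) (c \<cdot> q)"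
  have e: "e \<cdot> i = u'" "e \<cdot> j = a'" "e \<in> mor A S E'"
    unfolding e_def using copair_components[OF S(2-9) u' m'(1)] by auto
  have w: "w \<cdot> i = u" "w \<cdot> j = c" "w \<in> mor A S Z"
    unfolding w_def using copair_components[OF S(2-9) u c] by auto
  \<comment> \<open>\<open>E'\<close> is the pushout: \<open>e\<close> out of the biproduct of \<open>E\<close> and \<open>Y\<close> is the cokernel of its kernel, which \<open>w\<close> kills.\<close>
  have "epi_arrow A e"
  proof (rule epi_arrowI[OF e(3)])
    fix U v assume v: "v \<in> mor A E' U" "v \<cdot> e = Zero A S U"
    have "U \<in> Ob A" using v mor_objects by blast
    have "v \<cdot> u' = (v \<cdot> e) \<cdot> i" unfolding e(1)[symmetric] using v(1) S(2) e(3) by (auto simp: mor_def)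
    then have vu: "v \<cdot> u' = Zero A E U" unfolding v(2) using \<open>U \<in> Ob A\<close> S(2) by (auto simp: mor_def)
    have "v \<cdot> a' = (v \<cdot> e) \<cdot> j" unfolding e(2)[symmetric] using v(1) S(3) e(3) by (auto simp: mor_def)
    then have va: "v \<cdot> a' = Zero A Y U" unfolding v(2) using \<open>U \<in> Ob A\<close> S(3) by (auto simp: mor_def)
    obtain x where x: "x \<in> mor A (Tgt A b') U" "x \<cdot> b' = v"
      using short_exact_cokernel[OF ab'] v(1) va by (auto simp: XE)
    have "x \<cdot> b = (x \<cdot> b') \<cdot> u'" unfolding id[symmetric] using x(1) m'(2) u' by (auto simp: mor_def)
    also have "\<dots> = Zero A E U" unfolding x(2) vu ..
    finally have "x = Zero A (Tgt A b) U"
      by (rule short_exact_epi_zero[OF ab]) (use x(1) bb XE in auto)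
    then show "v = Zero A E' U"
      unfolding x(2)[symmetric] using \<open>U \<in> Ob A\<close> m'(2) bb by (auto simp: mor_def)
  qed
  moreover obtain \<kappa> where \<kappa>: "is_kernel A e \<kappa>" using has_kernels e(3) by (auto simp: mor_def)
  ultimately have coker: "is_cokernel A \<kappa> e" by (rule epi_cokernel_of_kernel)
  define K where "K = Src A \<kappa>"
  note \<kappa>m = kernel_arrow[OF \<kappa> e(3), folded K_def]
  have e\<kappa>: "Plus A (u' \<cdot> (p \<cdot> \<kappa>)) (a' \<cdot> (q \<cdot> \<kappa>)) = Zero A K E'"
    using \<kappa>m(2) unfolding e_def using \<kappa>m(1) u' m'(1) S(4,5) by (auto simp: mor_def)
  \<comment> \<open>The kernel of \<open>e\<close> has components \<open>p \<kappa>\<close> and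
    \<open>q \<kappa>\<close>. Since \<open>b' a' = 0\<close>, the first is killed by
    \<open>b\<close> and comes from some \<open>z\<close> into X; monicity of \<open>a'\<close> then
    makes the second the negative of \<open>h z\<close>, which is why \<open>w\<close> kills
    \<open>\<kappa>\<close>.\<close>
  have "b \<cdot> (p \<cdot> \<kappa>) = b' \<cdot> (u' \<cdot> (p \<cdot> \<kappa>))"
    unfolding id[symmetric] using m'(2) u' S(4) \<kappa>m(1) by (auto simp: mor_def)
  also have "\<dots> = Plus A (b' \<cdot> (u' \<cdot> (p \<cdot> \<kappa>))) ((b' \<cdot> a') \<cdot> (q \<cdot> \<kappa>))"
    unfolding m'(4) using m'(1,2) u' S(4,5) \<kappa>m(1) by (auto simp: mor_def)
  also have "\<dots> = b' \<cdot> Plus A (u' \<cdot> (p \<cdot> \<kappa>)) (a' \<cdot> (q \<cdot> \<kappa>))"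
    using m'(1,2) u' S(4,5) \<kappa>m(1) by (auto simp: mor_def)
  also have "\<dots> = Zero A K (Tgt A b)"
    unfolding e\<kappa> using m'(2) \<kappa>m(1) bb by (auto simp: mor_def)
  finally obtain z where z: "z \<in> mor A K X" "a \<cdot> z = p \<cdot> \<kappa>"
    using short_exact_kernel[OF ab, of "p \<cdot> \<kappa>" K] \<kappa>m(1) S(4) by (auto simp: mor_def XE)
  have "a' \<cdot> Plus A (h \<cdot> z) (q \<cdot> \<kappa>) = Plus A ((a' \<cdot> h) \<cdot> z) (a' \<cdot> (q \<cdot> \<kappa>))"
    using m'(1) h z(1) S(5) \<kappa>m(1) by (auto simp: mor_def)
  also have "\<dots> = Plus A (u' \<cdot> (p \<cdot> \<kappa>)) (a' \<cdot> (q \<cdot> \<kappa>))"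
    unfolding sq[symmetric] z(2)[symmetric] using m(1) u' z(1) by (auto simp: mor_def)
  also have "\<dots> = Zero A K E'" by (rule e\<kappa>)
  finally have hz: "Plus A (h \<cdot> z) (q \<cdot> \<kappa>) = Zero A K Y"
    by (rule short_exact_mono_zero[OF ab']) (use h z(1) S(5) \<kappa>m(1) XE in \<open>auto simp: mor_def\<close>)
  have "w \<cdot> \<kappa> = Plus A (u \<cdot> (p \<cdot> \<kappa>)) (c \<cdot> (q \<cdot> \<kappa>))"
    unfolding w_def using \<kappa>m(1) u c S(4,5) by (auto simp: mor_def)
  also have "\<dots> = Plus A ((c \<cdot> h) \<cdot> z) (c \<cdot> (q \<cdot> \<kappa>))"
    unfolding uc[symmetric] z(2)[symmetric] using m(1) u z(1) by (auto simp: mor_def)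
  also have "\<dots> = c \<cdot> Plus A (h \<cdot> z) (q \<cdot> \<kappa>)"
    using c h z(1) S(5) \<kappa>m(1) by (auto simp: mor_def)
  also have "\<dots> = Zero A K Z"
    unfolding hz using c \<kappa>m(1) by (auto simp: mor_def)
  finally obtain k where k: "k \<in> mor A E' Z" "k \<cdot> e = w"
    using cokernel_factor[OF coker \<kappa>m(1) w(3)] e(3) by (auto simp: mor_def)
  have "k \<cdot> u' = (k \<cdot> e) \<cdot> i" unfolding e(1)[symmetric] using k(1) e(3) S(2) by (auto simp: mor_def)
  moreover have "k \<cdot> a' = (k \<cdot> e) \<cdot> j" unfolding e(2)[symmetric] using k(1) e(3) S(3) by (auto simp: mor_def)
  ultimately have "k \<cdot> u' = u" "k \<cdot> a' = c" unfolding k(2) w by auto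
  then show ?thesis using k(1) by (auto simp: XE)
qed

lemma pullback_factor:
  assumes ab: "short_exact A a b" and ab': "short_exact A a' b'"
    and k: "k \<in> mor A (Tgt A a') (Tgt A a)" and g: "g \<in> mor A (Tgt A b') (Tgt A b)"
    and id: "k \<cdot> a' = a" and sq: "b \<cdot> k = g \<cdot> b'"
    and c: "c \<in> mor A Z (Tgt A b')" and u: "u \<in> mor A Z (Tgt A a)" and uc: "b \<cdot> u = g \<cdot> c"
  shows "\<exists>v\<in>mor A Z (Tgt A a'). k \<cdot> v = u \<and> b' \<cdot> v = c"
  using abelian_category.pushout_factor[OF op_abelian, of b a b' a' k g c Z u] assms
  by (simp add: short_exact_opcat[OF abelian_category_axioms] short_exactD(3))

text \<open>Both sides are sets of extensions, compared member by member. A witness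
  \<open>u'\<close> for the pushout lets \<open>u\<close> factor as \<open>k u'\<close>, and
  \<open>k\<close> is the witness for the pullback; the converse uses the universal property of the
  pullback. In each direction one of the two conditions is immediate and the other needs an
  argument.\<close>

lemma ext_push_eq_pull:
  assumes s: "short_exact A a b" and t: "short_exact A c d" and "ses_map A (a, b) (c, d) h u g"
  shows "ext_push A (a, b) h = ext_pull A (c, d) g"
proof -
  define X E C where X: "X = Src A a" "E = Tgt A a" "C = Tgt A b"
  define Y J D where Y: "Y = Src A c" "J = Tgt A c" "D = Tgt A d"
  note ab = short_exactD[OF s, folded X] and cd = short_exactD[OF t, folded Y]
  have m: "h \<in> mor A X Y" "u \<in> mor A E J" "g \<in> mor A C D" "u \<cdot> a = c \<cdot> h" "d \<cdot> u = g \<cdot> b"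
    using assms(3) by (simp_all add: ses_map_def X Y)
  have gh: "Src A g = C" "Tgt A h = Y" using m by (auto simp: mor_def)
  have "(\<exists>u'\<in>mor A E (Tgt A a'). u' \<cdot> a = a' \<cdot> h \<and> b' \<cdot> u' = b) \<longleftrightarrow>
      (\<exists>k\<in>mor A (Tgt A a') J. k \<cdot> a' = c \<and> d \<cdot> k = g \<cdot> b')"
    if ex: "short_exact A a' b'" "Src A a' = Y" "Tgt A b' = C" for a' b'
  proof
    note ab' = short_exactD[OF ex(1), unfolded ex(2,3)]
    assume "\<exists>u'\<in>mor A E (Tgt A a'). u' \<cdot> a = a' \<cdot> h \<and> b' \<cdot> u' = b"
    then obtain u' where u': "u' \<in> mor A E (Tgt A a')" "u' \<cdot> a = a' \<cdot> h" "b' \<cdot> u' = b" by blast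
    obtain k where k: "k \<in> mor A (Tgt A a') J" "k \<cdot> u' = u" "k \<cdot> a' = c"
      using pushout_factor[OF s ex(1) _ _ u'(2,3), of c J u] u'(1) m cd(1) ex X Y by auto
    have gb: "g \<cdot> b' \<in> mor A (Tgt A a') D" and dk: "d \<cdot> k \<in> mor A (Tgt A a') D"
      using m(3) ab'(2) cd(2) k(1) by (auto simp: mor_def)
    \<comment> \<open>The defect of the remaining square vanishes on \<open>a'\<close>, hence equals
      \<open>x b'\<close>. Composing with \<open>u'\<close> turns it into \<open>x b\<close>, which
      is \<open>d u - g b = 0\<close>, and \<open>b\<close> is epi.\<close>
    define z where "z = Minus A (d \<cdot> k) (g \<cdot> b')"
    have z: "z \<in> mor A (Tgt A a') D" unfolding z_def using dk gb by (rule mor_simps(3))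
    have "z \<cdot> a' = Minus A (d \<cdot> (k \<cdot> a')) (g \<cdot> (b' \<cdot> a'))"
      unfolding z_def using m(3) ab'(1,2) cd(2) k(1) by (auto simp: mor_def)
    also have "\<dots> = Zero A Y D"
      unfolding k(3) cd(4) ab'(4) using m(3) ab'(1,2) cd(2) by (auto simp: mor_def Minus_def)
    finally obtain x where x: "x \<in> mor A C D" "x \<cdot> b' = z"
      using short_exact_cokernel[OF ex(1) z] ex by auto
    have "x \<cdot> b = (x \<cdot> b') \<cdot> u'" unfolding u'(3)[symmetric] using x(1) ab'(2) u'(1) by (auto simp: mor_def)
    also have "\<dots> = Minus A (d \<cdot> (k \<cdot> u')) (g \<cdot> (b' \<cdot> u'))"
      unfolding x(2) z_def using m(3) ab'(2) cd(2) k(1) u'(1) by (auto simp: mor_def)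
    also have "\<dots> = Zero A E D"
      unfolding k(2) m(5) u'(3) using m(3) ab(2) by (auto simp: mor_def)
    finally have "x = Zero A C D"
      by (rule short_exact_epi_zero[OF s]) (use x(1) X in auto)
    then have "z = Zero A (Tgt A a') D" unfolding x(2)[symmetric] using m(3) ab'(2) by (auto simp: mor_def)
    then have "d \<cdot> k = g \<cdot> b'"
      unfolding z_def using dk gb by (rule minus_zeroD)
    then show "\<exists>k\<in>mor A (Tgt A a') J. k \<cdot> a' = c \<and> d \<cdot> k = g \<cdot> b'" using k by blast
  next
    note ab' = short_exactD[OF ex(1), unfolded ex(2,3)]
    assume "\<exists>k\<in>mor A (Tgt A a') J. k \<cdot> a' = c \<and> d \<cdot> k = g \<cdot> b'"
    then obtain k where k: "k \<in> mor A (Tgt A a') J" "k \<cdot> a' = c" "d \<cdot> k = g \<cdot> b'" by blast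
    obtain u' where u': "u' \<in> mor A E (Tgt A a')" "k \<cdot> u' = u" "b' \<cdot> u' = b"
      using pullback_factor[OF t ex(1) _ _ k(2,3), of b E u] k(1) m ab(2) ex X Y by auto
    have gb: "a' \<cdot> h \<in> mor A X (Tgt A a')" and dk: "u' \<cdot> a \<in> mor A X (Tgt A a')"
      using m(1) ab'(1) ab(1) u'(1) by (auto simp: mor_def)
    \<comment> \<open>The mirror image: this defect is killed by \<open>b'\<close>, hence equals
      \<open>a' x\<close>, and composing with \<open>k\<close> gives
      \<open>c x = u a - c h = 0\<close> with \<open>c\<close> mono.\<close>
    define z where "z = Minus A (u' \<cdot> a) (a' \<cdot> h)"
    have z: "z \<in> mor A X (Tgt A a')" unfolding z_def using dk gb by (rule mor_simps(3))
    have "b' \<cdot> z = Minus A ((b' \<cdot> u') \<cdot> a) ((b' \<cdot> a') \<cdot> h)"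
      unfolding z_def using m(1) ab'(1,2) ab(1) u'(1) by (auto simp: mor_def)
    also have "\<dots> = Zero A X C"
      unfolding u'(3) ab(4) ab'(4) using m(1) ab'(1,2) ab(1) by (auto simp: mor_def Minus_def)
    finally obtain x where x: "x \<in> mor A X Y" "a' \<cdot> x = z"
      using short_exact_kernel[OF ex(1) z] ex by auto
    have "c \<cdot> x = k \<cdot> (a' \<cdot> x)" unfolding k(2)[symmetric] using x(1) ab'(1) k(1) by (auto simp: mor_def)
    also have "\<dots> = Minus A ((k \<cdot> u') \<cdot> a) ((k \<cdot> a') \<cdot> h)"
      unfolding x(2) z_def using m(1) ab'(1) ab(1) k(1) u'(1) by (auto simp: mor_def)
    also have "\<dots> = Zero A X J"
      unfolding k(2) m(4) u'(2) using m(1) cd(1) by (auto simp: mor_def)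
    finally have "x = Zero A X Y"
      by (rule short_exact_mono_zero[OF t]) (use x(1) Y in auto)
    then have "z = Zero A X (Tgt A a')" unfolding x(2)[symmetric] using m(1) ab'(1) by (auto simp: mor_def)
    then have "u' \<cdot> a = a' \<cdot> h"
      unfolding z_def using dk gb by (rule minus_zeroD)
    then show "\<exists>u'\<in>mor A E (Tgt A a'). u' \<cdot> a = a' \<cdot> h \<and> b' \<cdot> u' = b" using u' by blast
  qed
  then show ?thesis
    by (auto simp: ext_push_def ext_pull_def extensions_def gh simp flip: X Y)
qed

text \<open>The pullback is built as the kernel of \<open>d p - g q\<close> on the biproduct of J
  and C. Nonemptiness matters because equal pullback classes carry information only through a common
  member.\<close>

lemma ext_pull_nonempty:
  assumes t: "short_exact A c d" and g: "g \<in> mor A C (Tgt A d)"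
  shows "ext_pull A (c, d) g \<noteq> {}"
proof -
  define Y J D where Y: "Y = Src A c" "J = Tgt A c" "D = Tgt A d"
  note cd = short_exactD[OF t, folded Y] and g = g[folded Y]
  have "J \<in> Ob A" "C \<in> Ob A" using mor_objects cd g by blast+
  then obtain S i j p q where S: "S \<in> Ob A" "i \<in> mor A J S" "j \<in> mor A C S" "p \<in> mor A S J" "q \<in> mor A S C"
    "p \<cdot> i = Ident A J" "q \<cdot> j = Ident A C" "q \<cdot> i = Zero A J C" "p \<cdot> j = Zero A C J"
    "Plus A (i \<cdot> p) (j \<cdot> q) = Ident A S"
    by (rule biproductE)
  define e where "e = Minus A (d \<cdot> p) (g \<cdot> q)"
  have e: "e \<in> mor A S D" unfolding e_def using cd(2) g S(4,5) by (auto simp: mor_def)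
  have ei: "e \<cdot> i = d"
  proof -
    have "e \<cdot> i = Minus A (d \<cdot> (p \<cdot> i)) (g \<cdot> (q \<cdot> i))"
      unfolding e_def using cd(2) g S(2,4,5) by (auto simp: mor_def)
    then show ?thesis unfolding S using cd(2) g by (auto simp: mor_def Minus_def)
  qed
  have "epi_arrow A e"
  proof (rule epi_arrowI[OF e])
    fix U v assume v: "v \<in> mor A D U" "v \<cdot> e = Zero A S U"
    have "v \<cdot> d = (v \<cdot> e) \<cdot> i" unfolding ei[symmetric] using v(1) e S(2) by (auto simp: mor_def)
    also have "\<dots> = Zero A J U"
      unfolding v(2) using v(1) cd(2) S(2) by (auto simp: mor_def)
    finally show "v = Zero A D U"
      by (rule short_exact_epi_zero[OF t]) (use v(1) Y in auto)
  qed
  moreover obtain k where k: "is_kernel A e k" using has_kernels e by (auto simp: mor_def)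
  ultimately have coker: "is_cokernel A k e" by (rule epi_cokernel_of_kernel)
  define K where "K = Src A k"
  note km = kernel_arrow[OF k e, folded K_def]
  define k2 where "k2 = q \<cdot> k"
  have k2: "k2 \<in> mor A K C" and k1: "p \<cdot> k \<in> mor A K J"
    unfolding k2_def using km(1) S(4,5) by (auto simp: mor_def)
  have "Minus A (d \<cdot> (p \<cdot> k)) (g \<cdot> k2) = Zero A K D"
    using km(2) unfolding e_def k2_def using km(1) S(4,5) cd(2) g by (auto simp: mor_def)
  then have sq: "d \<cdot> (p \<cdot> k) = g \<cdot> k2"
    by (rule minus_zeroD) (use cd(2) k1 k2 g in \<open>auto simp: mor_def\<close>)
  \<comment> \<open>Pullbacks of epis are epi: if v kills \<open>k2\<close>, then \<open>v q\<close>
    factors as \<open>w e\<close>. Restricting to the summand J gives \<open>w d = 0\<close>, so w =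
    0, and restricting to the summand C gives v = 0.\<close>
  have epi: "epi_arrow A k2"
  proof (rule epi_arrowI[OF k2])
    fix U v assume v: "v \<in> mor A C U" "v \<cdot> k2 = Zero A K U"
    have "(v \<cdot> q) \<cdot> k = Zero A K U"
      using v(2) unfolding k2_def using v(1) S(5) km(1) by (auto simp: mor_def)
    moreover have vq: "v \<cdot> q \<in> mor A S U" using v(1) S(5) by (auto simp: mor_def)
    ultimately obtain w where w: "w \<in> mor A D U" "w \<cdot> e = v \<cdot> q"
      using cokernel_factor[OF coker km(1) vq] e by (auto simp: mor_def)
    have "w \<cdot> d = (w \<cdot> e) \<cdot> i" unfolding ei[symmetric] using w(1) e S(2) by (auto simp: mor_def)
    also have "\<dots> = v \<cdot> (q \<cdot> i)" unfolding w(2) using v(1) S(2,5) by (auto simp: mor_def)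
    also have "\<dots> = Zero A J U"
      unfolding S(8) using v(1) w(1) cd(2) by (auto simp: mor_def)
    finally have w0: "w = Zero A D U"
      by (rule short_exact_epi_zero[OF t]) (use w(1) Y in auto)
    have "v = v \<cdot> (q \<cdot> j)" unfolding S(7) using v(1) by (auto simp: mor_def)
    also have "\<dots> = (w \<cdot> e) \<cdot> j" unfolding w(2) using v(1) S(3,5) by (auto simp: mor_def)
    also have "\<dots> = Zero A C U"
      unfolding w0 using v(1) e S(3) w(1) by (auto simp: mor_def)
    finally show "v = Zero A C U" .
  qed
  have ic: "i \<cdot> c \<in> mor A Y S" using cd(1) S(2) by (auto simp: mor_def)
  have "e \<cdot> (i \<cdot> c) = (e \<cdot> i) \<cdot> c" using e S(2) cd(1) by (auto simp: mor_def)
  then have "e \<cdot> (i \<cdot> c) = Zero A Y D" unfolding ei cd(4) .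
  then obtain a' where a': "a' \<in> mor A Y K" "k \<cdot> a' = i \<cdot> c"
    using kernel_factor[OF k e ic] by (auto simp: K_def)
  have "(p \<cdot> k) \<cdot> a' = p \<cdot> (k \<cdot> a')" using S(4) km(1) a'(1) by (auto simp: mor_def)
  also have "\<dots> = (p \<cdot> i) \<cdot> c" unfolding a'(2) using S(2,4) cd(1) by (auto simp: mor_def)
  also have "\<dots> = c" unfolding S(6) using cd(1) by (auto simp: mor_def)
  finally have ka: "(p \<cdot> k) \<cdot> a' = c" .
  have "k2 \<cdot> a' = q \<cdot> (k \<cdot> a')" unfolding k2_def using S(5) km(1) a'(1) by (auto simp: mor_def)
  also have "\<dots> = (q \<cdot> i) \<cdot> c" unfolding a'(2) using S(2,5) cd(1) by (auto simp: mor_def)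
  also have "\<dots> = Zero A Y C" unfolding S(8) using cd(1) g by (auto simp: mor_def)
  finally have k2a: "k2 \<cdot> a' = Zero A Y C" .
  have "mono_arrow A a'"
  proof (rule mono_arrowI[OF a'(1)])
    fix U x assume x: "x \<in> mor A U Y" "a' \<cdot> x = Zero A U K"
    have "c \<cdot> x = (p \<cdot> k) \<cdot> (a' \<cdot> x)"
      unfolding ka[symmetric] using k1 a'(1) x(1) S(4) km(1) by (auto simp: mor_def)
    also have "\<dots> = Zero A U J"
      unfolding x(2) using k1 km(1) x(1) by (auto simp: mor_def)
    finally show "x = Zero A U Y"
      by (rule short_exact_mono_zero[OF t]) (use x(1) Y in auto)
  qed
  have "is_kernel A k2 a'"
  proof (rule is_kernelI[OF k2 a'(1) k2a \<open>mono_arrow A a'\<close>])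
    fix U x assume x: "x \<in> mor A U K" "k2 \<cdot> x = Zero A U C"
    have pkx: "(p \<cdot> k) \<cdot> x \<in> mor A U J" using k1 x(1) by (auto simp: mor_def)
    have "d \<cdot> ((p \<cdot> k) \<cdot> x) = (d \<cdot> (p \<cdot> k)) \<cdot> x" using cd(2) k1 x(1) S(4) km(1) by (auto simp: mor_def)
    also have "\<dots> = g \<cdot> (k2 \<cdot> x)" unfolding sq using g k2 x(1) by (auto simp: mor_def)
    also have "\<dots> = Zero A U D" unfolding x(2) using g x(1) by (auto simp: mor_def)
    finally obtain y where y: "y \<in> mor A U Y" "c \<cdot> y = (p \<cdot> k) \<cdot> x"
      using short_exact_kernel[OF t, of "(p \<cdot> k) \<cdot> x" U] pkx by (auto simp: Y)
    \<comment> \<open>Split \<open>k x\<close> into its two components: the second is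
      \<open>k2 x = 0\<close>, the first comes from Y along \<open>c\<close>, so \<open>k x\<close>
      equals \<open>k a' y\<close>.\<close>
    have "k \<cdot> x = Plus A (i \<cdot> p) (j \<cdot> q) \<cdot> (k \<cdot> x)"
      unfolding S(10) using km(1) x(1) by (auto simp: mor_def)
    also have "\<dots> = Plus A (i \<cdot> ((p \<cdot> k) \<cdot> x)) (j \<cdot> (k2 \<cdot> x))"
      unfolding k2_def using km(1) x(1) S(2-5) by (auto simp: mor_def)
    also have "\<dots> = (i \<cdot> c) \<cdot> y"
      unfolding x(2) y(2)[symmetric] using x(1) y(1) S(2,3) cd(1) by (auto simp: mor_def)
    also have "\<dots> = k \<cdot> (a' \<cdot> y)"
      unfolding a'(2)[symmetric] using km(1) a'(1) y(1) by (auto simp: mor_def)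
    finally have "a' \<cdot> y = x"
      by (intro mono_arrowD[OF kernel_mono[OF k] km(1), of "a' \<cdot> y" U x])
        (use x(1) a'(1) y(1) in \<open>auto simp: mor_def\<close>)
    then show "\<exists>h\<in>mor A U Y. a' \<cdot> h = x" using y(1) by blast
  qed
  then have "short_exact A a' k2"
    using epi by (simp add: short_exact_iff epi_cokernel_of_kernel)
  then have "(a', k2) \<in> ext_pull A (c, d) g"
    using a'(1) k2 g k1 ka sq by (auto simp: ext_pull_def extensions_def mor_def Y)
  then show ?thesis by blast
qed

text \<open>A common extension maps to (c, d) in two ways. The difference of the two middle maps
  vanishes on \<open>a'\<close>, so it descends to some w on C. This is exactness of the connecting
  sequence at Hom(C, D), obtained without the group structure on Ext.\<close>

lemma ext_pull_eq_imp:
  assumes t: "short_exact A c d" and g: "g \<in> mor A C (Tgt A d)" "g' \<in> mor A C (Tgt A d)"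
    and eq: "ext_pull A (c, d) g = ext_pull A (c, d) g'"
  shows "\<exists>w\<in>mor A C (Tgt A c). Minus A g g' = d \<cdot> w"
proof -
  define Y J D where Y: "Y = Src A c" "J = Tgt A c" "D = Tgt A d"
  note cd = short_exactD[OF t, folded Y] and g = g[folded Y]
  obtain a' b' where e: "(a', b') \<in> ext_pull A (c, d) g" "(a', b') \<in> ext_pull A (c, d) g'"
    using ext_pull_nonempty[OF t, of g C] g eq by (auto simp: Y)
  have ex: "short_exact A a' b'" "Src A a' = Y" "Tgt A b' = C"
    using e(1) g by (auto simp: ext_pull_def extensions_def mor_def Y)
  note ab' = short_exactD[OF ex(1), unfolded ex(2,3)]
  obtain k where k: "k \<in> mor A (Tgt A a') J" "k \<cdot> a' = c" "d \<cdot> k = g \<cdot> b'"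
    using e(1) by (auto simp: ext_pull_def Y)
  obtain k' where k': "k' \<in> mor A (Tgt A a') J" "k' \<cdot> a' = c" "d \<cdot> k' = g' \<cdot> b'"
    using e(2) by (auto simp: ext_pull_def Y)
  have kk: "Minus A k k' \<in> mor A (Tgt A a') J" using k(1) k'(1) by (rule mor_simps(3))
  have "Minus A k k' \<cdot> a' = Minus A c c" using k(1) k'(1) ab'(1) k(2) k'(2) by (auto simp: mor_def)
  then have "Minus A k k' \<cdot> a' = Zero A Y J" using cd(1) by (auto simp: mor_def)
  then obtain w where w: "w \<in> mor A C J" "w \<cdot> b' = Minus A k k'"
    using short_exact_cokernel[OF ex(1) kk] ex by auto
  have "(d \<cdot> w) \<cdot> b' = d \<cdot> (w \<cdot> b')" using cd(2) w(1) ab'(2) by (auto simp: mor_def)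
  also have "\<dots> = Minus A (d \<cdot> k) (d \<cdot> k')" unfolding w(2) using cd(2) k(1) k'(1) by (auto simp: mor_def)
  also have "\<dots> = Minus A g g' \<cdot> b'" unfolding k(3) k'(3) using g ab'(2) by (auto simp: mor_def)
  finally have "d \<cdot> w = Minus A g g'"
    by (rule short_exact_epi[OF ex(1)]) (use cd(2) w(1) g ex(3) in \<open>auto simp: mor_def\<close>)
  then show ?thesis using w(1) unfolding Y by metis
qed

text \<open>The very same extension represents both pushouts: only the comparison map out of the
  middle object changes, by \<open>a' w\<close>, which \<open>b'\<close> does not see.\<close>

lemma ext_push_plus_subset:
  assumes s: "short_exact A a b" and h: "h \<in> mor A (Src A a) Y" and w: "w \<in> mor A (Tgt A a) Y"
  shows "ext_push A (a, b) h \<subseteq> ext_push A (a, b) (Plus A (w \<cdot> a) h)"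
proof
  fix e assume e: "e \<in> ext_push A (a, b) h"
  obtain a' b' where e': "e = (a', b')" by (cases e)
  note ab = short_exactD[OF s]
  have ex: "short_exact A a' b'" "Src A a' = Y" "Tgt A b' = Tgt A b"
    using e h by (auto simp: e' ext_push_def extensions_def mor_def)
  note ab' = short_exactD[OF ex(1), unfolded ex(2,3)]
  obtain u where u: "u \<in> mor A (Tgt A a) (Tgt A a')" "u \<cdot> a = a' \<cdot> h" "b' \<cdot> u = b"
    using e by (auto simp: e' ext_push_def)
  define u' where "u' = Plus A (a' \<cdot> w) u"
  have u': "u' \<in> mor A (Tgt A a) (Tgt A a')"
    unfolding u'_def using u(1) ab'(1) w by (auto simp: mor_def)
  have "u' \<cdot> a = Plus A (a' \<cdot> (w \<cdot> a)) (u \<cdot> a)"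
    unfolding u'_def using u(1) ab'(1) w ab(1) by (auto simp: mor_def)
  also have "\<dots> = a' \<cdot> Plus A (w \<cdot> a) h"
    unfolding u(2) using ab'(1) w ab(1) h by (auto simp: mor_def)
  finally have 1: "u' \<cdot> a = a' \<cdot> Plus A (w \<cdot> a) h" .
  have "b' \<cdot> u' = Plus A ((b' \<cdot> a') \<cdot> w) (b' \<cdot> u)"
    unfolding u'_def using u(1) ab'(1,2) w by (auto simp: mor_def)
  also have "\<dots> = b" unfolding ab'(4) u(3) using w ab(2) by (auto simp: mor_def)
  finally have 2: "b' \<cdot> u' = b" .
  have "Tgt A (Plus A (w \<cdot> a) h) = Y" using w ab(1) h by (auto simp: mor_def)
  then show "e \<in> ext_push A (a, b) (Plus A (w \<cdot> a) h)"
    using ex u' 1 2 by (auto simp: e' ext_push_def extensions_def)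
qed

lemma ext_push_plus:
  assumes s: "short_exact A a b" and h: "h \<in> mor A (Src A a) Y" and w: "w \<in> mor A (Tgt A a) Y"
  shows "ext_push A (a, b) (Plus A (w \<cdot> a) h) = ext_push A (a, b) h"
proof
  note ab = short_exactD[OF s]
  have "Plus A (w \<cdot> a) h \<in> mor A (Src A a) Y" "Neg A w \<in> mor A (Tgt A a) Y"
    using w ab(1) h by (auto simp: mor_def)
  from ext_push_plus_subset[OF s this]
  show "ext_push A (a, b) (Plus A (w \<cdot> a) h) \<subseteq> ext_push A (a, b) h"
    using w ab(1) h by (auto simp: mor_def)
qed (rule ext_push_plus_subset[OF assms])

section \<open>The ideal of morphisms factoring through V, and the composite of beta and
  delta\<close>

lemma factoring_subset: "factoring A V X Y \<subseteq> mor A X Y"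
  by (auto simp: factoring_def)

lemma factoringI:
  "Z \<in> V \<Longrightarrow> a \<in> mor A X Z \<Longrightarrow> b \<in> mor A Z Y \<Longrightarrow> b \<cdot> a \<in> factoring A V X Y"
  using mor_simps(1) unfolding factoring_def by fast

lemma factoring_comp:
  assumes "f \<in> factoring A V X Y" "g \<in> mor A X' X" "h \<in> mor A Y Y'"
  shows "h \<cdot> f \<cdot> g \<in> factoring A V X' Y'"
proof -
  obtain Z a b where Z: "Z \<in> V" "a \<in> mor A X Z" "b \<in> mor A Z Y" "f = b \<cdot> a"
    using assms(1) by (auto simp: factoring_def)
  have "h \<cdot> f \<cdot> g = (h \<cdot> b) \<cdot> (a \<cdot> g)" unfolding Z(4) using Z(2,3) assms(2,3) by (auto simp: mor_def)
  moreover have "a \<cdot> g \<in> mor A X' Z" "h \<cdot> b \<in> mor A Z Y'" using Z(2,3) assms(2,3) by (auto simp: mor_def)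
  ultimately show ?thesis using factoringI[OF Z(1)] by simp
qed

text \<open>The point is closure under sums: b a + b' a' factors through the biproduct of the two
  intermediate objects, which V contains.\<close>

lemma factoring_subgroup:
  assumes "subcategory A V" "X \<in> Ob A" "Y \<in> Ob A"
  shows "subgroup (factoring A V X Y) (Hom A X Y)"
proof -
  interpret G: comm_group "Hom A X Y" by (rule hom_group[OF assms(2,3)])
  obtain Z where Z: "Z \<in> V" "Z \<in> Ob A" "V \<subseteq> Ob A"
    using assms(1) unfolding subcategory_def by blast
  show ?thesis
  proof (rule G.subgroupI)
    have "Zero A Z Y \<cdot> Zero A X Z \<in> factoring A V X Y"
      by (rule factoringI[OF Z(1) mor_simps(5)[OF assms(2) Z(2)] mor_simps(5)[OF Z(2) assms(3)]])
    then show "factoring A V X Y \<noteq> {}" by blast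
    fix f assume f: "f \<in> factoring A V X Y"
    then obtain P a b where P: "P \<in> V" "a \<in> mor A X P" "b \<in> mor A P Y" "f = b \<cdot> a"
      by (auto simp: factoring_def)
    have "Neg A f = Neg A b \<cdot> a" unfolding P(4) using P(2,3) by (auto simp: mor_def)
    then have "Neg A f \<in> factoring A V X Y" using factoringI[OF P(1,2) mor_simps(4)[OF P(3)]] by simp
    moreover have "f \<in> mor A X Y" using f factoring_subset by blast
    ultimately show "inv\<^bsub>Hom A X Y\<^esub> f \<in> factoring A V X Y" by (simp add: Neg_def mor_def)
    fix f' assume "f' \<in> factoring A V X Y"
    then obtain P' a' b' where P': "P' \<in> V" "a' \<in> mor A X P'" "b' \<in> mor A P' Y" "f' = b' \<cdot> a'"
      by (auto simp: factoring_def)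
    have "P \<in> Ob A" "P' \<in> Ob A" using P(1) P'(1) Z by blast+
    then obtain S i j p q where S: "S \<in> Ob A" "i \<in> mor A P S" "j \<in> mor A P' S" "p \<in> mor A S P" "q \<in> mor A S P'"
      "p \<cdot> i = Ident A P" "q \<cdot> j = Ident A P'" "q \<cdot> i = Zero A P P'" "p \<cdot> j = Zero A P' P"
      "biproduct A P P' S" by (rule biproductE)
    have "S \<in> V" using assms(1) P(1) P'(1) S(10) unfolding subcategory_def by blast
    define w where "w = Plus A (b \<cdot> p) (b' \<cdot> q)"
    note w = copair_components[OF S(2-9) P(3) P'(3), folded w_def]
    have "w \<cdot> Plus A (i \<cdot> a) (j \<cdot> a') = Plus A ((w \<cdot> i) \<cdot> a) ((w \<cdot> j) \<cdot> a')"
      using w(3) S(2,3) P(2) P'(2) by (auto simp: mor_def)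
    then have "Plus A f f' = w \<cdot> Plus A (i \<cdot> a) (j \<cdot> a')" unfolding w(1,2) P(4) P'(4) by simp
    moreover have "Plus A (i \<cdot> a) (j \<cdot> a') \<in> mor A X S" using S(2,3) P(2) P'(2) by (auto simp: mor_def)
    ultimately show "f \<otimes>\<^bsub>Hom A X Y\<^esub> f' \<in> factoring A V X Y"
      using factoringI[OF \<open>S \<in> V\<close> _ w(3)] by simp
  qed (use factoring_subset in auto)
qed

lemma factoring_normal:
  assumes "subcategory A V" "X \<in> Ob A" "Y \<in> Ob A"
  shows "factoring A V X Y \<lhd> Hom A X Y"
  using factoring_subgroup[OF assms] comm_group.normal_iff_subgroup[OF hom_group] assms by blast

lemma Hom_mod_class_eq_iff:
  assumes "subcategory A V" "f \<in> mor A X Y" "g \<in> mor A X Y"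
  shows "Hom_mod_class A V X Y f = Hom_mod_class A V X Y g \<longleftrightarrow> Minus A f g \<in> factoring A V X Y"
proof -
  have XY: "X \<in> Ob A" "Y \<in> Ob A" using assms(2) mor_objects by blast+
  interpret G: comm_group "Hom A X Y" by (rule hom_group[OF XY])
  interpret H: subgroup "factoring A V X Y" "Hom A X Y" by (rule factoring_subgroup[OF assms(1) XY])
  have inv: "f \<otimes>\<^bsub>Hom A X Y\<^esub> inv\<^bsub>Hom A X Y\<^esub> g = Minus A f g"
    using assms(3) by (simp add: Minus_def Neg_def mor_def)
  have "Hom_mod_class A V X Y f = Hom_mod_class A V X Y g \<longleftrightarrow>
      f \<in> factoring A V X Y #>\<^bsub>Hom A X Y\<^esub> g"
    unfolding Hom_mod_class_def
    using G.repr_independence[OF _ _ H.is_subgroup] G.rcos_self[OF _ H.is_subgroup] assms(2,3) by auto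
  also have "\<dots> \<longleftrightarrow> Minus A f g \<in> factoring A V X Y"
    using H.rcos_module[OF G.is_group, of g f] assms(2,3) inv by simp
  finally show ?thesis .
qed

text \<open>A morphism through V extends along a by \<open>ext\<close>, so adding it to h does not
  change the pushout; the set to which \<open>the_elem\<close> is applied in \<open>delta_V\<close>
  is thus a singleton. The pushout is the pullback along g, and any other g' with this pullback
  differs from g by a morphism through the middle term of (c, d), which lies in V; this determines
  the \<open>THE\<close> in \<open>beta_V\<close>. One map of short exact sequences therefore
  computes a transition map.\<close>

lemma beta_delta_V:
  assumes V: "subcategory A V" and s: "short_exact A a b" and t: "short_exact A c d"
    and c: "Tgt A c \<in> V" and m: "ses_map A (a, b) (c, d) h u g"
    and ext: "\<And>Y f. Y \<in> V \<Longrightarrow> f \<in> mor A (Src A a) Y \<Longrightarrow> \<exists>f'\<in>mor A (Tgt A a) Y. f' \<cdot> a = f"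
  shows "ext_push A (a, b) ` Hom_mod_class A V (Src A a) (Src A c) h = {ext_push A (a, b) h}" (is ?E)
    and "beta_V A V (a, b) (c, d) (delta_V A (a, b) (Hom_mod_class A V (Src A a) (Src A c) h))
       = Hom_mod_class A V (Tgt A b) (Tgt A d) g"
proof -
  have h: "h \<in> mor A (Src A a) (Src A c)" and g: "g \<in> mor A (Tgt A b) (Tgt A d)"
    using m by (simp_all add: ses_map_def)
  have XY: "Src A a \<in> Ob A" "Src A c \<in> Ob A" using h mor_objects by blast+
  interpret G: comm_group "Hom A (Src A a) (Src A c)" by (rule hom_group[OF XY])
  note ab = short_exactD[OF s] and cd = short_exactD[OF t]
  have "ext_push A (a, b) h' = ext_push A (a, b) h"
    if h': "h' \<in> Hom_mod_class A V (Src A a) (Src A c) h" for h'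
  proof -
    obtain f where f: "f \<in> factoring A V (Src A a) (Src A c)" "h' = Plus A f h"
      using h' by (auto simp: Hom_mod_class_def r_coset_def)
    then obtain Z x y where Z: "Z \<in> V" "x \<in> mor A (Src A a) Z" "y \<in> mor A Z (Src A c)" "f = y \<cdot> x"
      by (auto simp: factoring_def)
    obtain x' where x': "x' \<in> mor A (Tgt A a) Z" "x' \<cdot> a = x" using ext[OF Z(1,2)] by blast
    have "f = (y \<cdot> x') \<cdot> a" unfolding Z(4) x'(2)[symmetric] using Z(3) x'(1) ab(1) by (auto simp: mor_def)
    moreover have "y \<cdot> x' \<in> mor A (Tgt A a) (Src A c)" using Z(3) x'(1) by (auto simp: mor_def)
    ultimately show ?thesis using ext_push_plus[OF s h] f(2) by simp
  qed
  moreover have "h \<in> Hom_mod_class A V (Src A a) (Src A c) h"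
    unfolding Hom_mod_class_def
    using G.rcos_self[OF _ factoring_subgroup[OF V XY]] h by simp
  ultimately show E: ?E by blast
  have e: "delta_V A (a, b) (Hom_mod_class A V (Src A a) (Src A c) h) = ext_pull A (c, d) g"
    unfolding delta_V_def E using ext_push_eq_pull[OF s t m] by simp
  show "beta_V A V (a, b) (c, d) (delta_V A (a, b) (Hom_mod_class A V (Src A a) (Src A c) h))
       = Hom_mod_class A V (Tgt A b) (Tgt A d) g"
    unfolding e beta_V_def
  proof (rule the_equality)
    fix k assume "\<exists>g'\<in>mor A (Tgt A (snd (a, b))) (Tgt A (snd (c, d))).
        ext_pull A (c, d) g' = ext_pull A (c, d) g \<and>
        k = Hom_mod_class A V (Tgt A (snd (a, b))) (Tgt A (snd (c, d))) g'"
    then obtain g' where g': "g' \<in> mor A (Tgt A b) (Tgt A d)" "ext_pull A (c, d) g' = ext_pull A (c, d) g"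
      "k = Hom_mod_class A V (Tgt A b) (Tgt A d) g'" by auto
    obtain w where w: "w \<in> mor A (Tgt A b) (Tgt A c)" "Minus A g' g = d \<cdot> w"
      using ext_pull_eq_imp[OF t g'(1) g g'(2)] by blast
    then have "Minus A g' g \<in> factoring A V (Tgt A b) (Tgt A d)"
      using factoringI[OF c w(1) cd(2)] by simp
    then show "k = Hom_mod_class A V (Tgt A b) (Tgt A d) g"
      unfolding g'(3) using Hom_mod_class_eq_iff[OF V g'(1) g] by simp
  qed (use g in auto)
qed

end

section \<open>Proper coresolutions\<close>

locale coresolving = abelian_category A for A :: "('o, 'm) addcat" (structure) +
  fixes V :: "'o set"
  assumes subcat: "subcategory A V"
begin

abbreviation cores :: "'o \<Rightarrow> ('o, 'm) augmented \<Rightarrow> bool" where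
  "cores M I \<equiv> proper_coresolution A V M I"

abbreviation "\<Theta> \<equiv> Theta A"
abbreviation "\<iota> \<equiv> Theta_inc A"
abbreviation "\<pi> \<equiv> Theta_proj A"
abbreviation cob :: "('o, 'm) augmented \<Rightarrow> nat \<Rightarrow> 'o" where "cob I i \<equiv> cobj I (int i)"

lemma cores_complex: "cores M I \<Longrightarrow> cochain_complex A I"
  unfolding proper_coresolution_def by simp

lemma cores_cdiff:
  assumes "cores M I"
  shows "cdiff I i \<in> mor A (cobj I i) (cobj I (i + 1))"
    "cdiff I (i + 1) \<cdot> cdiff I i = Zero A (cobj I i) (cobj I (i + 2))"
    "cobj I i \<in> Ob A"
  using cores_complex[OF assms] by (simp_all add: cochain_complex_def)

lemma cores_cdiff_Suc:
  assumes "cores M I"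
  shows "cdiff I (int i) \<in> mor A (cob I i) (cob I (Suc i))"
  using cores_cdiff(1)[OF assms, of "int i"] by (simp add: add.commute)

lemma cores_V: "cores M I \<Longrightarrow> cob I i \<in> V"
  unfolding proper_coresolution_def by simp

lemma cores_neg: "cores M I \<Longrightarrow> i < 0 \<Longrightarrow> zero_object A (cobj I i)"
  unfolding proper_coresolution_def by simp

lemma cores_aug: "cores M I \<Longrightarrow> aug I \<in> mor A M (cob I 0)"
  unfolding proper_coresolution_def by simp

lemma Theta_0: "cores M I \<Longrightarrow> \<Theta> I 0 = M"
  using cores_aug by (auto simp: Theta_def Theta_inc_def mor_def)

text \<open>Makes the two cases of \<open>Theta_inc\<close> uniform: exactness at the augmentation
  in degree 0, the chosen kernel above it.\<close>

lemma Theta_inc_kernel: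
  assumes "cores M I"
  shows "is_kernel A (cdiff I (int i)) (\<iota> I i)"
proof (cases i)
  case 0
  have "mono_arrow A (aug I)" "exact_at A (aug I) (cdiff I 0)"
    using assms by (simp_all add: proper_coresolution_def)
  then show ?thesis using 0 by (simp add: Theta_inc_def mono_exact_is_kernel)
next
  case (Suc j)
  have "cdiff I (int i) \<in> Ar A" using cores_cdiff(1)[OF assms] by (simp add: mor_def)
  then have "is_kernel A (cdiff I (int i)) (ker_arrow A (cdiff I (int i)))"
    unfolding ker_arrow_def by (rule someI_ex[OF has_kernels])
  then show ?thesis using Suc by (simp add: Theta_inc_def)
qed

lemma Theta_inc_mor: "cores M I \<Longrightarrow> \<iota> I i \<in> mor A (\<Theta> I i) (cob I i)"
  using kernel_arrow(1)[OF Theta_inc_kernel cores_cdiff(1)] by (simp add: Theta_def)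

lemma Theta_Ob: "cores M I \<Longrightarrow> \<Theta> I i \<in> Ob A"
  using Theta_inc_mor mor_objects(1) by blast

lemma cores_exact: "cores M I \<Longrightarrow> exact_at A (cdiff I (int i)) (cdiff I (int (Suc i)))"
  unfolding proper_coresolution_def by (simp add: add.commute[of "1::int"])

lemma Theta_proj:
  assumes "cores M I"
  shows "\<pi> I i \<in> mor A (cob I i) (\<Theta> I (Suc i))" "\<iota> I (Suc i) \<cdot> \<pi> I i = cdiff I (int i)"
    "short_exact A (\<iota> I i) (\<pi> I i)"
proof -
  note fac = exact_factorization[OF cores_cdiff_Suc[OF assms] cores_cdiff_Suc[OF assms, of "Suc i"]
      cores_exact[OF assms] Theta_inc_kernel[OF assms] Theta_inc_kernel[OF assms], folded Theta_def]
  have "\<pi> I i \<in> mor A (cob I i) (\<Theta> I (Suc i)) \<and> \<iota> I (Suc i) \<cdot> \<pi> I i = cdiff I (int i)"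
    unfolding Theta_proj_def by (rule theI'[OF fac(1)])
  then show "\<pi> I i \<in> mor A (cob I i) (\<Theta> I (Suc i))" "\<iota> I (Suc i) \<cdot> \<pi> I i = cdiff I (int i)"
    by blast+
  then show "short_exact A (\<iota> I i) (\<pi> I i)" by (rule fac(2))
qed

lemma Theta_proj_inc:
  assumes "cores M I"
  shows "\<pi> I i \<cdot> \<iota> I i = Zero A (\<Theta> I i) (\<Theta> I (Suc i))"
  using short_exactD(4)[OF Theta_proj(3)[OF assms, of i]] Theta_proj(1)[OF assms, of i]
  by (simp add: Theta_def mor_def)

lemma Theta_src_tgt:
  assumes "cores M I"
  shows "Src A (\<iota> I i) = \<Theta> I i" "Tgt A (\<iota> I i) = cob I i" "Src A (\<pi> I i) = cob I i"
    "Tgt A (\<pi> I i) = \<Theta> I (Suc i)"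
  using Theta_inc_mor[OF assms, of i] Theta_proj(1)[OF assms, of i] by (auto simp: mor_def)

text \<open>Properness speaks of differentials, extension problems of syzygies. The composite of f
  with the projection onto the syzygy is a cocycle for Hom into Y, hence of the form h d, and
  cancelling the epi projection shows that h extends f.\<close>

lemma cores_extend:
  assumes I: "cores M I" and Y: "Y \<in> V" and f: "f \<in> mor A (\<Theta> I i) Y"
  shows "\<exists>g\<in>mor A (cob I i) Y. g \<cdot> \<iota> I i = f"
proof -
  have p: "(\<lambda>h. h \<cdot> aug I) ` mor A (cobj I 0) Y = mor A M Y"
    "kernel (Hom A (cobj I 0) Y) (Hom A M Y) (\<lambda>h. h \<cdot> aug I)
          = (\<lambda>h. h \<cdot> cdiff I 0) ` mor A (cobj I 1) Y"
    "\<And>i. i \<ge> 0 \<Longrightarrow> kernel (Hom A (cobj I (i + 1)) Y) (Hom A (cobj I i) Y) (\<lambda>h. h \<cdot> cdiff I i)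
          = (\<lambda>h. h \<cdot> cdiff I (i + 1)) ` mor A (cobj I (i + 2)) Y"
    using I Y unfolding proper_coresolution_def by blast+
  show ?thesis
  proof (cases i)
    case 0
    then have "f \<in> (\<lambda>h. h \<cdot> aug I) ` mor A (cobj I 0) Y"
      using p(1) f Theta_0[OF I] by simp
    then show ?thesis using 0 by (auto simp: Theta_inc_def)
  next
    case (Suc j)
    note f = f[unfolded Suc] and \<pi> = Theta_proj(1,2)[OF I, of j] and \<iota> = Theta_inc_mor[OF I]
    have fp: "f \<cdot> \<pi> I j \<in> mor A (cob I j) Y" using f \<pi>(1) by (rule mor_simps(1)[rotated])
    have "(f \<cdot> \<pi> I j) \<cdot> \<iota> I j = f \<cdot> (\<pi> I j \<cdot> \<iota> I j)" using f \<pi>(1) \<iota>[of j] by (auto simp: mor_def)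
    also have "\<dots> = Zero A (\<Theta> I j) Y"
      unfolding Theta_proj_inc[OF I] using Theta_Ob[OF I] f \<iota>[of j] by (auto simp: mor_def)
    finally have fpi: "(f \<cdot> \<pi> I j) \<cdot> \<iota> I j = Zero A (\<Theta> I j) Y" .
    \<comment> \<open>Properness has separate kernel clauses: for \<open>j = 0\<close> the preceding
      arrow is the augmentation, above it is a differential, reached from the inclusion of the
      syzygy by composing with the preceding projection.\<close>
    have "\<exists>h\<in>mor A (cob I (Suc j)) Y. f \<cdot> \<pi> I j = h \<cdot> cdiff I (int j)"
    proof (cases j)
      case 0
      have "f \<cdot> \<pi> I j \<in> kernel (Hom A (cobj I 0) Y) (Hom A M Y) (\<lambda>h. h \<cdot> aug I)"
        using fp fpi Theta_0[OF I] 0 by (simp add: kernel_def Theta_inc_def)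
      then show ?thesis unfolding p(2) using 0 by auto
    next
      case (Suc k)
      have "(f \<cdot> \<pi> I j) \<cdot> cdiff I (int k) = ((f \<cdot> \<pi> I j) \<cdot> \<iota> I j) \<cdot> \<pi> I k"
        unfolding Theta_proj(2)[OF I, of k, symmetric] Suc
        using fp[unfolded Suc] \<iota>[of "Suc k"] Theta_proj(1)[OF I, of k] f[unfolded Suc] \<pi>(1)[unfolded Suc]
        by (auto simp: mor_def)
      also have "\<dots> = Zero A (cob I k) Y"
        unfolding fpi using Theta_Ob[OF I] f Theta_proj(1)[OF I, of k] Suc by (auto simp: mor_def)
      finally have "f \<cdot> \<pi> I j \<in> kernel (Hom A (cobj I (int k + 1)) Y) (Hom A (cobj I (int k)) Y)
          (\<lambda>h. h \<cdot> cdiff I (int k))"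
        using fp Suc by (simp add: kernel_def add.commute[of "1::int"])
      then have "f \<cdot> \<pi> I j \<in> (\<lambda>h. h \<cdot> cdiff I (int k + 1)) ` mor A (cobj I (int k + 2)) Y"
        using p(3)[of "int k"] by simp
      then show ?thesis using Suc by (auto simp: add.commute[of "2::int"] add.commute[of "1::int"])
    qed
    then obtain h where h: "h \<in> mor A (cob I (Suc j)) Y" "f \<cdot> \<pi> I j = h \<cdot> cdiff I (int j)" by blast
    have hi: "h \<cdot> \<iota> I (Suc j) \<in> mor A (\<Theta> I (Suc j)) Y" using h(1) \<iota>[of "Suc j"] by (rule mor_simps(1)[rotated])
    have "(h \<cdot> \<iota> I (Suc j)) \<cdot> \<pi> I j = f \<cdot> \<pi> I j"
      unfolding h(2) \<pi>(2)[symmetric] using h(1) \<iota>[of "Suc j"] \<pi>(1) by (auto simp: mor_def)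
    then have "h \<cdot> \<iota> I (Suc j) = f"
      by (rule short_exact_epi[OF Theta_proj(3)[OF I, of j]])
        (use hi f Theta_src_tgt[OF I] in auto)
    then show ?thesis using h(1) Suc by blast
  qed
qed

text \<open>Every factorisation through V can be rerouted through \<open>\<iota> I i\<close>, since
  the first factor extends along it. Vanishing modulo V is thereby an extension problem for a single
  fixed mono.\<close>

lemma factoring_iff_extend:
  assumes I: "cores M I"
  shows "h \<in> factoring A V (\<Theta> I i) Y \<longleftrightarrow> (\<exists>e\<in>mor A (cob I i) Y. h = e \<cdot> \<iota> I i)"
proof
  assume "h \<in> factoring A V (\<Theta> I i) Y"
  then obtain Z a b where Z: "Z \<in> V" "a \<in> mor A (\<Theta> I i) Z" "b \<in> mor A Z Y" "h = b \<cdot> a"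
    by (auto simp: factoring_def)
  obtain a' where a': "a' \<in> mor A (cob I i) Z" "a' \<cdot> \<iota> I i = a"
    using cores_extend[OF I Z(1,2)] by blast
  have "h = (b \<cdot> a') \<cdot> \<iota> I i"
    unfolding Z(4) a'(2)[symmetric] using Z(3) a'(1) Theta_inc_mor[OF I, of i] by (auto simp: mor_def)
  then show "\<exists>e\<in>mor A (cob I i) Y. h = e \<cdot> \<iota> I i" using mor_simps(1)[OF a'(1) Z(3)] by blast
qed (use factoringI[OF cores_V[OF I] Theta_inc_mor[OF I]] in blast)

lemma ses_map_Theta_iff:
  assumes I: "cores M I" and J: "cores N J"
  shows "ses_map A (Theta_seq A I i) (Theta_seq A J k) h u h' \<longleftrightarrow>
    h \<in> mor A (\<Theta> I i) (\<Theta> J k) \<and> u \<in> mor A (cob I i) (cob J k) \<and>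
    h' \<in> mor A (\<Theta> I (Suc i)) (\<Theta> J (Suc k)) \<and> u \<cdot> \<iota> I i = \<iota> J k \<cdot> h \<and> \<pi> J k \<cdot> u = h' \<cdot> \<pi> I i"
  by (simp add: ses_map_def Theta_seq_def Theta_src_tgt[OF I] Theta_src_tgt[OF J])

text \<open>The composite of h with the inclusion into \<open>J^k\<close> ends in V, so properness
  extends it over \<open>I^i\<close>; the extension respects the syzygies and therefore passes to
  the cokernels.\<close>

lemma step_exists:
  assumes I: "cores M I" and J: "cores N J" and h: "h \<in> mor A (\<Theta> I i) (\<Theta> J k)"
  shows "\<exists>u h'. ses_map A (Theta_seq A I i) (Theta_seq A J k) h u h'"
proof -
  note i = Theta_inc_mor[OF I, of i] Theta_proj[OF I, of i]
  note j = Theta_inc_mor[OF J, of k] Theta_proj[OF J, of k]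
  have ih: "\<iota> J k \<cdot> h \<in> mor A (\<Theta> I i) (cob J k)" using h j(1) by (rule mor_simps)
  obtain u where u: "u \<in> mor A (cob I i) (cob J k)" "u \<cdot> \<iota> I i = \<iota> J k \<cdot> h"
    using cores_extend[OF I cores_V[OF J] ih] by blast
  have pu: "\<pi> J k \<cdot> u \<in> mor A (cob I i) (\<Theta> J (Suc k))" using u(1) j(2) by (rule mor_simps)
  have "(\<pi> J k \<cdot> u) \<cdot> \<iota> I i = \<pi> J k \<cdot> (u \<cdot> \<iota> I i)" using u(1) j(2) i(1) by (auto simp: mor_def)
  also have "\<dots> = (\<pi> J k \<cdot> \<iota> J k) \<cdot> h" unfolding u(2) using j(1,2) h by (auto simp: mor_def)
  also have "\<dots> = Zero A (\<Theta> I i) (\<Theta> J (Suc k))"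
    unfolding Theta_proj_inc[OF J] using Theta_Ob[OF J] j(2) h by (auto simp: mor_def)
  finally obtain h' where "h' \<in> mor A (\<Theta> I (Suc i)) (\<Theta> J (Suc k))" "h' \<cdot> \<pi> I i = \<pi> J k \<cdot> u"
    using short_exact_cokernel[OF i(4), of "\<pi> J k \<cdot> u"] pu by (auto simp: Theta_src_tgt[OF I])
  then show ?thesis
    using u h unfolding ses_map_Theta_iff[OF I J] by metis
qed

lemma Hom_mod_step:
  assumes I: "cores M I" and J: "cores N J"
    and m: "ses_map A (Theta_seq A I i) (Theta_seq A J k) h u h'"
  shows "ext_push A (Theta_seq A I i) ` Hom_mod_class A V (\<Theta> I i) (\<Theta> J k) h
      = {ext_push A (Theta_seq A I i) h}"
    and "beta_V A V (Theta_seq A I i) (Theta_seq A J k)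
      (delta_V A (Theta_seq A I i) (Hom_mod_class A V (\<Theta> I i) (\<Theta> J k) h))
    = Hom_mod_class A V (\<Theta> I (Suc i)) (\<Theta> J (Suc k)) h'"
proof -
  have c: "Tgt A (\<iota> J k) \<in> V" using cores_V[OF J] by (simp add: Theta_src_tgt[OF J])
  have e: "\<exists>f'\<in>mor A (Tgt A (\<iota> I i)) Y. f' \<cdot> \<iota> I i = f" if "Y \<in> V" "f \<in> mor A (Src A (\<iota> I i)) Y" for Y f
    using cores_extend[OF I that(1)] that(2) by (simp add: Theta_src_tgt[OF I])
  show "ext_push A (Theta_seq A I i) ` Hom_mod_class A V (\<Theta> I i) (\<Theta> J k) h
      = {ext_push A (Theta_seq A I i) h}"
    "beta_V A V (Theta_seq A I i) (Theta_seq A J k)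
      (delta_V A (Theta_seq A I i) (Hom_mod_class A V (\<Theta> I i) (\<Theta> J k) h))
    = Hom_mod_class A V (\<Theta> I (Suc i)) (\<Theta> J (Suc k)) h'"
    using beta_delta_V[OF subcat Theta_proj(3)[OF I, of i] Theta_proj(3)[OF J, of k] c
        m[unfolded Theta_seq_def] e]
    by (simp_all add: Theta_seq_def Theta_src_tgt[OF I] Theta_src_tgt[OF J])
qed

section \<open>Ladders of short exact sequences and their null homotopies\<close>

definition ladder where
  "ladder I i J k h u \<longleftrightarrow>
     (\<forall>j. ses_map A (Theta_seq A I (i + j)) (Theta_seq A J (k + j)) (h j) (u j) (h (Suc j)))"

lemma ladder_exists:
  assumes I: "cores M I" and J: "cores N J" and h: "h0 \<in> mor A (\<Theta> I i) (\<Theta> J k)"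
  shows "\<exists>h u. h 0 = h0 \<and> ladder I i J k h u"
proof -
  let ?P = "\<lambda>j h. h \<in> mor A (\<Theta> I (i + j)) (\<Theta> J (k + j))"
  let ?Q = "\<lambda>j h h'. \<exists>u. ses_map A (Theta_seq A I (i + j)) (Theta_seq A J (k + j)) h u h'"
  \<comment> \<open>The clause for \<open>j = 0\<close> in the invariant makes the dependent choice
    start at \<open>h0\<close>.\<close>
  have "\<exists>h. (\<forall>j. (?P j (h j) \<and> (j = 0 \<longrightarrow> h j = h0)) \<and> ?Q j (h j) (h (Suc j)))"
  proof (rule dependent_nat_choice)
    show "\<exists>x. ?P 0 x \<and> (0 = (0::nat) \<longrightarrow> x = h0)" using h by auto
    fix x j assume "?P j x \<and> (j = 0 \<longrightarrow> x = h0)"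
    then obtain u h' where m: "ses_map A (Theta_seq A I (i + j)) (Theta_seq A J (k + j)) x u h'"
      using step_exists[OF I J] by blast
    then have "?P (Suc j) h'" using ses_map_Theta_iff[OF I J] by simp
    then show "\<exists>y. (?P (Suc j) y \<and> (Suc j = 0 \<longrightarrow> y = h0)) \<and> ?Q j x y" using m by blast
  qed
  then obtain h where h: "h 0 = h0" "\<And>j. ?Q j (h j) (h (Suc j))" by blast
  then obtain u where "\<And>j. ses_map A (Theta_seq A I (i + j)) (Theta_seq A J (k + j)) (h j) (u j) (h (Suc j))"
    by metis
  then show ?thesis using h(1) unfolding ladder_def by blast
qed

text \<open>\<open>u - \<iota> e\<close> vanishes on the syzygy, so it descends to the next syzygy
  and extends by properness to an arrow \<open>\<sigma>\<close> out of the next term. Then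
  \<open>\<pi> \<sigma>\<close> extends \<open>h'\<close> just as e extends h, so the situation
  reproduces itself one degree higher.\<close>

lemma null_step:
  assumes I: "cores M I" and J: "cores N J"
    and m: "ses_map A (Theta_seq A I i) (Theta_seq A J k) h u h'"
    and e: "e \<in> mor A (cob I i) (\<Theta> J k)" "e \<cdot> \<iota> I i = h"
  shows "\<exists>\<sigma>\<in>mor A (cob I (Suc i)) (cob J k).
    u = Plus A (\<iota> J k \<cdot> e) (\<sigma> \<cdot> cdiff I (int i)) \<and> (\<pi> J k \<cdot> \<sigma>) \<cdot> \<iota> I (Suc i) = h'"
proof -
  note i = Theta_inc_mor[OF I, of i] Theta_proj[OF I, of i]
  note i' = Theta_inc_mor[OF I, of "Suc i"]
  note j = Theta_inc_mor[OF J, of k] Theta_proj[OF J, of k]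
  have m: "h \<in> mor A (\<Theta> I i) (\<Theta> J k)" "u \<in> mor A (cob I i) (cob J k)"
    "h' \<in> mor A (\<Theta> I (Suc i)) (\<Theta> J (Suc k))" "u \<cdot> \<iota> I i = \<iota> J k \<cdot> h" "\<pi> J k \<cdot> u = h' \<cdot> \<pi> I i"
    using m by (simp_all add: ses_map_Theta_iff[OF I J])
  define v where "v = Minus A u (\<iota> J k \<cdot> e)"
  have v: "v \<in> mor A (cob I i) (cob J k)" unfolding v_def using m(2) e(1) j(1) by (auto simp: mor_def)
  have "v \<cdot> \<iota> I i = Minus A (u \<cdot> \<iota> I i) (\<iota> J k \<cdot> (e \<cdot> \<iota> I i))"
    unfolding v_def using m(2) e(1) j(1) i(1) by (auto simp: mor_def)
  also have "\<dots> = Zero A (\<Theta> I i) (cob J k)"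
    unfolding e(2) m(4) using m(1) j(1) by (auto simp: mor_def)
  finally obtain w where w: "w \<in> mor A (\<Theta> I (Suc i)) (cob J k)" "w \<cdot> \<pi> I i = v"
    using short_exact_cokernel[OF i(4), of v] v by (auto simp: Theta_src_tgt[OF I])
  obtain \<sigma> where \<sigma>: "\<sigma> \<in> mor A (cob I (Suc i)) (cob J k)" "\<sigma> \<cdot> \<iota> I (Suc i) = w"
    using cores_extend[OF I cores_V[OF J] w(1)] by blast
  have sd: "\<sigma> \<cdot> cdiff I (int i) = v"
    unfolding i(3)[symmetric] w(2)[symmetric] \<sigma>(2)[symmetric] using \<sigma>(1) i(2) i' by (auto simp: mor_def)
  have "Plus A (\<iota> J k \<cdot> e) v = u"
    unfolding v_def Minus_def using m(2) e(1) j(1)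
    by (auto simp: mor_def plus_commute[of "\<iota> J k \<cdot> e" "Plus A u (Neg A (\<iota> J k \<cdot> e))"])
  then have 1: "u = Plus A (\<iota> J k \<cdot> e) (\<sigma> \<cdot> cdiff I (int i))" using sd by simp
  have "(\<pi> J k \<cdot> w) \<cdot> \<pi> I i = \<pi> J k \<cdot> (w \<cdot> \<pi> I i)" using j(2) w(1) i(2) by (auto simp: mor_def)
  also have "\<dots> = Minus A (\<pi> J k \<cdot> u) ((\<pi> J k \<cdot> \<iota> J k) \<cdot> e)"
    unfolding w(2) v_def using j(1,2) m(2) e(1) by (auto simp: mor_def)
  also have "\<dots> = h' \<cdot> \<pi> I i"
    unfolding m(5) Theta_proj_inc[OF J] using Theta_Ob[OF J] cores_cdiff(3)[OF I] j(2) m(3) e(1) i(2) by (auto simp: mor_def Minus_def)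
  finally have "\<pi> J k \<cdot> w = h'"
    by (rule short_exact_epi[OF i(4)])
      (use j(2) w(1) m(3) Theta_src_tgt[OF I] in \<open>auto simp: mor_def\<close>)
  moreover have "(\<pi> J k \<cdot> \<sigma>) \<cdot> \<iota> I (Suc i) = \<pi> J k \<cdot> w"
    unfolding \<sigma>(2)[symmetric] using j(2) \<sigma>(1) i' by (auto simp: mor_def)
  ultimately show ?thesis using 1 \<sigma>(1) by auto
qed

text \<open>Iterating the previous step, the next e is \<open>\<pi> \<sigma>\<close>, so
  \<open>\<iota> e\<close> becomes d \<open>\<sigma>\<close>. In the first rung
  \<open>\<iota> e\<close> need not have this form, which is why the formula starts at
  \<open>u (Suc j)\<close>.\<close>

lemma null_homotopy:
  assumes I: "cores M I" and J: "cores N J" and l: "ladder I i J k h u"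
    and fac: "h 0 \<in> factoring A V (\<Theta> I i) (\<Theta> J k)"
  shows "\<exists>\<sigma>. \<forall>j. \<sigma> j \<in> mor A (cob I (Suc (i + j))) (cob J (k + j)) \<and>
    u (Suc j) = Plus A (cdiff J (int (k + j)) \<cdot> \<sigma> j) (\<sigma> (Suc j) \<cdot> cdiff I (int (Suc (i + j))))"
proof -
  let ?P = "\<lambda>j e. e \<in> mor A (cob I (i + j)) (\<Theta> J (k + j)) \<and> e \<cdot> \<iota> I (i + j) = h j"
  let ?R = "\<lambda>j e e' \<sigma>. \<sigma> \<in> mor A (cob I (Suc (i + j))) (cob J (k + j)) \<and>
    u j = Plus A (\<iota> J (k + j) \<cdot> e) (\<sigma> \<cdot> cdiff I (int (i + j))) \<and> e' = \<pi> J (k + j) \<cdot> \<sigma>"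
  let ?Q = "\<lambda>j e e'. \<exists>\<sigma>. ?R j e e' \<sigma>"
  have "\<exists>e. \<forall>j. ?P j (e j) \<and> ?Q j (e j) (e (Suc j))"
  proof (rule dependent_nat_choice)
    show "\<exists>e. ?P 0 e" using fac unfolding factoring_iff_extend[OF I] by auto
    fix e j assume e: "?P j e"
    have "ses_map A (Theta_seq A I (i + j)) (Theta_seq A J (k + j)) (h j) (u j) (h (Suc j))"
      using l by (simp add: ladder_def)
    from null_step[OF I J this] e obtain \<sigma> where \<sigma>:
      "\<sigma> \<in> mor A (cob I (Suc (i + j))) (cob J (k + j))"
      "u j = Plus A (\<iota> J (k + j) \<cdot> e) (\<sigma> \<cdot> cdiff I (int (i + j)))"
      "(\<pi> J (k + j) \<cdot> \<sigma>) \<cdot> \<iota> I (Suc (i + j)) = h (Suc j)" by blast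
    have "\<pi> J (k + j) \<cdot> \<sigma> \<in> mor A (cob I (Suc (i + j))) (\<Theta> J (Suc (k + j)))"
      using \<sigma>(1) Theta_proj(1)[OF J] by (rule mor_simps)
    then show "\<exists>y. ?P (Suc j) y \<and> ?Q j e y" using \<sigma> by auto
  qed
  then obtain e where e: "\<And>j. ?P j (e j)" "\<And>j. ?Q j (e j) (e (Suc j))" by blast
  then obtain \<sigma> where \<sigma>: "\<And>j. ?R j (e j) (e (Suc j)) (\<sigma> j)" by metis
  have "u (Suc j) = Plus A (cdiff J (int (k + j)) \<cdot> \<sigma> j) (\<sigma> (Suc j) \<cdot> cdiff I (int (Suc (i + j))))" for j
  proof -
    have "\<iota> J (k + Suc j) \<cdot> e (Suc j) = cdiff J (int (k + j)) \<cdot> \<sigma> j"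
      unfolding Theta_proj(2)[OF J, symmetric]
      using \<sigma>[of j] Theta_inc_mor[OF J, of "Suc (k + j)"] Theta_proj(1)[OF J, of "k + j"]
      by (auto simp: mor_def)
    then show ?thesis using \<sigma>[of "Suc j"] by simp
  qed
  then show ?thesis using \<sigma> by blast
qed

end

section \<open>Quotient complexes and sequential colimits\<close>

text \<open>Read from left to right, \<open>eq\<close> says that the image does not depend on the
  representative; read from right to left, it is injectivity. \<open>mult\<close> asks only that
  some representative of the product is related to the product of the images.\<close>

lemma iso_of_relation:
  assumes carr: "carrier G = c ` Z"
    and tot: "\<And>a. a \<in> Z \<Longrightarrow> \<exists>y\<in>carrier C. R a y"
    and surj: "\<And>y. y \<in> carrier C \<Longrightarrow> \<exists>a\<in>Z. R a y"
    and eq: "\<And>a b y z. a \<in> Z \<Longrightarrow> b \<in> Z \<Longrightarrow> y \<in> carrier C \<Longrightarrow> z \<in> carrier C \<Longrightarrow> R a y \<Longrightarrow> R b z \<Longrightarrow>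
      c a = c b \<longleftrightarrow> y = z"
    and mult: "\<And>a b y z. a \<in> Z \<Longrightarrow> b \<in> Z \<Longrightarrow> y \<in> carrier C \<Longrightarrow> z \<in> carrier C \<Longrightarrow> R a y \<Longrightarrow> R b z \<Longrightarrow>
      y \<otimes>\<^bsub>C\<^esub> z \<in> carrier C \<and> (\<exists>e\<in>Z. c e = c a \<otimes>\<^bsub>G\<^esub> c b \<and> R e (y \<otimes>\<^bsub>C\<^esub> z))"
  shows "\<exists>F\<in>iso G C. \<forall>a\<in>Z. \<forall>y\<in>carrier C. R a y \<longrightarrow> F (c a) = y"
proof -
  define F where "F x = (SOME y. y \<in> carrier C \<and> (\<exists>a\<in>Z. x = c a \<and> R a y))" for x
  have F: "F (c a) \<in> carrier C \<and> (\<exists>b\<in>Z. c a = c b \<and> R b (F (c a)))" if "a \<in> Z" for a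
  proof -
    have "\<exists>y. y \<in> carrier C \<and> (\<exists>b\<in>Z. c a = c b \<and> R b y)" using tot[OF that] that by blast
    then show ?thesis unfolding F_def by (rule someI_ex)
  qed
  have Fc: "F (c a) = y" if "a \<in> Z" "y \<in> carrier C" "R a y" for a y
    using F[OF that(1)] eq that by metis
  have "F \<in> hom G C"
  proof (rule homI)
    show "F x \<in> carrier C" if "x \<in> carrier G" for x using that F carr by auto
    fix x x' assume "x \<in> carrier G" "x' \<in> carrier G"
    then obtain a b where ab: "a \<in> Z" "b \<in> Z" "x = c a" "x' = c b" using carr by blast
    obtain y z where yz: "y \<in> carrier C" "z \<in> carrier C" "R a y" "R b z" using tot ab by metis
    obtain e where "e \<in> Z" "c e = c a \<otimes>\<^bsub>G\<^esub> c b" "R e (y \<otimes>\<^bsub>C\<^esub> z)" "y \<otimes>\<^bsub>C\<^esub> z \<in> carrier C"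
      using mult[OF ab(1,2) yz] by blast
    then show "F (x \<otimes>\<^bsub>G\<^esub> x') = F x \<otimes>\<^bsub>C\<^esub> F x'"
      using Fc[of e] Fc[OF ab(1) yz(1,3)] Fc[OF ab(2) yz(2,4)] ab by simp
  qed
  moreover have "bij_betw F (carrier G) (carrier C)"
    unfolding bij_betw_def
  proof
    show "inj_on F (carrier G)"
    proof (rule inj_onI)
      fix x x' assume x: "x \<in> carrier G" "x' \<in> carrier G" "F x = F x'"
      then obtain a b where ab: "a \<in> Z" "b \<in> Z" "x = c a" "x' = c b" using carr by blast
      obtain y z where yz: "y \<in> carrier C" "z \<in> carrier C" "R a y" "R b z" using tot ab by metis
      have "y = z" using Fc[OF ab(1) yz(1,3)] Fc[OF ab(2) yz(2,4)] x(3) ab by simp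
      then show "x = x'" using eq[OF ab(1,2) yz] ab by simp
    qed
    have "y \<in> F ` carrier G" if y: "y \<in> carrier C" for y
    proof -
      obtain a where a: "a \<in> Z" "R a y" using surj[OF y] by blast
      then have "F (c a) = y" using Fc y by blast
      then show ?thesis using a(1) unfolding carr by blast
    qed
    moreover have "F x \<in> carrier C" if "x \<in> carrier G" for x using that F carr by auto
    ultimately show "F ` carrier G = carrier C" by blast
  qed
  ultimately have "F \<in> iso G C" by (simp add: iso_def)
  then show ?thesis using Fc by blast
qed

text \<open>f carries a coset of B into a single coset of B', so all members of the union defining
  \<open>coset_map\<close> coincide.\<close>

lemma coset_map_rcos:
  assumes G: "group G" and B: "subgroup B G" and G': "group G'" and B': "subgroup B' G'"
    and f: "f \<in> hom G G'" "f ` B \<subseteq> B'" and x: "x \<in> carrier G"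
  shows "coset_map G' B' f (B #>\<^bsub>G\<^esub> x) = B' #>\<^bsub>G'\<^esub> f x"
proof -
  interpret G: group G by (rule G)
  interpret G': group G' by (rule G')
  have "B' #>\<^bsub>G'\<^esub> f y = B' #>\<^bsub>G'\<^esub> f x" if y: "y \<in> B #>\<^bsub>G\<^esub> x" for y
  proof -
    obtain b where b: "b \<in> B" "y = b \<otimes>\<^bsub>G\<^esub> x" using y by (auto simp: r_coset_def)
    have "b \<in> carrier G" using b(1) subgroup.subset[OF B] by blast
    then have "f y = f b \<otimes>\<^bsub>G'\<^esub> f x" using b(2) hom_mult[OF f(1) _ x] by simp
    moreover have fb: "f b \<in> B'" "f b \<in> carrier G'" "f x \<in> carrier G'"
      using b(1) f(2) subgroup.subset[OF B'] hom_in_carrier[OF f(1)] x by auto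
    ultimately have "B' #>\<^bsub>G'\<^esub> f y = (B' #>\<^bsub>G'\<^esub> f b) #>\<^bsub>G'\<^esub> f x"
      using G'.coset_mult_assoc subgroup.subset[OF B'] by simp
    also have "B' #>\<^bsub>G'\<^esub> f b = B'" using G'.coset_join2 fb(1,2) B' by blast
    finally show ?thesis .
  qed
  moreover have "x \<in> B #>\<^bsub>G\<^esub> x" using G.rcos_self[OF x B] .
  ultimately show ?thesis unfolding coset_map_def by blast
qed

text \<open>Cohomology of a quotient complex, computed on representatives in the middle group.\<close>

locale quotient_cohomology =
  G0: comm_group G0 + G1: comm_group G1 + G2: comm_group G2
  for G0 :: "'a monoid" and G1 :: "'b monoid" and G2 :: "'c monoid" +
  fixes B0 B1 B2 d0 d1
  assumes B0: "subgroup B0 G0" and B1: "subgroup B1 G1" and B2: "subgroup B2 G2"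
    and d0: "d0 \<in> hom G0 G1" and d0_B: "d0 ` B0 \<subseteq> B1"
    and d1: "d1 \<in> hom G1 G2" and d1_B: "d1 ` B1 \<subseteq> B2"
    and dd: "\<And>x. x \<in> carrier G0 \<Longrightarrow> d1 (d0 x) \<in> B2"
begin

definition cocycles where "cocycles = {x \<in> carrier G1. d1 x \<in> B2}"
definition coboundaries where "coboundaries = coset_map G1 B1 d0 ` carrier (G0 Mod B0)"
definition cls where "cls x = coboundaries #>\<^bsub>G1 Mod B1\<^esub> (B1 #>\<^bsub>G1\<^esub> x)"
definition cohomology where
  "cohomology = (G1 Mod B1)\<lparr>carrier := kernel (G1 Mod B1) (G2 Mod B2) (coset_map G2 B2 d1)\<rparr>
     Mod coboundaries"

lemma normal_B1: "B1 \<lhd> G1"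
  using B1 G1.normal_iff_subgroup by blast

lemma comm_quotient: "comm_group (G1 Mod B1)"
  by (rule G1.abelian_FactGroup[OF B1])

sublocale Q: comm_group "G1 Mod B1" by (rule comm_quotient)

lemma rcos_hom: "(\<lambda>x. B1 #>\<^bsub>G1\<^esub> x) \<in> hom G1 (G1 Mod B1)"
  by (rule normal.r_coset_hom_Mod[OF normal_B1])

lemma coboundaries_eq: "coboundaries = (\<lambda>s. B1 #>\<^bsub>G1\<^esub> d0 s) ` carrier G0"
  unfolding coboundaries_def carrier_FactGroup image_image
  by (intro image_cong refl coset_map_rcos G0.is_group G1.is_group B0 B1 d0 d0_B)

lemma coboundaries_subgroup: "subgroup coboundaries (G1 Mod B1)"
proof -
  have "(\<lambda>x. B1 #>\<^bsub>G1\<^esub> x) \<circ> d0 \<in> hom G0 (G1 Mod B1)" using hom_compose[OF d0 rcos_hom] .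
  then interpret h: group_hom G0 "G1 Mod B1" "(\<lambda>x. B1 #>\<^bsub>G1\<^esub> x) \<circ> d0"
    by unfold_locales
  show ?thesis using h.img_is_subgroup by (simp add: coboundaries_eq image_comp comp_def)
qed

lemma kernel_eq: "kernel (G1 Mod B1) (G2 Mod B2) (coset_map G2 B2 d1) = (\<lambda>x. B1 #>\<^bsub>G1\<^esub> x) ` cocycles"
proof -
  have "coset_map G2 B2 d1 (B1 #>\<^bsub>G1\<^esub> x) = B2 \<longleftrightarrow> d1 x \<in> B2" if "x \<in> carrier G1" for x
  proof -
    have "coset_map G2 B2 d1 (B1 #>\<^bsub>G1\<^esub> x) = B2 #>\<^bsub>G2\<^esub> d1 x"
      by (intro coset_map_rcos G1.is_group G2.is_group B1 B2 d1 d1_B that)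
    moreover have "d1 x \<in> carrier G2" using hom_in_carrier[OF d1 that] .
    ultimately show ?thesis
      using G2.coset_join1[OF _ _ B2] G2.coset_join2[OF _ B2] subgroup.subset[OF B2] by auto
  qed
  then show ?thesis by (auto simp: kernel_def carrier_FactGroup cocycles_def)
qed

lemma carrier_cohomology: "carrier cohomology = cls ` cocycles"
  unfolding cohomology_def carrier_FactGroup cls_def
  by (simp add: kernel_eq image_image r_coset_def)

lemma cls_mult:
  assumes "x \<in> carrier G1" "y \<in> carrier G1"
  shows "cls (x \<otimes>\<^bsub>G1\<^esub> y) = cls x \<otimes>\<^bsub>cohomology\<^esub> cls y"
proof -
  have n: "coboundaries \<lhd> G1 Mod B1" using coboundaries_subgroup Q.normal_iff_subgroup by blast
  have c: "B1 #>\<^bsub>G1\<^esub> x \<in> carrier (G1 Mod B1)" "B1 #>\<^bsub>G1\<^esub> y \<in> carrier (G1 Mod B1)"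
    using assms by (auto simp: carrier_FactGroup)
  have "cls x \<otimes>\<^bsub>cohomology\<^esub> cls y = cls x <#>\<^bsub>G1 Mod B1\<^esub> cls y"
    by (simp add: cohomology_def set_mult_def)
  also have "\<dots> = coboundaries #>\<^bsub>G1 Mod B1\<^esub> ((B1 #>\<^bsub>G1\<^esub> x) \<otimes>\<^bsub>G1 Mod B1\<^esub> (B1 #>\<^bsub>G1\<^esub> y))"
    unfolding cls_def by (rule normal.rcos_sum[OF n c])
  also have "\<dots> = cls (x \<otimes>\<^bsub>G1\<^esub> y)"
    unfolding cls_def using hom_mult[OF rcos_hom assms] by simp
  finally show ?thesis by simp
qed

text \<open>Unfolds two nested quotients: the outer one contributes a coboundary
  \<open>d0 s\<close>, the inner one an element of B1.\<close>

lemma cls_eq_iff: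
  assumes "x \<in> carrier G1" "y \<in> carrier G1"
  shows "cls x = cls y \<longleftrightarrow> (\<exists>s\<in>carrier G0. \<exists>b\<in>B1. x = b \<otimes>\<^bsub>G1\<^esub> (d0 s \<otimes>\<^bsub>G1\<^esub> y))"
proof -
  have c: "B1 #>\<^bsub>G1\<^esub> x \<in> carrier (G1 Mod B1)" "B1 #>\<^bsub>G1\<^esub> y \<in> carrier (G1 Mod B1)"
    using assms by (auto simp: carrier_FactGroup)
  have "cls x = cls y \<longleftrightarrow> B1 #>\<^bsub>G1\<^esub> x \<in> coboundaries #>\<^bsub>G1 Mod B1\<^esub> (B1 #>\<^bsub>G1\<^esub> y)"
    unfolding cls_def
    using Q.repr_independence[OF _ c(2) coboundaries_subgroup] Q.rcos_self[OF c(1) coboundaries_subgroup] by auto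
  also have "\<dots> \<longleftrightarrow> (\<exists>s\<in>carrier G0. B1 #>\<^bsub>G1\<^esub> x = (B1 #>\<^bsub>G1\<^esub> d0 s) \<otimes>\<^bsub>G1 Mod B1\<^esub> (B1 #>\<^bsub>G1\<^esub> y))"
    by (auto simp: r_coset_def[of "G1 Mod B1"] coboundaries_eq)
  also have "\<dots> \<longleftrightarrow> (\<exists>s\<in>carrier G0. B1 #>\<^bsub>G1\<^esub> x = B1 #>\<^bsub>G1\<^esub> (d0 s \<otimes>\<^bsub>G1\<^esub> y))"
    using hom_mult[OF rcos_hom _ assms(2)] hom_in_carrier[OF d0] by (metis (no_types, lifting))
  also have "\<dots> \<longleftrightarrow> (\<exists>s\<in>carrier G0. x \<in> B1 #>\<^bsub>G1\<^esub> (d0 s \<otimes>\<^bsub>G1\<^esub> y))"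
    using G1.repr_independence[OF _ _ B1] G1.rcos_self[OF assms(1) B1] G1.m_closed[OF _ assms(2)]
      hom_in_carrier[OF d0] by metis
  also have "\<dots> \<longleftrightarrow> (\<exists>s\<in>carrier G0. \<exists>b\<in>B1. x = b \<otimes>\<^bsub>G1\<^esub> (d0 s \<otimes>\<^bsub>G1\<^esub> y))"
    by (simp add: r_coset_def)
  finally show ?thesis .
qed

end

text \<open>\<open>coset_map_rcos\<close> is applied once for each of the two quotients. For the
  outer one F must send coboundaries to coboundaries, which is what \<open>F0\<close> provides; no
  chain map in the neighbouring degree has to be named.\<close>

lemma coset_map_cls:
  assumes "quotient_cohomology G0 G1 G2 B0 B1 B2 d0 d1"
    and "quotient_cohomology G0' G1' G2' B0' B1' B2' d0' d1'"
    and F: "F \<in> hom G1 G1'" "F ` B1 \<subseteq> B1'"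
    and F0: "\<And>s. s \<in> carrier G0 \<Longrightarrow> \<exists>s'\<in>carrier G0'. F (d0 s) = d0' s'"
    and x: "x \<in> carrier G1"
  shows "coset_map (G1' Mod B1') (coset_map G1' B1' d0' ` carrier (G0' Mod B0'))
      (coset_map G1' B1' F) (quotient_cohomology.cls G0 G1 B0 B1 d0 x)
    = quotient_cohomology.cls G0' G1' B0' B1' d0' (F x)"
proof -
  interpret c: quotient_cohomology G0 G1 G2 B0 B1 B2 d0 d1 by (rule assms(1))
  interpret c': quotient_cohomology G0' G1' G2' B0' B1' B2' d0' d1' by (rule assms(2))
  have F': "coset_map G1' B1' F (B1 #>\<^bsub>G1\<^esub> y) = B1' #>\<^bsub>G1'\<^esub> F y" if "y \<in> carrier G1" for y
    by (rule coset_map_rcos[OF c.G1.is_group c.B1 c'.G1.is_group c'.B1 F that])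
  have "coset_map G1' B1' F \<in> hom (G1 Mod B1) (G1' Mod B1')"
  proof (rule homI)
    show "coset_map G1' B1' F q \<in> carrier (G1' Mod B1')" if "q \<in> carrier (G1 Mod B1)" for q
      using that F' hom_in_carrier[OF F(1)] by (auto simp: carrier_FactGroup)
    fix q r assume "q \<in> carrier (G1 Mod B1)" "r \<in> carrier (G1 Mod B1)"
    then obtain y z where yz: "y \<in> carrier G1" "z \<in> carrier G1" "q = B1 #>\<^bsub>G1\<^esub> y" "r = B1 #>\<^bsub>G1\<^esub> z"
      by (auto simp: carrier_FactGroup)
    show "coset_map G1' B1' F (q \<otimes>\<^bsub>G1 Mod B1\<^esub> r)
        = coset_map G1' B1' F q \<otimes>\<^bsub>G1' Mod B1'\<^esub> coset_map G1' B1' F r"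
      unfolding yz(3,4) hom_mult[OF c.rcos_hom yz(1,2), symmetric] F'[OF yz(1)] F'[OF yz(2)]
        F'[OF c.G1.m_closed[OF yz(1,2)]] hom_mult[OF F(1) yz(1,2)]
      using hom_mult[OF c'.rcos_hom] hom_in_carrier[OF F(1)] yz by simp
  qed
  moreover have "coset_map G1' B1' F ` c.coboundaries \<subseteq> c'.coboundaries"
  proof -
    have "B1' #>\<^bsub>G1'\<^esub> F (d0 s) \<in> c'.coboundaries" if "s \<in> carrier G0" for s
      using F0[OF that] unfolding c'.coboundaries_eq by auto
    then show ?thesis
      using F' hom_in_carrier[OF c.d0] by (auto simp: c.coboundaries_eq)
  qed
  ultimately show ?thesis
    unfolding c.cls_def c'.cls_def c'.coboundaries_def[symmetric]
    using coset_map_rcos[OF c.Q.is_group c.coboundaries_subgroup c'.Q.is_group c'.coboundaries_subgroup,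
        of "coset_map G1' B1' F" "B1 #>\<^bsub>G1\<^esub> x"] F'[OF x] x
    by (simp add: carrier_FactGroup)
qed

section \<open>Sequential colimits computed on representatives\<close>

lemma UN_pair_const:
  assumes "(i, x) \<in> p" "\<And>j y. (j, y) \<in> p \<Longrightarrow> f j y = c"
  shows "(\<Union>(j, y)\<in>p. f j y) = c"
proof -
  have "(\<Union>(j, y)\<in>p. f j y) = (\<Union>q\<in>p. c)" using assms(2) by (intro SUP_cong refl) auto
  then show ?thesis using assms(1) by auto
qed

locale direct_system =
  fixes i0 :: nat and G :: "nat \<Rightarrow> 'a monoid" and t :: "nat \<Rightarrow> 'a \<Rightarrow> 'a"
  assumes group: "i0 \<le> i \<Longrightarrow> group (G i)"
    and step: "i0 \<le> i \<Longrightarrow> t i \<in> hom (G i) (G (Suc i))"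
begin

abbreviation cl :: "nat \<Rightarrow> 'a \<Rightarrow> (nat \<times> 'a) set" where
  "cl i x \<equiv> colim_rel i0 G t `` {(i, x)}"

lemma mult_closed:
  "i0 \<le> i \<Longrightarrow> x \<in> carrier (G i) \<Longrightarrow> y \<in> carrier (G i) \<Longrightarrow> x \<otimes>\<^bsub>G i\<^esub> y \<in> carrier (G i)"
  using monoid.m_closed[OF group.is_monoid[OF group]] .

lemma transition_closed:
  "i0 \<le> i \<Longrightarrow> x \<in> carrier (G i) \<Longrightarrow> transition t i k x \<in> carrier (G (i + k))"
  by (induction k) (use hom_in_carrier[OF step] in auto)

lemma transition_mult:
  "i0 \<le> i \<Longrightarrow> x \<in> carrier (G i) \<Longrightarrow> y \<in> carrier (G i) \<Longrightarrow>
    transition t i k (x \<otimes>\<^bsub>G i\<^esub> y) = transition t i k x \<otimes>\<^bsub>G (i + k)\<^esub> transition t i k y"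
  by (induction k) (use hom_mult[OF step] transition_closed in auto)

lemma transition_add: "transition t i (k + l) x = transition t (i + k) l (transition t i k x)"
  by (induction l) (auto simp: add.assoc)

lemma transition_le:
  "i \<le> j \<Longrightarrow> j \<le> k \<Longrightarrow> transition t j (k - j) (transition t i (j - i) x) = transition t i (k - i) x"
  using transition_add[of i "j - i" "k - j" x] by simp

lemma equiv_colim_rel: "equiv {(i, x). i0 \<le> i \<and> x \<in> carrier (G i)} (colim_rel i0 G t)"
proof (rule equivI)
  show "colim_rel i0 G t \<subseteq> {(i, x). i0 \<le> i \<and> x \<in> carrier (G i)} \<times> {(i, x). i0 \<le> i \<and> x \<in> carrier (G i)}"
    by (auto simp: colim_rel_def)
  show "refl_on {(i, x). i0 \<le> i \<and> x \<in> carrier (G i)} (colim_rel i0 G t)"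
    by (auto simp: refl_on_def colim_rel_def)
  show "sym (colim_rel i0 G t)"
  proof (rule symI)
    fix p q assume pq: "(p, q) \<in> colim_rel i0 G t"
    obtain i x j y where [simp]: "p = (i, x)" "q = (j, y)" by (cases p; cases q)
    obtain k where "i \<le> k" "j \<le> k" "transition t i (k - i) x = transition t j (k - j) y"
      using pq by (auto simp: colim_rel_def)
    then show "(q, p) \<in> colim_rel i0 G t"
      using pq by (auto simp: colim_rel_def intro!: exI[of _ k])
  qed
  show "trans (colim_rel i0 G t)"
  proof (rule transI)
    fix p q r assume pq: "(p, q) \<in> colim_rel i0 G t" "(q, r) \<in> colim_rel i0 G t"
    obtain i x j y l z where [simp]: "p = (i, x)" "q = (j, y)" "r = (l, z)"
      by (cases p; cases q; cases r)
    obtain k m where k: "i \<le> k" "j \<le> k" "transition t i (k - i) x = transition t j (k - j) y"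
      and m: "j \<le> m" "l \<le> m" "transition t j (m - j) y = transition t l (m - l) z"
      using pq by (auto simp: colim_rel_def)
    let ?M = "max k m"
    have "transition t i (?M - i) x = transition t l (?M - l) z"
      using transition_le[OF k(1), of ?M x] transition_le[OF k(2), of ?M y]
        transition_le[OF m(1), of ?M y] transition_le[OF m(2), of ?M z] k(3) m(3) by simp
    then show "(p, r) \<in> colim_rel i0 G t"
      using pq k m unfolding colim_rel_def by (auto intro!: exI[of _ ?M])
  qed
qed

lemma class_eq_iff:
  assumes "i0 \<le> i" "x \<in> carrier (G i)" "i0 \<le> j" "y \<in> carrier (G j)"
  shows "cl i x = cl j y \<longleftrightarrow>
    (\<exists>k. i \<le> k \<and> j \<le> k \<and> transition t i (k - i) x = transition t j (k - j) y)"
  using eq_equiv_class_iff[OF equiv_colim_rel, of "(i, x)" "(j, y)"] assms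
  by (simp add: colim_rel_def)

lemma class_transition:
  assumes "i0 \<le> i" "x \<in> carrier (G i)"
  shows "cl i x = cl (i + k) (transition t i k x)"
  using assms transition_closed[OF assms, of k]
  by (subst class_eq_iff) (auto intro!: exI[of _ "i + k"])

lemma carrier_seq_colim: "carrier (seq_colim i0 G t) = {cl i x |i x. i0 \<le> i \<and> x \<in> carrier (G i)}"
  by (auto simp: seq_colim_def quotient_def)

lemma class_self: "i0 \<le> i \<Longrightarrow> x \<in> carrier (G i) \<Longrightarrow> (i, x) \<in> cl i x"
  by (auto simp: colim_rel_def)

lemma class_mem:
  assumes "(j, y) \<in> cl i x"
  shows "i0 \<le> j" "y \<in> carrier (G j)" "cl j y = cl i x"
  using assms equiv_class_eq[OF equiv_colim_rel, of "(i, x)" "(j, y)"] by (auto simp: colim_rel_def)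

text \<open>The product is a union over all pairs of representatives, at arbitrary levels. Once both
  representatives have merged with transitions of x and y, the homomorphism property turns each of
  these products into a transition of the product of x and y.\<close>

lemma class_mult:
  assumes i: "i0 \<le> i" "x \<in> carrier (G i)" "y \<in> carrier (G i)"
  shows "cl i x \<otimes>\<^bsub>seq_colim i0 G t\<^esub> cl i y = cl i (x \<otimes>\<^bsub>G i\<^esub> y)"
proof -
  let ?f = "\<lambda>j x' l y'. let k = max j l in
    cl k (transition t j (k - j) x' \<otimes>\<^bsub>G k\<^esub> transition t l (k - l) y')"
  have "?f j x' l y' = cl i (x \<otimes>\<^bsub>G i\<^esub> y)" if p: "(j, x') \<in> cl i x" and q: "(l, y') \<in> cl i y" for j x' l y'
  proof -
    obtain m where m: "i \<le> m" "j \<le> m" "transition t i (m - i) x = transition t j (m - j) x'" and j: "i0 \<le> j" "x' \<in> carrier (G j)"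
      using p by (auto simp: colim_rel_def)
    obtain n where n: "i \<le> n" "l \<le> n" "transition t i (n - i) y = transition t l (n - l) y'" and l: "i0 \<le> l" "y' \<in> carrier (G l)"
      using q by (auto simp: colim_rel_def)
    \<comment> \<open>At level \<open>M\<close> both representatives have merged with x and y, and
      \<open>M\<close> also lies above the level \<open>k\<close> at which their product is
      formed.\<close>
    define M where "M = max m n"
    define k where "k = max j l"
    have M: "m \<le> M" "n \<le> M" "k \<le> M" "i \<le> M" and k: "j \<le> k" "l \<le> k" "i0 \<le> k"
      using m n j by (auto simp: M_def k_def)
    have c: "transition t j (k - j) x' \<in> carrier (G k)" "transition t l (k - l) y' \<in> carrier (G k)"
      using transition_closed[OF j, of "k - j"] transition_closed[OF l, of "k - l"] k by simp_all
    have "transition t k (M - k) (transition t j (k - j) x' \<otimes>\<^bsub>G k\<^esub> transition t l (k - l) y')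
        = transition t j (M - j) x' \<otimes>\<^bsub>G M\<^esub> transition t l (M - l) y'"
      using transition_mult[OF k(3) c, of "M - k"] M k transition_le by simp
    also have "transition t j (M - j) x' = transition t i (M - i) x"
      using transition_le[OF m(1) M(1), of x] transition_le[OF m(2) M(1), of x'] m(3) by simp
    also have "transition t l (M - l) y' = transition t i (M - i) y"
      using transition_le[OF n(1) M(2), of y] transition_le[OF n(2) M(2), of y'] n(3) by simp
    also have "transition t i (M - i) x \<otimes>\<^bsub>G M\<^esub> transition t i (M - i) y
        = transition t i (M - i) (x \<otimes>\<^bsub>G i\<^esub> y)"
      using transition_mult[OF i, of "M - i"] M by simp
    finally have e: "transition t k (M - k) (transition t j (k - j) x' \<otimes>\<^bsub>G k\<^esub> transition t l (k - l) y')
        = transition t i (M - i) (x \<otimes>\<^bsub>G i\<^esub> y)" .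
    have "cl k (transition t j (k - j) x' \<otimes>\<^bsub>G k\<^esub> transition t l (k - l) y') = cl i (x \<otimes>\<^bsub>G i\<^esub> y)"
      using e M k i c mult_closed[OF k(3) c] mult_closed[OF i]
      by (subst class_eq_iff) (auto intro!: exI[of _ M])
    then show ?thesis by (simp add: Let_def k_def)
  qed
  then have "(\<Union>(j, x')\<in>cl i x. \<Union>(l, y')\<in>cl i y. ?f j x' l y') = cl i (x \<otimes>\<^bsub>G i\<^esub> y)"
    by (intro UN_pair_const[OF class_self[OF i(1,2)]] UN_pair_const[OF class_self[OF i(1,3)]])
  then show ?thesis by (simp add: seq_colim_def)
qed

lemma seq_colim_map_class:
  assumes "direct_system i0 G' t'"
    and u: "\<And>i x. i0 \<le> i \<Longrightarrow> x \<in> carrier (G i) \<Longrightarrow> u i x \<in> carrier (G' i)"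
    and ut: "\<And>i x. i0 \<le> i \<Longrightarrow> x \<in> carrier (G i) \<Longrightarrow> u (Suc i) (t i x) = t' i (u i x)"
    and i: "i0 \<le> i" "x \<in> carrier (G i)"
  shows "seq_colim_map i0 G' t' u (cl i x) = colim_rel i0 G' t' `` {(i, u i x)}"
proof -
  interpret d: direct_system i0 G' t' by (rule assms(1))
  have tr: "u (i + k) (transition t i k x) = transition t' i k (u i x)"
    if "i0 \<le> i" "x \<in> carrier (G i)" for i k x
    by (induction k) (use that ut transition_closed in auto)
  have "d.cl j (u j y) = d.cl i (u i x)" if y: "(j, y) \<in> cl i x" for j y
  proof -
    obtain k where k: "i \<le> k" "j \<le> k" "transition t i (k - i) x = transition t j (k - j) y" and j: "i0 \<le> j" "y \<in> carrier (G j)"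
      using y by (auto simp: colim_rel_def)
    then have "transition t' i (k - i) (u i x) = transition t' j (k - j) (u j y)"
      using tr[OF i, of "k - i"] tr[OF j, of "k - j"] by simp
    then show ?thesis using u i j k by (subst d.class_eq_iff) (auto intro!: exI[of _ k])
  qed
  then show ?thesis
    unfolding seq_colim_map_def by (intro UN_pair_const[OF class_self[OF i]])
qed

end

text \<open>Agreement is demanded only on elements of the groups, because transition maps built from
  \<open>THE\<close> and \<open>the_elem\<close> are not controlled elsewhere. This form is needed
  to compare a direct system with its dual.\<close>

lemma seq_colim_cong:
  assumes "direct_system i0 G t" and "\<And>i x. i0 \<le> i \<Longrightarrow> x \<in> carrier (G i) \<Longrightarrow> t' i x = t i x"
  shows "direct_system i0 G t'" and "colim_rel i0 G t' = colim_rel i0 G t"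
proof -
  interpret direct_system i0 G t by (rule assms(1))
  show "direct_system i0 G t'"
  proof (rule direct_system.intro)
    show "t' i \<in> hom (G i) (G (Suc i))" if "i0 \<le> i" for i
      using step[OF that] assms(2)[OF that] mult_closed[OF that]
      by (auto simp: hom_def Pi_def)
  qed (use group in auto)
  have "transition t' i k x = transition t i k x" if "i0 \<le> i" "x \<in> carrier (G i)" for i k x
    by (induction k) (use that transition_closed assms(2) in auto)
  then show "colim_rel i0 G t' = colim_rel i0 G t"
    by (auto simp: colim_rel_def)
qed

section \<open>Stable cohomology\<close>

text \<open>The sign (-1)^n for an arbitrary integer n; depending on parity alone, it avoids powers
  with negative exponents.\<close>

definition koszul :: "('o, 'm) addcat \<Rightarrow> int \<Rightarrow> 'm \<Rightarrow> 'm" where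
  "koszul A n f = (if even n then f else Neg A f)"

definition stable_cocycle ::
  "('o, 'm) addcat \<Rightarrow> ('o, 'm, 'z) cochain_scheme \<Rightarrow> ('o, 'm, 'z) cochain_scheme \<Rightarrow> int \<Rightarrow> (int \<Rightarrow> 'm) set" where
  "stable_cocycle A X Y n = {\<alpha> \<in> carrier (hom_cx A X Y n).
     finite {i. Compose A (cdiff Y (n + i)) (\<alpha> i) \<noteq> koszul A n (Compose A (\<alpha> (i + 1)) (cdiff X i))}}"

definition stable_class ::
  "('o, 'm) addcat \<Rightarrow> ('o, 'm, 'z) cochain_scheme \<Rightarrow> ('o, 'm, 'z) cochain_scheme \<Rightarrow> int \<Rightarrow> (int \<Rightarrow> 'm) \<Rightarrow> (int \<Rightarrow> 'm) set set" where
  "stable_class A X Y n = quotient_cohomology.cls (hom_cx A X Y (n - 1)) (hom_cx A X Y n)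
    (carrier (bounded_hom_cx A X Y (n - 1))) (carrier (bounded_hom_cx A X Y n)) (hom_diff A X Y (n - 1))"

context abelian_category
begin

lemma koszul_arrow [simp]:
  "f \<in> Ar A \<Longrightarrow> koszul A n f \<in> Ar A" "f \<in> Ar A \<Longrightarrow> Src A (koszul A n f) = Src A f"
  "f \<in> Ar A \<Longrightarrow> Tgt A (koszul A n f) = Tgt A f"
  by (simp_all add: koszul_def)

lemma koszul_mor: "f \<in> mor A X Y \<Longrightarrow> koszul A n f \<in> mor A X Y"
  by (simp add: mor_def)

lemma koszul_plus:
  "f \<in> Ar A \<Longrightarrow> g \<in> Ar A \<Longrightarrow> Src A g = Src A f \<Longrightarrow> Tgt A g = Tgt A f \<Longrightarrow>
    koszul A n (Plus A f g) = Plus A (koszul A n f) (koszul A n g)"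
  by (simp add: koszul_def)

lemma koszul_zero [simp]: "X \<in> Ob A \<Longrightarrow> Y \<in> Ob A \<Longrightarrow> koszul A n (Zero A X Y) = Zero A X Y"
  by (simp add: koszul_def)

lemma koszul_comp:
  assumes "f \<in> Ar A" "g \<in> Ar A" "Tgt A f = Src A g"
  shows "g \<cdot> koszul A n f = koszul A n (g \<cdot> f)" "koszul A n g \<cdot> f = koszul A n (g \<cdot> f)"
  using assms by (simp_all add: koszul_def)

lemma koszul_koszul: "f \<in> Ar A \<Longrightarrow> koszul A m (koszul A n f) = koszul A (m + n) f"
  by (auto simp: koszul_def)

lemma koszul_twice: "f \<in> Ar A \<Longrightarrow> koszul A m (koszul A m f) = f"
  by (simp add: koszul_def)

lemma koszul_cong: "even m = even n \<Longrightarrow> koszul A m f = koszul A n f"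
  by (simp add: koszul_def)

text \<open>The sign -(-1)^n of the second term is (-1)^(n+1), so the case distinction in the
  differential disappears into \<open>koszul\<close>.\<close>

lemma hom_diff_koszul:
  "hom_diff A X Y n \<alpha> i = Plus A (cdiff Y (n + i) \<cdot> \<alpha> i) (koszul A (n + 1) (\<alpha> (i + 1) \<cdot> cdiff X i))"
  by (auto simp: hom_diff_def koszul_def)

lemma complexD:
  assumes "cochain_complex A X"
  shows "cobj X i \<in> Ob A" "cdiff X i \<in> mor A (cobj X i) (cobj X (i + 1))"
    "j = i + 1 \<Longrightarrow> cdiff X j \<cdot> cdiff X i = Zero A (cobj X i) (cobj X (j + 1))"
  using assms by (simp_all add: cochain_complex_def add.commute[of "2::int"])

lemma complex_cdiff_simps:
  assumes "cochain_complex A X"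
  shows "cdiff X i \<in> Ar A" "Src A (cdiff X i) = cobj X i" "Tgt A (cdiff X i) = cobj X (i + 1)"
  using complexD(2)[OF assms, of i] by (auto simp: mor_def)

lemma complex_zero_comp:
  assumes "cochain_complex A X" "j = i + 1"
  shows "f \<in> mor A Z (cobj X i) \<Longrightarrow> cdiff X j \<cdot> cdiff X i \<cdot> f = Zero A Z (cobj X (j + 1))"
    "g \<in> mor A (cobj X (j + 1)) Z \<Longrightarrow> g \<cdot> cdiff X j \<cdot> cdiff X i = Zero A (cobj X i) Z"
proof -
  note c = complexD[OF assms(1)]
  note s = complex_cdiff_simps[OF assms(1)]
  show "cdiff X j \<cdot> cdiff X i \<cdot> f = Zero A Z (cobj X (j + 1))" if f: "f \<in> mor A Z (cobj X i)"
  proof -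
    have "cdiff X j \<cdot> cdiff X i \<cdot> f = (cdiff X j \<cdot> cdiff X i) \<cdot> f"
      using f s assms(2) by (auto simp: mor_def)
    then show ?thesis unfolding c(3)[OF assms(2)] using f c(1) by (auto simp: mor_def)
  qed
  show "g \<cdot> cdiff X j \<cdot> cdiff X i = Zero A (cobj X i) Z" if g: "g \<in> mor A (cobj X (j + 1)) Z"
    unfolding c(3)[OF assms(2)] using g c(1) by (auto simp: mor_def)
qed

lemma carrier_hom_cx:
  "\<alpha> \<in> carrier (hom_cx A X Y n) \<longleftrightarrow> (\<forall>i. \<alpha> i \<in> mor A (cobj X i) (cobj Y (n + i)))"
  by (simp add: hom_cx_def PiE_iff)

lemma mult_hom_cx: "\<alpha> \<otimes>\<^bsub>hom_cx A X Y n\<^esub> \<beta> = (\<lambda>i. Plus A (\<alpha> i) (\<beta> i))"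
  by (simp add: hom_cx_def restrict_def)

lemma Hom_group: "X \<in> Ob A \<Longrightarrow> Y \<in> Ob A \<Longrightarrow> group (Hom A X Y)"
  by (rule comm_group.axioms(2)[OF hom_group])

lemma comm_group_hom_cx:
  assumes "cochain_complex A X" "cochain_complex A Y"
  shows "comm_group (hom_cx A X Y n)"
proof -
  have "group (hom_cx A X Y n)"
    unfolding hom_cx_def using complexD(1)[OF assms(1)] complexD(1)[OF assms(2)]
    by (intro product_group Hom_group)
  then show ?thesis
  proof (rule group.group_comm_groupI)
    fix \<alpha> \<beta> assume "\<alpha> \<in> carrier (hom_cx A X Y n)" "\<beta> \<in> carrier (hom_cx A X Y n)"
    then show "\<alpha> \<otimes>\<^bsub>hom_cx A X Y n\<^esub> \<beta> = \<beta> \<otimes>\<^bsub>hom_cx A X Y n\<^esub> \<alpha>"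
      unfolding carrier_hom_cx mult_hom_cx by (intro ext plus_commute) (simp_all add: mor_def)
  qed
qed

lemma carrier_bounded_hom_cx:
  assumes "cochain_complex A X" "cochain_complex A Y"
  shows "\<alpha> \<in> carrier (bounded_hom_cx A X Y n) \<longleftrightarrow>
    \<alpha> \<in> carrier (hom_cx A X Y n) \<and> finite {i. \<alpha> i \<noteq> Zero A (cobj X i) (cobj Y (n + i))}"
proof -
  have g: "\<And>i. group (Hom A (cobj X i) (cobj Y (n + i)))"
    using complexD(1)[OF assms(1)] complexD(1)[OF assms(2)] by (intro Hom_group)
  show ?thesis unfolding bounded_hom_cx_def carrier_sum_group[OF g] by (simp add: hom_cx_def PiE_iff)
qed

lemma subgroup_bounded_hom_cx:
  assumes "cochain_complex A X" "cochain_complex A Y"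
  shows "subgroup (carrier (bounded_hom_cx A X Y n)) (hom_cx A X Y n)"
proof -
  have g: "\<And>i. group (Hom A (cobj X i) (cobj Y (n + i)))"
    using complexD(1)[OF assms(1)] complexD(1)[OF assms(2)] by (intro Hom_group)
  show ?thesis
    unfolding bounded_hom_cx_def hom_cx_def carrier_sum_group[OF g] by (rule subgroup_sum_group[OF g])
qed

lemma hom_diff_carrier:
  assumes X: "cochain_complex A X" and Y: "cochain_complex A Y"
    and \<alpha>: "\<alpha> \<in> carrier (hom_cx A X Y n)" and m: "m = n + 1"
  shows "hom_diff A X Y n \<alpha> \<in> carrier (hom_cx A X Y m)"
proof -
  have a: "\<alpha> i \<in> Ar A" "Src A (\<alpha> i) = cobj X i" "Tgt A (\<alpha> i) = cobj Y (n + i)" for i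
    using \<alpha> by (auto simp: carrier_hom_cx mor_def)
  show ?thesis
    unfolding carrier_hom_cx hom_diff_koszul
    by (auto simp: a mor_def complex_cdiff_simps[OF X] complex_cdiff_simps[OF Y] m add_ac)
qed

lemma hom_diff_hom:
  assumes X: "cochain_complex A X" and Y: "cochain_complex A Y" and m: "m = n + 1"
  shows "hom_diff A X Y n \<in> hom (hom_cx A X Y n) (hom_cx A X Y m)"
proof (rule homI)
  show "hom_diff A X Y n \<alpha> \<in> carrier (hom_cx A X Y m)" if "\<alpha> \<in> carrier (hom_cx A X Y n)" for \<alpha>
    by (rule hom_diff_carrier[OF X Y that m])
  fix \<alpha> \<beta> assume ab: "\<alpha> \<in> carrier (hom_cx A X Y n)" "\<beta> \<in> carrier (hom_cx A X Y n)"
  have a: "\<alpha> i \<in> Ar A" "Src A (\<alpha> i) = cobj X i" "Tgt A (\<alpha> i) = cobj Y (n + i)"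
    "\<beta> i \<in> Ar A" "Src A (\<beta> i) = cobj X i" "Tgt A (\<beta> i) = cobj Y (n + i)" for i
    using ab by (auto simp: carrier_hom_cx mor_def)
  show "hom_diff A X Y n (\<alpha> \<otimes>\<^bsub>hom_cx A X Y n\<^esub> \<beta>)
      = hom_diff A X Y n \<alpha> \<otimes>\<^bsub>hom_cx A X Y m\<^esub> hom_diff A X Y n \<beta>"
    unfolding mult_hom_cx hom_diff_koszul
    by (rule ext) (simp add: a complex_cdiff_simps[OF X] complex_cdiff_simps[OF Y] koszul_plus add_ac
        plus_left_commute)
qed

lemma hom_diff_bounded:
  assumes X: "cochain_complex A X" and Y: "cochain_complex A Y"
    and \<alpha>: "\<alpha> \<in> carrier (bounded_hom_cx A X Y n)" and m: "m = n + 1"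
  shows "hom_diff A X Y n \<alpha> \<in> carrier (bounded_hom_cx A X Y m)"
proof -
  have \<alpha>': "\<alpha> \<in> carrier (hom_cx A X Y n)" and fin: "finite {i. \<alpha> i \<noteq> Zero A (cobj X i) (cobj Y (n + i))}"
    using \<alpha> by (auto simp: carrier_bounded_hom_cx[OF X Y])
  let ?S = "{i. \<alpha> i \<noteq> Zero A (cobj X i) (cobj Y (n + i))}"
  \<comment> \<open>Component i of the differential involves \<open>\<alpha>\<close> only in degrees
    i and i + 1, so the support grows at most by its shift by one.\<close>
  have "hom_diff A X Y n \<alpha> i = Zero A (cobj X i) (cobj Y (m + i))" if "i \<notin> ?S \<union> (\<lambda>i. i - 1) ` ?S" for i
  proof -
    have z: "\<alpha> i = Zero A (cobj X i) (cobj Y (n + i))"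
      "\<alpha> (i + 1) = Zero A (cobj X (i + 1)) (cobj Y (n + (i + 1)))"
      using that by (auto simp: image_iff Bex_def)
    show ?thesis
      unfolding hom_diff_koszul z m using complexD(1)[OF X] complexD(1)[OF Y]
      by (simp add: complex_cdiff_simps[OF X] complex_cdiff_simps[OF Y] add_ac)
  qed
  then have "{i. hom_diff A X Y n \<alpha> i \<noteq> Zero A (cobj X i) (cobj Y (m + i))} \<subseteq> ?S \<union> (\<lambda>i. i - 1) ` ?S"
    by blast
  then have "finite {i. hom_diff A X Y n \<alpha> i \<noteq> Zero A (cobj X i) (cobj Y (m + i))}"
    using fin finite_subset by blast
  then show ?thesis
    using hom_diff_carrier[OF X Y \<alpha>' m] by (simp add: carrier_bounded_hom_cx[OF X Y])
qed

text \<open>The outer terms contain two consecutive differentials. The mixed term occurs twice, with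
  signs (-1)^(n+1) and (-1)^(n+2), and cancels.\<close>

lemma hom_diff_hom_diff:
  assumes X: "cochain_complex A X" and Y: "cochain_complex A Y"
    and \<alpha>: "\<alpha> \<in> carrier (hom_cx A X Y n)" and m: "m = n + 1"
  shows "hom_diff A X Y m (hom_diff A X Y n \<alpha>) i = Zero A (cobj X i) (cobj Y (m + 1 + i))"
proof -
  have a: "\<alpha> i \<in> mor A (cobj X i) (cobj Y (n + i))" for i using \<alpha> by (simp add: carrier_hom_cx)
  have a': "\<alpha> i \<in> Ar A" "Src A (\<alpha> i) = cobj X i" "Tgt A (\<alpha> i) = cobj Y (n + i)" for i
    using a[of i] by (auto simp: mor_def)
  let ?t = "cdiff Y (n + (i + 1)) \<cdot> \<alpha> (i + 1) \<cdot> cdiff X i"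
  have t: "?t \<in> mor A (cobj X i) (cobj Y (n + i + 2))"
    by (auto simp: mor_def a' complex_cdiff_simps[OF X] complex_cdiff_simps[OF Y] add_ac)
  have z1: "cdiff Y (m + i) \<cdot> cdiff Y (n + i) \<cdot> \<alpha> i = Zero A (cobj X i) (cobj Y (m + i + 1))"
    by (rule complex_zero_comp(1)[OF Y _ a]) (simp add: m)
  have z2: "\<alpha> (i + 1 + 1) \<cdot> cdiff X (i + 1) \<cdot> cdiff X i = Zero A (cobj X i) (cobj Y (n + (i + 1 + 1)))"
    by (rule complex_zero_comp(2)[OF X _ a]) simp
  have "hom_diff A X Y m (hom_diff A X Y n \<alpha>) i =
    Plus A (Plus A (cdiff Y (m + i) \<cdot> cdiff Y (n + i) \<cdot> \<alpha> i) (koszul A (n + 1) ?t))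
      (Plus A (koszul A (m + 1) ?t) (koszul A (m + 1 + (n + 1)) (\<alpha> (i + 1 + 1) \<cdot> cdiff X (i + 1) \<cdot> cdiff X i)))"
    unfolding hom_diff_koszul
    by (simp add: a' m complex_cdiff_simps[OF X] complex_cdiff_simps[OF Y] koszul_plus koszul_comp
        koszul_koszul add_ac)
  also have "\<dots> = Plus A (koszul A (n + 1) ?t) (koszul A (m + 1) ?t)"
    unfolding z1 z2 using t complexD(1)[OF X] complexD(1)[OF Y] by (auto simp: m mor_def add_ac)
  also have "\<dots> = Zero A (cobj X i) (cobj Y (m + 1 + i))"
    using t by (auto simp: m koszul_def mor_def add_ac)
  finally show ?thesis .
qed

lemma quotient_cohomology_hom_cx:
  assumes X: "cochain_complex A X" and Y: "cochain_complex A Y"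
  shows "quotient_cohomology (hom_cx A X Y (n - 1)) (hom_cx A X Y n) (hom_cx A X Y (n + 1))
    (carrier (bounded_hom_cx A X Y (n - 1))) (carrier (bounded_hom_cx A X Y n))
    (carrier (bounded_hom_cx A X Y (n + 1))) (hom_diff A X Y (n - 1)) (hom_diff A X Y n)"
proof (intro quotient_cohomology.intro quotient_cohomology_axioms.intro comm_group_hom_cx X Y
    subgroup_bounded_hom_cx hom_diff_hom)
  show "hom_diff A X Y n (hom_diff A X Y (n - 1) \<alpha>) \<in> carrier (bounded_hom_cx A X Y (n + 1))"
    if "\<alpha> \<in> carrier (hom_cx A X Y (n - 1))" for \<alpha>
    using hom_diff_hom_diff[OF X Y that] hom_diff_carrier[OF X Y hom_diff_carrier[OF X Y that]]
    by (simp add: carrier_bounded_hom_cx[OF X Y])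
qed (use hom_diff_bounded[OF X Y, of _ "n - 1" n] hom_diff_bounded[OF X Y, of _ n "n + 1"] in auto)

lemma hom_diff_eq_zero_iff:
  assumes X: "cochain_complex A X" and Y: "cochain_complex A Y" and \<alpha>: "\<alpha> \<in> carrier (hom_cx A X Y n)"
  shows "hom_diff A X Y n \<alpha> i = Zero A (cobj X i) (cobj Y (n + 1 + i)) \<longleftrightarrow>
    cdiff Y (n + i) \<cdot> \<alpha> i = koszul A n (\<alpha> (i + 1) \<cdot> cdiff X i)"
proof -
  have a: "\<alpha> i \<in> Ar A" "Src A (\<alpha> i) = cobj X i" "Tgt A (\<alpha> i) = cobj Y (n + i)" for i
    using \<alpha> by (auto simp: carrier_hom_cx mor_def)
  let ?x = "cdiff Y (n + i) \<cdot> \<alpha> i" and ?y = "\<alpha> (i + 1) \<cdot> cdiff X i"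
  have m: "?x \<in> Ar A" "?y \<in> Ar A" "Src A ?x = cobj X i" "Src A ?y = cobj X i"
    "Tgt A ?x = cobj Y (n + 1 + i)" "Tgt A ?y = cobj Y (n + 1 + i)"
    by (simp_all add: a complex_cdiff_simps[OF X] complex_cdiff_simps[OF Y] add_ac)
  have "koszul A (n + 1) ?y = Neg A (koszul A n ?y)" using m by (simp add: koszul_def)
  then have "hom_diff A X Y n \<alpha> i = Minus A ?x (koszul A n ?y)" by (simp add: hom_diff_koszul Minus_def)
  then show ?thesis
    using minus_eq_iff[of ?x "koszul A n ?y" "Zero A (cobj X i) (cobj Y (n + 1 + i))"] m
      complexD(1)[OF X] complexD(1)[OF Y] by simp
qed

text \<open>The interface to the double quotient: from here on only families of arrows appear, and
  equality of classes means being homotopic in all but finitely many degrees.\<close>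

lemma stable_Ext_facts:
  assumes X: "cochain_complex A X" and Y: "cochain_complex A Y"
  shows "carrier (stable_Ext A X Y n) = stable_class A X Y n ` stable_cocycle A X Y n"
    and "\<alpha> \<in> carrier (hom_cx A X Y n) \<Longrightarrow> \<beta> \<in> carrier (hom_cx A X Y n) \<Longrightarrow>
      stable_class A X Y n (\<lambda>i. Plus A (\<alpha> i) (\<beta> i)) = stable_class A X Y n \<alpha> \<otimes>\<^bsub>stable_Ext A X Y n\<^esub> stable_class A X Y n \<beta>"
    and "\<alpha> \<in> carrier (hom_cx A X Y n) \<Longrightarrow> \<beta> \<in> carrier (hom_cx A X Y n) \<Longrightarrow>
      stable_class A X Y n \<alpha> = stable_class A X Y n \<beta> \<longleftrightarrow>
      (\<exists>s\<in>carrier (hom_cx A X Y (n - 1)).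
         finite {i. \<alpha> i \<noteq> Plus A (hom_diff A X Y (n - 1) s i) (\<beta> i)})"
proof -
  interpret q: quotient_cohomology "hom_cx A X Y (n - 1)" "hom_cx A X Y n" "hom_cx A X Y (n + 1)"
    "carrier (bounded_hom_cx A X Y (n - 1))" "carrier (bounded_hom_cx A X Y n)"
    "carrier (bounded_hom_cx A X Y (n + 1))" "hom_diff A X Y (n - 1)" "hom_diff A X Y n"
    by (rule quotient_cohomology_hom_cx[OF X Y])
  have H: "stable_Ext A X Y n = q.cohomology"
    by (simp add: stable_Ext_def q.cohomology_def q.coboundaries_def stable_hom_cx_def stable_cocycles_def
        stable_coboundaries_def stable_hom_diff_def)
  have "q.cocycles = stable_cocycle A X Y n"
    using hom_diff_eq_zero_iff[OF X Y] hom_diff_carrier[OF X Y]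
    by (auto simp: q.cocycles_def stable_cocycle_def carrier_bounded_hom_cx[OF X Y])
  then show "carrier (stable_Ext A X Y n) = stable_class A X Y n ` stable_cocycle A X Y n"
    by (simp add: H q.carrier_cohomology stable_class_def)
  assume ab: "\<alpha> \<in> carrier (hom_cx A X Y n)" "\<beta> \<in> carrier (hom_cx A X Y n)"
  show "stable_class A X Y n (\<lambda>i. Plus A (\<alpha> i) (\<beta> i)) = stable_class A X Y n \<alpha> \<otimes>\<^bsub>stable_Ext A X Y n\<^esub> stable_class A X Y n \<beta>"
    using q.cls_mult[OF ab] by (simp add: H mult_hom_cx stable_class_def)
  have "(\<exists>b\<in>carrier (bounded_hom_cx A X Y n). \<alpha> = b \<otimes>\<^bsub>hom_cx A X Y n\<^esub> (d \<otimes>\<^bsub>hom_cx A X Y n\<^esub> \<beta>)) \<longleftrightarrow>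
      finite {i. \<alpha> i \<noteq> Plus A (d i) (\<beta> i)}" if d: "d \<in> carrier (hom_cx A X Y n)" for d
  proof -
    have m: "\<alpha> i \<in> mor A (cobj X i) (cobj Y (n + i))" "\<beta> i \<in> mor A (cobj X i) (cobj Y (n + i))"
      "d i \<in> mor A (cobj X i) (cobj Y (n + i))" for i
      using ab d by (simp_all add: carrier_hom_cx)
    have dm: "Plus A (d i) (\<beta> i) \<in> mor A (cobj X i) (cobj Y (n + i))" for i
      using m by (intro mor_simps)
    show ?thesis
    proof
      assume "\<exists>b\<in>carrier (bounded_hom_cx A X Y n). \<alpha> = b \<otimes>\<^bsub>hom_cx A X Y n\<^esub> (d \<otimes>\<^bsub>hom_cx A X Y n\<^esub> \<beta>)"
      then obtain b where b: "b \<in> carrier (hom_cx A X Y n)" "finite {i. b i \<noteq> Zero A (cobj X i) (cobj Y (n + i))}"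
        "\<alpha> = (\<lambda>i. Plus A (b i) (Plus A (d i) (\<beta> i)))"
        by (auto simp: carrier_bounded_hom_cx[OF X Y] mult_hom_cx)
      have "\<alpha> i = Plus A (d i) (\<beta> i)" if "b i = Zero A (cobj X i) (cobj Y (n + i))" for i
        unfolding b(3) that using dm[of i] by (simp add: mor_def)
      then have "{i. \<alpha> i \<noteq> Plus A (d i) (\<beta> i)} \<subseteq> {i. b i \<noteq> Zero A (cobj X i) (cobj Y (n + i))}" by blast
      then show "finite {i. \<alpha> i \<noteq> Plus A (d i) (\<beta> i)}" using b(2) finite_subset by blast
    next
      assume fin: "finite {i. \<alpha> i \<noteq> Plus A (d i) (\<beta> i)}"
      \<comment> \<open>The error term vanishes outside the finite exceptional set, so it lies in
        the bounded subcomplex.\<close>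
      define b where "b i = Minus A (\<alpha> i) (Plus A (d i) (\<beta> i))" for i
      have bm: "b i \<in> mor A (cobj X i) (cobj Y (n + i))" for i
        unfolding b_def using m(1) dm by (rule mor_simps)
      have "\<alpha> i = Plus A (b i) (Plus A (d i) (\<beta> i))" for i
        using minus_eq_iff[of "\<alpha> i" "Plus A (d i) (\<beta> i)" "b i"] m(1)[of i] dm[of i] bm[of i]
        by (simp add: b_def mor_def)
      then have "\<alpha> = b \<otimes>\<^bsub>hom_cx A X Y n\<^esub> (d \<otimes>\<^bsub>hom_cx A X Y n\<^esub> \<beta>)" by (simp add: mult_hom_cx fun_eq_iff)
      moreover have "b i = Zero A (cobj X i) (cobj Y (n + i))" if "\<alpha> i = Plus A (d i) (\<beta> i)" for i
        unfolding b_def that using dm[of i] by (auto simp: mor_def)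
      then have "{i. b i \<noteq> Zero A (cobj X i) (cobj Y (n + i))} \<subseteq> {i. \<alpha> i \<noteq> Plus A (d i) (\<beta> i)}" by blast
      then have "b \<in> carrier (bounded_hom_cx A X Y n)"
        using fin finite_subset bm by (auto simp: carrier_bounded_hom_cx[OF X Y] carrier_hom_cx)
      ultimately show "\<exists>b\<in>carrier (bounded_hom_cx A X Y n). \<alpha> = b \<otimes>\<^bsub>hom_cx A X Y n\<^esub> (d \<otimes>\<^bsub>hom_cx A X Y n\<^esub> \<beta>)"
        by blast
    qed
  qed
  moreover have "hom_diff A X Y (n - 1) s \<in> carrier (hom_cx A X Y n)" if "s \<in> carrier (hom_cx A X Y (n - 1))" for s
    using hom_diff_carrier[OF X Y that] by simp
  ultimately show "stable_class A X Y n \<alpha> = stable_class A X Y n \<beta> \<longleftrightarrow>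
      (\<exists>s\<in>carrier (hom_cx A X Y (n - 1)).
         finite {i. \<alpha> i \<noteq> Plus A (hom_diff A X Y (n - 1) s i) (\<beta> i)})"
    unfolding stable_class_def q.cls_eq_iff[OF ab] by (intro bex_cong refl) blast
qed

lemma stable_cocycle_plus:
  assumes P: "cochain_complex A P" and Q: "cochain_complex A Q"
    and \<alpha>: "\<alpha> \<in> stable_cocycle A P Q n" and \<beta>: "\<beta> \<in> stable_cocycle A P Q n"
  shows "(\<lambda>i. Plus A (\<alpha> i) (\<beta> i)) \<in> stable_cocycle A P Q n"
proof -
  note s = complex_cdiff_simps[OF P] complex_cdiff_simps[OF Q]
  have a: "\<alpha> i \<in> Ar A" "Src A (\<alpha> i) = cobj P i" "Tgt A (\<alpha> i) = cobj Q (n + i)"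
    "\<beta> i \<in> Ar A" "Src A (\<beta> i) = cobj P i" "Tgt A (\<beta> i) = cobj Q (n + i)" for i
    using \<alpha> \<beta> by (auto simp: stable_cocycle_def carrier_hom_cx mor_def)
  let ?N = "\<lambda>\<alpha>. {i. cdiff Q (n + i) \<cdot> \<alpha> i \<noteq> koszul A n (\<alpha> (i + 1) \<cdot> cdiff P i)}"
  have "cdiff Q (n + i) \<cdot> Plus A (\<alpha> i) (\<beta> i) = koszul A n (Plus A (\<alpha> (i + 1)) (\<beta> (i + 1)) \<cdot> cdiff P i)"
    if "i \<notin> ?N \<alpha> \<union> ?N \<beta>" for i
    using that by (simp add: a s koszul_plus)
  then have "?N (\<lambda>i. Plus A (\<alpha> i) (\<beta> i)) \<subseteq> ?N \<alpha> \<union> ?N \<beta>" by blast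
  moreover have "finite (?N \<alpha> \<union> ?N \<beta>)" using \<alpha> \<beta> by (simp add: stable_cocycle_def)
  ultimately have "finite (?N (\<lambda>i. Plus A (\<alpha> i) (\<beta> i)))" by (rule finite_subset)
  then show ?thesis by (simp add: stable_cocycle_def carrier_hom_cx a mor_def)
qed

section \<open>Action of cochain maps on stable cohomology\<close>

lemma cochain_mapD:
  assumes "cochain_map A X Y \<phi>"
  shows "\<phi> i \<in> mor A (cobj X i) (cobj Y i)" "cdiff Y i \<cdot> \<phi> i = \<phi> (i + 1) \<cdot> cdiff X i"
  using assms by (auto simp: cochain_map_def)

lemma act_carrier:
  assumes \<phi>: "cochain_map A X' X \<phi>" and \<gamma>: "cochain_map A Y Y' \<gamma>"
    and \<alpha>: "\<alpha> \<in> carrier (hom_cx A X Y n)"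
  shows "(\<lambda>i. \<gamma> (n + i) \<cdot> \<alpha> i \<cdot> \<phi> i) \<in> carrier (hom_cx A X' Y' n)"
  using cochain_mapD(1)[OF \<phi>] cochain_mapD(1)[OF \<gamma>] \<alpha> mor_simps(1) unfolding carrier_hom_cx by metis

text \<open>Stated for a single degree so that it serves both cocycles with finitely many exceptions
  and cochains satisfying the equation from a given degree on. The maps \<open>\<phi>\<close> and
  \<open>\<gamma>\<close> have degree 0 and contribute no sign.\<close>

lemma act_cocycle_at:
  assumes cx: "cochain_complex A X" "cochain_complex A X'" "cochain_complex A Y" "cochain_complex A Y'"
    and \<phi>: "cochain_map A X' X \<phi>" and \<gamma>: "cochain_map A Y Y' \<gamma>"
    and \<alpha>: "\<alpha> \<in> carrier (hom_cx A X Y n)"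
    and c: "cdiff Y (n + j) \<cdot> \<alpha> j = koszul A n (\<alpha> (j + 1) \<cdot> cdiff X j)"
  shows "cdiff Y' (n + j) \<cdot> \<gamma> (n + j) \<cdot> \<alpha> j \<cdot> \<phi> j
      = koszul A n ((\<gamma> (n + (j + 1)) \<cdot> \<alpha> (j + 1) \<cdot> \<phi> (j + 1)) \<cdot> cdiff X' j)"
proof -
  note s = complex_cdiff_simps[OF cx(1)] complex_cdiff_simps[OF cx(2)] complex_cdiff_simps[OF cx(3)]
    complex_cdiff_simps[OF cx(4)]
  have a: "\<alpha> i \<in> Ar A" "Src A (\<alpha> i) = cobj X i" "Tgt A (\<alpha> i) = cobj Y (n + i)"
    "\<phi> i \<in> Ar A" "Src A (\<phi> i) = cobj X' i" "Tgt A (\<phi> i) = cobj X i"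
    "\<gamma> i \<in> Ar A" "Src A (\<gamma> i) = cobj Y i" "Tgt A (\<gamma> i) = cobj Y' i" for i
    using \<alpha> cochain_mapD(1)[OF \<phi>, of i] cochain_mapD(1)[OF \<gamma>, of i] by (auto simp: carrier_hom_cx mor_def)
  have "cdiff Y' (n + j) \<cdot> \<gamma> (n + j) \<cdot> \<alpha> j \<cdot> \<phi> j = (cdiff Y' (n + j) \<cdot> \<gamma> (n + j)) \<cdot> \<alpha> j \<cdot> \<phi> j"
    by (simp add: a s)
  also have "\<dots> = \<gamma> (n + j + 1) \<cdot> (cdiff Y (n + j) \<cdot> \<alpha> j) \<cdot> \<phi> j"
    unfolding cochain_mapD(2)[OF \<gamma>] by (simp add: a s)
  also have "\<dots> = koszul A n (\<gamma> (n + (j + 1)) \<cdot> \<alpha> (j + 1) \<cdot> (cdiff X j \<cdot> \<phi> j))"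
    unfolding c by (simp add: a s koszul_comp add.assoc)
  also have "\<dots> = koszul A n ((\<gamma> (n + (j + 1)) \<cdot> \<alpha> (j + 1) \<cdot> \<phi> (j + 1)) \<cdot> cdiff X' j)"
    unfolding cochain_mapD(2)[OF \<phi>] by (simp add: a s)
  finally show ?thesis .
qed

lemma act_stable_cocycle:
  assumes cx: "cochain_complex A X" "cochain_complex A X'" "cochain_complex A Y" "cochain_complex A Y'"
    and \<phi>: "cochain_map A X' X \<phi>" and \<gamma>: "cochain_map A Y Y' \<gamma>"
    and \<alpha>: "\<alpha> \<in> stable_cocycle A X Y n"
  shows "(\<lambda>i. \<gamma> (n + i) \<cdot> \<alpha> i \<cdot> \<phi> i) \<in> stable_cocycle A X' Y' n"
proof -
  have c: "\<alpha> \<in> carrier (hom_cx A X Y n)"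
    and fin: "finite {i. cdiff Y (n + i) \<cdot> \<alpha> i \<noteq> koszul A n (\<alpha> (i + 1) \<cdot> cdiff X i)}"
    using \<alpha> by (auto simp: stable_cocycle_def)
  have "{i. cdiff Y' (n + i) \<cdot> \<gamma> (n + i) \<cdot> \<alpha> i \<cdot> \<phi> i
      \<noteq> koszul A n ((\<gamma> (n + (i + 1)) \<cdot> \<alpha> (i + 1) \<cdot> \<phi> (i + 1)) \<cdot> cdiff X' i)}
    \<subseteq> {i. cdiff Y (n + i) \<cdot> \<alpha> i \<noteq> koszul A n (\<alpha> (i + 1) \<cdot> cdiff X i)}"
    using act_cocycle_at[OF cx \<phi> \<gamma> c] by blast
  then show ?thesis
    using finite_subset[OF _ fin] act_carrier[OF \<phi> \<gamma> c] by (simp add: stable_cocycle_def)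
qed

lemma act_hom_diff:
  assumes X: "cochain_complex A X" "cochain_complex A X'" and Y: "cochain_complex A Y" "cochain_complex A Y'"
    and \<phi>: "cochain_map A X' X \<phi>" and \<gamma>: "cochain_map A Y Y' \<gamma>"
    and \<alpha>: "\<alpha> \<in> carrier (hom_cx A X Y n)" and m: "m = n + 1"
  shows "\<gamma> (m + i) \<cdot> hom_diff A X Y n \<alpha> i \<cdot> \<phi> i
    = hom_diff A X' Y' n (\<lambda>i. \<gamma> (n + i) \<cdot> \<alpha> i \<cdot> \<phi> i) i"
proof -
  have a: "\<alpha> i \<in> Ar A" "Src A (\<alpha> i) = cobj X i" "Tgt A (\<alpha> i) = cobj Y (n + i)"
    "\<phi> i \<in> Ar A" "Src A (\<phi> i) = cobj X' i" "Tgt A (\<phi> i) = cobj X i"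
    "\<gamma> i \<in> Ar A" "Src A (\<gamma> i) = cobj Y i" "Tgt A (\<gamma> i) = cobj Y' i" for i
    using \<alpha> cochain_mapD(1)[OF \<phi>, of i] cochain_mapD(1)[OF \<gamma>, of i] by (auto simp: carrier_hom_cx mor_def)
  note s = complex_cdiff_simps[OF X(1)] complex_cdiff_simps[OF X(2)] complex_cdiff_simps[OF Y(1)]
    complex_cdiff_simps[OF Y(2)]
  have m': "m + i = n + i + 1" "m + i = n + (i + 1)" using m by simp_all
  have "hom_diff A X' Y' n (\<lambda>i. \<gamma> (n + i) \<cdot> \<alpha> i \<cdot> \<phi> i) i
    = Plus A ((cdiff Y' (n + i) \<cdot> \<gamma> (n + i)) \<cdot> \<alpha> i \<cdot> \<phi> i)
        (koszul A (n + 1) (\<gamma> (n + (i + 1)) \<cdot> \<alpha> (i + 1) \<cdot> (\<phi> (i + 1) \<cdot> cdiff X' i)))"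
    unfolding hom_diff_koszul by (simp add: a s add_ac)
  also have "\<dots> = Plus A ((\<gamma> (n + i + 1) \<cdot> cdiff Y (n + i)) \<cdot> \<alpha> i \<cdot> \<phi> i)
        (koszul A (n + 1) (\<gamma> (n + (i + 1)) \<cdot> \<alpha> (i + 1) \<cdot> (cdiff X i \<cdot> \<phi> i)))"
    unfolding cochain_mapD(2)[OF \<phi>] cochain_mapD(2)[OF \<gamma>] ..
  also have "\<dots> = \<gamma> (m + i) \<cdot> hom_diff A X Y n \<alpha> i \<cdot> \<phi> i"
    unfolding hom_diff_koszul m by (simp add: a s koszul_comp add_ac)
  finally show ?thesis ..
qed

lemma stable_Ext_act_class:
  assumes X: "cochain_complex A X" "cochain_complex A X'" and Y: "cochain_complex A Y" "cochain_complex A Y'"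
    and \<phi>: "cochain_map A X' X \<phi>" and \<gamma>: "cochain_map A Y Y' \<gamma>"
    and \<alpha>: "\<alpha> \<in> carrier (hom_cx A X Y n)"
  shows "stable_Ext_act A X' Y' n \<phi> \<gamma> (stable_class A X Y n \<alpha>)
    = stable_class A X' Y' n (\<lambda>i. \<gamma> (n + i) \<cdot> \<alpha> i \<cdot> \<phi> i)"
proof -
  let ?F = "\<lambda>n \<alpha> i. \<gamma> (n + i) \<cdot> \<alpha> i \<cdot> \<phi> i"
  have pm: "\<phi> i \<in> mor A (cobj X' i) (cobj X i)" "\<gamma> i \<in> mor A (cobj Y i) (cobj Y' i)" for i
    using cochain_mapD(1)[OF \<phi>] cochain_mapD(1)[OF \<gamma>] by auto
  have "?F n \<in> hom (hom_cx A X Y n) (hom_cx A X' Y' n)"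
  proof (rule homI)
    show "?F n \<alpha> \<in> carrier (hom_cx A X' Y' n)" if "\<alpha> \<in> carrier (hom_cx A X Y n)" for \<alpha>
      by (rule act_carrier[OF \<phi> \<gamma> that])
    fix \<alpha> \<beta> assume ab: "\<alpha> \<in> carrier (hom_cx A X Y n)" "\<beta> \<in> carrier (hom_cx A X Y n)"
    have "\<gamma> (n + i) \<cdot> Plus A (\<alpha> i) (\<beta> i) \<cdot> \<phi> i = Plus A (\<gamma> (n + i) \<cdot> \<alpha> i \<cdot> \<phi> i) (\<gamma> (n + i) \<cdot> \<beta> i \<cdot> \<phi> i)" for i
      using ab pm(1)[of i] pm(2)[of "n + i"] by (auto simp: carrier_hom_cx mor_def)
    then show "?F n (\<alpha> \<otimes>\<^bsub>hom_cx A X Y n\<^esub> \<beta>) = ?F n \<alpha> \<otimes>\<^bsub>hom_cx A X' Y' n\<^esub> ?F n \<beta>"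
      by (simp add: mult_hom_cx)
  qed
  moreover have "?F n ` carrier (bounded_hom_cx A X Y n) \<subseteq> carrier (bounded_hom_cx A X' Y' n)"
  proof
    fix \<beta>' assume "\<beta>' \<in> ?F n ` carrier (bounded_hom_cx A X Y n)"
    then obtain \<beta> where \<beta>: "\<beta>' = ?F n \<beta>" "\<beta> \<in> carrier (hom_cx A X Y n)"
      "finite {i. \<beta> i \<noteq> Zero A (cobj X i) (cobj Y (n + i))}"
      by (auto simp: carrier_bounded_hom_cx[OF X(1) Y(1)])
    have "\<beta>' i = Zero A (cobj X' i) (cobj Y' (n + i))" if "\<beta> i = Zero A (cobj X i) (cobj Y (n + i))" for i
      unfolding \<beta>(1) that using pm(1)[of i] pm(2)[of "n + i"] complexD(1)[OF X(1)] complexD(1)[OF X(2)] complexD(1)[OF Y(1)]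
      by (auto simp: mor_def)
    then have "{i. \<beta>' i \<noteq> Zero A (cobj X' i) (cobj Y' (n + i))} \<subseteq> {i. \<beta> i \<noteq> Zero A (cobj X i) (cobj Y (n + i))}"
      by blast
    then show "\<beta>' \<in> carrier (bounded_hom_cx A X' Y' n)"
      using act_carrier[OF \<phi> \<gamma> \<beta>(2)] \<beta>(1,3) finite_subset by (auto simp: carrier_bounded_hom_cx[OF X(2) Y(2)])
  qed
  moreover have "\<exists>s'\<in>carrier (hom_cx A X' Y' (n - 1)). ?F n (hom_diff A X Y (n - 1) s) = hom_diff A X' Y' (n - 1) s'"
    if s: "s \<in> carrier (hom_cx A X Y (n - 1))" for s
    using act_hom_diff[OF X Y \<phi> \<gamma> s, of n] act_carrier[OF \<phi> \<gamma> s]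
    by (intro bexI[of _ "?F (n - 1) s"]) auto
  ultimately show ?thesis
    unfolding stable_Ext_act_def stable_class_def stable_hom_cx_def stable_coboundaries_def stable_hom_diff_def
    using coset_map_cls[OF quotient_cohomology_hom_cx[OF X(1) Y(1), of n]
        quotient_cohomology_hom_cx[OF X(2) Y(2), of n], of "?F n" \<alpha>] \<alpha> by simp
qed

end

section \<open>Stable cocycles and syzygy morphisms\<close>

text \<open>Components out of the negative part of a coresolution start at zero objects and satisfy
  every equation, so validity in large degrees is all that finiteness asks for.\<close>

lemma finite_int_exceptions:
  assumes "\<And>i. i < (0::int) \<Longrightarrow> P i" "\<And>i. int m \<le> i \<Longrightarrow> P i"
  shows "finite {i. \<not> P i}"
proof (rule finite_subset)
  show "{i. \<not> P i} \<subseteq> {0..int m}"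
  proof
    fix i assume "i \<in> {i. \<not> P i}"
    then show "i \<in> {0..int m}" using assms(1)[of i] assms(2)[of i]
      by (cases "i < 0"; cases "int m \<le> i") auto
  qed
qed simp

lemma finite_int_bound:
  assumes "finite {i::int. \<not> P i}"
  obtains m :: nat where "\<And>i. int m \<le> i \<Longrightarrow> P i"
\<comment> \<open>Inserting 0 keeps the maximum defined when there is no exception; adding 1 puts
  the bound strictly above every exception.\<close>
proof (rule that[of "nat (Max (insert 0 {i. \<not> P i})) + 1"])
  fix i assume i: "int (nat (Max (insert 0 {i. \<not> P i})) + 1) \<le> i"
  show "P i"
  proof (rule ccontr)
    assume "\<not> P i"
    then have "i \<le> Max (insert 0 {i. \<not> P i})" using assms by (intro Max_ge) auto
    then show False using i by linarith
  qed
qed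

context abelian_category
begin

lemma zero_object_unique:
  assumes "zero_object A Z"
  shows "f \<in> mor A Z X \<Longrightarrow> g \<in> mor A Z X \<Longrightarrow> f = g" "f \<in> mor A X Z \<Longrightarrow> g \<in> mor A X Z \<Longrightarrow> f = g"
  using assms mor_objects unfolding zero_object_def by metis+

lemma ses_map_comp:
  assumes "ses_map A r s h u g" "ses_map A s t h' u' g'"
    and "short_exact A (fst r) (snd r)" "short_exact A (fst s) (snd s)" "short_exact A (fst t) (snd t)"
  shows "ses_map A r t (h' \<cdot> h) (u' \<cdot> u) (g' \<cdot> g)"
proof -
  note r = short_exactD(1-3)[OF assms(3)] and s = short_exactD(1-3)[OF assms(4)]
    and t = short_exactD(1-3)[OF assms(5)]
  have m: "h \<in> mor A (Src A (fst r)) (Src A (fst s))" "u \<in> mor A (Tgt A (fst r)) (Tgt A (fst s))"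
    "g \<in> mor A (Tgt A (snd r)) (Tgt A (snd s))" "h' \<in> mor A (Src A (fst s)) (Src A (fst t))"
    "u' \<in> mor A (Tgt A (fst s)) (Tgt A (fst t))" "g' \<in> mor A (Tgt A (snd s)) (Tgt A (snd t))"
    and e: "u \<cdot> fst r = fst s \<cdot> h" "snd s \<cdot> u = g \<cdot> snd r"
      "u' \<cdot> fst s = fst t \<cdot> h'" "snd t \<cdot> u' = g' \<cdot> snd s"
    using assms(1,2) by (auto simp: ses_map_def)
  have "(u' \<cdot> u) \<cdot> fst r = u' \<cdot> (u \<cdot> fst r)" using m r(1) by (auto simp: mor_def)
  also have "\<dots> = (u' \<cdot> fst s) \<cdot> h" unfolding e(1) using m s(1) by (auto simp: mor_def)
  also have "\<dots> = fst t \<cdot> h' \<cdot> h" unfolding e(3) using m t(1) by (auto simp: mor_def)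
  finally have 1: "(u' \<cdot> u) \<cdot> fst r = fst t \<cdot> h' \<cdot> h" .
  have "snd t \<cdot> u' \<cdot> u = (snd t \<cdot> u') \<cdot> u" using m t by (auto simp: mor_def)
  also have "\<dots> = g' \<cdot> (snd s \<cdot> u)" unfolding e(4) using m s by (auto simp: mor_def)
  also have "\<dots> = (g' \<cdot> g) \<cdot> snd r" unfolding e(2) using m r by (auto simp: mor_def)
  finally have 2: "snd t \<cdot> u' \<cdot> u = (g' \<cdot> g) \<cdot> snd r" .
  show ?thesis
    unfolding ses_map_def using 1 2 mor_simps(1)[OF m(1,4)] mor_simps(1)[OF m(2,5)] mor_simps(1)[OF m(3,6)]
    by blast
qed

end

context coresolving
begin

lemma ses_map_plus:
  assumes I: "cores M I" and J: "cores N J"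
    and m: "ses_map A (Theta_seq A I i) (Theta_seq A J k) h u g" "ses_map A (Theta_seq A I i) (Theta_seq A J k) h' u' g'"
  shows "ses_map A (Theta_seq A I i) (Theta_seq A J k) (Plus A h h') (Plus A u u') (Plus A g g')"
    and "ses_map A (Theta_seq A I i) (Theta_seq A J k) (Minus A h h') (Minus A u u') (Minus A g g')"
proof -
  note m = m[unfolded ses_map_Theta_iff[OF I J]]
  note t = Theta_inc_mor[OF I, of i] Theta_proj(1)[OF I, of i] Theta_inc_mor[OF J, of k] Theta_proj(1)[OF J, of k]
  have "Plus A u u' \<cdot> \<iota> I i = Plus A (u \<cdot> \<iota> I i) (u' \<cdot> \<iota> I i)" "Minus A u u' \<cdot> \<iota> I i = Minus A (u \<cdot> \<iota> I i) (u' \<cdot> \<iota> I i)"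
    "\<iota> J k \<cdot> Plus A h h' = Plus A (\<iota> J k \<cdot> h) (\<iota> J k \<cdot> h')" "\<iota> J k \<cdot> Minus A h h' = Minus A (\<iota> J k \<cdot> h) (\<iota> J k \<cdot> h')"
    "\<pi> J k \<cdot> Plus A u u' = Plus A (\<pi> J k \<cdot> u) (\<pi> J k \<cdot> u')" "\<pi> J k \<cdot> Minus A u u' = Minus A (\<pi> J k \<cdot> u) (\<pi> J k \<cdot> u')"
    "Plus A g g' \<cdot> \<pi> I i = Plus A (g \<cdot> \<pi> I i) (g' \<cdot> \<pi> I i)" "Minus A g g' \<cdot> \<pi> I i = Minus A (g \<cdot> \<pi> I i) (g' \<cdot> \<pi> I i)"
    using m t by (auto simp: mor_def)
  then show "ses_map A (Theta_seq A I i) (Theta_seq A J k) (Plus A h h') (Plus A u u') (Plus A g g')"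
    "ses_map A (Theta_seq A I i) (Theta_seq A J k) (Minus A h h') (Minus A u u') (Minus A g g')"
    unfolding ses_map_Theta_iff[OF I J] using m by (auto intro: mor_simps)
qed

section \<open>Morphisms modulo V and the direct system of complete cohomology\<close>

lemma Hom_mod_carrier: "carrier (Hom_mod A V X Y) = Hom_mod_class A V X Y ` mor A X Y"
  by (simp add: Hom_mod_def carrier_FactGroup Hom_mod_class_def)

lemma Hom_mod_mult:
  assumes "f \<in> mor A X Y" "g \<in> mor A X Y"
  shows "Hom_mod_class A V X Y f \<otimes>\<^bsub>Hom_mod A V X Y\<^esub> Hom_mod_class A V X Y g
    = Hom_mod_class A V X Y (Plus A f g)"
  using normal.rcos_sum[OF factoring_normal[OF subcat mor_objects[OF assms(1)]]] assms
  by (simp add: Hom_mod_def Hom_mod_class_def)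

abbreviation tix :: "int \<Rightarrow> nat \<Rightarrow> nat" where "tix n i \<equiv> nat (int i + n)"

text \<open>The lower bound on i keeps i + n nonnegative; below it the truncation in
  \<open>nat\<close> would break the successor law.\<close>

lemma tix_Suc: "nat (- n) \<le> i \<Longrightarrow> tix n (Suc i) = Suc (tix n i)"
  by simp

lemma tix_add: "nat (- n) \<le> i \<Longrightarrow> tix n (i + j) = tix n i + j"
  by simp

lemma int_tix: "nat (- n) \<le> i \<Longrightarrow> int (tix n i) = n + int i"
  by simp

abbreviation hcl :: "('o, 'm) augmented \<Rightarrow> ('o, 'm) augmented \<Rightarrow> int \<Rightarrow> nat \<Rightarrow> 'm \<Rightarrow> 'm set" where
  "hcl I J n i \<equiv> Hom_mod_class A V (\<Theta> I i) (\<Theta> J (tix n i))"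

lemma complete_step:
  assumes I: "cores M I" and J: "cores N J" and i: "nat (- n) \<le> i"
    and m: "ses_map A (Theta_seq A I i) (Theta_seq A J (tix n i)) h u g"
  shows "complete_V_step A V I J n i (hcl I J n i h) = hcl I J n (Suc i) g"
  using Hom_mod_step(2)[OF I J m] unfolding complete_V_step_def tix_Suc[OF i] .

text \<open>The transition maps are additive because maps of short exact sequences can be added: the
  sum of two of them computes the transition of the sum.\<close>

lemma complete_direct_system:
  assumes I: "cores M I" and J: "cores N J"
  shows "direct_system (nat (- n)) (complete_V_obj A V I J n) (complete_V_step A V I J n)"
proof (rule direct_system.intro)
  fix i assume i: "nat (- n) \<le> i"
  show "group (complete_V_obj A V I J n i)"
    unfolding complete_V_obj_def Hom_mod_def
    by (rule normal.factorgroup_is_group[OF factoring_normal[OF subcat Theta_Ob[OF I] Theta_Ob[OF J]]])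
  show "complete_V_step A V I J n i \<in> hom (complete_V_obj A V I J n i) (complete_V_obj A V I J n (Suc i))"
  proof (rule homI)
    fix c assume "c \<in> carrier (complete_V_obj A V I J n i)"
    then obtain h where h: "h \<in> mor A (\<Theta> I i) (\<Theta> J (tix n i))" "c = hcl I J n i h"
      by (auto simp: complete_V_obj_def Hom_mod_carrier)
    obtain u g where m: "ses_map A (Theta_seq A I i) (Theta_seq A J (tix n i)) h u g"
      using step_exists[OF I J h(1)] by blast
    then have "g \<in> mor A (\<Theta> I (Suc i)) (\<Theta> J (tix n (Suc i)))"
      unfolding tix_Suc[OF i] by (simp add: ses_map_Theta_iff[OF I J])
    then show "complete_V_step A V I J n i c \<in> carrier (complete_V_obj A V I J n (Suc i))"
      unfolding h(2) complete_step[OF I J i m] complete_V_obj_def Hom_mod_carrier by blast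
    fix c' assume "c' \<in> carrier (complete_V_obj A V I J n i)"
    then obtain h' where h': "h' \<in> mor A (\<Theta> I i) (\<Theta> J (tix n i))" "c' = hcl I J n i h'"
      by (auto simp: complete_V_obj_def Hom_mod_carrier)
    obtain u' g' where m': "ses_map A (Theta_seq A I i) (Theta_seq A J (tix n i)) h' u' g'"
      using step_exists[OF I J h'(1)] by blast
    then have "g' \<in> mor A (\<Theta> I (Suc i)) (\<Theta> J (tix n (Suc i)))"
      unfolding tix_Suc[OF i] by (simp add: ses_map_Theta_iff[OF I J])
    then show "complete_V_step A V I J n i (c \<otimes>\<^bsub>complete_V_obj A V I J n i\<^esub> c')
      = complete_V_step A V I J n i c \<otimes>\<^bsub>complete_V_obj A V I J n (Suc i)\<^esub> complete_V_step A V I J n i c'"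
      unfolding h(2) h'(2) complete_step[OF I J i m] complete_step[OF I J i m']
      using complete_step[OF I J i ses_map_plus(1)[OF I J m m']]
        Hom_mod_mult[OF h(1) h'(1)] Hom_mod_mult[OF \<open>g \<in> _\<close> \<open>g' \<in> _\<close>]
      by (simp add: complete_V_obj_def)
  qed
qed

definition ccl :: "('o, 'm) augmented \<Rightarrow> ('o, 'm) augmented \<Rightarrow> int \<Rightarrow> nat \<Rightarrow> 'm \<Rightarrow> (nat \<times> 'm set) set" where
  "ccl I J n i h = colim_rel (nat (- n)) (complete_V_obj A V I J n) (complete_V_step A V I J n) ``
     {(i, hcl I J n i h)}"

lemma hcl_carrier:
  "h \<in> mor A (\<Theta> I i) (\<Theta> J (tix n i)) \<Longrightarrow> hcl I J n i h \<in> carrier (complete_V_obj A V I J n i)"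
  by (simp add: complete_V_obj_def Hom_mod_carrier)

lemma carrier_complete:
  assumes I: "cores M I" and J: "cores N J"
  shows "carrier (complete_Ext_V A V I J n)
    = {ccl I J n i h |i h. nat (- n) \<le> i \<and> h \<in> mor A (\<Theta> I i) (\<Theta> J (tix n i))}"
  using direct_system.carrier_seq_colim[OF complete_direct_system[OF I J]]
  unfolding complete_Ext_V_def ccl_def by (auto simp: complete_V_obj_def Hom_mod_carrier)

lemma ccl_mult:
  assumes I: "cores M I" and J: "cores N J" and i: "nat (- n) \<le> i"
    and h: "h \<in> mor A (\<Theta> I i) (\<Theta> J (tix n i))" "g \<in> mor A (\<Theta> I i) (\<Theta> J (tix n i))"
  shows "ccl I J n i h \<otimes>\<^bsub>complete_Ext_V A V I J n\<^esub> ccl I J n i g = ccl I J n i (Plus A h g)"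
proof -
  have "hcl I J n i h \<otimes>\<^bsub>complete_V_obj A V I J n i\<^esub> hcl I J n i g = hcl I J n i (Plus A h g)"
    unfolding complete_V_obj_def by (rule Hom_mod_mult[OF h])
  then show ?thesis
    using direct_system.class_mult[OF complete_direct_system[OF I J] i hcl_carrier[OF h(1)] hcl_carrier[OF h(2)]]
    by (simp add: complete_Ext_V_def ccl_def)
qed

text \<open>Each rung of the ladder computes one transition map, so an entire ladder traces the path
  of its first class through the system.\<close>

lemma ladder_transition:
  assumes I: "cores M I" and J: "cores N J" and i: "nat (- n) \<le> i"
    and l: "ladder I i J (tix n i) h u"
  shows "transition (complete_V_step A V I J n) i j (hcl I J n i (h 0)) = hcl I J n (i + j) (h j)"
proof (induction j)
  case (Suc j)
  have ij: "nat (- n) \<le> i + j" using i by simp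
  have "ses_map A (Theta_seq A I (i + j)) (Theta_seq A J (tix n (i + j))) (h j) (u j) (h (Suc j))"
    using l unfolding ladder_def tix_add[OF i] by blast
  from complete_step[OF I J ij this] Suc show ?case by simp
qed simp

text \<open>
  \<open>rep I J n \<alpha> i h\<close>: from degree \<open>i\<close> on, \<open>\<alpha>\<close> is a cocycle, and its \<open>i\<close>-th component, twisted by
  \<open>(-1)\<^sup>n\<^sup>i\<close> so that it commutes with the differentials, restricts to \<open>h\<close> on the kernels.
\<close>

definition rep :: "('o, 'm) augmented \<Rightarrow> ('o, 'm) augmented \<Rightarrow> int \<Rightarrow> (int \<Rightarrow> 'm) \<Rightarrow> nat \<Rightarrow> 'm \<Rightarrow> bool" where
  "rep I J n \<alpha> i h \<longleftrightarrow> nat (- n) \<le> i \<and> \<alpha> \<in> carrier (hom_cx A I J n) \<and>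
     (\<forall>j\<ge>int i. cdiff J (n + j) \<cdot> \<alpha> j = koszul A n (\<alpha> (j + 1) \<cdot> cdiff I j)) \<and>
     h \<in> mor A (\<Theta> I i) (\<Theta> J (tix n i)) \<and>
     \<iota> J (tix n i) \<cdot> h = koszul A (n * int i) (\<alpha> (int i)) \<cdot> \<iota> I i"

abbreviation tw :: "int \<Rightarrow> (int \<Rightarrow> 'm) \<Rightarrow> nat \<Rightarrow> 'm" where
  "tw n \<alpha> j \<equiv> koszul A (n * int j) (\<alpha> (int j))"

lemma tw_mor:
  assumes "\<alpha> \<in> carrier (hom_cx A I J n)" "nat (- n) \<le> j"
  shows "tw n \<alpha> j \<in> mor A (cob I j) (cob J (tix n j))"
  using assms(1) koszul_mor unfolding carrier_hom_cx int_tix[OF assms(2)] by blast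

text \<open>The cocycle equation contributes a sign (-1)^n, and n j + n = n (j + 1) is precisely the
  twist of the next component.\<close>

lemma tw_cdiff:
  assumes I: "cores M I" and J: "cores N J" and \<alpha>: "\<alpha> \<in> carrier (hom_cx A I J n)" and j: "nat (- n) \<le> j"
    and c: "cdiff J (n + int j) \<cdot> \<alpha> (int j) = koszul A n (\<alpha> (int j + 1) \<cdot> cdiff I (int j))"
  shows "cdiff J (int (tix n j)) \<cdot> tw n \<alpha> j = tw n \<alpha> (Suc j) \<cdot> cdiff I (int j)"
proof -
  note s = complex_cdiff_simps[OF cores_complex[OF I]] complex_cdiff_simps[OF cores_complex[OF J]]
  have a: "\<alpha> i \<in> Ar A" "Src A (\<alpha> i) = cobj I i" "Tgt A (\<alpha> i) = cobj J (n + i)" for i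
    using \<alpha> by (auto simp: carrier_hom_cx mor_def)
  have "cdiff J (int (tix n j)) \<cdot> tw n \<alpha> j = koszul A (n * int j) (cdiff J (n + int j) \<cdot> \<alpha> (int j))"
    unfolding int_tix[OF j] by (simp add: koszul_comp a s)
  also have "\<dots> = koszul A (n * int j + n) (\<alpha> (int j + 1) \<cdot> cdiff I (int j))"
    unfolding c by (simp add: koszul_koszul a s)
  also have "\<dots> = tw n \<alpha> (Suc j) \<cdot> cdiff I (int j)"
    by (simp add: koszul_comp a s add.commute[of 1] distrib_left)
  finally show ?thesis .
qed

lemma rep_exists:
  assumes I: "cores M I" and J: "cores N J" and \<alpha>: "\<alpha> \<in> carrier (hom_cx A I J n)" and i: "nat (- n) \<le> i"
    and c: "\<And>j. int i \<le> j \<Longrightarrow> cdiff J (n + j) \<cdot> \<alpha> j = koszul A n (\<alpha> (j + 1) \<cdot> cdiff I j)"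
  shows "\<exists>h. rep I J n \<alpha> i h"
proof -
  let ?k = "tix n i"
  note t = tw_mor[OF \<alpha> i]
  have t': "tw n \<alpha> (Suc i) \<in> mor A (cob I (Suc i)) (cob J (Suc ?k))"
    unfolding tix_Suc[OF i, symmetric] by (rule tw_mor[OF \<alpha>]) (use i in simp)
  note \<iota> = Theta_inc_mor[OF I, of i]
  have ti: "tw n \<alpha> i \<cdot> \<iota> I i \<in> mor A (\<Theta> I i) (cob J ?k)" using \<iota> t by (rule mor_simps)
  note d = cores_cdiff_Suc[OF J, of ?k] cores_cdiff_Suc[OF I, of i]
  have "cdiff J (int ?k) \<cdot> (tw n \<alpha> i \<cdot> \<iota> I i) = (cdiff J (int ?k) \<cdot> tw n \<alpha> i) \<cdot> \<iota> I i"
    using d t \<iota> by (auto simp: mor_def)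
  also have "\<dots> = tw n \<alpha> (Suc i) \<cdot> (cdiff I (int i) \<cdot> \<iota> I i)"
    unfolding tw_cdiff[OF I J \<alpha> i c[OF order_refl]] using t' d \<iota> by (auto simp: mor_def)
  also have "\<dots> = Zero A (\<Theta> I i) (cob J (Suc ?k))"
    using kernel_arrow(2)[OF Theta_inc_kernel[OF I] d(2)] t' \<iota> cores_cdiff(3)[OF I]
    by (auto simp: mor_def Theta_def)
  finally obtain h where "h \<in> mor A (\<Theta> I i) (\<Theta> J ?k)" "\<iota> J ?k \<cdot> h = tw n \<alpha> i \<cdot> \<iota> I i"
    using kernel_factor[OF Theta_inc_kernel[OF J] d(1) ti] by (auto simp: Theta_src_tgt[OF J])
  then show ?thesis using \<alpha> i c by (auto simp: rep_def)
qed

text \<open>The left square is part of \<open>rep\<close>; the right one is the commutation with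
  differentials after cancelling the inclusion of the next syzygy, which is mono.\<close>

lemma rep_step:
  assumes I: "cores M I" and J: "cores N J" and r: "rep I J n \<alpha> i h" "rep I J n \<alpha> (Suc i) h'"
  shows "ses_map A (Theta_seq A I i) (Theta_seq A J (tix n i)) h (tw n \<alpha> i) h'"
proof -
  let ?k = "tix n i"
  note r = r[unfolded rep_def]
  have i: "nat (- n) \<le> i" and \<alpha>: "\<alpha> \<in> carrier (hom_cx A I J n)" using r by auto
  note t = tw_mor[OF \<alpha> i]
  have t': "tw n \<alpha> (Suc i) \<in> mor A (cob I (Suc i)) (cob J (Suc ?k))"
    unfolding tix_Suc[OF i, symmetric] by (rule tw_mor[OF \<alpha>]) (use i in simp)
  note \<iota> = Theta_inc_mor[OF I, of "Suc i"] Theta_inc_mor[OF J, of "Suc ?k"]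
    and \<pi> = Theta_proj(1)[OF I, of i] Theta_proj(1)[OF J, of ?k]
  have h': "h' \<in> mor A (\<Theta> I (Suc i)) (\<Theta> J (Suc ?k))"
    "\<iota> J (Suc ?k) \<cdot> h' = tw n \<alpha> (Suc i) \<cdot> \<iota> I (Suc i)"
    using r unfolding tix_Suc[OF i] by auto
  have "\<iota> J (Suc ?k) \<cdot> (\<pi> J ?k \<cdot> tw n \<alpha> i) = cdiff J (int ?k) \<cdot> tw n \<alpha> i"
    unfolding Theta_proj(2)[OF J, symmetric] using \<iota> \<pi> t by (auto simp: mor_def)
  also have "\<dots> = tw n \<alpha> (Suc i) \<cdot> (\<iota> I (Suc i) \<cdot> \<pi> I i)"
    unfolding Theta_proj(2)[OF I] using r by (intro tw_cdiff[OF I J \<alpha> i]) auto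
  also have "\<dots> = (tw n \<alpha> (Suc i) \<cdot> \<iota> I (Suc i)) \<cdot> \<pi> I i"
    using t' \<iota>(1) \<pi>(1) by (auto simp: mor_def)
  also have "\<dots> = \<iota> J (Suc ?k) \<cdot> (h' \<cdot> \<pi> I i)"
    unfolding h'(2)[symmetric] using \<iota>(2) h'(1) \<pi>(1) by (auto simp: mor_def)
  finally have "\<pi> J ?k \<cdot> tw n \<alpha> i = h' \<cdot> \<pi> I i"
    by (rule short_exact_mono[OF Theta_proj(3)[OF J]])
      (use \<pi> t h' Theta_src_tgt[OF J] in \<open>auto simp: mor_def\<close>)
  then show ?thesis unfolding ses_map_Theta_iff[OF I J] using r t h'(1) by auto
qed

lemma rep_chain:
  assumes I: "cores M I" and J: "cores N J" and r: "rep I J n \<alpha> i h"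
  shows "\<exists>hs. hs 0 = h \<and> (\<forall>j. rep I J n \<alpha> (i + j) (hs j)) \<and>
    ladder I i J (tix n i) hs (\<lambda>j. tw n \<alpha> (i + j))"
proof -
  have i: "nat (- n) \<le> i" and \<alpha>: "\<alpha> \<in> carrier (hom_cx A I J n)"
    and c: "\<And>j. int i \<le> j \<Longrightarrow> cdiff J (n + j) \<cdot> \<alpha> j = koszul A n (\<alpha> (j + 1) \<cdot> cdiff I j)"
    using r unfolding rep_def by auto
  \<comment> \<open>Representatives exist at every level above i; at level i itself the given h is
    kept.\<close>
  have "\<exists>g. rep I J n \<alpha> (i + j) g \<and> (j = 0 \<longrightarrow> g = h)" for j
  proof (cases "j = 0")
    case False
    have "\<exists>g. rep I J n \<alpha> (i + j) g" by (rule rep_exists[OF I J \<alpha>]) (use i c in auto)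
    then show ?thesis using False by blast
  qed (use r in auto)
  then obtain hs where hs: "\<And>j. rep I J n \<alpha> (i + j) (hs j)" "hs 0 = h" by metis
  have "ladder I i J (tix n i) hs (\<lambda>j. tw n \<alpha> (i + j))"
    unfolding ladder_def
  proof
    fix j
    have "ses_map A (Theta_seq A I (i + j)) (Theta_seq A J (tix n (i + j))) (hs j) (tw n \<alpha> (i + j)) (hs (Suc j))"
      by (rule rep_step[OF I J]) (use hs(1)[of j] hs(1)[of "Suc j"] in auto)
    then show "ses_map A (Theta_seq A I (i + j)) (Theta_seq A J (tix n i + j)) (hs j) (tw n \<alpha> (i + j)) (hs (Suc j))"
      unfolding tix_add[OF i] .
  qed
  then show ?thesis using hs by blast
qed

text \<open>Injectivity. The difference of the two ladders starts with a morphism through V, so it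
  is null homotopic in higher degrees, and removing the twist from that homotopy gives one between
  the cochains.\<close>

lemma rep_hcl_eq_imp:
  assumes I: "cores M I" and J: "cores N J" and r: "rep I J n \<alpha> k h" "rep I J n \<beta> k g"
    and eq: "hcl I J n k h = hcl I J n k g"
  shows "stable_class A I J n \<alpha> = stable_class A I J n \<beta>"
proof -
  note c = cores_complex[OF I] cores_complex[OF J]
  have k: "nat (- n) \<le> k" and \<alpha>: "\<alpha> \<in> carrier (hom_cx A I J n)" and \<beta>: "\<beta> \<in> carrier (hom_cx A I J n)"
    and h: "h \<in> mor A (\<Theta> I k) (\<Theta> J (tix n k))" and g: "g \<in> mor A (\<Theta> I k) (\<Theta> J (tix n k))"
    using r unfolding rep_def by auto
  obtain hs gs where hs: "hs 0 = h" "ladder I k J (tix n k) hs (\<lambda>j. tw n \<alpha> (k + j))"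
    and gs: "gs 0 = g" "ladder I k J (tix n k) gs (\<lambda>j. tw n \<beta> (k + j))"
    using rep_chain[OF I J r(1)] rep_chain[OF I J r(2)] by blast
  let ?u = "\<lambda>j. Minus A (tw n \<alpha> (k + j)) (tw n \<beta> (k + j))"
  have l: "ladder I k J (tix n k) (\<lambda>j. Minus A (hs j) (gs j)) ?u"
    using hs(2) gs(2) ses_map_plus(2)[OF I J] unfolding ladder_def by blast
  have "Minus A (hs 0) (gs 0) \<in> factoring A V (\<Theta> I k) (\<Theta> J (tix n k))"
    using Hom_mod_class_eq_iff[OF subcat h g] eq hs(1) gs(1) by simp
  from null_homotopy[OF I J l this] obtain \<sigma> where
    \<sigma>: "\<And>j. \<sigma> j \<in> mor A (cob I (Suc (k + j))) (cob J (tix n k + j))"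
    and \<sigma>': "\<And>j. ?u (Suc j) = Plus A (cdiff J (int (tix n k + j)) \<cdot> \<sigma> j) (\<sigma> (Suc j) \<cdot> cdiff I (int (Suc (k + j))))"
    by blast
  \<comment> \<open>\<open>\<sigma> j\<close> starts at degree k + j + 1, whence the index i - k -
    1. The sign (-1)^(n i) removes the twist. Being zero up to degree k is harmless, since the
    homotopy equation may fail in degrees 0 to k.\<close>
  define s where "s i = (if int k < i then koszul A (n * i) (\<sigma> (nat (i - int k - 1)))
    else Zero A (cobj I i) (cobj J (n - 1 + i)))" for i
  have s_eq: "s (int (Suc (k + j))) = koszul A (n * int (Suc (k + j))) (\<sigma> j)" for j
    by (simp add: s_def)
  have s: "s i \<in> mor A (cobj I i) (cobj J (n - 1 + i))" for i
  proof (cases "int k < i")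
    case True
    define j where "j = nat (i - int k - 1)"
    have i: "i = int (Suc (k + j))" using True by (simp add: j_def)
    have "int (tix n k + j) = n - 1 + i" using int_tix[OF k] i by simp
    then show ?thesis using \<sigma>[of j] koszul_mor unfolding i s_eq by metis
  qed (simp add: s_def mor_simps cores_cdiff(3)[OF I] cores_cdiff(3)[OF J])
  have "\<alpha> i = Plus A (hom_diff A I J (n - 1) s i) (\<beta> i)" if "int (Suc k) \<le> i" for i
  proof -
    define j where "j = nat (i - int k - 1)"
    have i: "i = int (Suc (k + j))" using that by (simp add: j_def)
    have ab: "\<alpha> i \<in> Ar A" "Src A (\<alpha> i) = cobj I i" "Tgt A (\<alpha> i) = cobj J (n + i)"
      "\<beta> i \<in> Ar A" "Src A (\<beta> i) = cobj I i" "Tgt A (\<beta> i) = cobj J (n + i)" for i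
      using \<alpha> \<beta> by (auto simp: carrier_hom_cx mor_def)
    note cd = complex_cdiff_simps[OF c(1)] complex_cdiff_simps[OF c(2)]
    have sj: "\<sigma> j \<in> Ar A" "Src A (\<sigma> j) = cobj I i" "Tgt A (\<sigma> j) = cobj J (n - 1 + i)"
      "\<sigma> (Suc j) \<in> Ar A" "Src A (\<sigma> (Suc j)) = cobj I (i + 1)" "Tgt A (\<sigma> (Suc j)) = cobj J (n + i)"
    proof -
      have x: "int (Suc (k + j)) = i" "int (tix n k + j) = n - 1 + i" "int (Suc (k + Suc j)) = i + 1"
        "int (tix n k + Suc j) = n + i"
        using int_tix[OF k] i by auto
      show "\<sigma> j \<in> Ar A" "Src A (\<sigma> j) = cobj I i" "Tgt A (\<sigma> j) = cobj J (n - 1 + i)"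
        "\<sigma> (Suc j) \<in> Ar A" "Src A (\<sigma> (Suc j)) = cobj I (i + 1)" "Tgt A (\<sigma> (Suc j)) = cobj J (n + i)"
        using \<sigma>[of j] \<sigma>[of "Suc j"] unfolding x by (simp_all add: mor_def)
    qed
    have d: "Minus A (koszul A (n * i) (\<alpha> i)) (koszul A (n * i) (\<beta> i))
      = Plus A (cdiff J (n - 1 + i) \<cdot> \<sigma> j) (\<sigma> (Suc j) \<cdot> cdiff I i)"
    proof -
      have x: "int (tix n k + j) = n - 1 + i" "int (k + Suc j) = i" "int (Suc (k + j)) = i"
        using int_tix[OF k] i by auto
      show ?thesis using \<sigma>'[of j] unfolding x .
    qed
    have "koszul A (n * i) (\<alpha> i) = Plus A (Plus A (cdiff J (n - 1 + i) \<cdot> \<sigma> j) (\<sigma> (Suc j) \<cdot> cdiff I i)) (koszul A (n * i) (\<beta> i))"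
      using minus_eq_iff[of "koszul A (n * i) (\<alpha> i)" "koszul A (n * i) (\<beta> i)"
        "Plus A (cdiff J (n - 1 + i) \<cdot> \<sigma> j) (\<sigma> (Suc j) \<cdot> cdiff I i)"] d
      by (simp add: ab sj cd)
    then have "koszul A (n * i) (koszul A (n * i) (\<alpha> i)) = koszul A (n * i)
      (Plus A (Plus A (cdiff J (n - 1 + i) \<cdot> \<sigma> j) (\<sigma> (Suc j) \<cdot> cdiff I i)) (koszul A (n * i) (\<beta> i)))"
      by simp
    then have e: "\<alpha> i = Plus A (Plus A (koszul A (n * i) (cdiff J (n - 1 + i) \<cdot> \<sigma> j)) (koszul A (n * i) (\<sigma> (Suc j) \<cdot> cdiff I i))) (\<beta> i)"
      by (simp add: ab sj cd koszul_plus koszul_twice)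
    have s1: "s i = koszul A (n * i) (\<sigma> j)" using s_eq[of j] i by simp
    have s2: "s (i + 1) = koszul A (n * i + n) (\<sigma> (Suc j))"
    proof -
      have x: "int (Suc (k + Suc j)) = i + 1" using i by simp
      show ?thesis using s_eq[of "Suc j"] unfolding x by (simp add: distrib_left)
    qed
    \<comment> \<open>In degree n - 1 the term s d carries the sign (-1)^n, and the next component
      of s the sign (-1)^(n i + n); together they give (-1)^(n i), the sign of the other
      term.\<close>
    have "hom_diff A I J (n - 1) s i = Plus A (koszul A (n * i) (cdiff J (n - 1 + i) \<cdot> \<sigma> j)) (koszul A (n * i) (\<sigma> (Suc j) \<cdot> cdiff I i))"
      unfolding hom_diff_koszul s1 s2
      using koszul_cong[of "n + (n * i + n)" "n * i"] by (simp add: ab sj cd koszul_comp koszul_koszul)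
    then show ?thesis using e by simp
  qed
  \<comment> \<open>In negative degrees both sides are arrows out of a zero object.\<close>
  moreover have "\<alpha> i = Plus A (hom_diff A I J (n - 1) s i) (\<beta> i)" if "i < 0" for i
  proof (rule zero_object_unique(1)[OF cores_neg[OF I that]])
    have "s \<in> carrier (hom_cx A I J (n - 1))" using s by (simp add: carrier_hom_cx)
    then have "hom_diff A I J (n - 1) s \<in> carrier (hom_cx A I J n)" by (rule hom_diff_carrier[OF c]) simp
    then show "\<alpha> i \<in> mor A (cobj I i) (cobj J (n + i))"
      "Plus A (hom_diff A I J (n - 1) s i) (\<beta> i) \<in> mor A (cobj I i) (cobj J (n + i))"
      using \<alpha> \<beta> by (auto simp: carrier_hom_cx intro!: mor_simps(2))
  qed
  ultimately have "finite {i. \<alpha> i \<noteq> Plus A (hom_diff A I J (n - 1) s i) (\<beta> i)}"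
    by (rule finite_int_exceptions[rotated])
  moreover have "s \<in> carrier (hom_cx A I J (n - 1))" using s by (simp add: carrier_hom_cx)
  ultimately show ?thesis unfolding stable_Ext_facts(3)[OF c \<alpha> \<beta>] by blast
qed

end

section \<open>From stable cocycles to the colimit and back\<close>

context coresolving
begin

lemma ccl_eq_iff:
  assumes I: "cores M I" and J: "cores N J"
    and i: "nat (- n) \<le> i" "h \<in> mor A (\<Theta> I i) (\<Theta> J (tix n i))"
    and j: "nat (- n) \<le> j" "g \<in> mor A (\<Theta> I j) (\<Theta> J (tix n j))"
  shows "ccl I J n i h = ccl I J n j g \<longleftrightarrow>
    (\<exists>k. i \<le> k \<and> j \<le> k \<and> transition (complete_V_step A V I J n) i (k - i) (hcl I J n i h)
       = transition (complete_V_step A V I J n) j (k - j) (hcl I J n j g))"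
  unfolding ccl_def
  by (rule direct_system.class_eq_iff[OF complete_direct_system[OF I J] i(1) hcl_carrier[OF i(2)]
        j(1) hcl_carrier[OF j(2)]])

lemma ladder_ccl:
  assumes I: "cores M I" and J: "cores N J" and i: "nat (- n) \<le> i"
    and l: "ladder I i J (tix n i) h u"
  shows "ccl I J n i (h 0) = ccl I J n (i + j) (h j)"
proof -
  have "h 0 \<in> mor A (\<Theta> I i) (\<Theta> J (tix n i))"
    using spec[OF l[unfolded ladder_def], of 0] by (simp add: ses_map_Theta_iff[OF I J])
  from direct_system.class_transition[OF complete_direct_system[OF I J] i hcl_carrier[OF this], of j]
  show ?thesis unfolding ccl_def ladder_transition[OF I J i l] .
qed

text \<open>Any two related pairs can be compared or added only at a common level; this raises a
  pair to a prescribed level without changing its class in the colimit.\<close>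

lemma rep_ccl_move:
  assumes I: "cores M I" and J: "cores N J" and r: "rep I J n \<alpha> i h" and m: "i \<le> m"
  shows "\<exists>g. rep I J n \<alpha> m g \<and> ccl I J n i h = ccl I J n m g \<and>
    transition (complete_V_step A V I J n) i (m - i) (hcl I J n i h) = hcl I J n m g"
proof -
  obtain hs where hs: "hs 0 = h" "\<And>j. rep I J n \<alpha> (i + j) (hs j)"
    "ladder I i J (tix n i) hs (\<lambda>j. tw n \<alpha> (i + j))" using rep_chain[OF I J r] by blast
  have i: "nat (- n) \<le> i" using r by (simp add: rep_def)
  have "rep I J n \<alpha> m (hs (m - i))" using hs(2)[of "m - i"] m by simp
  moreover have "ccl I J n i h = ccl I J n m (hs (m - i))"
    using ladder_ccl[OF I J i hs(3), of "m - i"] hs(1) m by simp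
  moreover have "transition (complete_V_step A V I J n) i (m - i) (hcl I J n i h) = hcl I J n m (hs (m - i))"
    using ladder_transition[OF I J i hs(3), of "m - i"] hs(1) m by simp
  ultimately show ?thesis by blast
qed

lemma rep_D:
  assumes "rep I J n \<alpha> i h"
  shows "nat (- n) \<le> i" "\<alpha> \<in> carrier (hom_cx A I J n)" "h \<in> mor A (\<Theta> I i) (\<Theta> J (tix n i))"
    "\<iota> J (tix n i) \<cdot> h = tw n \<alpha> i \<cdot> \<iota> I i"
  using assms by (auto simp: rep_def)

lemma rep_ccl_carrier:
  "cores M I \<Longrightarrow> cores N J \<Longrightarrow> rep I J n \<alpha> i h \<Longrightarrow> ccl I J n i h \<in> carrier (complete_Ext_V A V I J n)"
  using rep_D(1,3)[of I J n \<alpha> i h] carrier_complete[of M I N J n] by blast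

lemma rep_cocycle:
  assumes I: "cores M I" and J: "cores N J" and r: "rep I J n \<alpha> i h"
  shows "\<alpha> \<in> stable_cocycle A I J n"
proof -
  note s = complex_cdiff_simps[OF cores_complex[OF I]] complex_cdiff_simps[OF cores_complex[OF J]]
  have a: "\<alpha> i \<in> Ar A" "Src A (\<alpha> i) = cobj I i" "Tgt A (\<alpha> i) = cobj J (n + i)" for i
    using rep_D(2)[OF r] by (auto simp: carrier_hom_cx mor_def)
  have "finite {j. cdiff J (n + j) \<cdot> \<alpha> j \<noteq> koszul A n (\<alpha> (j + 1) \<cdot> cdiff I j)}"
  proof (rule finite_int_exceptions)
    show "cdiff J (n + j) \<cdot> \<alpha> j = koszul A n (\<alpha> (j + 1) \<cdot> cdiff I j)" if "j < 0" for j
      by (rule zero_object_unique(1)[OF cores_neg[OF I that], of _ "cobj J (n + j + 1)"])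
        (simp_all add: a s mor_def add_ac)
    show "cdiff J (n + j) \<cdot> \<alpha> j = koszul A n (\<alpha> (j + 1) \<cdot> cdiff I j)" if "int i \<le> j" for j
      using r that by (simp add: rep_def)
  qed
  then show ?thesis using rep_D(2)[OF r] by (simp add: stable_cocycle_def)
qed

lemma cocycle_rep:
  assumes I: "cores M I" and J: "cores N J" and \<alpha>: "\<alpha> \<in> stable_cocycle A I J n"
  shows "\<exists>i h. m \<le> i \<and> rep I J n \<alpha> i h"
proof -
  have c: "\<alpha> \<in> carrier (hom_cx A I J n)"
    "finite {i. \<not> cdiff J (n + i) \<cdot> \<alpha> i = koszul A n (\<alpha> (i + 1) \<cdot> cdiff I i)}"
    using \<alpha> by (auto simp: stable_cocycle_def)
  obtain b where b: "\<And>i. int b \<le> i \<Longrightarrow> cdiff J (n + i) \<cdot> \<alpha> i = koszul A n (\<alpha> (i + 1) \<cdot> cdiff I i)"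
    using finite_int_bound[OF c(2)] by blast
  \<comment> \<open>Beyond \<open>b\<close> the cocycle equation holds without exception, and
    \<open>nat (- n)\<close> makes the target index i + n a natural number.\<close>
  define i where "i = max m (max b (nat (- n)))"
  have "\<exists>h. rep I J n \<alpha> i h"
    by (rule rep_exists[OF I J c(1)]) (auto simp: i_def intro!: b)
  moreover have "m \<le> i" by (simp add: i_def)
  ultimately show ?thesis by blast
qed

text \<open>Independence of the representative. In a large degree m the cochains differ by a
  boundary; on the syzygy the summand ending in d disappears, and the other one, after cancelling
  \<open>\<iota>\<close>, is \<open>\<pi> \<sigma> \<iota>\<close>. So the two induced morphisms
  differ by one that factors through \<open>I^m\<close>.\<close>

lemma rep_class_eq_imp:
  assumes I: "cores M I" and J: "cores N J" and r: "rep I J n \<alpha> i0 h0" "rep I J n \<beta> j0 g0"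
    and eq: "stable_class A I J n \<alpha> = stable_class A I J n \<beta>"
  shows "ccl I J n i0 h0 = ccl I J n j0 g0"
proof -
  note c = cores_complex[OF I] cores_complex[OF J]
  note cd = complex_cdiff_simps[OF c(1)] complex_cdiff_simps[OF c(2)]
  obtain s where s: "s \<in> carrier (hom_cx A I J (n - 1))"
    and fin: "finite {i. \<not> \<alpha> i = Plus A (hom_diff A I J (n - 1) s i) (\<beta> i)}"
    using eq stable_Ext_facts(3)[OF c rep_D(2)[OF r(1)] rep_D(2)[OF r(2)]] by auto
  obtain b where b: "\<And>i. int b \<le> i \<Longrightarrow> \<alpha> i = Plus A (hom_diff A I J (n - 1) s i) (\<beta> i)"
    using finite_int_bound[OF fin] by blast
  \<comment> \<open>The bound \<open>nat (1 - n)\<close> gives m + n at least 1, so that the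
    homotopy component in degree m ends in a term \<open>J^k\<close> with k = m + n - 1 still
    nonnegative and a projection out of it is available.\<close>
  define m where "m = max (max i0 j0) (max b (nat (1 - n)))"
  have m: "i0 \<le> m" "j0 \<le> m" "int b \<le> int m" "nat (- n) \<le> m" "1 \<le> int m + n"
    by (auto simp: m_def)
  obtain h where h: "rep I J n \<alpha> m h" "ccl I J n i0 h0 = ccl I J n m h"
    using rep_ccl_move[OF I J r(1) m(1)] by blast
  obtain g where g: "rep I J n \<beta> m g" "ccl I J n j0 g0 = ccl I J n m g"
    using rep_ccl_move[OF I J r(2) m(2)] by blast
  define k where "k = tix n m - 1"
  have k: "tix n m = Suc k" "n - 1 + int m = int k" "n + int m = int (Suc k)" using m(5) by (auto simp: k_def)
  let ?i = "int m"
  define \<sigma> where "\<sigma> = koszul A (n * ?i) (s ?i)"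
  have sm: "s i \<in> Ar A" "Src A (s i) = cobj I i" "Tgt A (s i) = cobj J (n - 1 + i)" for i
    using s by (auto simp: carrier_hom_cx mor_def)
  have ab: "\<alpha> i \<in> Ar A" "Src A (\<alpha> i) = cobj I i" "Tgt A (\<alpha> i) = cobj J (n + i)"
    "\<beta> i \<in> Ar A" "Src A (\<beta> i) = cobj I i" "Tgt A (\<beta> i) = cobj J (n + i)" for i
    using rep_D(2)[OF h(1)] rep_D(2)[OF g(1)] by (auto simp: carrier_hom_cx mor_def)
  have \<sigma>: "\<sigma> \<in> mor A (cob I m) (cob J k)"
    unfolding \<sigma>_def k(2)[symmetric] by (simp add: sm mor_def)
  note \<iota> = Theta_inc_mor[OF I, of m] Theta_inc_mor[OF J, of "Suc k"] and \<pi> = Theta_proj(1)[OF J, of k]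
  have hm: "h \<in> mor A (\<Theta> I m) (\<Theta> J (Suc k))" "g \<in> mor A (\<Theta> I m) (\<Theta> J (Suc k))"
    "\<iota> J (Suc k) \<cdot> h = tw n \<alpha> m \<cdot> \<iota> I m" "\<iota> J (Suc k) \<cdot> g = tw n \<beta> m \<cdot> \<iota> I m"
    using rep_D(3,4)[OF h(1)] rep_D(3,4)[OF g(1)] unfolding k(1) by auto
  \<comment> \<open>The syzygy is the kernel of the differential, so this part of the boundary is
    invisible on it.\<close>
  have z: "(s (?i + 1) \<cdot> cdiff I ?i) \<cdot> \<iota> I m = Zero A (\<Theta> I m) (cobj J (n + ?i))"
  proof -
    have "(s (?i + 1) \<cdot> cdiff I ?i) \<cdot> \<iota> I m = s (?i + 1) \<cdot> (cdiff I ?i \<cdot> \<iota> I m)"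
      using \<iota>(1) by (simp add: mor_def sm cd)
    also have "cdiff I ?i \<cdot> \<iota> I m = Zero A (\<Theta> I m) (cobj I (?i + 1))"
      using kernel_arrow(2)[OF Theta_inc_kernel[OF I] cores_cdiff(1)[OF I]] by (simp add: Theta_def)
    also have "s (?i + 1) \<cdot> \<dots> = Zero A (\<Theta> I m) (cobj J (n + ?i))"
      by (simp add: sm Theta_Ob[OF I])
    finally show ?thesis .
  qed
  define D where "D = cdiff J (n - 1 + ?i)"
  have D: "D \<in> Ar A" "Src A D = cob J k" "Tgt A D = cobj J (n + ?i)"
    unfolding D_def by (simp_all add: cd k(2)) (simp add: k(3) add.commute)
  have D': "D = \<iota> J (Suc k) \<cdot> \<pi> J k" unfolding D_def k(2) Theta_proj(2)[OF J] ..
  have sk: "Tgt A (s ?i) = cob J k" by (simp add: sm k(2))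
  have "hom_diff A I J (n - 1) s ?i = Plus A (D \<cdot> s ?i) (koszul A n (s (?i + 1) \<cdot> cdiff I ?i))"
    by (simp add: hom_diff_koszul D_def)
  then have "tw n \<alpha> m = Plus A (Plus A (D \<cdot> \<sigma>) (koszul A (n * ?i + n) (s (?i + 1) \<cdot> cdiff I ?i))) (tw n \<beta> m)"
    unfolding b[OF m(3)] \<sigma>_def by (simp add: ab sm(1,2) sm(3)[of "?i + 1"] sk D cd koszul_plus koszul_comp koszul_koszul)
  then have "tw n \<alpha> m \<cdot> \<iota> I m = Plus A (Plus A (D \<cdot> \<sigma>) (koszul A (n * ?i + n) (s (?i + 1) \<cdot> cdiff I ?i))) (tw n \<beta> m) \<cdot> \<iota> I m"
    by simp
  also have "\<dots> = Plus A (Plus A (D \<cdot> \<sigma> \<cdot> \<iota> I m)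
      (koszul A (n * ?i + n) ((s (?i + 1) \<cdot> cdiff I ?i) \<cdot> \<iota> I m))) (tw n \<beta> m \<cdot> \<iota> I m)"
    using \<iota>(1) \<sigma> by (simp add: ab sm cd mor_def koszul_comp D)
  also have "\<dots> = Plus A (D \<cdot> \<sigma> \<cdot> \<iota> I m) (tw n \<beta> m \<cdot> \<iota> I m)"
    unfolding z using \<iota>(1) \<sigma> by (simp add: ab sm cd mor_def D Theta_Ob[OF I] cores_cdiff(3)[OF J])
  also have "\<dots> = \<iota> J (Suc k) \<cdot> Plus A (\<pi> J k \<cdot> \<sigma> \<cdot> \<iota> I m) g"
    unfolding hm(4)[symmetric] D'
    using \<iota> \<pi> \<sigma> hm(2) by (auto simp: mor_def)
  finally have "\<iota> J (Suc k) \<cdot> h = \<iota> J (Suc k) \<cdot> Plus A (\<pi> J k \<cdot> \<sigma> \<cdot> \<iota> I m) g" using hm(3) by simp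
  then have "h = Plus A (\<pi> J k \<cdot> \<sigma> \<cdot> \<iota> I m) g"
    by (rule short_exact_mono[OF Theta_proj(3)[OF J]])
      (use \<iota> \<pi> \<sigma> hm(1,2) Theta_src_tgt[OF J] in \<open>auto simp: mor_def\<close>)
  moreover have "\<pi> J k \<cdot> \<sigma> \<cdot> \<iota> I m = (\<pi> J k \<cdot> \<sigma>) \<cdot> \<iota> I m" using \<iota>(1) \<pi> \<sigma> by (auto simp: mor_def)
  ultimately have h_eq: "h = Plus A ((\<pi> J k \<cdot> \<sigma>) \<cdot> \<iota> I m) g" by (simp only:)
  have p\<sigma>: "\<pi> J k \<cdot> \<sigma> \<in> mor A (cob I m) (\<Theta> J (Suc k))" using \<sigma> \<pi> by (rule mor_simps)
  have p\<sigma>i: "(\<pi> J k \<cdot> \<sigma>) \<cdot> \<iota> I m \<in> mor A (\<Theta> I m) (\<Theta> J (Suc k))" using \<iota>(1) p\<sigma> by (rule mor_simps)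
  have "Minus A h g = (\<pi> J k \<cdot> \<sigma>) \<cdot> \<iota> I m"
    by (rule iffD2[OF minus_eq_iff h_eq])
      (use hm(1,2) p\<sigma>i in \<open>simp_all only: mor_def mem_Collect_eq\<close>)
  then have "Minus A h g \<in> factoring A V (\<Theta> I m) (\<Theta> J (Suc k))"
    unfolding factoring_iff_extend[OF I] using p\<sigma> by blast
  then have "hcl I J n m h = hcl I J n m g"
    unfolding k(1) using Hom_mod_class_eq_iff[OF subcat hm(1,2)] by blast
  then have "ccl I J n m h = ccl I J n m g" by (simp only: ccl_def)
  then show ?thesis using h(2) g(2) by simp
qed

lemma rep_class_eq_iff:
  assumes I: "cores M I" and J: "cores N J" and r: "rep I J n \<alpha> i h" "rep I J n \<beta> j g"
  shows "stable_class A I J n \<alpha> = stable_class A I J n \<beta> \<longleftrightarrow> ccl I J n i h = ccl I J n j g"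
proof
  assume "ccl I J n i h = ccl I J n j g"
  then obtain k where k: "i \<le> k" "j \<le> k" "transition (complete_V_step A V I J n) i (k - i) (hcl I J n i h)
       = transition (complete_V_step A V I J n) j (k - j) (hcl I J n j g)"
    using ccl_eq_iff[OF I J rep_D(1,3)[OF r(1)] rep_D(1,3)[OF r(2)]] by blast
  obtain h' where h': "rep I J n \<alpha> k h'"
    "transition (complete_V_step A V I J n) i (k - i) (hcl I J n i h) = hcl I J n k h'"
    using rep_ccl_move[OF I J r(1) k(1)] by blast
  obtain g' where g': "rep I J n \<beta> k g'"
    "transition (complete_V_step A V I J n) j (k - j) (hcl I J n j g) = hcl I J n k g'"
    using rep_ccl_move[OF I J r(2) k(2)] by blast
  show "stable_class A I J n \<alpha> = stable_class A I J n \<beta>"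
    using rep_hcl_eq_imp[OF I J h'(1) g'(1)] h'(2) g'(2) k(3) by simp
qed (rule rep_class_eq_imp[OF I J r])

text \<open>Extend h to a ladder, remove the twist from its middle components and put zero below i.
  This can violate the cocycle equation in nonnegative degrees only just below i, where
  \<open>rep\<close> asks for nothing.\<close>

lemma rep_surj:
  assumes I: "cores M I" and J: "cores N J" and i: "nat (- n) \<le> i" and h: "h \<in> mor A (\<Theta> I i) (\<Theta> J (tix n i))"
  shows "\<exists>\<alpha>. rep I J n \<alpha> i h"
proof -
  note cd = complex_cdiff_simps[OF cores_complex[OF I]] complex_cdiff_simps[OF cores_complex[OF J]]
  obtain hs u where hs: "hs 0 = h" and l: "ladder I i J (tix n i) hs u" using ladder_exists[OF I J h] by blast
  note l = l[unfolded ladder_def ses_map_Theta_iff[OF I J], rule_format]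
  have u: "u j \<in> mor A (cob I (i + j)) (cobj J (n + int (i + j)))" for j
  proof -
    have "int (tix n i + j) = n + int (i + j)" using int_tix[OF i] by simp
    then show ?thesis using l[of j] by metis
  qed
  have um: "u j \<in> Ar A" "Src A (u j) = cob I (i + j)" "Tgt A (u j) = cobj J (n + int (i + j))" for j
    using u[of j] by (auto simp: mor_def)
  define \<alpha> where "\<alpha> l = (if int i \<le> l then koszul A (n * l) (u (nat l - i)) else Zero A (cobj I l) (cobj J (n + l)))" for l
  have a: "\<alpha> (int (i + j)) = koszul A (n * int (i + j)) (u j)" for j by (simp add: \<alpha>_def nat_add_distrib)
  have "\<alpha> l \<in> mor A (cobj I l) (cobj J (n + l))" for l
  proof (cases "int i \<le> l")
    case True
    then have l: "l = int (i + (nat l - i))" by simp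
    show ?thesis using koszul_mor[OF u[of "nat l - i"], of "n * l"] a[of "nat l - i"] l by simp
  qed (simp add: \<alpha>_def mor_simps cores_cdiff(3)[OF I] cores_cdiff(3)[OF J])
  then have \<alpha>: "\<alpha> \<in> carrier (hom_cx A I J n)" by (simp add: carrier_hom_cx)
  have "cdiff J (n + l) \<cdot> \<alpha> l = koszul A n (\<alpha> (l + 1) \<cdot> cdiff I l)" if il: "int i \<le> l" for l
  proof -
    define j where "j = nat l - i"
    have lj: "l = int (i + j)" "l + 1 = int (i + Suc j)" using il by (auto simp: j_def)
    have "cdiff J (n + l) \<cdot> u j = u (Suc j) \<cdot> cdiff I l"
    proof -
      have x: "n + l = int (tix n i + j)" using int_tix[OF i] lj(1) by simp
      note lj' = l[of j] and ls = l[of "Suc j"]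
      note \<iota> = Theta_inc_mor[OF I, of "Suc (i + j)"] Theta_inc_mor[OF J, of "Suc (tix n i + j)"]
        and \<pi> = Theta_proj(1)[OF I, of "i + j"] Theta_proj(1)[OF J, of "tix n i + j"]
      have "cdiff J (n + l) \<cdot> u j = \<iota> J (Suc (tix n i + j)) \<cdot> (\<pi> J (tix n i + j) \<cdot> u j)"
        unfolding x Theta_proj(2)[OF J, symmetric] using lj' \<iota> \<pi> by (auto simp: mor_def)
      also have "\<dots> = (\<iota> J (Suc (tix n i + j)) \<cdot> hs (Suc j)) \<cdot> \<pi> I (i + j)"
        using lj' \<iota> \<pi> by (auto simp: mor_def)
      also have "\<iota> J (Suc (tix n i + j)) \<cdot> hs (Suc j) = u (Suc j) \<cdot> \<iota> I (Suc (i + j))"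
        using ls by simp
      also have "\<dots> \<cdot> \<pi> I (i + j) = u (Suc j) \<cdot> cdiff I l"
        unfolding lj(1) Theta_proj(2)[OF I, symmetric] using um[of "Suc j"] \<iota>(1) \<pi>(1) by (auto simp: mor_def)
      finally show ?thesis .
    qed
    moreover have "\<alpha> l = koszul A (n * l) (u j)" using a[of j] lj(1) by simp
    moreover have "\<alpha> (l + 1) = koszul A (n * l + n) (u (Suc j))"
      using a[of "Suc j"] unfolding lj(2)[symmetric] by (simp add: distrib_left)
    \<comment> \<open>The signs match because n + (n l + n) and n l have the same parity.\<close>
    ultimately show ?thesis
      using um[of j] um[of "Suc j"] koszul_cong[of "n + (n * l + n)" "n * l"]
      unfolding lj(1)[symmetric] lj(2)[symmetric]
      by (simp add: koszul_comp cd koszul_koszul)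
  qed
  moreover have "\<iota> J (tix n i) \<cdot> h = tw n \<alpha> i \<cdot> \<iota> I i"
  proof -
    have "tw n \<alpha> i = u 0" using a[of 0] um[of 0] by (simp add: koszul_twice)
    then show ?thesis using l[of 0] hs by simp
  qed
  ultimately show ?thesis using \<alpha> i h unfolding rep_def by blast
qed

lemma rep_plus:
  assumes I: "cores M I" and J: "cores N J" and r: "rep I J n \<alpha> i h" "rep I J n \<beta> i g"
  shows "rep I J n (\<lambda>i. Plus A (\<alpha> i) (\<beta> i)) i (Plus A h g)"
proof -
  note c = cores_complex[OF I] cores_complex[OF J]
  note cd = complex_cdiff_simps[OF c(1)] complex_cdiff_simps[OF c(2)]
  have ab: "\<alpha> i \<in> Ar A" "Src A (\<alpha> i) = cobj I i" "Tgt A (\<alpha> i) = cobj J (n + i)"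
    "\<beta> i \<in> Ar A" "Src A (\<beta> i) = cobj I i" "Tgt A (\<beta> i) = cobj J (n + i)" for i
    using rep_D(2)[OF r(1)] rep_D(2)[OF r(2)] by (auto simp: carrier_hom_cx mor_def)
  have "(\<lambda>i. Plus A (\<alpha> i) (\<beta> i)) \<in> carrier (hom_cx A I J n)"
    using ab by (simp add: carrier_hom_cx mor_def)
  moreover have "cdiff J (n + j) \<cdot> Plus A (\<alpha> j) (\<beta> j) = koszul A n (Plus A (\<alpha> (j + 1)) (\<beta> (j + 1)) \<cdot> cdiff I j)"
    if "int i \<le> j" for j
  proof -
    have "cdiff J (n + j) \<cdot> \<alpha> j = koszul A n (\<alpha> (j + 1) \<cdot> cdiff I j)"
      "cdiff J (n + j) \<cdot> \<beta> j = koszul A n (\<beta> (j + 1) \<cdot> cdiff I j)" using r that by (auto simp: rep_def)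
    then show ?thesis by (simp add: ab cd koszul_plus)
  qed
  moreover have "Plus A h g \<in> mor A (\<Theta> I i) (\<Theta> J (tix n i))"
    using rep_D(3)[OF r(1)] rep_D(3)[OF r(2)] by (rule mor_simps)
  moreover have "\<iota> J (tix n i) \<cdot> Plus A h g = koszul A (n * int i) (Plus A (\<alpha> (int i)) (\<beta> (int i))) \<cdot> \<iota> I i"
  proof -
    have "\<iota> J (tix n i) \<cdot> Plus A h g = Plus A (\<iota> J (tix n i) \<cdot> h) (\<iota> J (tix n i) \<cdot> g)"
      using rep_D(3)[OF r(1)] rep_D(3)[OF r(2)] Theta_inc_mor[OF J] by (auto simp: mor_def)
    also have "\<dots> = koszul A (n * int i) (Plus A (\<alpha> (int i)) (\<beta> (int i))) \<cdot> \<iota> I i"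
      unfolding rep_D(4)[OF r(1)] rep_D(4)[OF r(2)] using Theta_inc_mor[OF I, of i]
      by (simp add: ab koszul_plus mor_def)
    finally show ?thesis .
  qed
  ultimately show ?thesis using rep_D(1)[OF r(1)] unfolding rep_def by blast
qed

text \<open>The second clause fixes the isomorphism on all representatives; naturality is later read
  off from it, with no further access to how the function was chosen.\<close>

lemma stable_complete_iso:
  assumes I: "cores M I" and J: "cores N J"
  shows "\<exists>F\<in>iso (stable_Ext A I J n) (complete_Ext_V A V I J n).
    \<forall>\<alpha> i h. rep I J n \<alpha> i h \<longrightarrow> F (stable_class A I J n \<alpha>) = ccl I J n i h"
proof -
  note c = cores_complex[OF I] cores_complex[OF J]
  let ?R = "\<lambda>\<alpha> y. \<exists>i h. rep I J n \<alpha> i h \<and> y = ccl I J n i h"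
  have "\<exists>F\<in>iso (stable_Ext A I J n) (complete_Ext_V A V I J n).
    \<forall>\<alpha>\<in>stable_cocycle A I J n. \<forall>y\<in>carrier (complete_Ext_V A V I J n). ?R \<alpha> y \<longrightarrow> F (stable_class A I J n \<alpha>) = y"
  proof (rule iso_of_relation[OF stable_Ext_facts(1)[OF c]])
    show "\<exists>y\<in>carrier (complete_Ext_V A V I J n). ?R \<alpha> y" if "\<alpha> \<in> stable_cocycle A I J n" for \<alpha>
      using cocycle_rep[OF I J that] rep_ccl_carrier[OF I J] by blast
    show "\<exists>\<alpha>\<in>stable_cocycle A I J n. ?R \<alpha> y" if y: "y \<in> carrier (complete_Ext_V A V I J n)" for y
    proof -
      obtain i h where ih: "nat (- n) \<le> i" "h \<in> mor A (\<Theta> I i) (\<Theta> J (tix n i))" "y = ccl I J n i h"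
        using y unfolding carrier_complete[OF I J] by blast
      then show ?thesis using rep_surj[OF I J ih(1,2)] rep_cocycle[OF I J] by blast
    qed
    fix \<alpha> \<beta> y z
    assume ab: "\<alpha> \<in> stable_cocycle A I J n" "\<beta> \<in> stable_cocycle A I J n" and R: "?R \<alpha> y" "?R \<beta> z"
    obtain i h j g where r: "rep I J n \<alpha> i h" "rep I J n \<beta> j g" "y = ccl I J n i h" "z = ccl I J n j g"
      using R by blast
    show "stable_class A I J n \<alpha> = stable_class A I J n \<beta> \<longleftrightarrow> y = z"
      unfolding r(3,4) by (rule rep_class_eq_iff[OF I J r(1,2)])
    \<comment> \<open>Addition in the colimit is visible only for classes at one level, so both are
      first raised to the larger one.\<close>
    obtain h' g' where r': "rep I J n \<alpha> (max i j) h'" "rep I J n \<beta> (max i j) g'"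
      "y = ccl I J n (max i j) h'" "z = ccl I J n (max i j) g'"
      using rep_ccl_move[OF I J r(1), of "max i j"] rep_ccl_move[OF I J r(2), of "max i j"] r(3,4) by auto
    note p = rep_plus[OF I J r'(1,2)]
    have yz: "y \<otimes>\<^bsub>complete_Ext_V A V I J n\<^esub> z = ccl I J n (max i j) (Plus A h' g')"
      unfolding r'(3,4) by (rule ccl_mult[OF I J rep_D(1,3)[OF r'(1)] rep_D(3)[OF r'(2)]])
    have "y \<otimes>\<^bsub>complete_Ext_V A V I J n\<^esub> z \<in> carrier (complete_Ext_V A V I J n)"
      unfolding yz by (rule rep_ccl_carrier[OF I J p])
    moreover have "stable_class A I J n (\<lambda>i. Plus A (\<alpha> i) (\<beta> i))
        = stable_class A I J n \<alpha> \<otimes>\<^bsub>stable_Ext A I J n\<^esub> stable_class A I J n \<beta>"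
      by (rule stable_Ext_facts(2)[OF c rep_D(2)[OF r(1)] rep_D(2)[OF r(2)]])
    ultimately show "y \<otimes>\<^bsub>complete_Ext_V A V I J n\<^esub> z \<in> carrier (complete_Ext_V A V I J n) \<and>
      (\<exists>e\<in>stable_cocycle A I J n. stable_class A I J n e
          = stable_class A I J n \<alpha> \<otimes>\<^bsub>stable_Ext A I J n\<^esub> stable_class A I J n \<beta> \<and>
        ?R e (y \<otimes>\<^bsub>complete_Ext_V A V I J n\<^esub> z))"
      using p rep_cocycle[OF I J p] yz by blast
  qed
  then obtain F where F: "F \<in> iso (stable_Ext A I J n) (complete_Ext_V A V I J n)"
    and F': "\<And>\<alpha> y. \<alpha> \<in> stable_cocycle A I J n \<Longrightarrow> y \<in> carrier (complete_Ext_V A V I J n) \<Longrightarrow> ?R \<alpha> y \<Longrightarrow>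
      F (stable_class A I J n \<alpha>) = y" by blast
  have "F (stable_class A I J n \<alpha>) = ccl I J n i h" if r: "rep I J n \<alpha> i h" for \<alpha> i h
    using F'[OF rep_cocycle[OF I J r] rep_ccl_carrier[OF I J r]] r by blast
  then show ?thesis using F by blast
qed

end

section \<open>Functoriality\<close>

context coresolving
begin

abbreviation lift :: "('o, 'm) augmented \<Rightarrow> 'm \<Rightarrow> ('o, 'm) augmented \<Rightarrow> (int \<Rightarrow> 'm) \<Rightarrow> bool" where
  "lift \<equiv> coresolution_lift A"

lemma liftD:
  assumes "lift I f J \<phi>"
  shows "cochain_map A I J \<phi>" "\<phi> 0 \<cdot> aug I = aug J \<cdot> f" "\<phi> i \<in> mor A (cobj I i) (cobj J i)"
    "cdiff J i \<cdot> \<phi> i = \<phi> (i + 1) \<cdot> cdiff I i"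
  using assms cochain_mapD[of I J \<phi>] by (auto simp: coresolution_lift_def)

lemma liftD_Suc:
  assumes "lift I f J \<phi>"
  shows "cdiff J (int i) \<cdot> \<phi> (int i) = \<phi> (int (Suc i)) \<cdot> cdiff I (int i)"
  using liftD(4)[OF assms, of "int i"] by (simp add: add.commute)

text \<open>As the zeroth syzygy is the object itself, a lift of f is the row of middle components
  of a ladder starting at f, continued by zero in negative degrees.\<close>

lemma lift_exists:
  assumes I: "cores M I" and J: "cores N J" and f: "f \<in> mor A M N"
  shows "\<exists>\<phi>. lift I f J \<phi>"
proof -
  note cd = cores_cdiff[OF I] cores_cdiff[OF J]
  have "f \<in> mor A (\<Theta> I 0) (\<Theta> J 0)" using f Theta_0[OF I] Theta_0[OF J] by simp
  from ladder_exists[OF I J this] obtain h u where h: "h 0 = f" and l: "ladder I 0 J 0 h u" by blast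
  have l: "h j \<in> mor A (\<Theta> I j) (\<Theta> J j)" "u j \<in> mor A (cob I j) (cob J j)"
    "u j \<cdot> \<iota> I j = \<iota> J j \<cdot> h j" "\<pi> J j \<cdot> u j = h (Suc j) \<cdot> \<pi> I j" for j
    using l[unfolded ladder_def ses_map_Theta_iff[OF I J], rule_format, of j] by auto
  have comm: "cdiff J (int j) \<cdot> u j = u (Suc j) \<cdot> cdiff I (int j)" for j
  proof -
    note \<iota> = Theta_inc_mor[OF I, of "Suc j"] Theta_inc_mor[OF J, of "Suc j"]
      and \<pi> = Theta_proj(1)[OF I, of j] Theta_proj(1)[OF J, of j]
    have "cdiff J (int j) \<cdot> u j = \<iota> J (Suc j) \<cdot> (\<pi> J j \<cdot> u j)"
      unfolding Theta_proj(2)[OF J, symmetric] using l(2)[of j] \<iota> \<pi> by (auto simp: mor_def)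
    also have "\<dots> = (\<iota> J (Suc j) \<cdot> h (Suc j)) \<cdot> \<pi> I j"
      unfolding l(4) using l(1)[of "Suc j"] \<iota> \<pi> by (auto simp: mor_def)
    also have "\<dots> = u (Suc j) \<cdot> cdiff I (int j)"
      unfolding l(3)[symmetric] Theta_proj(2)[OF I, symmetric] using l(2)[of "Suc j"] \<iota> \<pi> by (auto simp: mor_def)
    finally show ?thesis .
  qed
  define \<phi> where "\<phi> i = (if 0 \<le> i then u (nat i) else Zero A (cobj I i) (cobj J i))" for i
  have \<phi>: "\<phi> i \<in> mor A (cobj I i) (cobj J i)" for i
    using l(2)[of "nat i"] cd(3,6) by (cases "0 \<le> i") (simp_all add: \<phi>_def mor_simps)
  have "cdiff J i \<cdot> \<phi> i = \<phi> (i + 1) \<cdot> cdiff I i" for i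
  proof (cases "0 \<le> i")
    case True
    then show ?thesis using comm[of "nat i"] by (simp add: \<phi>_def nat_add_distrib)
  next
    case False
    show ?thesis
      by (rule zero_object_unique(1)[OF cores_neg[OF I], of i _ "cobj J (i + 1)"])
        (use False mor_simps(1)[OF \<phi>[of i] cd(4)[of i]] mor_simps(1)[OF cd(1)[of i] \<phi>[of "i + 1"]] in auto)
  qed
  moreover have "\<phi> 0 \<cdot> aug I = aug J \<cdot> f" using l(3)[of 0] h by (simp add: \<phi>_def Theta_inc_def)
  ultimately show ?thesis using \<phi> by (auto simp: coresolution_lift_def cochain_map_def)
qed

lemma lift_comp:
  assumes I: "cores M I" and J: "cores N J" and K: "cores L K" and f: "f \<in> mor A M N" and g: "g \<in> mor A N L"
    and \<phi>: "lift I f J \<phi>" and \<psi>: "lift J g K \<psi>"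
  shows "lift I (g \<cdot> f) K (\<lambda>i. \<psi> i \<cdot> \<phi> i)"
proof -
  note cd = cores_cdiff(1)[OF I] cores_cdiff(1)[OF J] cores_cdiff(1)[OF K]
  note aug = cores_aug[OF I] cores_aug[OF J] cores_aug[OF K]
  note m = liftD(3)[OF \<phi>] liftD(3)[OF \<psi>]
  have "cdiff K i \<cdot> \<psi> i \<cdot> \<phi> i = (\<psi> (i + 1) \<cdot> \<phi> (i + 1)) \<cdot> cdiff I i" for i
  proof -
    have "cdiff K i \<cdot> \<psi> i \<cdot> \<phi> i = (cdiff K i \<cdot> \<psi> i) \<cdot> \<phi> i"
      using m(1)[of i] m(2)[of i] cd(3)[of i] by (auto simp: mor_def)
    also have "\<dots> = \<psi> (i + 1) \<cdot> (cdiff J i \<cdot> \<phi> i)"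
      unfolding liftD(4)[OF \<psi>] using m(1)[of i] m(2)[of "i + 1"] cd(2)[of i] by (auto simp: mor_def)
    also have "\<dots> = (\<psi> (i + 1) \<cdot> \<phi> (i + 1)) \<cdot> cdiff I i"
      unfolding liftD(4)[OF \<phi>] using m(1)[of "i + 1"] m(2)[of "i + 1"] cd(1)[of i] by (auto simp: mor_def)
    finally show ?thesis .
  qed
  moreover have "(\<psi> 0 \<cdot> \<phi> 0) \<cdot> aug I = aug K \<cdot> g \<cdot> f"
  proof -
    have "(\<psi> 0 \<cdot> \<phi> 0) \<cdot> aug I = \<psi> 0 \<cdot> (\<phi> 0 \<cdot> aug I)" using m(1)[of 0] m(2)[of 0] aug by (auto simp: mor_def)
    also have "\<dots> = (\<psi> 0 \<cdot> aug J) \<cdot> f" unfolding liftD(2)[OF \<phi>] using m(2)[of 0] aug f by (auto simp: mor_def)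
    also have "\<dots> = aug K \<cdot> g \<cdot> f" unfolding liftD(2)[OF \<psi>] using aug f g by (auto simp: mor_def)
    finally show ?thesis .
  qed
  moreover have "\<psi> i \<cdot> \<phi> i \<in> mor A (cobj I i) (cobj K i)" for i using m by (rule mor_simps(1))
  ultimately show ?thesis by (auto simp: coresolution_lift_def cochain_map_def)
qed

lemma lift_ident:
  assumes I: "cores M I"
  shows "lift I (Ident A M) I (\<lambda>i. Ident A (cobj I i))"
  using cores_cdiff[OF I] cores_aug[OF I]
  by (auto simp: coresolution_lift_def cochain_map_def mor_def)

section \<open>Morphisms induced on syzygies, and independence of the lifts\<close>

abbreviation "T \<equiv> Theta_map A"

lemma Theta_map_unique:
  assumes J: "cores N J" and h: "h \<in> mor A (\<Theta> I i) (\<Theta> J i)" "\<iota> J i \<cdot> h = \<phi> (int i) \<cdot> \<iota> I i"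
  shows "T I J \<phi> i = h"
  unfolding Theta_map_def
proof (rule the_equality)
  fix h' assume h': "h' \<in> mor A (\<Theta> I i) (\<Theta> J i) \<and> \<iota> J i \<cdot> h' = \<phi> (int i) \<cdot> \<iota> I i"
  then have "\<iota> J i \<cdot> h' = \<iota> J i \<cdot> h" using h by simp
  then show "h' = h"
    by (rule short_exact_mono[OF Theta_proj(3)[OF J]]) (use h h' Theta_src_tgt[OF J] in auto)
qed (use h in auto)

lemma Theta_map:
  assumes I: "cores M I" and J: "cores N J" and \<phi>: "lift I f J \<phi>"
  shows "T I J \<phi> i \<in> mor A (\<Theta> I i) (\<Theta> J i)" "\<iota> J i \<cdot> T I J \<phi> i = \<phi> (int i) \<cdot> \<iota> I i"
proof -
  note \<iota> = Theta_inc_mor[OF I, of i] and m = liftD(3)[OF \<phi>] and cd = cores_cdiff_Suc[OF I] cores_cdiff_Suc[OF J]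
  have pi: "\<phi> (int i) \<cdot> \<iota> I i \<in> mor A (\<Theta> I i) (cob J i)" using \<iota> m by (rule mor_simps)
  have "cdiff J (int i) \<cdot> (\<phi> (int i) \<cdot> \<iota> I i) = (cdiff J (int i) \<cdot> \<phi> (int i)) \<cdot> \<iota> I i"
    using \<iota> m[of "int i"] cd(2)[of i] by (auto simp: mor_def)
  also have "\<dots> = \<phi> (int (Suc i)) \<cdot> (cdiff I (int i) \<cdot> \<iota> I i)"
    unfolding liftD_Suc[OF \<phi>] using \<iota> m[of "int (Suc i)"] cd(1)[of i] by (auto simp: mor_def)
  also have "\<dots> = Zero A (\<Theta> I i) (cob J (Suc i))"
    using kernel_arrow(2)[OF Theta_inc_kernel[OF I] cd(1)] \<iota> m[of "int (Suc i)"] cores_cdiff(3)[OF I]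
    by (auto simp: mor_def Theta_def)
  finally obtain h where h: "h \<in> mor A (\<Theta> I i) (\<Theta> J i)" "\<iota> J i \<cdot> h = \<phi> (int i) \<cdot> \<iota> I i"
    using kernel_factor[OF Theta_inc_kernel[OF J] cd(2) pi] by (auto simp: Theta_src_tgt[OF J])
  then have "T I J \<phi> i = h" by (rule Theta_map_unique[OF J])
  then show "T I J \<phi> i \<in> mor A (\<Theta> I i) (\<Theta> J i)" "\<iota> J i \<cdot> T I J \<phi> i = \<phi> (int i) \<cdot> \<iota> I i"
    using h by auto
qed

text \<open>The restrictions of a lift to the syzygies form a ladder, so the transition maps take
  each restriction to the next.\<close>

lemma Theta_map_ses:
  assumes I: "cores M I" and J: "cores N J" and \<phi>: "lift I f J \<phi>"
  shows "ses_map A (Theta_seq A I i) (Theta_seq A J i) (T I J \<phi> i) (\<phi> (int i)) (T I J \<phi> (Suc i))"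
proof -
  note \<iota> = Theta_inc_mor[OF I, of "Suc i"] Theta_inc_mor[OF J, of "Suc i"]
    and \<pi> = Theta_proj(1)[OF I, of i] Theta_proj(1)[OF J, of i]
  note t = Theta_map[OF I J \<phi>] and m = liftD(3)[OF \<phi>]
  have "\<iota> J (Suc i) \<cdot> (\<pi> J i \<cdot> \<phi> (int i)) = cdiff J (int i) \<cdot> \<phi> (int i)"
    unfolding Theta_proj(2)[OF J, symmetric] using \<iota> \<pi> m[of "int i"] by (auto simp: mor_def)
  also have "\<dots> = (\<phi> (int (Suc i)) \<cdot> \<iota> I (Suc i)) \<cdot> \<pi> I i"
    unfolding liftD_Suc[OF \<phi>] Theta_proj(2)[OF I, symmetric] using \<iota> \<pi> m[of "int (Suc i)"] by (auto simp: mor_def)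
  also have "\<dots> = \<iota> J (Suc i) \<cdot> (T I J \<phi> (Suc i) \<cdot> \<pi> I i)"
    unfolding t(2)[symmetric] using \<iota> \<pi> t(1)[of "Suc i"] by (auto simp: mor_def)
  finally have "\<pi> J i \<cdot> \<phi> (int i) = T I J \<phi> (Suc i) \<cdot> \<pi> I i"
    by (rule short_exact_mono[OF Theta_proj(3)[OF J]])
      (use \<pi> m[of "int i"] t(1)[of "Suc i"] Theta_src_tgt[OF J] in \<open>auto simp: mor_def\<close>)
  then show ?thesis unfolding ses_map_Theta_iff[OF I J] using t m by auto
qed

lemma Theta_map_comp:
  assumes I: "cores M I" and J: "cores N J" and K: "cores L K" and \<phi>: "lift I f J \<phi>" and \<psi>: "lift J g K \<psi>"
  shows "T I K (\<lambda>i. \<psi> i \<cdot> \<phi> i) i = T J K \<psi> i \<cdot> T I J \<phi> i"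
proof (rule Theta_map_unique[OF K])
  note t = Theta_map[OF I J \<phi>, of i] and t' = Theta_map[OF J K \<psi>, of i]
  note \<iota> = Theta_inc_mor[OF I, of i] Theta_inc_mor[OF J, of i] Theta_inc_mor[OF K, of i]
  note m = liftD(3)[OF \<phi>, of "int i"] liftD(3)[OF \<psi>, of "int i"]
  show "T J K \<psi> i \<cdot> T I J \<phi> i \<in> mor A (\<Theta> I i) (\<Theta> K i)" using t(1) t'(1) by (rule mor_simps)
  have "\<iota> K i \<cdot> T J K \<psi> i \<cdot> T I J \<phi> i = (\<iota> K i \<cdot> T J K \<psi> i) \<cdot> T I J \<phi> i"
    using \<iota>(3) t(1) t'(1) by (auto simp: mor_def)
  also have "\<dots> = \<psi> (int i) \<cdot> (\<iota> J i \<cdot> T I J \<phi> i)"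
    unfolding t'(2) using \<iota>(2) t(1) m by (auto simp: mor_def)
  also have "\<dots> = (\<psi> (int i) \<cdot> \<phi> (int i)) \<cdot> \<iota> I i"
    unfolding t(2) using \<iota>(1) m by (auto simp: mor_def)
  finally show "\<iota> K i \<cdot> T J K \<psi> i \<cdot> T I J \<phi> i = (\<psi> (int i) \<cdot> \<phi> (int i)) \<cdot> \<iota> I i" .
qed

lemma Theta_map_ident:
  assumes I: "cores M I"
  shows "T I I (\<lambda>i. Ident A (cobj I i)) i = Ident A (\<Theta> I i)"
  by (rule Theta_map_unique[OF I])
    (use Theta_inc_mor[OF I, of i] Theta_Ob[OF I] in \<open>auto simp: mor_def\<close>)

text \<open>At level 0 both restrictions are f. The class at level i + 1 is the transition of the
  class at level i, so equality propagates; no homotopy between the two lifts has to be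
  constructed.\<close>

lemma Theta_map_class_unique:
  assumes I: "cores M I" and J: "cores N J" and \<phi>: "lift I f J \<phi>" and \<psi>: "lift I f J \<psi>"
  shows "Hom_mod_class A V (\<Theta> I i) (\<Theta> J i) (T I J \<phi> i) = Hom_mod_class A V (\<Theta> I i) (\<Theta> J i) (T I J \<psi> i)"
proof (induction i)
  case 0
  have "T I J \<phi> 0 = T I J \<psi> 0"
  proof (rule Theta_map_unique[OF J])
    show "T I J \<psi> 0 \<in> mor A (\<Theta> I 0) (\<Theta> J 0)" by (rule Theta_map[OF I J \<psi>])
    show "\<iota> J 0 \<cdot> T I J \<psi> 0 = \<phi> (int 0) \<cdot> \<iota> I 0"
      using Theta_map(2)[OF I J \<psi>, of 0] liftD(2)[OF \<phi>] liftD(2)[OF \<psi>] by (simp add: Theta_inc_def)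
  qed
  then show ?case by simp
next
  case (Suc i)
  then show ?case
    using Hom_mod_step(2)[OF I J Theta_map_ses[OF I J \<phi>], of i] Hom_mod_step(2)[OF I J Theta_map_ses[OF I J \<psi>], of i]
    by simp
qed

text \<open>Morphisms through V form a two-sided ideal, and g f - g' f' is the sum of g (f - f') and
  (g - g') f'.\<close>

lemma Hom_mod_class_comp_cong:
  assumes f: "f \<in> mor A X Y" "f' \<in> mor A X Y" and g: "g \<in> mor A Y Z" "g' \<in> mor A Y Z"
    and eq: "Hom_mod_class A V X Y f = Hom_mod_class A V X Y f'" "Hom_mod_class A V Y Z g = Hom_mod_class A V Y Z g'"
  shows "Hom_mod_class A V X Z (g \<cdot> f) = Hom_mod_class A V X Z (g' \<cdot> f')"
proof -
  have X: "X \<in> Ob A" and Y: "Y \<in> Ob A" and Z: "Z \<in> Ob A" using f g mor_objects by blast+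
  have "Minus A f f' \<in> factoring A V X Y" "Minus A g g' \<in> factoring A V Y Z"
    using eq Hom_mod_class_eq_iff[OF subcat f] Hom_mod_class_eq_iff[OF subcat g] by auto
  then have "g \<cdot> Minus A f f' \<cdot> Ident A X \<in> factoring A V X Z" "Ident A Z \<cdot> Minus A g g' \<cdot> f' \<in> factoring A V X Z"
    using factoring_comp mor_simps(6)[OF X] mor_simps(6)[OF Z] f g by blast+
  moreover have "g \<cdot> Minus A f f' \<cdot> Ident A X = Minus A (g \<cdot> f) (g \<cdot> f')"
    "Ident A Z \<cdot> Minus A g g' \<cdot> f' = Minus A (g \<cdot> f') (g' \<cdot> f')"
    using f g X Z by (auto simp: mor_def)
  ultimately have "Minus A (g \<cdot> f) (g \<cdot> f') \<in> factoring A V X Z" "Minus A (g \<cdot> f') (g' \<cdot> f') \<in> factoring A V X Z"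
    by simp_all
  then show ?thesis
    using Hom_mod_class_eq_iff[OF subcat] mor_simps(1)[OF f(1) g(1)] mor_simps(1)[OF f(2) g(1)] mor_simps(1)[OF f(2) g(2)]
    by metis
qed

text \<open>Composition with the restricted lifts respects the ideal at each level and commutes with
  the transition maps, so it can be evaluated on any representative.\<close>

lemma act_class:
  assumes I: "cores M I" and I': "cores M' I'" and J: "cores N J" and J': "cores N' J'"
    and \<phi>: "lift I' f I \<phi>" and \<gamma>: "lift J g J' \<gamma>"
    and i: "nat (- n) \<le> i" and h: "h \<in> mor A (\<Theta> I i) (\<Theta> J (tix n i))"
  shows "complete_Ext_act_V A V I' I J J' n \<phi> \<gamma> (ccl I J n i h)
    = ccl I' J' n i (T J J' \<gamma> (tix n i) \<cdot> h \<cdot> T I' I \<phi> i)"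
proof -
  define u where "u i = coset_map (Hom A (\<Theta> I' i) (\<Theta> J' (tix n i))) (factoring A V (\<Theta> I' i) (\<Theta> J' (tix n i)))
            (\<lambda>h. T J J' \<gamma> (tix n i) \<cdot> h \<cdot> T I' I \<phi> i)" for i
  let ?F = "\<lambda>i h. T J J' \<gamma> (tix n i) \<cdot> h \<cdot> T I' I \<phi> i"
  note t = Theta_map(1)[OF I' I \<phi>] and s = Theta_map(1)[OF J J' \<gamma>]
  have F: "?F i h \<in> mor A (\<Theta> I' i) (\<Theta> J' (tix n i))" if "h \<in> mor A (\<Theta> I i) (\<Theta> J (tix n i))" for i h
    using t[of i] s[of "tix n i"] that by (intro mor_simps(1))
  have u: "u i (hcl I J n i h) = hcl I' J' n i (?F i h)" if h: "h \<in> mor A (\<Theta> I i) (\<Theta> J (tix n i))" for i h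
    unfolding u_def Hom_mod_class_def
  proof (rule coset_map_rcos)
    show "group (Hom A (\<Theta> I i) (\<Theta> J (tix n i)))" "group (Hom A (\<Theta> I' i) (\<Theta> J' (tix n i)))"
      using Theta_Ob[OF I] Theta_Ob[OF J] Theta_Ob[OF I'] Theta_Ob[OF J'] by (auto intro: Hom_group)
    show "subgroup (factoring A V (\<Theta> I i) (\<Theta> J (tix n i))) (Hom A (\<Theta> I i) (\<Theta> J (tix n i)))"
      by (rule factoring_subgroup[OF subcat Theta_Ob[OF I] Theta_Ob[OF J]])
    show "subgroup (factoring A V (\<Theta> I' i) (\<Theta> J' (tix n i))) (Hom A (\<Theta> I' i) (\<Theta> J' (tix n i)))"
      by (rule factoring_subgroup[OF subcat Theta_Ob[OF I'] Theta_Ob[OF J']])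
    show "?F i \<in> hom (Hom A (\<Theta> I i) (\<Theta> J (tix n i))) (Hom A (\<Theta> I' i) (\<Theta> J' (tix n i)))"
    proof (rule homI)
      show "?F i h \<in> carrier (Hom A (\<Theta> I' i) (\<Theta> J' (tix n i)))" if "h \<in> carrier (Hom A (\<Theta> I i) (\<Theta> J (tix n i)))" for h
        using that F by simp
      fix h g assume "h \<in> carrier (Hom A (\<Theta> I i) (\<Theta> J (tix n i)))" "g \<in> carrier (Hom A (\<Theta> I i) (\<Theta> J (tix n i)))"
      then show "?F i (h \<otimes>\<^bsub>Hom A (\<Theta> I i) (\<Theta> J (tix n i))\<^esub> g) = ?F i h \<otimes>\<^bsub>Hom A (\<Theta> I' i) (\<Theta> J' (tix n i))\<^esub> ?F i g"
        using t[of i] s[of "tix n i"] by (auto simp: mor_def)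
    qed
    show "?F i ` factoring A V (\<Theta> I i) (\<Theta> J (tix n i)) \<subseteq> factoring A V (\<Theta> I' i) (\<Theta> J' (tix n i))"
      using factoring_comp[OF _ t s] by auto
    show "h \<in> carrier (Hom A (\<Theta> I i) (\<Theta> J (tix n i)))" using h by simp
  qed
  have "seq_colim_map (nat (- n)) (complete_V_obj A V I' J' n) (complete_V_step A V I' J' n) u (ccl I J n i h)
    = colim_rel (nat (- n)) (complete_V_obj A V I' J' n) (complete_V_step A V I' J' n) `` {(i, u i (hcl I J n i h))}"
    unfolding ccl_def
  proof (rule direct_system.seq_colim_map_class[OF complete_direct_system[OF I J] complete_direct_system[OF I' J']])
    fix i c assume i: "nat (- n) \<le> i" and "c \<in> carrier (complete_V_obj A V I J n i)"
    then obtain h where h: "h \<in> mor A (\<Theta> I i) (\<Theta> J (tix n i))" "c = hcl I J n i h"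
      by (auto simp: complete_V_obj_def Hom_mod_carrier)
    show "u i c \<in> carrier (complete_V_obj A V I' J' n i)"
      unfolding h(2) u[OF h(1)] by (rule hcl_carrier[OF F[OF h(1)]])
    obtain v h' where m: "ses_map A (Theta_seq A I i) (Theta_seq A J (tix n i)) h v h'"
      using step_exists[OF I J h(1)] by blast
    then have h': "h' \<in> mor A (\<Theta> I (Suc i)) (\<Theta> J (tix n (Suc i)))"
      unfolding tix_Suc[OF i] by (simp add: ses_map_Theta_iff[OF I J])
    have sh: "short_exact A (fst (Theta_seq A K j)) (snd (Theta_seq A K j))" if "cores L K" for L K j
      using Theta_proj(3)[OF that] by (simp add: Theta_seq_def)
    \<comment> \<open>Stacking the rung of one lift, a rung below h and the rung of the other lift
      gives a map of short exact sequences, which computes the transition of the conjugated morphism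
      as the conjugate of h'.\<close>
    have "ses_map A (Theta_seq A I' i) (Theta_seq A J' (tix n i)) (?F i h)
        (\<gamma> (int (tix n i)) \<cdot> v \<cdot> \<phi> (int i)) (T J J' \<gamma> (Suc (tix n i)) \<cdot> h' \<cdot> T I' I \<phi> (Suc i))"
      by (rule ses_map_comp[OF ses_map_comp[OF Theta_map_ses[OF I' I \<phi>] m] Theta_map_ses[OF J J' \<gamma>]])
        (rule sh I I' J J')+
    then have m': "ses_map A (Theta_seq A I' i) (Theta_seq A J' (tix n i)) (?F i h)
        (\<gamma> (int (tix n i)) \<cdot> v \<cdot> \<phi> (int i)) (?F (Suc i) h')"
      unfolding tix_Suc[OF i] .
    show "u (Suc i) (complete_V_step A V I J n i c) = complete_V_step A V I' J' n i (u i c)"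
      unfolding h(2) u[OF h(1)] complete_step[OF I J i m] complete_step[OF I' J' i m'] u[OF h'] ..
  qed (use i hcl_carrier[OF h] in auto)
  then show ?thesis unfolding complete_Ext_act_V_def Let_def u_def[symmetric] u[OF h] ccl_def .
qed

text \<open>Different lifts restrict to equal classes modulo V, and composition respects such
  classes. All actions therefore agree and the \<open>THE\<close> is determined.\<close>

lemma complete_map:
  assumes I: "cores M I" and I': "cores M' I'" and J: "cores N J" and J': "cores N' J'"
    and \<phi>: "lift I' f I \<phi>" and \<gamma>: "lift J g J' \<gamma>"
    and i: "nat (- n) \<le> i" and h: "h \<in> mor A (\<Theta> I i) (\<Theta> J (tix n i))"
  shows "complete_Ext_map_V A V I' I J J' n f g (ccl I J n i h)
    = ccl I' J' n i (T J J' \<gamma> (tix n i) \<cdot> h \<cdot> T I' I \<phi> i)"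
  unfolding complete_Ext_map_V_def
proof (rule the_equality)
  show "\<exists>\<phi>' \<gamma>'. lift I' f I \<phi>' \<and> lift J g J' \<gamma>' \<and>
    ccl I' J' n i (T J J' \<gamma> (tix n i) \<cdot> h \<cdot> T I' I \<phi> i) = complete_Ext_act_V A V I' I J J' n \<phi>' \<gamma>' (ccl I J n i h)"
    using act_class[OF I I' J J' \<phi> \<gamma> i h] \<phi> \<gamma> by metis
  fix y assume "\<exists>\<phi>' \<gamma>'. lift I' f I \<phi>' \<and> lift J g J' \<gamma>' \<and>
    y = complete_Ext_act_V A V I' I J J' n \<phi>' \<gamma>' (ccl I J n i h)"
  then obtain \<phi>' \<gamma>' where l: "lift I' f I \<phi>'" "lift J g J' \<gamma>'"
    and y: "y = complete_Ext_act_V A V I' I J J' n \<phi>' \<gamma>' (ccl I J n i h)" by blast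
  have "hcl I' J' n i (T J J' \<gamma>' (tix n i) \<cdot> h \<cdot> T I' I \<phi>' i) = hcl I' J' n i (T J J' \<gamma> (tix n i) \<cdot> h \<cdot> T I' I \<phi> i)"
  proof -
    note t = Theta_map(1)[OF I' I \<phi>, of i] Theta_map(1)[OF I' I l(1), of i]
      Theta_map(1)[OF J J' \<gamma>, of "tix n i"] Theta_map(1)[OF J J' l(2), of "tix n i"]
    have "Hom_mod_class A V (\<Theta> I' i) (\<Theta> J (tix n i)) (h \<cdot> T I' I \<phi>' i)
      = Hom_mod_class A V (\<Theta> I' i) (\<Theta> J (tix n i)) (h \<cdot> T I' I \<phi> i)"
      by (rule Hom_mod_class_comp_cong[OF t(2,1) h h Theta_map_class_unique[OF I' I l(1) \<phi>] refl])
    then show ?thesis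
      by (rule Hom_mod_class_comp_cong[OF mor_simps(1)[OF t(2) h] mor_simps(1)[OF t(1) h] t(4,3) _
            Theta_map_class_unique[OF J J' l(2) \<gamma>]])
  qed
  then show "y = ccl I' J' n i (T J J' \<gamma> (tix n i) \<cdot> h \<cdot> T I' I \<phi> i)"
    unfolding y act_class[OF I I' J J' l i h] by (simp only: ccl_def)
qed

text \<open>The core of naturality: composing a cocycle with lifts corresponds to composing its
  syzygy morphism with their restrictions. The lifts have degree 0, so the twist moves past
  them.\<close>

lemma rep_act:
  assumes I: "cores M I" and I': "cores M' I'" and J: "cores N J" and J': "cores N' J'"
    and \<phi>: "lift I' f I \<phi>" and \<gamma>: "lift J g J' \<gamma>" and r: "rep I J n \<alpha> i h"
  shows "rep I' J' n (\<lambda>i. \<gamma> (n + i) \<cdot> \<alpha> i \<cdot> \<phi> i) i (T J J' \<gamma> (tix n i) \<cdot> h \<cdot> T I' I \<phi> i)"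
proof -
  note i = rep_D(1)[OF r] and h = rep_D(3)[OF r]
  have a: "\<alpha> i \<in> Ar A" "Src A (\<alpha> i) = cobj I i" "Tgt A (\<alpha> i) = cobj J (n + i)"
    "\<phi> i \<in> Ar A" "Src A (\<phi> i) = cobj I' i" "Tgt A (\<phi> i) = cobj I i"
    "\<gamma> i \<in> Ar A" "Src A (\<gamma> i) = cobj J i" "Tgt A (\<gamma> i) = cobj J' i" for i
    using rep_D(2)[OF r] liftD(3)[OF \<phi>, of i] liftD(3)[OF \<gamma>, of i] by (auto simp: carrier_hom_cx mor_def)
  note t = Theta_map[OF I' I \<phi>, of i] and g = Theta_map[OF J J' \<gamma>, of "tix n i"]
  have "cdiff J' (n + j) \<cdot> \<gamma> (n + j) \<cdot> \<alpha> j \<cdot> \<phi> j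
      = koszul A n ((\<gamma> (n + (j + 1)) \<cdot> \<alpha> (j + 1) \<cdot> \<phi> (j + 1)) \<cdot> cdiff I' j)" if "int i \<le> j" for j
    by (rule act_cocycle_at[OF cores_complex[OF I] cores_complex[OF I'] cores_complex[OF J] cores_complex[OF J']
          liftD(1)[OF \<phi>] liftD(1)[OF \<gamma>] rep_D(2)[OF r]])
      (use r that in \<open>simp add: rep_def\<close>)
  moreover have "\<iota> J' (tix n i) \<cdot> T J J' \<gamma> (tix n i) \<cdot> h \<cdot> T I' I \<phi> i
      = koszul A (n * int i) (\<gamma> (n + int i) \<cdot> \<alpha> (int i) \<cdot> \<phi> (int i)) \<cdot> \<iota> I' i"
  proof -
    note \<iota> = Theta_inc_mor[OF I, of i] Theta_inc_mor[OF J, of "tix n i"] Theta_inc_mor[OF I', of i]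
      Theta_inc_mor[OF J', of "tix n i"]
    note tw = tw_mor[OF rep_D(2)[OF r] i]
    have "\<iota> J' (tix n i) \<cdot> T J J' \<gamma> (tix n i) \<cdot> h \<cdot> T I' I \<phi> i
      = (\<iota> J' (tix n i) \<cdot> T J J' \<gamma> (tix n i)) \<cdot> h \<cdot> T I' I \<phi> i"
      using \<iota> t(1) g(1) h by (auto simp: mor_def)
    also have "\<dots> = \<gamma> (int (tix n i)) \<cdot> (\<iota> J (tix n i) \<cdot> h) \<cdot> T I' I \<phi> i"
      unfolding g(2) using \<iota> t(1) liftD(3)[OF \<gamma>, of "int (tix n i)"] h by (auto simp: mor_def)
    also have "\<dots> = \<gamma> (int (tix n i)) \<cdot> tw n \<alpha> i \<cdot> (\<iota> I i \<cdot> T I' I \<phi> i)"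
      unfolding rep_D(4)[OF r] using \<iota> t(1) liftD(3)[OF \<gamma>, of "int (tix n i)"] tw by (auto simp: mor_def)
    also have "\<dots> = koszul A (n * int i) (\<gamma> (n + int i) \<cdot> \<alpha> (int i) \<cdot> \<phi> (int i)) \<cdot> \<iota> I' i"
      unfolding t(2) int_tix[OF i] using \<iota>(3) by (simp add: a koszul_comp mor_def)
    finally show ?thesis .
  qed
  moreover have "T J J' \<gamma> (tix n i) \<cdot> h \<cdot> T I' I \<phi> i \<in> mor A (\<Theta> I' i) (\<Theta> J' (tix n i))"
    using t(1) g(1) h by (intro mor_simps(1))
  moreover have "(\<lambda>i. \<gamma> (n + i) \<cdot> \<alpha> i \<cdot> \<phi> i) \<in> carrier (hom_cx A I' J' n)"
    by (rule act_carrier[OF liftD(1)[OF \<phi>] liftD(1)[OF \<gamma>] rep_D(2)[OF r]])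
  ultimately show ?thesis using i unfolding rep_def by blast
qed

text \<open>Independence of the lifts is imported from the colimit: the resulting cochains represent
  the same colimit element, and equality there reflects to stable classes.\<close>

lemma stable_map:
  assumes I: "cores M I" and I': "cores M' I'" and J: "cores N J" and J': "cores N' J'"
    and \<phi>: "lift I' f I \<phi>" and \<gamma>: "lift J g J' \<gamma>" and \<alpha>: "\<alpha> \<in> stable_cocycle A I J n"
  shows "stable_Ext_map_V A I' I J J' n f g (stable_class A I J n \<alpha>)
    = stable_class A I' J' n (\<lambda>i. \<gamma> (n + i) \<cdot> \<alpha> i \<cdot> \<phi> i)"
  unfolding stable_Ext_map_V_def
proof (rule the_equality)
  have \<alpha>c: "\<alpha> \<in> carrier (hom_cx A I J n)" using \<alpha> by (simp add: stable_cocycle_def)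
  note act = stable_Ext_act_class[OF cores_complex[OF I] cores_complex[OF I'] cores_complex[OF J] cores_complex[OF J']
      liftD(1) liftD(1) \<alpha>c]
  show "\<exists>\<phi>' \<gamma>'. lift I' f I \<phi>' \<and> lift J g J' \<gamma>' \<and>
    stable_class A I' J' n (\<lambda>i. \<gamma> (n + i) \<cdot> \<alpha> i \<cdot> \<phi> i) = stable_Ext_act A I' J' n \<phi>' \<gamma>' (stable_class A I J n \<alpha>)"
    using act[OF \<phi> \<gamma>] \<phi> \<gamma> by metis
  fix y assume "\<exists>\<phi>' \<gamma>'. lift I' f I \<phi>' \<and> lift J g J' \<gamma>' \<and> y = stable_Ext_act A I' J' n \<phi>' \<gamma>' (stable_class A I J n \<alpha>)"
  then obtain \<phi>' \<gamma>' where l: "lift I' f I \<phi>'" "lift J g J' \<gamma>'"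
    and y: "y = stable_Ext_act A I' J' n \<phi>' \<gamma>' (stable_class A I J n \<alpha>)" by blast
  obtain i h where r: "rep I J n \<alpha> i h" using cocycle_rep[OF I J \<alpha>] by blast
  have "ccl I' J' n i (T J J' \<gamma>' (tix n i) \<cdot> h \<cdot> T I' I \<phi>' i) = ccl I' J' n i (T J J' \<gamma> (tix n i) \<cdot> h \<cdot> T I' I \<phi> i)"
    using complete_map[OF I I' J J' l rep_D(1,3)[OF r]] complete_map[OF I I' J J' \<phi> \<gamma> rep_D(1,3)[OF r]] by simp
  then show "y = stable_class A I' J' n (\<lambda>i. \<gamma> (n + i) \<cdot> \<alpha> i \<cdot> \<phi> i)"
    unfolding y act[OF l]
    using rep_class_eq_iff[OF I' J' rep_act[OF I I' J J' l r] rep_act[OF I I' J J' \<phi> \<gamma> r]] by blast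
qed

section \<open>Functoriality of complete cohomology and change of coresolution\<close>

lemma complete_map_comp:
  assumes I: "cores M I" and I': "cores M' I'" and I'': "cores M'' I''"
    and J: "cores N J" and J': "cores N' J'" and J'': "cores N'' J''"
    and f: "f \<in> mor A M' M" and f': "f' \<in> mor A M'' M'" and g: "g \<in> mor A N N'" and g': "g' \<in> mor A N' N''"
    and x: "x \<in> carrier (complete_Ext_V A V I J n)"
  shows "complete_Ext_map_V A V I' I J J' n f g x \<in> carrier (complete_Ext_V A V I' J' n)"
    and "complete_Ext_map_V A V I'' I' J' J'' n f' g' (complete_Ext_map_V A V I' I J J' n f g x)
      = complete_Ext_map_V A V I'' I J J'' n (f \<cdot> f') (g' \<cdot> g) x"
proof -
  obtain i h where i: "nat (- n) \<le> i" and h: "h \<in> mor A (\<Theta> I i) (\<Theta> J (tix n i))" and x: "x = ccl I J n i h"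
    using x unfolding carrier_complete[OF I J] by blast
  obtain \<phi> \<phi>' \<gamma> \<gamma>' where l: "lift I' f I \<phi>" "lift I'' f' I' \<phi>'" "lift J g J' \<gamma>" "lift J' g' J'' \<gamma>'"
    using lift_exists[OF I' I f] lift_exists[OF I'' I' f'] lift_exists[OF J J' g] lift_exists[OF J' J'' g'] by blast
  note t = Theta_map(1)[OF I' I l(1), of i] Theta_map(1)[OF I'' I' l(2), of i]
    Theta_map(1)[OF J J' l(3), of "tix n i"] Theta_map(1)[OF J' J'' l(4), of "tix n i"]
  have h': "T J J' \<gamma> (tix n i) \<cdot> h \<cdot> T I' I \<phi> i \<in> mor A (\<Theta> I' i) (\<Theta> J' (tix n i))"
    using t h by (intro mor_simps(1))
  then show "complete_Ext_map_V A V I' I J J' n f g x \<in> carrier (complete_Ext_V A V I' J' n)"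
    unfolding x complete_map[OF I I' J J' l(1,3) i h] carrier_complete[OF I' J'] using i by blast
  have "T J' J'' \<gamma>' (tix n i) \<cdot> (T J J' \<gamma> (tix n i) \<cdot> h \<cdot> T I' I \<phi> i) \<cdot> T I'' I' \<phi>' i
    = (T J' J'' \<gamma>' (tix n i) \<cdot> T J J' \<gamma> (tix n i)) \<cdot> h \<cdot> (T I' I \<phi> i \<cdot> T I'' I' \<phi>' i)"
    using t h by (auto simp: mor_def)
  then show "complete_Ext_map_V A V I'' I' J' J'' n f' g' (complete_Ext_map_V A V I' I J J' n f g x)
      = complete_Ext_map_V A V I'' I J J'' n (f \<cdot> f') (g' \<cdot> g) x"
    unfolding x complete_map[OF I I' J J' l(1,3) i h] complete_map[OF I' I'' J' J'' l(2,4) i h']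
      complete_map[OF I I'' J J'' lift_comp[OF I'' I' I f' f l(2,1)] lift_comp[OF J J' J'' g g' l(3,4)] i h]
      Theta_map_comp[OF I'' I' I l(2,1)] Theta_map_comp[OF J J' J'' l(3,4)] by simp
qed

lemma complete_map_ident:
  assumes I: "cores M I" and J: "cores N J" and x: "x \<in> carrier (complete_Ext_V A V I J n)"
  shows "complete_Ext_map_V A V I I J J n (Ident A M) (Ident A N) x = x"
proof -
  obtain i h where i: "nat (- n) \<le> i" and h: "h \<in> mor A (\<Theta> I i) (\<Theta> J (tix n i))" and x: "x = ccl I J n i h"
    using x unfolding carrier_complete[OF I J] by blast
  have "Ident A (\<Theta> J (tix n i)) \<cdot> h \<cdot> Ident A (\<Theta> I i) = h"
    using h Theta_Ob[OF I] Theta_Ob[OF J] by (auto simp: mor_def)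
  then show ?thesis
    unfolding x complete_map[OF I I J J lift_ident[OF I] lift_ident[OF J] i h] Theta_map_ident[OF I] Theta_map_ident[OF J]
    by simp
qed

text \<open>By functoriality the maps induced by identities in the two directions are mutually
  inverse. This exchanges the coresolutions used for stable cohomology for those used in the
  colimit.\<close>

lemma complete_map_iso:
  assumes I: "cores M I" and I': "cores M I'" and J: "cores N J" and J': "cores N J'"
  shows "complete_Ext_map_V A V I' I J J' n (Ident A M) (Ident A N)
    \<in> iso (complete_Ext_V A V I J n) (complete_Ext_V A V I' J' n)"
proof -
  have M: "M \<in> Ob A" "N \<in> Ob A" using cores_aug[OF I] cores_aug[OF J] mor_objects by blast+
  note id = mor_simps(6)[OF M(1)] mor_simps(6)[OF M(2)]
  have idc: "Ident A M \<cdot> Ident A M = Ident A M" "Ident A N \<cdot> Ident A N = Ident A N" using M by simp_all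
  let ?F = "complete_Ext_map_V A V I' I J J' n (Ident A M) (Ident A N)"
  let ?G = "complete_Ext_map_V A V I I' J' J n (Ident A M) (Ident A N)"
  have F: "?F x \<in> carrier (complete_Ext_V A V I' J' n)" "?G (?F x) = x" if "x \<in> carrier (complete_Ext_V A V I J n)" for x
    using complete_map_comp[OF I I' I J J' J id(1) id(1) id(2) id(2) that] complete_map_ident[OF I J that]
    unfolding idc by simp_all
  have G: "?G x \<in> carrier (complete_Ext_V A V I J n)" "?F (?G x) = x" if "x \<in> carrier (complete_Ext_V A V I' J' n)" for x
    using complete_map_comp[OF I' I I' J' J J' id(1) id(1) id(2) id(2) that] complete_map_ident[OF I' J' that]
    unfolding idc by simp_all
  have "bij_betw ?F (carrier (complete_Ext_V A V I J n)) (carrier (complete_Ext_V A V I' J' n))"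
    by (rule bij_betwI[where g = ?G]) (use F G in auto)
  moreover have "?F \<in> hom (complete_Ext_V A V I J n) (complete_Ext_V A V I' J' n)"
  proof (rule homI)
    fix x y assume x: "x \<in> carrier (complete_Ext_V A V I J n)" and y: "y \<in> carrier (complete_Ext_V A V I J n)"
    obtain i h where ih: "nat (- n) \<le> i" "h \<in> mor A (\<Theta> I i) (\<Theta> J (tix n i))" "x = ccl I J n i h"
      using x unfolding carrier_complete[OF I J] by blast
    obtain j g where jg: "nat (- n) \<le> j" "g \<in> mor A (\<Theta> I j) (\<Theta> J (tix n j))" "y = ccl I J n j g"
      using y unfolding carrier_complete[OF I J] by blast
    \<comment> \<open>Realising both elements by cocycles allows moving them to a common level,
      where additivity is that of composition.\<close>
    obtain \<alpha> \<beta> where ab: "rep I J n \<alpha> i h" "rep I J n \<beta> j g"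
      using rep_surj[OF I J ih(1,2)] rep_surj[OF I J jg(1,2)] by blast
    define m where "m = max i j"
    obtain h' where h': "rep I J n \<alpha> m h'" "x = ccl I J n m h'"
      using rep_ccl_move[OF I J ab(1), of m] ih(3) by (auto simp: m_def)
    obtain g' where g': "rep I J n \<beta> m g'" "y = ccl I J n m g'"
      using rep_ccl_move[OF I J ab(2), of m] jg(3) by (auto simp: m_def)
    note m = rep_D(1)[OF h'(1)] and hg = rep_D(3)[OF h'(1)] rep_D(3)[OF g'(1)]
    have hgp: "Plus A h' g' \<in> mor A (\<Theta> I m) (\<Theta> J (tix n m))" using hg by (rule mor_simps)
    obtain \<phi> \<gamma> where l: "lift I' (Ident A M) I \<phi>" "lift J (Ident A N) J' \<gamma>"
      using lift_exists[OF I' I id(1)] lift_exists[OF J J' id(2)] by blast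
    note t = Theta_map(1)[OF I' I l(1), of m] Theta_map(1)[OF J J' l(2), of "tix n m"]
    let ?t = "\<lambda>h. T J J' \<gamma> (tix n m) \<cdot> h \<cdot> T I' I \<phi> m"
    have th: "?t h' \<in> mor A (\<Theta> I' m) (\<Theta> J' (tix n m))" "?t g' \<in> mor A (\<Theta> I' m) (\<Theta> J' (tix n m))"
      using t hg by (auto intro: mor_simps(1))
    have tp: "?t (Plus A h' g') = Plus A (?t h') (?t g')" using t hg by (auto simp: mor_def)
    show "?F (x \<otimes>\<^bsub>complete_Ext_V A V I J n\<^esub> y) = ?F x \<otimes>\<^bsub>complete_Ext_V A V I' J' n\<^esub> ?F y"
      unfolding h'(2) g'(2) ccl_mult[OF I J m hg] complete_map[OF I I' J J' l m hg(1)]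
        complete_map[OF I I' J J' l m hg(2)] complete_map[OF I I' J J' l m hgp] tp ccl_mult[OF I' J' m th] ..
  qed (rule F)
  ultimately show ?thesis by (simp add: iso_def)
qed

theorem stable_iso_complete:
  fixes I S :: "'o \<Rightarrow> ('o, 'm) augmented" and n :: int
  assumes I: "\<And>M. M \<in> Ob A \<Longrightarrow> cores M (I M)" and S: "\<And>M. M \<in> Ob A \<Longrightarrow> cores M (S M)"
  shows "\<exists>\<Phi>.
      (\<forall>M\<in>Ob A. \<forall>N\<in>Ob A.
         \<Phi> M N \<in> iso (stable_Ext A (I M) (I N) n) (complete_Ext_V A V (S M) (S N) n)) \<and>
      (\<forall>M\<in>Ob A. \<forall>N\<in>Ob A. \<forall>M'\<in>Ob A. \<forall>N'\<in>Ob A. \<forall>f\<in>mor A M' M. \<forall>g\<in>mor A N N'.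
         \<forall>x\<in>carrier (stable_Ext A (I M) (I N) n).
           \<Phi> M' N' (stable_Ext_map_V A (I M') (I M) (I N) (I N') n f g x)
             = complete_Ext_map_V A V (S M') (S M) (S N) (S N') n f g (\<Phi> M N x))"
proof -
  let ?P = "\<lambda>M N F. F \<in> iso (stable_Ext A (I M) (I N) n) (complete_Ext_V A V (I M) (I N) n) \<and>
    (\<forall>\<alpha> i h. rep (I M) (I N) n \<alpha> i h \<longrightarrow> F (stable_class A (I M) (I N) n \<alpha>) = ccl (I M) (I N) n i h)"
  define F where "F M N = (SOME F. ?P M N F)" for M N
  have "?P M N (F M N)" if "M \<in> Ob A" "N \<in> Ob A" for M N
  proof -
    have "\<exists>F. ?P M N F" using stable_complete_iso[OF I[OF that(1)] I[OF that(2)], of n] unfolding Bex_def .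
    then show ?thesis unfolding F_def by (rule someI_ex)
  qed
  then have F: "\<And>M N. M \<in> Ob A \<Longrightarrow> N \<in> Ob A \<Longrightarrow>
      F M N \<in> iso (stable_Ext A (I M) (I N) n) (complete_Ext_V A V (I M) (I N) n)"
    and F': "\<And>M N \<alpha> i h. M \<in> Ob A \<Longrightarrow> N \<in> Ob A \<Longrightarrow> rep (I M) (I N) n \<alpha> i h \<Longrightarrow>
      F M N (stable_class A (I M) (I N) n \<alpha>) = ccl (I M) (I N) n i h" by simp_all
  \<comment> \<open>The isomorphism for the coresolutions \<open>I\<close>, followed by the change
    from \<open>I\<close> to \<open>S\<close>.\<close>
  define \<Phi> where "\<Phi> M N = complete_Ext_map_V A V (S M) (I M) (I N) (S N) n (Ident A M) (Ident A N) \<circ> F M N" for M N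
  show ?thesis
  proof (intro exI[of _ \<Phi>] conjI ballI)
    fix M N assume MN: "M \<in> Ob A" "N \<in> Ob A"
    show "\<Phi> M N \<in> iso (stable_Ext A (I M) (I N) n) (complete_Ext_V A V (S M) (S N) n)"
      unfolding \<Phi>_def
      by (rule iso_set_trans[OF F[OF MN] complete_map_iso[OF I[OF MN(1)] S[OF MN(1)] I[OF MN(2)] S[OF MN(2)]]])
    fix M' N' f g x
    assume MN': "M' \<in> Ob A" "N' \<in> Ob A" and f: "f \<in> mor A M' M" and g: "g \<in> mor A N N'"
      and x: "x \<in> carrier (stable_Ext A (I M) (I N) n)"
    note I' = I[OF MN(1)] I[OF MN'(1)] I[OF MN(2)] I[OF MN'(2)]
    note S' = S[OF MN(1)] S[OF MN'(1)] S[OF MN(2)] S[OF MN'(2)]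
    obtain \<alpha> where \<alpha>: "\<alpha> \<in> stable_cocycle A (I M) (I N) n" "x = stable_class A (I M) (I N) n \<alpha>"
      using x stable_Ext_facts(1)[OF cores_complex[OF I'(1)] cores_complex[OF I'(3)]] by auto
    obtain i h where r: "rep (I M) (I N) n \<alpha> i h" using cocycle_rep[OF I'(1,3) \<alpha>(1)] by blast
    obtain \<phi> \<gamma> where l: "lift (I M') f (I M) \<phi>" "lift (I N) g (I N') \<gamma>"
      using lift_exists[OF I'(2,1) f] lift_exists[OF I'(3,4) g] by blast
    \<comment> \<open>Naturality for \<open>I\<close> alone: both sides are the colimit class of h
      composed with the restrictions of the two lifts.\<close>
    have eq: "F M' N' (stable_Ext_map_V A (I M') (I M) (I N) (I N') n f g x)
      = complete_Ext_map_V A V (I M') (I M) (I N) (I N') n f g (F M N x)"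
      unfolding \<alpha>(2) stable_map[OF I'(1-4) l \<alpha>(1)] F'[OF MN r] F'[OF MN' rep_act[OF I'(1-4) l r]]
        complete_map[OF I'(1-4) l rep_D(1,3)[OF r]] ..
    have Fx: "F M N x \<in> carrier (complete_Ext_V A V (I M) (I N) n)"
      unfolding \<alpha>(2) F'[OF MN r] by (rule rep_ccl_carrier[OF I'(1,3) r])
    note id = mor_simps(6)[OF MN(1)] mor_simps(6)[OF MN(2)] mor_simps(6)[OF MN'(1)] mor_simps(6)[OF MN'(2)]
    have c: "f \<cdot> Ident A M' = f" "Ident A M \<cdot> f = f" "g \<cdot> Ident A N = g" "Ident A N' \<cdot> g = g"
      using f g by (auto simp: mor_def)
    \<comment> \<open>Changing coresolutions before or after applying f and g gives by functoriality
      the one map that f and g induce from \<open>I\<close> to \<open>S\<close>.\<close>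
    show "\<Phi> M' N' (stable_Ext_map_V A (I M') (I M) (I N) (I N') n f g x)
             = complete_Ext_map_V A V (S M') (S M) (S N) (S N') n f g (\<Phi> M N x)"
      unfolding \<Phi>_def comp_def eq
        complete_map_comp(2)[OF I'(1,2) S'(2) I'(3,4) S'(4) f id(3) g id(4) Fx]
        complete_map_comp(2)[OF I'(1) S'(1,2) I'(3) S'(3,4) id(1) f id(2) g Fx] c ..
  qed
qed

end

section \<open>Duality\<close>

text \<open>The arrow \<open>cdiff P (- i - 1)\<close> runs from degree -i-1 to degree -i; reversed
  and reindexed it runs from degree i to degree i + 1. The augmentation out of \<open>P^0\<close>
  becomes one into it.\<close>

definition opaug :: "('o, 'm) augmented \<Rightarrow> ('o, 'm) augmented" where
  "opaug P = \<lparr>cobj = (\<lambda>i. cobj P (- i)), cdiff = (\<lambda>i. cdiff P (- i - 1)), aug = aug P\<rparr>"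

lemma opaug_simps [simp]:
  "cobj (opaug P) i = cobj P (- i)" "cdiff (opaug P) i = cdiff P (- i - 1)" "aug (opaug P) = aug P"
  by (simp_all add: opaug_def)

lemma opaug_opaug [simp]: "opaug (opaug P) = P"
  by (cases P) (simp add: opaug_def)

lemma koszul_opcat [simp]: "koszul (opcat A) = koszul A"
  by (simp add: koszul_def fun_eq_iff)

lemma Hom_mod_opcat [simp]: "Hom_mod (opcat A) W X Y = Hom_mod A W Y X"
  by (simp add: Hom_mod_def)

lemma Hom_mod_class_opcat [simp]: "Hom_mod_class (opcat A) W X Y = Hom_mod_class A W Y X"
  by (simp add: Hom_mod_class_def fun_eq_iff)

lemma cochain_complex_opcat:
  assumes "cochain_complex A P"
  shows "cochain_complex (opcat A) (opaug P)"
  unfolding cochain_complex_def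
proof (intro allI conjI)
  note c = assms[unfolded cochain_complex_def, rule_format]
  fix i :: int
  show "cobj (opaug P) i \<in> Ob (opcat A)" using c by simp
  show "cdiff (opaug P) i \<in> mor (opcat A) (cobj (opaug P) i) (cobj (opaug P) (i + 1))"
    using c[of "- i - 1"] by simp
  show "Compose (opcat A) (cdiff (opaug P) (i + 1)) (cdiff (opaug P) i)
      = Zero (opcat A) (cobj (opaug P) i) (cobj (opaug P) (i + 2))"
  proof -
    define k where "k = - i - 2"
    have i: "i = - k - 2" by (simp add: k_def)
    show ?thesis using c[of k] unfolding i by (simp add: add.commute)
  qed
qed

lemma cochain_map_opcat:
  assumes "cochain_map A P' P \<phi>"
  shows "cochain_map (opcat A) (opaug P) (opaug P') (\<lambda>i. \<phi> (- i))"
  unfolding cochain_map_def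
proof (intro allI conjI)
  note c = assms[unfolded cochain_map_def, rule_format]
  fix i :: int
  show "\<phi> (- i) \<in> mor (opcat A) (cobj (opaug P) i) (cobj (opaug P') i)" using c by simp
  show "Compose (opcat A) (cdiff (opaug P') i) (\<phi> (- i))
      = Compose (opcat A) (\<phi> (- (i + 1))) (cdiff (opaug P) i)"
    using c[of "- i - 1"] by simp
qed

lemma lift_opcat: "resolution_lift A P' f P \<phi> \<Longrightarrow> coresolution_lift (opcat A) (opaug P) f (opaug P') (\<lambda>i. \<phi> (- i))"
  by (simp add: resolution_lift_def coresolution_lift_def cochain_map_opcat)

lemma lift_opcat':
  assumes "coresolution_lift (opcat A) (opaug P) f (opaug P') \<phi>"
  shows "resolution_lift A P' f P (\<lambda>i. \<phi> (- i))"
  using assms cochain_map_opcat[of "opcat A" "opaug P" "opaug P'" \<phi>]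
  by (simp add: resolution_lift_def coresolution_lift_def)

lemma minus_int_Suc: "- int (Suc i) = - int i - 1"
  by simp

text \<open>Kernels in the opposite category are by definition the cokernels, so both choices apply
  \<open>SOME\<close> to the same predicate: the chosen syzygies coincide, not merely up to
  isomorphism.\<close>

lemma Theta_inc_opcat [simp]: "Theta_inc (opcat A) (opaug P) i = Omega_proj A P i"
  unfolding Omega_proj_def minus_int_Suc by (simp add: Theta_inc_def ker_arrow_def coker_arrow_def)

lemma Theta_opcat [simp]: "Theta (opcat A) (opaug P) i = Omega A P i"
  by (simp add: Theta_def Omega_def)

lemma Theta_proj_opcat [simp]: "Theta_proj (opcat A) (opaug P) i = Omega_inc A P i"
  unfolding Omega_inc_def minus_int_Suc by (simp add: Theta_proj_def)

lemma Theta_seq_opcat: "Theta_seq (opcat A) (opaug P) i = prod.swap (Omega_seq A P i)"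
  by (simp add: Theta_seq_def Omega_seq_def)

lemma Theta_map_opcat: "Theta_map (opcat A) (opaug Q') (opaug Q) (\<lambda>i. \<gamma> (- i)) i = Omega_map A Q Q' \<gamma> i"
  by (simp add: Theta_map_def Omega_map_def)

section \<open>Proper resolutions as proper coresolutions in the opposite category\<close>

locale resolving = abelian_category A for A :: "('o, 'm) addcat" (structure) +
  fixes W :: "'o set"
  assumes subcat: "subcategory A W"
begin

sublocale op: coresolving "opcat A" W
  by (intro coresolving.intro op_abelian coresolving_axioms.intro) (simp add: subcat)

lemma proper_opcat:
  assumes "proper_resolution A W M P"
  shows "proper_coresolution (opcat A) W M (opaug P)"
proof -
  note p = assms[unfolded proper_resolution_def]
  have ex: "exact_at A (cdiff P (- (i + 1) - 1)) (cdiff P (- i - 1))" if "i \<ge> 0" for i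
  proof -
    have "\<forall>i<0. exact_at A (cdiff P (i - 1)) (cdiff P i)" using p by blast
    moreover have "- i - 1 < 0" using that by simp
    ultimately have "exact_at A (cdiff P (- i - 1 - 1)) (cdiff P (- i - 1))" by blast
    moreover have "- (i + 1) - 1 = - i - 1 - 1" by simp
    ultimately show ?thesis by (simp only:)
  qed
  have k: "kernel (Hom A X (cobj P (- (i + 1)))) (Hom A X (cobj P (- i))) ((\<cdot>) (cdiff P (- i - 1)))
        = (\<cdot>) (cdiff P (- (i + 1) - 1)) ` mor A X (cobj P (- (i + 2)))" if "i \<ge> 0" "X \<in> W" for i X
  proof -
    have "- i - 1 < 0" using that by simp
    then have "kernel (Hom A X (cobj P (- i - 1))) (Hom A X (cobj P (- i - 1 + 1))) ((\<cdot>) (cdiff P (- i - 1)))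
        = (\<cdot>) (cdiff P (- i - 1 - 1)) ` mor A X (cobj P (- i - 1 - 1))"
      using p that(2) by blast
    moreover have "- (i + 1) = - i - 1" "- i - 1 + 1 = - i" "- (i + 2) = - i - 1 - 1" by simp_all
    ultimately show ?thesis by (simp only:)
  qed
  note tail = p[THEN conjunct2, THEN conjunct2, THEN conjunct2, THEN conjunct2]
  note p' = p[THEN conjunct1] p[THEN conjunct2, THEN conjunct1, rule_format]
    p[THEN conjunct2, THEN conjunct2, THEN conjunct1, rule_format]
    p[THEN conjunct2, THEN conjunct2, THEN conjunct2, THEN conjunct1] tail[THEN conjunct1] tail[THEN conjunct2, THEN conjunct1]
    tail[THEN conjunct2, THEN conjunct2, THEN conjunct2, THEN bspec, THEN conjunct1]
    tail[THEN conjunct2, THEN conjunct2, THEN conjunct2, THEN bspec, THEN conjunct2, THEN conjunct1]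
  show ?thesis
    unfolding proper_coresolution_def opcat_simps mor_opcat Hom_opcat opaug_simps zero_object_opcat
      mono_arrow_opcat exact_at_opcat[OF abelian_category_axioms] minus_zero diff_0
    by (intro conjI allI impI ballI cochain_complex_opcat p' ex k) auto
qed

text \<open>A stored extension changes the order of its arrows under duality. The hypothesis
  reconciles two names of the middle object, the target of the first arrow and the source of the
  second.\<close>

lemma ext_push_opcat:
  assumes "Src A (snd s) = Tgt A (fst s)"
  shows "ext_push (opcat A) (prod.swap s) h = prod.swap ` ext_pull A s h"
proof -
  obtain a b where s: "s = (a, b)" by (cases s)
  have "(y, x) \<in> ext_push (opcat A) (b, a) h \<longleftrightarrow> (x, y) \<in> ext_pull A (a, b) h" for x y
  proof (cases "short_exact A x y")
    case True
    have "(\<exists>u\<in>mor A (Src A y) (Src A b). b \<cdot> u = h \<cdot> y \<and> u \<cdot> x = a) \<longleftrightarrow>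
      (\<exists>u\<in>mor A (Tgt A x) (Tgt A a). u \<cdot> x = a \<and> b \<cdot> u = h \<cdot> y)"
      using assms short_exactD(3)[OF True] unfolding s by auto
    then show ?thesis
      unfolding ext_push_def ext_pull_def extensions_def
      by (simp add: short_exact_opcat[OF abelian_category_axioms] conj_ac)
  qed (simp add: ext_push_def ext_pull_def extensions_def short_exact_opcat[OF abelian_category_axioms])
  then show ?thesis unfolding s by force
qed

lemma ext_pull_opcat:
  assumes "Src A (snd s) = Tgt A (fst s)"
  shows "ext_pull (opcat A) (prod.swap s) g = prod.swap ` ext_push A s g"
proof -
  obtain a b where s: "s = (a, b)" by (cases s)
  have "(y, x) \<in> ext_pull (opcat A) (b, a) g \<longleftrightarrow> (x, y) \<in> ext_push A (a, b) g" for x y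
  proof (cases "short_exact A x y")
    case True
    have "(\<exists>u\<in>mor A (Src A b) (Src A y). y \<cdot> u = b \<and> u \<cdot> a = x \<cdot> g) \<longleftrightarrow>
      (\<exists>u\<in>mor A (Tgt A a) (Tgt A x). u \<cdot> a = x \<cdot> g \<and> y \<cdot> u = b)"
      using assms short_exactD(3)[OF True] unfolding s by auto
    then show ?thesis
      unfolding ext_push_def ext_pull_def extensions_def
      by (simp add: short_exact_opcat[OF abelian_category_axioms] conj_ac)
  qed (simp add: ext_push_def ext_pull_def extensions_def short_exact_opcat[OF abelian_category_axioms])
  then show ?thesis unfolding s by force
qed

lemma Omega_seq_middle:
  assumes "proper_resolution A W M P"
  shows "Src A (snd (Omega_seq A P i)) = Tgt A (fst (Omega_seq A P i))"
  using op.Theta_src_tgt(2,3)[OF proper_opcat[OF assms], of i] by (simp add: Omega_seq_def)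

lemma complete_obj_opcat: "complete_V_obj (opcat A) W (opaug Q) (opaug P) n = complete_W_obj A W P Q n"
  by (simp add: complete_V_obj_def complete_W_obj_def fun_eq_iff)

lemma beta_opcat:
  assumes "Src A (snd s) = Tgt A (fst s)"
  shows "beta_V (opcat A) W (prod.swap t) (prod.swap s) (prod.swap ` e) = beta_W A W s t e"
  by (simp add: beta_V_def beta_W_def ext_pull_opcat[OF assms] inj_image_eq_iff)

text \<open>The \<open>beta\<close> parts correspond for every argument, whereas
  \<open>the_elem\<close> in the \<open>delta\<close> parts can be compared only where the extension
  class is constant on c. For c in the group this is \<open>Hom_mod_step\<close>.\<close>

lemma complete_step_opcat:
  assumes P: "proper_resolution A W M P" and Q: "proper_resolution A W N Q"
    and c: "c \<in> carrier (complete_W_obj A W P Q n i)"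
  shows "complete_W_step A W P Q n i c = complete_V_step (opcat A) W (opaug Q) (opaug P) n i c"
proof -
  note P' = proper_opcat[OF P] and Q' = proper_opcat[OF Q]
  note push = ext_push_opcat[OF Omega_seq_middle[OF Q], of i]
  let ?k = "nat (int i + n)"
  obtain h where h: "h \<in> mor (opcat A) (Theta (opcat A) (opaug Q) i) (Theta (opcat A) (opaug P) ?k)"
    "c = Hom_mod_class (opcat A) W (Theta (opcat A) (opaug Q) i) (Theta (opcat A) (opaug P) ?k) h"
    using c unfolding complete_obj_opcat[symmetric] complete_V_obj_def op.Hom_mod_carrier by blast
  obtain u g where "ses_map (opcat A) (Theta_seq (opcat A) (opaug Q) i) (Theta_seq (opcat A) (opaug P) ?k) h u g"
    using op.step_exists[OF Q' P' h(1)] by blast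
  from op.Hom_mod_step(1)[OF Q' P' this]
  have E: "ext_push (opcat A) (prod.swap (Omega_seq A Q i)) ` c = {ext_push (opcat A) (prod.swap (Omega_seq A Q i)) h}"
    unfolding h(2) Theta_seq_opcat .
  have "ext_pull A (Omega_seq A Q i) ` c = (`) prod.swap ` ext_push (opcat A) (prod.swap (Omega_seq A Q i)) ` c"
    by (simp add: push image_image)
  then have "ext_pull A (Omega_seq A Q i) ` c = {ext_pull A (Omega_seq A Q i) h}"
    unfolding E by (simp add: push image_image)
  then have "delta_V (opcat A) (prod.swap (Omega_seq A Q i)) c = prod.swap ` delta_W A (Omega_seq A Q i) c"
    using E by (simp add: delta_V_def delta_W_def push)
  then show ?thesis
    by (simp add: complete_W_step_def complete_V_step_def Theta_seq_opcat beta_opcat[OF Omega_seq_middle[OF P]])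
qed

lemma complete_systems:
  assumes P: "proper_resolution A W M P" and Q: "proper_resolution A W N Q"
  shows "direct_system (nat (- n)) (complete_W_obj A W P Q n) (complete_V_step (opcat A) W (opaug Q) (opaug P) n)"
    and "direct_system (nat (- n)) (complete_W_obj A W P Q n) (complete_W_step A W P Q n)"
    and "colim_rel (nat (- n)) (complete_W_obj A W P Q n) (complete_W_step A W P Q n)
      = colim_rel (nat (- n)) (complete_W_obj A W P Q n) (complete_V_step (opcat A) W (opaug Q) (opaug P) n)"
proof -
  show 1: "direct_system (nat (- n)) (complete_W_obj A W P Q n) (complete_V_step (opcat A) W (opaug Q) (opaug P) n)"
    using op.complete_direct_system[OF proper_opcat[OF Q] proper_opcat[OF P]] unfolding complete_obj_opcat .
  show "direct_system (nat (- n)) (complete_W_obj A W P Q n) (complete_W_step A W P Q n)"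
    "colim_rel (nat (- n)) (complete_W_obj A W P Q n) (complete_W_step A W P Q n)
      = colim_rel (nat (- n)) (complete_W_obj A W P Q n) (complete_V_step (opcat A) W (opaug Q) (opaug P) n)"
    using seq_colim_cong[OF 1 complete_step_opcat[OF P Q]] by auto
qed

text \<open>Multiplication in the colimit uses the transition maps, so the two products are compared
  only on the carrier, after raising both factors to one level.\<close>

lemma complete_Ext_opcat:
  assumes P: "proper_resolution A W M P" and Q: "proper_resolution A W N Q"
  shows "carrier (complete_Ext_W A W P Q n) = carrier (complete_Ext_V (opcat A) W (opaug Q) (opaug P) n)"
    and "p \<in> carrier (complete_Ext_W A W P Q n) \<Longrightarrow> q \<in> carrier (complete_Ext_W A W P Q n) \<Longrightarrow>
      p \<otimes>\<^bsub>complete_Ext_W A W P Q n\<^esub> q = p \<otimes>\<^bsub>complete_Ext_V (opcat A) W (opaug Q) (opaug P) n\<^esub> q"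
proof -
  interpret V: direct_system "nat (- n)" "complete_W_obj A W P Q n" "complete_V_step (opcat A) W (opaug Q) (opaug P) n"
    by (rule complete_systems[OF P Q])
  interpret W: direct_system "nat (- n)" "complete_W_obj A W P Q n" "complete_W_step A W P Q n"
    by (rule complete_systems[OF P Q])
  note rel = complete_systems(3)[OF P Q, of n]
  show "carrier (complete_Ext_W A W P Q n) = carrier (complete_Ext_V (opcat A) W (opaug Q) (opaug P) n)"
    unfolding complete_Ext_W_def complete_Ext_V_def complete_obj_opcat V.carrier_seq_colim W.carrier_seq_colim rel ..
  assume "p \<in> carrier (complete_Ext_W A W P Q n)" "q \<in> carrier (complete_Ext_W A W P Q n)"
  then obtain i x j y where x: "nat (- n) \<le> i" "x \<in> carrier (complete_W_obj A W P Q n i)" "p = W.cl i x"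
    and y: "nat (- n) \<le> j" "y \<in> carrier (complete_W_obj A W P Q n j)" "q = W.cl j y"
    unfolding complete_Ext_W_def W.carrier_seq_colim by blast
  define k where "k = max i j"
  have k: "nat (- n) \<le> k" using x by (simp add: k_def)
  obtain x' where x': "x' \<in> carrier (complete_W_obj A W P Q n k)" "p = W.cl k x'"
    using W.class_transition[OF x(1,2), of "k - i"] W.transition_closed[OF x(1,2), of "k - i"] x(3)
    by (auto simp: k_def)
  obtain y' where y': "y' \<in> carrier (complete_W_obj A W P Q n k)" "q = W.cl k y'"
    using W.class_transition[OF y(1,2), of "k - j"] W.transition_closed[OF y(1,2), of "k - j"] y(3)
    by (auto simp: k_def)
  show "p \<otimes>\<^bsub>complete_Ext_W A W P Q n\<^esub> q = p \<otimes>\<^bsub>complete_Ext_V (opcat A) W (opaug Q) (opaug P) n\<^esub> q"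
    using W.class_mult[OF k x'(1) y'(1)] V.class_mult[OF k x'(1) y'(1)]
    unfolding complete_Ext_W_def complete_Ext_V_def complete_obj_opcat x'(2) y'(2) rel by simp
qed

lemma complete_act_opcat:
  assumes P: "proper_resolution A W M P" and P': "proper_resolution A W M' P'"
    and Q: "proper_resolution A W N Q" and Q': "proper_resolution A W N' Q'"
    and \<phi>: "resolution_lift A P' f P \<phi>" and \<gamma>: "resolution_lift A Q g Q' \<gamma>"
    and p: "p \<in> carrier (complete_Ext_W A W P Q n)"
  shows "complete_Ext_act_W A W P' P Q Q' n \<phi> \<gamma> p
    = complete_Ext_act_V (opcat A) W (opaug Q') (opaug Q) (opaug P) (opaug P') n (\<lambda>i. \<gamma> (- i)) (\<lambda>i. \<phi> (- i)) p"
proof -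
  note rel = complete_systems(3)[OF P' Q', of n]
  interpret W: direct_system "nat (- n)" "complete_W_obj A W P Q n" "complete_W_step A W P Q n"
    by (rule complete_systems[OF P Q])
  obtain i0 x0 where p: "p = W.cl i0 x0"
    using p unfolding complete_Ext_W_def W.carrier_seq_colim by blast
  let ?k = "\<lambda>i. nat (int i + n)"
  let ?u = "\<lambda>i. coset_map (Hom A (Omega A P' (?k i)) (Omega A Q' i)) (factoring A W (Omega A P' (?k i)) (Omega A Q' i))
            (\<lambda>h. Omega_map A Q Q' \<gamma> i \<cdot> h \<cdot> Omega_map A P' P \<phi> (?k i))"
  \<comment> \<open>Dualising brackets the triple composite the other way. Associativity holds for
    composable arrows, so the cosets must first be seen to consist of morphisms of the right
    type.\<close>
  let ?v = "\<lambda>i. coset_map (Hom A (Omega A P' (?k i)) (Omega A Q' i)) (factoring A W (Omega A P' (?k i)) (Omega A Q' i))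
            (\<lambda>h. (Omega_map A Q Q' \<gamma> i \<cdot> h) \<cdot> Omega_map A P' P \<phi> (?k i))"
  have "?u i x = ?v i x" if "(i, x) \<in> p" for i x
  proof -
    have "x \<in> carrier (complete_W_obj A W P Q n i)" using W.class_mem(2) that p by blast
    then obtain h where h: "h \<in> mor A (Omega A P (?k i)) (Omega A Q i)"
      "x = Hom_mod_class A W (Omega A P (?k i)) (Omega A Q i) h"
      by (auto simp: complete_W_obj_def Hom_mod_def carrier_FactGroup Hom_mod_class_def)
    have m: "Omega_map A Q Q' \<gamma> i \<in> mor A (Omega A Q i) (Omega A Q' i)"
      "Omega_map A P' P \<phi> (?k i) \<in> mor A (Omega A P' (?k i)) (Omega A P (?k i))"
      using op.Theta_map(1)[OF proper_opcat[OF Q'] proper_opcat[OF Q] lift_opcat[OF \<gamma>], of i]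
        op.Theta_map(1)[OF proper_opcat[OF P] proper_opcat[OF P'] lift_opcat[OF \<phi>], of "?k i"]
      by (simp_all add: Theta_map_opcat)
    have "h' \<in> mor A (Omega A P (?k i)) (Omega A Q i)" if "h' \<in> x" for h'
      using that h factoring_subset[of W "Omega A P (?k i)" "Omega A Q i"]
      by (auto simp: Hom_mod_class_def r_coset_def intro!: mor_simps(2))
    then have "Omega_map A Q Q' \<gamma> i \<cdot> h' \<cdot> Omega_map A P' P \<phi> (?k i)
      = (Omega_map A Q Q' \<gamma> i \<cdot> h') \<cdot> Omega_map A P' P \<phi> (?k i)" if "h' \<in> x" for h'
      using that m by (auto simp: mor_def)
    then show ?thesis unfolding coset_map_def by (intro SUP_cong refl) simp
  qed
  then have "(\<Union>(i, x)\<in>p. colim_rel (nat (- n)) (complete_W_obj A W P' Q' n) (complete_W_step A W P' Q' n) `` {(i, ?u i x)})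
    = (\<Union>(i, x)\<in>p. colim_rel (nat (- n)) (complete_W_obj A W P' Q' n) (complete_W_step A W P' Q' n) `` {(i, ?v i x)})"
    by (intro SUP_cong refl) auto
  then show ?thesis
    by (simp add: complete_Ext_act_W_def complete_Ext_act_V_def seq_colim_map_def complete_obj_opcat rel
        Theta_map_opcat Let_def)
qed

text \<open>Reindexing by i \<mapsto> -i matches lifts of resolutions with lifts of coresolutions,
  and f and g exchange their roles; both \<open>THE\<close> descriptions then have the same
  candidates.\<close>

lemma complete_map_opcat:
  assumes P: "proper_resolution A W M P" and P': "proper_resolution A W M' P'"
    and Q: "proper_resolution A W N Q" and Q': "proper_resolution A W N' Q'"
    and p: "p \<in> carrier (complete_Ext_W A W P Q n)"
  shows "complete_Ext_map_W A W P' P Q Q' n f g p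
    = complete_Ext_map_V (opcat A) W (opaug Q') (opaug Q) (opaug P) (opaug P') n g f p"
proof -
  have "(\<exists>\<phi> \<gamma>. resolution_lift A P' f P \<phi> \<and> resolution_lift A Q g Q' \<gamma> \<and> y = complete_Ext_act_W A W P' P Q Q' n \<phi> \<gamma> p)
    \<longleftrightarrow> (\<exists>\<phi> \<gamma>. coresolution_lift (opcat A) (opaug Q') g (opaug Q) \<phi> \<and>
        coresolution_lift (opcat A) (opaug P) f (opaug P') \<gamma> \<and>
        y = complete_Ext_act_V (opcat A) W (opaug Q') (opaug Q) (opaug P) (opaug P') n \<phi> \<gamma> p)" for y
  proof safe
    fix \<phi> \<gamma> assume l: "resolution_lift A P' f P \<phi>" "resolution_lift A Q g Q' \<gamma>"
    then show "\<exists>\<phi>' \<gamma>'. coresolution_lift (opcat A) (opaug Q') g (opaug Q) \<phi>' \<and>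
        coresolution_lift (opcat A) (opaug P) f (opaug P') \<gamma>' \<and>
        complete_Ext_act_W A W P' P Q Q' n \<phi> \<gamma> p
          = complete_Ext_act_V (opcat A) W (opaug Q') (opaug Q) (opaug P) (opaug P') n \<phi>' \<gamma>' p"
      using complete_act_opcat[OF P P' Q Q' l p] lift_opcat[OF l(1)] lift_opcat[OF l(2)] by blast
  next
    fix \<phi> \<gamma> assume l: "coresolution_lift (opcat A) (opaug Q') g (opaug Q) \<phi>"
      "coresolution_lift (opcat A) (opaug P) f (opaug P') \<gamma>"
    note l' = lift_opcat'[OF l(2)] lift_opcat'[OF l(1)]
    show "\<exists>\<phi>' \<gamma>'. resolution_lift A P' f P \<phi>' \<and> resolution_lift A Q g Q' \<gamma>' \<and>
        complete_Ext_act_V (opcat A) W (opaug Q') (opaug Q) (opaug P) (opaug P') n \<phi> \<gamma> p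
          = complete_Ext_act_W A W P' P Q Q' n \<phi>' \<gamma>' p"
      using complete_act_opcat[OF P P' Q Q' l' p] l' by (intro exI conjI) (auto)
  qed
  then show ?thesis unfolding complete_Ext_map_W_def complete_Ext_map_V_def by simp
qed

end

section \<open>Reversal of stable cocycles\<close>

lemma finite_reflect:
  assumes "finite {i::int. P i}"
  shows "finite {j. P (c - j)}"
proof -
  have "{j. P (c - j)} = (\<lambda>i. c - i) ` {i. P i}" by (auto simp: image_iff) (metis diff_diff_eq2 add_diff_cancel_left')
  then show ?thesis using assms by simp
qed

text \<open>The component from \<open>P^i\<close> to \<open>Q^(n+i)\<close>, reversed, starts in
  degree j = -n-i of \<open>opaug Q\<close> and ends in degree n + j = -i of \<open>opaug P\<close>;
  solving for i gives the index -n-j.\<close>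

lemma carrier_hom_cx_opcat:
  assumes "abelian_category A" and "\<alpha> \<in> carrier (hom_cx A P Q n)"
  shows "(\<lambda>j. \<alpha> (- n - j)) \<in> carrier (hom_cx (opcat A) (opaug Q) (opaug P) n)"
proof -
  interpret A: abelian_category A by (rule assms(1))
  interpret op: abelian_category "opcat A" by (rule A.op_abelian)
  have "\<alpha> (- n - j) \<in> mor A (cobj P (- n - j)) (cobj Q (n + (- n - j)))" for j
    using assms(2) unfolding A.carrier_hom_cx by blast
  then show ?thesis unfolding op.carrier_hom_cx by simp
qed

text \<open>The reversed equation in degree j is the original one in degree -n-1-j with its sides
  exchanged; the sign moves across because applying it twice is the identity.\<close>

lemma stable_cocycle_opcat:
  assumes A: "abelian_category A" and P: "cochain_complex A P" and Q: "cochain_complex A Q"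
    and \<alpha>: "\<alpha> \<in> stable_cocycle A P Q n"
  shows "(\<lambda>j. \<alpha> (- n - j)) \<in> stable_cocycle (opcat A) (opaug Q) (opaug P) n"
proof -
  interpret A: abelian_category A by (rule A)
  note s = A.complex_cdiff_simps[OF P] A.complex_cdiff_simps[OF Q]
  have c: "\<alpha> \<in> carrier (hom_cx A P Q n)" using \<alpha> by (simp add: stable_cocycle_def)
  have a: "\<alpha> i \<in> Ar A" "Src A (\<alpha> i) = cobj P i" "Tgt A (\<alpha> i) = cobj Q (n + i)" for i
    using c by (auto simp: A.carrier_hom_cx mor_def)
  have fin: "finite {i. Compose A (cdiff Q (n + i)) (\<alpha> i) \<noteq> koszul A n (Compose A (\<alpha> (i + 1)) (cdiff P i))}"
    using \<alpha> by (simp add: stable_cocycle_def)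
  have "Compose A (\<alpha> (- n - j)) (cdiff P (- (n + j) - 1))
      = koszul A n (Compose A (cdiff Q (- j - 1)) (\<alpha> (- n - (j + 1))))"
    if e: "Compose A (cdiff Q (n + (- n - 1 - j))) (\<alpha> (- n - 1 - j))
      = koszul A n (Compose A (\<alpha> (- n - 1 - j + 1)) (cdiff P (- n - 1 - j)))" for j
  proof -
    have x: "n + (- n - 1 - j) = - j - 1" "- n - 1 - j + 1 = - n - j" "- (n + j) - 1 = - n - 1 - j"
      "- n - (j + 1) = - n - 1 - j" by simp_all
    have "koszul A n (Compose A (cdiff Q (- j - 1)) (\<alpha> (- n - 1 - j)))
      = koszul A n (koszul A n (Compose A (\<alpha> (- n - j)) (cdiff P (- n - 1 - j))))"
      using e unfolding x by simp
    also have "\<dots> = Compose A (\<alpha> (- n - j)) (cdiff P (- n - 1 - j))"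
      by (rule A.koszul_twice) (simp add: a s)
    finally show ?thesis unfolding x by simp
  qed
  then have "{j. Compose A (\<alpha> (- n - j)) (cdiff P (- (n + j) - 1))
      \<noteq> koszul A n (Compose A (cdiff Q (- j - 1)) (\<alpha> (- n - (j + 1))))}
    \<subseteq> {j. Compose A (cdiff Q (n + (- n - 1 - j))) (\<alpha> (- n - 1 - j))
      \<noteq> koszul A n (Compose A (\<alpha> (- n - 1 - j + 1)) (cdiff P (- n - 1 - j)))}" by blast
  then have "finite {j. Compose A (\<alpha> (- n - j)) (cdiff P (- (n + j) - 1))
      \<noteq> koszul A n (Compose A (cdiff Q (- j - 1)) (\<alpha> (- n - (j + 1))))}"
    using finite_reflect[OF fin, of "- n - 1"] finite_subset by blast
  then show ?thesis using carrier_hom_cx_opcat[OF A c] by (simp add: stable_cocycle_def)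
qed

text \<open>
  Reversing \<open>\<alpha>\<close> to \<open>j \<mapsto> \<alpha> (- n - j)\<close> changes the differential by the sign \<open>(-1)\<^sup>n\<close>, which the
  cochain bounding \<open>\<alpha> - \<beta>\<close> has to absorb.
\<close>

lemma stable_class_opcat_imp:
  assumes A: "abelian_category A" and P: "cochain_complex A P" and Q: "cochain_complex A Q"
    and \<alpha>: "\<alpha> \<in> carrier (hom_cx A P Q n)" and \<beta>: "\<beta> \<in> carrier (hom_cx A P Q n)"
    and eq: "stable_class A P Q n \<alpha> = stable_class A P Q n \<beta>"
  shows "stable_class (opcat A) (opaug Q) (opaug P) n (\<lambda>j. \<alpha> (- n - j))
    = stable_class (opcat A) (opaug Q) (opaug P) n (\<lambda>j. \<beta> (- n - j))"
proof -
  interpret A: abelian_category A by (rule A)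
  interpret op: abelian_category "opcat A" by (rule A.op_abelian)
  note sd = A.complex_cdiff_simps[OF P] A.complex_cdiff_simps[OF Q]
  note c = cochain_complex_opcat[OF P] cochain_complex_opcat[OF Q]
  obtain s where s: "s \<in> carrier (hom_cx A P Q (n - 1))"
    and fin: "finite {i. \<alpha> i \<noteq> Plus A (hom_diff A P Q (n - 1) s i) (\<beta> i)}"
    using eq A.stable_Ext_facts(3)[OF P Q \<alpha> \<beta>] by blast
  have sa: "s i \<in> Ar A" "Src A (s i) = cobj P i" "Tgt A (s i) = cobj Q (n - 1 + i)" for i
    using s by (auto simp: A.carrier_hom_cx mor_def)
  define s' where "s' j = koszul A n (s (- (n - 1) - j))" for j
  have s': "s' \<in> carrier (hom_cx (opcat A) (opaug Q) (opaug P) (n - 1))"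
    using carrier_hom_cx_opcat[OF A s] op.koszul_mor unfolding op.carrier_hom_cx s'_def by simp
  have "hom_diff (opcat A) (opaug Q) (opaug P) (n - 1) s' j = hom_diff A P Q (n - 1) s (- n - j)" for j
  proof -
    define i where "i = - n - j"
    have x: "- (n - 1) - j = i + 1" "- (n - 1) - (j + 1) = i" "- (n - 1 + j) - 1 = i" "- j - 1 = n - 1 + i"
      by (auto simp: i_def)
    have "hom_diff (opcat A) (opaug Q) (opaug P) (n - 1) s' j
      = Plus A (Compose A (koszul A n (s (i + 1))) (cdiff P i))
         (koszul A n (Compose A (cdiff Q (n - 1 + i)) (koszul A n (s i))))"
      unfolding op.hom_diff_koszul s'_def by (simp add: x del: minus_add_distrib minus_diff_eq diff_add_eq)
    also have "\<dots> = Plus A (koszul A n (Compose A (s (i + 1)) (cdiff P i))) (Compose A (cdiff Q (n - 1 + i)) (s i))"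
      by (simp add: sa sd A.koszul_comp A.koszul_twice)
    also have "\<dots> = hom_diff A P Q (n - 1) s i"
      unfolding A.hom_diff_koszul by (simp add: sa sd A.plus_commute add_ac)
    finally show ?thesis unfolding i_def .
  qed
  then have "finite {j. \<alpha> (- n - j) \<noteq> Plus (opcat A) (hom_diff (opcat A) (opaug Q) (opaug P) (n - 1) s' j) (\<beta> (- n - j))}"
    using finite_reflect[OF fin, of "- n"] by simp
  then show ?thesis
    using s' op.stable_Ext_facts(3)[OF c(2,1) carrier_hom_cx_opcat[OF A \<alpha>] carrier_hom_cx_opcat[OF A \<beta>]] by blast
qed

text \<open>Reversing twice restores the cochain and the category, so the implication just proved
  also gives its converse.\<close>

lemma stable_class_opcat_iff:
  assumes A: "abelian_category A" and P: "cochain_complex A P" and Q: "cochain_complex A Q"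
    and \<alpha>: "\<alpha> \<in> carrier (hom_cx A P Q n)" and \<beta>: "\<beta> \<in> carrier (hom_cx A P Q n)"
  shows "stable_class (opcat A) (opaug Q) (opaug P) n (\<lambda>j. \<alpha> (- n - j))
      = stable_class (opcat A) (opaug Q) (opaug P) n (\<lambda>j. \<beta> (- n - j))
    \<longleftrightarrow> stable_class A P Q n \<alpha> = stable_class A P Q n \<beta>"
  using stable_class_opcat_imp[OF assms]
    stable_class_opcat_imp[OF abelian_category_opcat[OF A] cochain_complex_opcat[OF Q] cochain_complex_opcat[OF P]
      carrier_hom_cx_opcat[OF A \<alpha>] carrier_hom_cx_opcat[OF A \<beta>]] by auto

lemma stable_dual_iso:
  assumes A: "abelian_category A" and P: "cochain_complex A P" and Q: "cochain_complex A Q"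
  shows "\<exists>\<rho>\<in>iso (stable_Ext A P Q n) (stable_Ext (opcat A) (opaug Q) (opaug P) n).
    \<forall>\<alpha>\<in>stable_cocycle A P Q n. \<rho> (stable_class A P Q n \<alpha>) = stable_class (opcat A) (opaug Q) (opaug P) n (\<lambda>j. \<alpha> (- n - j))"
proof -
  interpret A: abelian_category A by (rule A)
  interpret op: abelian_category "opcat A" by (rule A.op_abelian)
  note c = cochain_complex_opcat[OF Q] cochain_complex_opcat[OF P]
  let ?d = "\<lambda>\<alpha> j. \<alpha> (- n - j)"
  let ?c = "stable_class (opcat A) (opaug Q) (opaug P) n"
  let ?C = "stable_Ext (opcat A) (opaug Q) (opaug P) n"
  have C: "?c (?d \<alpha>) \<in> carrier ?C" if "\<alpha> \<in> stable_cocycle A P Q n" for \<alpha>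
    using stable_cocycle_opcat[OF A P Q that] unfolding op.stable_Ext_facts(1)[OF c] by blast
  have "\<exists>\<rho>\<in>iso (stable_Ext A P Q n) ?C.
    \<forall>\<alpha>\<in>stable_cocycle A P Q n. \<forall>y\<in>carrier ?C. y = ?c (?d \<alpha>) \<longrightarrow> \<rho> (stable_class A P Q n \<alpha>) = y"
  proof (rule iso_of_relation[OF A.stable_Ext_facts(1)[OF P Q]])
    show "\<exists>y\<in>carrier ?C. y = ?c (?d \<alpha>)" if "\<alpha> \<in> stable_cocycle A P Q n" for \<alpha>
      using C[OF that] by blast
    show "\<exists>\<alpha>\<in>stable_cocycle A P Q n. y = ?c (?d \<alpha>)" if y: "y \<in> carrier ?C" for y
    proof -
      obtain \<beta> where \<beta>: "\<beta> \<in> stable_cocycle (opcat A) (opaug Q) (opaug P) n" "y = ?c \<beta>"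
        using y unfolding op.stable_Ext_facts(1)[OF c] by blast
      \<comment> \<open>Reversal is an involution, so reversing a cocycle of the opposite category
        yields its preimage.\<close>
      have "?d \<beta> \<in> stable_cocycle A P Q n"
        using stable_cocycle_opcat[OF A.op_abelian c \<beta>(1)] by simp
      then show ?thesis using \<beta>(2) by (intro bexI[of _ "?d \<beta>"]) simp_all
    qed
    fix \<alpha> \<beta> y z assume ab: "\<alpha> \<in> stable_cocycle A P Q n" "\<beta> \<in> stable_cocycle A P Q n"
      and yz: "y = ?c (?d \<alpha>)" "z = ?c (?d \<beta>)"
    have abc: "\<alpha> \<in> carrier (hom_cx A P Q n)" "\<beta> \<in> carrier (hom_cx A P Q n)"
      using ab by (simp_all add: stable_cocycle_def)
    show "stable_class A P Q n \<alpha> = stable_class A P Q n \<beta> \<longleftrightarrow> y = z"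
      unfolding yz using stable_class_opcat_iff[OF A P Q abc] by blast
    note p = A.stable_cocycle_plus[OF P Q ab]
    have "?c (?d (\<lambda>i. Plus A (\<alpha> i) (\<beta> i))) = y \<otimes>\<^bsub>?C\<^esub> z"
      using op.stable_Ext_facts(2)[OF c carrier_hom_cx_opcat[OF A abc(1)] carrier_hom_cx_opcat[OF A abc(2)]]
      unfolding yz by simp
    then show "y \<otimes>\<^bsub>?C\<^esub> z \<in> carrier ?C \<and> (\<exists>e\<in>stable_cocycle A P Q n. stable_class A P Q n e
        = stable_class A P Q n \<alpha> \<otimes>\<^bsub>stable_Ext A P Q n\<^esub> stable_class A P Q n \<beta> \<and> y \<otimes>\<^bsub>?C\<^esub> z = ?c (?d e))"
      using C[OF p] p A.stable_Ext_facts(2)[OF P Q abc] by (intro conjI bexI[of _ "\<lambda>i. Plus A (\<alpha> i) (\<beta> i)"]) simp_all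
  qed
  then obtain \<rho> where "\<rho> \<in> iso (stable_Ext A P Q n) ?C"
    "\<forall>\<alpha>\<in>stable_cocycle A P Q n. \<forall>y\<in>carrier ?C. y = ?c (?d \<alpha>) \<longrightarrow> \<rho> (stable_class A P Q n \<alpha>) = y"
    by (rule bexE)
  then show ?thesis using C by (intro bexI[of _ \<rho>]) simp_all
qed

context resolving
begin

lemma act_dual:
  assumes \<phi>: "resolution_lift A P' f P \<phi>" and \<gamma>: "resolution_lift A Q g Q' \<gamma>"
    and \<alpha>: "\<alpha> \<in> carrier (hom_cx A P Q n)"
  shows "(\<lambda>j. Compose (opcat A) (\<phi> (- (n + j))) (Compose (opcat A) (\<alpha> (- n - j)) (\<gamma> (- j))))
    = (\<lambda>j. \<gamma> (n + (- n - j)) \<cdot> \<alpha> (- n - j) \<cdot> \<phi> (- n - j))"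
proof
  fix j
  define i where "i = - n - j"
  have x: "- (n + j) = i" "- n - j = i" "- j = n + i" "n + (- n - j) = n + i" by (simp_all add: i_def)
  have "\<phi> i \<in> mor A (cobj P' i) (cobj P i)" "\<gamma> (n + i) \<in> mor A (cobj Q (n + i)) (cobj Q' (n + i))"
    "\<alpha> i \<in> mor A (cobj P i) (cobj Q (n + i))"
    using \<phi> \<gamma> \<alpha> by (auto simp: resolution_lift_def cochain_map_def carrier_hom_cx)
  then show "Compose (opcat A) (\<phi> (- (n + j))) (Compose (opcat A) (\<alpha> (- n - j)) (\<gamma> (- j)))
    = \<gamma> (n + (- n - j)) \<cdot> \<alpha> (- n - j) \<cdot> \<phi> (- n - j)"
    unfolding x opcat_simps by (auto simp: mor_def)
qed

lemma resolution_lift_exists: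
  assumes P: "proper_resolution A W M P" and P': "proper_resolution A W M' P'" and f: "f \<in> mor A M' M"
  shows "\<exists>\<phi>. resolution_lift A P' f P \<phi>"
proof -
  obtain \<phi> where "coresolution_lift (opcat A) (opaug P) f (opaug P') \<phi>"
    using op.lift_exists[OF proper_opcat[OF P] proper_opcat[OF P'], of f] f by auto
  from lift_opcat'[OF this] show ?thesis by blast
qed

text \<open>Independence of the lifts is imported by duality: after reversal every choice gives the
  induced map in the opposite category, and reversal is injective on stable classes.\<close>

lemma stable_map_W:
  assumes P: "proper_resolution A W M P" and P': "proper_resolution A W M' P'"
    and Q: "proper_resolution A W N Q" and Q': "proper_resolution A W N' Q'"
    and \<phi>: "resolution_lift A P' f P \<phi>" and \<gamma>: "resolution_lift A Q g Q' \<gamma>"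
    and \<alpha>: "\<alpha> \<in> stable_cocycle A P Q n"
  shows "stable_Ext_map_W A P' P Q Q' n f g (stable_class A P Q n \<alpha>)
      = stable_class A P' Q' n (\<lambda>i. \<gamma> (n + i) \<cdot> \<alpha> i \<cdot> \<phi> i)" (is ?E)
    and "stable_class (opcat A) (opaug Q') (opaug P') n (\<lambda>j. \<gamma> (n + (- n - j)) \<cdot> \<alpha> (- n - j) \<cdot> \<phi> (- n - j))
      = stable_Ext_map_V (opcat A) (opaug Q') (opaug Q) (opaug P) (opaug P') n g f
          (stable_class (opcat A) (opaug Q) (opaug P) n (\<lambda>j. \<alpha> (- n - j)))" (is ?D)
proof -
  have cx: "cochain_complex A P" "cochain_complex A P'" "cochain_complex A Q" "cochain_complex A Q'"
    using P P' Q Q' by (simp_all add: proper_resolution_def)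
  have \<alpha>c: "\<alpha> \<in> carrier (hom_cx A P Q n)" using \<alpha> by (simp add: stable_cocycle_def)
  have op: "stable_class (opcat A) (opaug Q') (opaug P') n (\<lambda>j. \<gamma> (n + (- n - j)) \<cdot> \<alpha> (- n - j) \<cdot> \<phi> (- n - j))
      = stable_Ext_map_V (opcat A) (opaug Q') (opaug Q) (opaug P) (opaug P') n g f
          (stable_class (opcat A) (opaug Q) (opaug P) n (\<lambda>j. \<alpha> (- n - j)))"
    if \<phi>: "resolution_lift A P' f P \<phi>" and \<gamma>: "resolution_lift A Q g Q' \<gamma>" for \<phi> \<gamma>
    using op.stable_map[OF proper_opcat[OF Q] proper_opcat[OF Q'] proper_opcat[OF P] proper_opcat[OF P']
        lift_opcat[OF \<gamma>] lift_opcat[OF \<phi>] stable_cocycle_opcat[OF abelian_category_axioms cx(1,3) \<alpha>]]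
    unfolding act_dual[OF \<phi> \<gamma> \<alpha>c] by (rule sym)
  show ?D by (rule op[OF \<phi> \<gamma>])
  have m: "cochain_map A P' P \<phi>" "cochain_map A Q Q' \<gamma>"
    if "resolution_lift A P' f P \<phi>" "resolution_lift A Q g Q' \<gamma>" for \<phi> \<gamma>
    using that by (simp_all add: resolution_lift_def)
  note act = stable_Ext_act_class[OF cx m \<alpha>c] and car = act_carrier[OF m \<alpha>c]
  show ?E
    unfolding stable_Ext_map_W_def
  proof (rule the_equality)
    show "\<exists>\<phi>' \<gamma>'. resolution_lift A P' f P \<phi>' \<and> resolution_lift A Q g Q' \<gamma>' \<and>
      stable_class A P' Q' n (\<lambda>i. \<gamma> (n + i) \<cdot> \<alpha> i \<cdot> \<phi> i) = stable_Ext_act A P' Q' n \<phi>' \<gamma>' (stable_class A P Q n \<alpha>)"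
      using act[OF \<phi> \<gamma> \<phi> \<gamma>] \<phi> \<gamma> by metis
    fix y assume "\<exists>\<phi>' \<gamma>'. resolution_lift A P' f P \<phi>' \<and> resolution_lift A Q g Q' \<gamma>' \<and>
      y = stable_Ext_act A P' Q' n \<phi>' \<gamma>' (stable_class A P Q n \<alpha>)"
    then obtain \<phi>' \<gamma>' where l: "resolution_lift A P' f P \<phi>'" "resolution_lift A Q g Q' \<gamma>'"
      and y: "y = stable_Ext_act A P' Q' n \<phi>' \<gamma>' (stable_class A P Q n \<alpha>)" by blast
    show "y = stable_class A P' Q' n (\<lambda>i. \<gamma> (n + i) \<cdot> \<alpha> i \<cdot> \<phi> i)"
      unfolding y act[OF l l]
      using op[OF l] op[OF \<phi> \<gamma>]
        stable_class_opcat_iff[OF abelian_category_axioms cx(2,4) car[OF l l] car[OF \<phi> \<gamma> \<phi> \<gamma>]] by simp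
  qed
qed

theorem stable_iso_complete:
  fixes P R :: "'o \<Rightarrow> ('o, 'm) augmented" and n :: int
  assumes P: "\<And>M. M \<in> Ob A \<Longrightarrow> proper_resolution A W M (P M)"
    and R: "\<And>M. M \<in> Ob A \<Longrightarrow> proper_resolution A W M (R M)"
  shows "\<exists>\<Psi>.
      (\<forall>M\<in>Ob A. \<forall>N\<in>Ob A.
         \<Psi> M N \<in> iso (stable_Ext A (P M) (P N) n) (complete_Ext_W A W (R M) (R N) n)) \<and>
      (\<forall>M\<in>Ob A. \<forall>N\<in>Ob A. \<forall>M'\<in>Ob A. \<forall>N'\<in>Ob A. \<forall>f\<in>mor A M' M. \<forall>g\<in>mor A N N'.
         \<forall>x\<in>carrier (stable_Ext A (P M) (P N) n).
           \<Psi> M' N' (stable_Ext_map_W A (P M') (P M) (P N) (P N') n f g x)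
             = complete_Ext_map_W A W (R M') (R M) (R N) (R N') n f g (\<Psi> M N x))"
proof -
  have "\<And>M. M \<in> Ob (opcat A) \<Longrightarrow> proper_coresolution (opcat A) W M (opaug (P M))"
    "\<And>M. M \<in> Ob (opcat A) \<Longrightarrow> proper_coresolution (opcat A) W M (opaug (R M))"
    using proper_opcat P R by simp_all
  from op.stable_iso_complete[OF this, of n] obtain \<Phi> where
    \<Phi>: "\<And>M N. M \<in> Ob A \<Longrightarrow> N \<in> Ob A \<Longrightarrow> \<Phi> M N \<in> iso (stable_Ext (opcat A) (opaug (P M)) (opaug (P N)) n)
      (complete_Ext_V (opcat A) W (opaug (R M)) (opaug (R N)) n)"
    and nat: "\<And>M N M' N' f g x. M \<in> Ob A \<Longrightarrow> N \<in> Ob A \<Longrightarrow> M' \<in> Ob A \<Longrightarrow> N' \<in> Ob A \<Longrightarrow>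
      f \<in> mor A M M' \<Longrightarrow> g \<in> mor A N' N \<Longrightarrow> x \<in> carrier (stable_Ext (opcat A) (opaug (P M)) (opaug (P N)) n) \<Longrightarrow>
      \<Phi> M' N' (stable_Ext_map_V (opcat A) (opaug (P M')) (opaug (P M)) (opaug (P N)) (opaug (P N')) n f g x)
       = complete_Ext_map_V (opcat A) W (opaug (R M')) (opaug (R M)) (opaug (R N)) (opaug (R N')) n f g (\<Phi> M N x)"
    unfolding opcat_simps mor_opcat by metis
  let ?P = "\<lambda>M N \<rho>. \<rho> \<in> iso (stable_Ext A (P M) (P N) n) (stable_Ext (opcat A) (opaug (P N)) (opaug (P M)) n) \<and>
    (\<forall>\<alpha>\<in>stable_cocycle A (P M) (P N) n. \<rho> (stable_class A (P M) (P N) n \<alpha>)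
      = stable_class (opcat A) (opaug (P N)) (opaug (P M)) n (\<lambda>j. \<alpha> (- n - j)))"
  define \<rho> where "\<rho> M N = (SOME \<rho>. ?P M N \<rho>)" for M N
  have cx: "cochain_complex A (P M)" if "M \<in> Ob A" for M
    using P[OF that] by (simp add: proper_resolution_def)
  have "?P M N (\<rho> M N)" if "M \<in> Ob A" "N \<in> Ob A" for M N
  proof -
    have "\<exists>\<rho>. ?P M N \<rho>"
      using stable_dual_iso[OF abelian_category_axioms cx[OF that(1)] cx[OF that(2)], of n] unfolding Bex_def[of "iso _ _"] .
    then show ?thesis unfolding \<rho>_def by (rule someI_ex)
  qed
  then have \<rho>: "\<And>M N. M \<in> Ob A \<Longrightarrow> N \<in> Ob A \<Longrightarrow>
      \<rho> M N \<in> iso (stable_Ext A (P M) (P N) n) (stable_Ext (opcat A) (opaug (P N)) (opaug (P M)) n)"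
    and \<rho>': "\<And>M N \<alpha>. M \<in> Ob A \<Longrightarrow> N \<in> Ob A \<Longrightarrow> \<alpha> \<in> stable_cocycle A (P M) (P N) n \<Longrightarrow>
      \<rho> M N (stable_class A (P M) (P N) n \<alpha>) = stable_class (opcat A) (opaug (P N)) (opaug (P M)) n (\<lambda>j. \<alpha> (- n - j))"
    by simp_all
  \<comment> \<open>Reversal exchanges the two arguments, hence the swapped indices of
    \<open>\<Phi>\<close>.\<close>
  define \<Psi> where "\<Psi> M N = \<Phi> N M \<circ> \<rho> M N" for M N
  have iso: "\<Psi> M N \<in> iso (stable_Ext A (P M) (P N) n) (complete_Ext_V (opcat A) W (opaug (R N)) (opaug (R M)) n)"
    if "M \<in> Ob A" "N \<in> Ob A" for M N
    unfolding \<Psi>_def by (rule iso_set_trans[OF \<rho>[OF that] \<Phi>[OF that(2,1)]])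
  show ?thesis
  proof (intro exI[of _ \<Psi>] conjI ballI)
    fix M N assume MN: "M \<in> Ob A" "N \<in> Ob A"
    note C = complete_Ext_opcat[OF R[OF MN(1)] R[OF MN(2)], where n = n]
    \<comment> \<open>The colimit for \<open>W\<close> and its dual have the same elements and the
      same product on them, so an isomorphism onto one is an isomorphism onto the other.\<close>
    show "\<Psi> M N \<in> iso (stable_Ext A (P M) (P N) n) (complete_Ext_W A W (R M) (R N) n)"
      using iso[OF MN] C by (auto simp: iso_def hom_def Pi_iff)
    fix M' N' f g x
    assume MN': "M' \<in> Ob A" "N' \<in> Ob A" and f: "f \<in> mor A M' M" and g: "g \<in> mor A N N'"
      and x: "x \<in> carrier (stable_Ext A (P M) (P N) n)"
    note P' = P[OF MN(1)] P[OF MN'(1)] P[OF MN(2)] P[OF MN'(2)]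
    note R' = R[OF MN(1)] R[OF MN'(1)] R[OF MN(2)] R[OF MN'(2)]
    obtain \<alpha> where \<alpha>: "\<alpha> \<in> stable_cocycle A (P M) (P N) n" "x = stable_class A (P M) (P N) n \<alpha>"
      using x stable_Ext_facts(1)[OF cx[OF MN(1)] cx[OF MN(2)]] by auto
    obtain \<phi> \<gamma> where l: "resolution_lift A (P M') f (P M) \<phi>" "resolution_lift A (P N) g (P N') \<gamma>"
      using resolution_lift_exists[OF P'(1,2) f] resolution_lift_exists[OF P'(4,3) g] by blast
    let ?\<beta> = "\<lambda>i. \<gamma> (n + i) \<cdot> \<alpha> i \<cdot> \<phi> i"
    note s = stable_map_W[OF P' l \<alpha>(1)]
    have \<beta>: "?\<beta> \<in> stable_cocycle A (P M') (P N') n"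
      by (rule act_stable_cocycle[OF cx[OF MN(1)] cx[OF MN'(1)] cx[OF MN(2)] cx[OF MN'(2)] _ _ \<alpha>(1)])
        (use l in \<open>simp_all add: resolution_lift_def\<close>)
    have "\<rho> M' N' (stable_Ext_map_W A (P M') (P M) (P N) (P N') n f g x)
      = stable_Ext_map_V (opcat A) (opaug (P N')) (opaug (P N)) (opaug (P M)) (opaug (P M')) n g f (\<rho> M N x)"
      unfolding \<alpha>(2) s(1) \<rho>'[OF MN' \<beta>] \<rho>'[OF MN \<alpha>(1)] s(2) ..
    moreover have "\<rho> M N x \<in> carrier (stable_Ext (opcat A) (opaug (P N)) (opaug (P M)) n)"
      using \<rho>[OF MN] x by (auto simp: iso_def hom_def)
    ultimately have "\<Psi> M' N' (stable_Ext_map_W A (P M') (P M) (P N) (P N') n f g x)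
      = complete_Ext_map_V (opcat A) W (opaug (R N')) (opaug (R N)) (opaug (R M)) (opaug (R M')) n g f (\<Psi> M N x)"
      unfolding \<Psi>_def comp_def using nat[OF MN(2,1) MN'(2,1) g f] by simp
    moreover have "\<Psi> M N x \<in> carrier (complete_Ext_W A W (R M) (R N) n)"
      using iso[OF MN] x C(1) by (auto simp: iso_def hom_def)
    ultimately show "\<Psi> M' N' (stable_Ext_map_W A (P M') (P M) (P N) (P N') n f g x)
             = complete_Ext_map_W A W (R M') (R M) (R N) (R N') n f g (\<Psi> M N x)"
      using complete_map_opcat[OF R'(1-4)] by simp
  qed
qed

end

theorem proposition4p5:
  fixes A :: "('o, 'm) addcat"
    and V W :: "'o set"
    and I S P R :: "'o \<Rightarrow> ('o, 'm) augmented"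
  assumes "abelian_category A"
    and "subcategory A V" and "special_preenveloping A V"
    and "subcategory A W" and "special_precovering A W"
    and "\<And>M. M \<in> Ob A \<Longrightarrow> proper_coresolution A V M (I M)"
    and "\<And>M. M \<in> Ob A \<Longrightarrow> special_coresolution A V M (S M)"
    and "\<And>M. M \<in> Ob A \<Longrightarrow> proper_resolution A W M (P M)"
    and "\<And>M. M \<in> Ob A \<Longrightarrow> special_resolution A W M (R M)"
  shows "\<forall>n :: int.
    (\<exists>\<Phi>.
      (\<forall>M\<in>Ob A. \<forall>N\<in>Ob A.
         \<Phi> M N \<in> iso (stable_Ext A (I M) (I N) n) (complete_Ext_V A V (S M) (S N) n)) \<and>
      (\<forall>M\<in>Ob A. \<forall>N\<in>Ob A. \<forall>M'\<in>Ob A. \<forall>N'\<in>Ob A. \<forall>f\<in>mor A M' M. \<forall>g\<in>mor A N N'.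
         \<forall>x\<in>carrier (stable_Ext A (I M) (I N) n).
           \<Phi> M' N' (stable_Ext_map_V A (I M') (I M) (I N) (I N') n f g x)
             = complete_Ext_map_V A V (S M') (S M) (S N) (S N') n f g (\<Phi> M N x))) \<and>
    (\<exists>\<Psi>.
      (\<forall>M\<in>Ob A. \<forall>N\<in>Ob A.
         \<Psi> M N \<in> iso (stable_Ext A (P M) (P N) n) (complete_Ext_W A W (R M) (R N) n)) \<and>
      (\<forall>M\<in>Ob A. \<forall>N\<in>Ob A. \<forall>M'\<in>Ob A. \<forall>N'\<in>Ob A. \<forall>f\<in>mor A M' M. \<forall>g\<in>mor A N N'.
         \<forall>x\<in>carrier (stable_Ext A (P M) (P N) n).
           \<Psi> M' N' (stable_Ext_map_W A (P M') (P M) (P N) (P N') n f g x)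
             = complete_Ext_map_W A W (R M') (R M) (R N) (R N') n f g (\<Psi> M N x)))"
proof -
  interpret V: coresolving A V
    using assms(1,2) by (intro coresolving.intro coresolving_axioms.intro)
  interpret W: resolving A W
    using assms(1,4) by (intro resolving.intro resolving_axioms.intro)
  \<comment> \<open>Special coresolutions and resolutions are by definition proper, which puts both
    halves into the setting of the two preceding theorems.\<close>
  have S: "\<And>M. M \<in> Ob A \<Longrightarrow> proper_coresolution A V M (S M)"
    and R: "\<And>M. M \<in> Ob A \<Longrightarrow> proper_resolution A W M (R M)"
    using assms(7,9) by (simp_all add: special_coresolution_def special_resolution_def)
  show ?thesis
    by (intro allI conjI V.stable_iso_complete[OF assms(6) S] W.stable_iso_complete[OF assms(8) R])
qed

end
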